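(* Let $K$ be an algebraically closed field, let $Q$ be a finite quiver, let $\mathcal{I}$ be an admissible ideal in the path algebra $KQ$, and let $A = KQ/\mathcal{I}$. Assume that $Q$ does not contain any loop (an arrow starting and ending in the same vertex). Then the following are equivalent: (i) $A$ is geometrically irreducible; (ii) $A$ is hereditary.
   Context: An ideal $\mathcal{I}$ in $KQ$ is admissible if (a) it is generated by a finite set of relations, where a relation is a linear combination $\sum_{i=1}^t \lambda_i p_i$ with $\lambda_i \in K^*$ and pairwise different paths $p_i$ of length at least two, all with the same starting vertex and all with the same end vertex, and (b) there is some $m \ge 2$ such that all paths of length at least $m$ lie in $\mathcal{I}$. In particular $A$ is finite-dimensional. For $d \ge 0$ let $\operatorname{mod}(A,d)$ be the affine scheme of $d$-dimensional (left) $A$-modules, i.e. of $K$-algebra homomorphisms $A \to M_d(K)$. A finite-dimensional $K$-algebra $A$ is geometrically irreducible if for each $d \ge 0$ all connected components of $\operatorname{mod}(A,d)$ are irreducible. For $A = KQ/\mathcal{I}$ with $n$ vertices this is equivalent to: for every dimension vector $\mathbf{d} \in \mathbb{N}^n$ the affine scheme $\operatorname{rep}(A,\mathbf{d})$ is irreducible, where $\operatorname{rep}(A,\mathbf{d})$ consists of the tuples $(M(a))_a \in \prod_{a} \operatorname{Hom}_K(K^{d_{s(a)}},K^{d_{t(a)}})$ ($a$ running over the arrows of $Q$, with start $s(a)$ and end $t(a)$) that satisfy all relations in $\mathcal{I}$. $A$ is hereditary if $\operatorname{gl.dim}(A) \le 1$. *)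

theory Defs
  imports
    "HOL-Analysis.Abstract_Topology_2"
    "HOL-Computational_Algebra.Polynomial"
    "HOL-Library.Poly_Mapping"
    "HOL-Library.Extended_Nat"
    "HOL-Algebra.QuotRing"
    "Jordan_Normal_Form.Matrix_Kernel"
    "Graph_Theory.Arc_Walk"
begin

section \<open>Path algebras and admissible ideals\<close>

text \<open>
  A finite quiver is a \<^const>\<open>fin_digraph\<close> (parallel arrows and loops are allowed).
  A path is a pair of its start vertex and the list of its arrows in order of travel, so that
  \<open>(u, [])\<close> is the trivial path at \<open>u\<close>.
\<close>

type_synonym ('v, 'e) qpath = "'v \<times> 'e list"

definition qpaths :: "('v, 'e) pre_digraph \<Rightarrow> ('v, 'e) qpath set" where
  "qpaths Q = {(u, p). \<exists>v. pre_digraph.awalk Q u p v}"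

definition qpath_end :: "('v, 'e) pre_digraph \<Rightarrow> ('v, 'e) qpath \<Rightarrow> 'v" where
  "qpath_end Q p = pre_digraph.awlast Q (fst p) (snd p)"

text \<open>
  Elements of the path algebra are the finitely supported functions from paths to \<open>K\<close>.
  Paths are composed like maps: \<open>p q\<close> is ``first \<open>q\<close>, then \<open>p\<close>'' and is zero unless \<open>p\<close> starts
  where \<open>q\<close> ends, so that left modules are representations \<open>M(a) : M(s(a)) \<rightarrow> M(t(a))\<close>.  The
  coefficient of a product at a path is therefore a sum over the ways to cut this path in two.
\<close>

definition path_algebra ::
  "('v, 'e) pre_digraph \<Rightarrow> ('k :: field, ('v, 'e) qpath \<Rightarrow> 'k) module" where
  "path_algebra Q =
    \<lparr> carrier = {f. finite {p. f p \<noteq> 0} \<and> {p. f p \<noteq> 0} \<subseteq> qpaths Q},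
      mult = (\<lambda>f g (u, r).
        \<Sum>k\<le>length r. f (qpath_end Q (u, take k r), drop k r) * g (u, take k r)),
      one = (\<lambda>(u, r). if u \<in> verts Q \<and> r = [] then 1 else 0),
      zero = (\<lambda>_. 0),
      add = (\<lambda>f g p. f p + g p),
      smult = (\<lambda>c f p. c * f p) \<rparr>"

definition path_element :: "('v, 'e) qpath \<Rightarrow> ('v, 'e) qpath \<Rightarrow> 'k :: field" where
  "path_element p = (\<lambda>q. if q = p then 1 else 0)"

text \<open>
  The support of \<open>r\<close> is the set of the paths \<open>p\<^sub>i\<close>, and its values there are the nonzero
  coefficients \<open>\<lambda>\<^sub>i\<close>.
\<close>

definition quiver_relation ::
  "('v, 'e) pre_digraph \<Rightarrow> (('v, 'e) qpath \<Rightarrow> 'k :: field) \<Rightarrow> bool" where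
  "quiver_relation Q r \<longleftrightarrow>
     finite {p. r p \<noteq> 0} \<and> {p. r p \<noteq> 0} \<noteq> {} \<and>
     (\<exists>u v. \<forall>p. r p \<noteq> 0 \<longrightarrow>
        p \<in> qpaths Q \<and> length (snd p) \<ge> 2 \<and> fst p = u \<and> qpath_end Q p = v)"

definition admissible_ideal ::
  "('v, 'e) pre_digraph \<Rightarrow> (('v, 'e) qpath \<Rightarrow> 'k :: field) set \<Rightarrow> bool" where
  "admissible_ideal Q I \<longleftrightarrow>
     ideal I (path_algebra Q) \<and>
     (\<exists>S. finite S \<and> (\<forall>r\<in>S. quiver_relation Q r) \<and> I = Idl\<^bsub>path_algebra Q\<^esub> S) \<and>
     (\<exists>m\<ge>2. \<forall>p\<in>qpaths Q. length (snd p) \<ge> m \<longrightarrow> path_element p \<in> I)"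

text \<open>The factor ring of HOL-Algebra together with the induced scalar multiplication on cosets.\<close>

definition quotient_algebra :: "('k, 'a) module \<Rightarrow> 'a set \<Rightarrow> ('k, 'a set) module" where
  "quotient_algebra A I =
     ring.extend (A Quot I) (module.fields (\<lambda>c X. \<Union>x\<in>X. I +>\<^bsub>A\<^esub> (c \<odot>\<^bsub>A\<^esub> x)))"


section \<open>The affine scheme of modules\<close>

text \<open>
  The Zariski topology on \<open>Spec (R/(S))\<close>, whose points are identified with the prime ideals of
  \<open>R\<close> that contain \<open>S\<close>.
\<close>

definition spec_points :: "'r :: comm_ring_1 set \<Rightarrow> 'r set set" where
  "spec_points S = {P. primeideal P class_ring \<and> S \<subseteq> P}"

definition spec_topology :: "'r :: comm_ring_1 set \<Rightarrow> 'r set topology" where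
  "spec_topology S = topology (\<lambda>U. \<exists>T. U = {P \<in> spec_points S. \<not> T \<subseteq> P})"

lemma openin_spec_topology:
  "openin (spec_topology S) U \<longleftrightarrow> (\<exists>T. U = {P \<in> spec_points S. \<not> T \<subseteq> P})"
proof -
  let ?L = "\<lambda>U. \<exists>T. U = {P \<in> spec_points S. \<not> T \<subseteq> P}"
  have "istopology ?L"
    unfolding istopology_def
  proof (intro conjI allI impI)
    fix U V assume "?L U" "?L V"
    then obtain T T' where U: "U = {P \<in> spec_points S. \<not> T \<subseteq> P}"
      and V: "V = {P \<in> spec_points S. \<not> T' \<subseteq> P}" by blast
    let ?W = "{t * t' | t t'. t \<in> T \<and> t' \<in> T'}"
    have "\<not> ?W \<subseteq> P \<longleftrightarrow> \<not> T \<subseteq> P \<and> \<not> T' \<subseteq> P" if "P \<in> spec_points S" for P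
    proof -
      interpret primeideal P "class_ring :: 'a ring"
        using that by (simp add: spec_points_def)
      have l: "t * t' \<in> P" if "t \<in> P" for t t' using I_r_closed[of t t'] that by simp
      have r: "t * t' \<in> P" if "t' \<in> P" for t t' using I_l_closed[of t' t] that by simp
      have p: "t \<in> P \<or> t' \<in> P" if "t * t' \<in> P" for t t' using I_prime[of t t'] that by simp
      show ?thesis using l r p by blast
    qed
    then have "U \<inter> V = {P \<in> spec_points S. \<not> ?W \<subseteq> P}" unfolding U V by blast
    then show "?L (U \<inter> V)" by blast
  next
    fix \<K> assume "\<forall>K\<in>\<K>. ?L K"
    then obtain T where "\<And>K. K \<in> \<K> \<Longrightarrow> K = {P \<in> spec_points S. \<not> T K \<subseteq> P}" by metis
    then have "\<Union>\<K> = {P \<in> spec_points S. \<not> (\<Union>K\<in>\<K>. T K) \<subseteq> P}" by blast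
    then show "?L (\<Union>\<K>)" by blast
  qed
  then show ?thesis by (simp add: spec_topology_def)
qed

lemma topspace_spec_topology: "topspace (spec_topology S) = spec_points S"
proof
  show "topspace (spec_topology S) \<subseteq> spec_points S"
    using openin_spec_topology[of S "topspace (spec_topology S)"] by auto
  have "P \<noteq> UNIV" if "P \<in> spec_points S" for P
    using primeideal.I_notcarr[of P class_ring] that by (auto simp: spec_points_def)
  then have "spec_points S = {P \<in> spec_points S. \<not> UNIV \<subseteq> P}" by auto
  then have "openin (spec_topology S) (spec_points S)"
    unfolding openin_spec_topology by blast
  then show "spec_points S \<subseteq> topspace (spec_topology S)" by (rule openin_subset)
qed

text \<open>
  \<open>mod(A,d)\<close> represents the functor that sends a commutative \<open>K\<close>-algebra \<open>R\<close> to the set of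
  \<open>K\<close>-algebra homomorphisms \<open>A \<rightarrow> M\<^sub>d(R)\<close>.  Its coordinate ring has a generator
  \<open>mod_coord x i j\<close> for the \<open>(i,j)\<close> entry of the image of each \<open>x \<in> A\<close>, subject to the equations
  saying that the generic matrices define a unital \<open>K\<close>-algebra homomorphism.  The polynomial
  ring below has a variable for every triple \<open>(x, i, j)\<close> of the underlying types, so the
  superfluous ones are set to zero.
\<close>

type_synonym ('k, 'x) mod_poly = "(('x \<times> nat \<times> nat) \<Rightarrow>\<^sub>0 nat) \<Rightarrow>\<^sub>0 'k"

definition mod_coord :: "'x \<Rightarrow> nat \<Rightarrow> nat \<Rightarrow> ('k :: field, 'x) mod_poly" where
  "mod_coord x i j = Poly_Mapping.single (Poly_Mapping.single (x, i, j) 1) 1"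

definition mod_const :: "'k :: field \<Rightarrow> ('k, 'x) mod_poly" where
  "mod_const c = Poly_Mapping.single 0 c"

definition generic_mat :: "nat \<Rightarrow> 'x \<Rightarrow> ('k :: field, 'x) mod_poly mat" where
  "generic_mat d x = mat d d (\<lambda>(i, j). mod_coord x i j)"

definition mod_equations :: "('k :: field, 'x) module \<Rightarrow> nat \<Rightarrow> ('k, 'x) mod_poly set" where
  "mod_equations A d =
     (let X = generic_mat d;
          E = {X (x \<oplus>\<^bsub>A\<^esub> y) - (X x + X y) | x y. x \<in> carrier A \<and> y \<in> carrier A}
            \<union> {X (x \<otimes>\<^bsub>A\<^esub> y) - X x * X y | x y. x \<in> carrier A \<and> y \<in> carrier A}
            \<union> {X (c \<odot>\<^bsub>A\<^esub> x) - mod_const c \<cdot>\<^sub>m X x | c x. x \<in> carrier A}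
            \<union> {X \<one>\<^bsub>A\<^esub> - 1\<^sub>m d}
      in {F $$ (i, j) | F i j. F \<in> E \<and> i < d \<and> j < d}
       \<union> {mod_coord x i j | x i j. x \<notin> carrier A \<or> i \<ge> d \<or> j \<ge> d})"

definition mod_scheme :: "('k :: field, 'x) module \<Rightarrow> nat \<Rightarrow> ('k, 'x) mod_poly set topology" where
  "mod_scheme A d = spec_topology (mod_equations A d)"

definition irreducible_in :: "'a topology \<Rightarrow> 'a set \<Rightarrow> bool" where
  "irreducible_in X C \<longleftrightarrow> C \<subseteq> topspace X \<and> C \<noteq> {} \<and>
     (\<forall>F G. closedin X F \<and> closedin X G \<and> C \<subseteq> F \<union> G \<longrightarrow> C \<subseteq> F \<or> C \<subseteq> G)"

definition geometrically_irreducible :: "('k :: field, 'x) module \<Rightarrow> bool" where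
  "geometrically_irreducible A \<longleftrightarrow>
     (\<forall>d. \<forall>C \<in> connected_components_of (mod_scheme A d). irreducible_in (mod_scheme A d) C)"


section \<open>Global dimension\<close>

text \<open>
  The category of finite-dimensional left modules: a \<open>d\<close>-dimensional module is \<open>(d, \<phi>)\<close> with a
  \<open>K\<close>-algebra homomorphism \<open>\<phi> : A \<rightarrow> M\<^sub>d(K)\<close>, acting on column vectors.  Every
  finite-dimensional module is isomorphic to one of this form.
\<close>

type_synonym ('k, 'x) fd_mod = "nat \<times> ('x \<Rightarrow> 'k mat)"

definition fd_module :: "('k :: field, 'x) module \<Rightarrow> ('k, 'x) fd_mod \<Rightarrow> bool" where
  "fd_module A M \<longleftrightarrow>
     snd M \<in> Ring.ring_hom A (ring_mat TYPE('k) (fst M) ()) \<and>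
     (\<forall>c. \<forall>x\<in>carrier A. snd M (c \<odot>\<^bsub>A\<^esub> x) = c \<cdot>\<^sub>m snd M x)"

definition mod_hom ::
  "('k :: field, 'x) module \<Rightarrow> ('k, 'x) fd_mod \<Rightarrow> ('k, 'x) fd_mod \<Rightarrow> 'k mat set" where
  "mod_hom A M N =
     {f \<in> carrier_mat (fst N) (fst M). \<forall>x\<in>carrier A. f * snd M x = snd N x * f}"

definition mat_image :: "'k :: field mat \<Rightarrow> 'k vec set" where
  "mat_image f = (\<lambda>v. f *\<^sub>v v) ` carrier_vec (dim_col f)"

definition surjective_mat :: "'k :: field mat \<Rightarrow> bool" where
  "surjective_mat f \<longleftrightarrow> mat_image f = carrier_vec (dim_row f)"

definition projective_module :: "('k :: field, 'x) module \<Rightarrow> ('k, 'x) fd_mod \<Rightarrow> bool" where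
  "projective_module A P \<longleftrightarrow> fd_module A P \<and>
     (\<forall>M N. \<forall>g \<in> mod_hom A M N. \<forall>h \<in> mod_hom A P N.
        fd_module A M \<and> fd_module A N \<and> surjective_mat g \<longrightarrow>
        (\<exists>l \<in> mod_hom A P M. g * l = h))"

text \<open>
  \<open>0 \<rightarrow> P n \<rightarrow> \<dots> \<rightarrow> P 0 \<rightarrow> M \<rightarrow> 0\<close> is exact, with maps \<open>f 0 : P 0 \<rightarrow> M\<close> and
  \<open>f (k+1) : P (k+1) \<rightarrow> P k\<close>.
\<close>

definition projective_resolution ::
  "('k :: field, 'x) module \<Rightarrow> ('k, 'x) fd_mod \<Rightarrow> nat \<Rightarrow>
     (nat \<Rightarrow> ('k, 'x) fd_mod) \<Rightarrow> (nat \<Rightarrow> 'k mat) \<Rightarrow> bool" where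
  "projective_resolution A M n P f \<longleftrightarrow>
     (\<forall>k\<le>n. projective_module A (P k)) \<and>
     f 0 \<in> mod_hom A (P 0) M \<and> surjective_mat (f 0) \<and>
     (\<forall>k<n. f (Suc k) \<in> mod_hom A (P (Suc k)) (P k) \<and> mat_image (f (Suc k)) = mat_kernel (f k)) \<and>
     mat_kernel (f n) = {0\<^sub>v (fst (P n))}"

definition proj_dim :: "('k :: field, 'x) module \<Rightarrow> ('k, 'x) fd_mod \<Rightarrow> enat" where
  "proj_dim A M = Inf {enat n | n. \<exists>P f. projective_resolution A M n P f}"

text \<open>
  For a finite-dimensional algebra, as considered here, the global dimension is the supremum of
  the projective dimensions of the finite-dimensional (equivalently, finitely generated) modules.
\<close>

definition gl_dim :: "('k :: field, 'x) module \<Rightarrow> enat" where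
  "gl_dim A = Sup {proj_dim A M | M. fd_module A M}"

definition hereditary :: "('k :: field, 'x) module \<Rightarrow> bool" where
  "hereditary A \<longleftrightarrow> gl_dim A \<le> 1"

end

theory Submission
  imports Defs "HOL-Library.Function_Algebras" "HOL-Computational_Algebra.Fraction_Field"
begin

text \<open>
  Both conditions hold if and only if \<open>I\<close> is zero, so that \<open>A\<close> is the path algebra \<open>KQ\<close>.

  Let \<open>A\<close> be hereditary.  An extension of a module \<open>M\<close> by a module \<open>N\<close> is given by a derivation from
  \<open>KQ\<close> to the matrices from \<open>M\<close> to \<open>N\<close> that vanishes on \<open>I\<close>.  Global dimension at most one makes
  \<open>Ext\<^sup>1(M, -)\<close> right exact, so these derivations lift along surjections of \<open>N\<close>
  (\<open>deriv_lift_of_hereditary\<close>).  Suppose that all elements of \<open>I\<close> have coefficient zero at the proper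
  subpaths of some path of length at least two.  Then the uniserial modules along these subpaths are
  modules over \<open>A\<close>, and to glue the one without the last step to the one without the first step is a
  lifting problem.  Its solution forces the coefficient at the whole path to vanish on \<open>I\<close> as well
  (\<open>coefficient_vanishes_step\<close>).  By induction on the length, \<open>I = 0\<close>.

  Let \<open>A\<close> be geometrically irreducible, let \<open>n = dim A\<close>, and let \<open>b\<^sub>\<beta>\<close>, for \<open>\<beta> < r\<close>, be the arrows into a
  vertex \<open>v\<close>.  Two modules of the same dimension are compared: the direct sum of \<open>A\<close> and of \<open>r n\<close>
  copies of the simple module at \<open>v\<close>, and an extension of the semisimplification of \<open>A\<close> by the same
  copies in which the map \<open>(b\<^sub>\<beta>)\<^sub>\<beta>\<close> is injective on the sum of the spaces at the starts of the \<open>b\<^sub>\<beta>\<close>;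
  the latter needs that no \<open>b\<^sub>\<beta>\<close> is a loop.  Both degenerate to the same semisimple module, so they lie
  in one component (\<open>families_connected\<close>).  An element \<open>x\<close> of \<open>I\<close> satisfies \<open>v x = \<Sum>\<^sub>\<beta> b\<^sub>\<beta> x\<^sub>\<beta>\<close>, where \<open>x\<^sub>\<beta>\<close>
  collects the paths of \<open>x\<close> with last arrow \<open>b\<^sub>\<beta>\<close>, stripped of this arrow.  Where \<open>(b\<^sub>\<beta>)\<^sub>\<beta>\<close> is
  injective, each \<open>x\<^sub>\<beta>\<close> therefore acts as zero.  Since this is an open condition that holds somewhere on
  an irreducible component, \<open>x\<^sub>\<beta>\<close> acts as zero on the whole component, in particular on \<open>A\<close>, which
  means \<open>x\<^sub>\<beta> \<in> I\<close> (\<open>strip_in_ideal_of_irreducible\<close>).  Stripping arrows repeatedly leads to coefficients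
  at trivial paths, which vanish on \<open>I\<close>.  Hence \<open>I = 0\<close>.

  Let \<open>I = 0\<close>.  A representation is then an arbitrary choice of matrices for the arrows between the
  spaces at the vertices (\<open>qrep_of_arrows\<close>).  Derivations that vanish at the vertices can be lifted
  arrow by arrow, from which it follows that the kernel of a surjection from a projective module is
  projective (\<open>projective_kernel_of_ideal_zero\<close>); as there are enough projective modules, \<open>A\<close> is
  hereditary.  For the module scheme, the vertices act by orthogonal idempotents with sum \<open>1\<close>, and
  expanding the determinant of this sum by columns yields, around each point, a basis adapted to these
  idempotents.  So the scheme is covered by open strata, one for each dimension vector
  (\<open>strata_cover\<close>), and two strata that meet are equal (\<open>stratum_overlap\<close>).  The representation with
  indeterminate arrow matrices in an indeterminate basis is a point of which all points of the stratum
  are specializations (\<open>stratum_generic_point\<close>), so every component lies in the closure of a single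
  point and is irreducible.
\<close>

section \<open>Path algebras and admissible ideals\<close>

lemma qpath_end_Nil [simp]: "qpath_end Q (u, []) = u"
  by (simp add: qpath_end_def pre_digraph.awalk_verts.simps)

lemma qpath_end_Cons [simp]: "qpath_end Q (u, a # r) = qpath_end Q (head Q a, r)"
  by (cases r) (simp_all add: qpath_end_def pre_digraph.awalk_verts.simps)

lemma qpath_end_append: "qpath_end Q (u, p @ q) = qpath_end Q (qpath_end Q (u, p), q)"
  by (induction p arbitrary: u) simp_all

context wf_digraph
begin

lemma qpaths_Nil [simp]: "(u, []) \<in> qpaths G \<longleftrightarrow> u \<in> verts G"
  by (auto simp: qpaths_def awalk_def)

lemma qpaths_Cons [simp]:
  "(u, a # r) \<in> qpaths G \<longleftrightarrow> a \<in> arcs G \<and> tail G a = u \<and> (head G a, r) \<in> qpaths G"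
  by (auto simp: qpaths_def awalk_def)

lemma qpath_end_in_verts: "(u, r) \<in> qpaths G \<Longrightarrow> qpath_end G (u, r) \<in> verts G"
  by (induction r arbitrary: u) auto

lemma qpaths_start: "(u, r) \<in> qpaths G \<Longrightarrow> u \<in> verts G"
  by (cases r) auto

lemma qpaths_append:
  "(u, p @ q) \<in> qpaths G \<longleftrightarrow> (u, p) \<in> qpaths G \<and> (qpath_end G (u, p), q) \<in> qpaths G"
proof (induction p arbitrary: u)
  case Nil
  then show ?case by (auto dest: qpaths_start)
qed auto

lemma qpaths_arcs: "(u, r) \<in> qpaths G \<Longrightarrow> set r \<subseteq> arcs G"
  by (induction r arbitrary: u) auto

end

lemma path_algebra_carrier:
  "x \<in> carrier (path_algebra Q) \<longleftrightarrow> finite {p. x p \<noteq> 0} \<and> {p. x p \<noteq> 0} \<subseteq> qpaths Q"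
  by (simp add: path_algebra_def)

lemma path_algebra_mult:
  "(x \<otimes>\<^bsub>path_algebra Q\<^esub> y) (u, r) =
     (\<Sum>k\<le>length r. x (qpath_end Q (u, take k r), drop k r) * y (u, take k r))"
  by (simp add: path_algebra_def)

lemma path_algebra_add: "x \<oplus>\<^bsub>path_algebra Q\<^esub> y = x + y"
  by (simp add: path_algebra_def plus_fun_def)

lemma path_algebra_smult: "c \<odot>\<^bsub>path_algebra Q\<^esub> x = (\<lambda>p. c * x p)"
  by (simp add: path_algebra_def)

lemma path_algebra_zero: "\<zero>\<^bsub>path_algebra Q\<^esub> = 0"
  by (simp add: path_algebra_def zero_fun_def)

lemma path_algebra_one:
  "\<one>\<^bsub>path_algebra Q\<^esub> = (\<lambda>(u, r). if u \<in> verts Q \<and> r = [] then 1 else 0)"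
  by (simp add: path_algebra_def)

lemma mult_at_vertex: "(x \<otimes>\<^bsub>path_algebra Q\<^esub> y) (u, []) = x (u, []) * y (u, [])"
  by (simp add: path_algebra_mult)

lemma mult_at_arrow:
  "(x \<otimes>\<^bsub>path_algebra Q\<^esub> y) (u, [a]) = x (u, [a]) * y (u, []) + x (head Q a, []) * y (u, [a])"
  by (simp add: path_algebra_mult)

lemma path_element_same [simp]: "path_element p p = 1"
  by (simp add: path_element_def)

lemma mult_path_element_right:
  "(x \<otimes>\<^bsub>path_algebra Q\<^esub> path_element (u, s)) (v, r) =
     (if v = u \<and> (\<exists>t. r = s @ t) then x (qpath_end Q (u, s), drop (length s) r) else 0)"
proof (cases "v = u \<and> (\<exists>t. r = s @ t)")
  case True
  then obtain t where vr: "v = u" "r = s @ t" by auto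
  have "path_element (u, s) (u, take k r) = (if k = length s then 1 else (0::'a))"
    if "k \<le> length r" for k
  proof (cases "k = length s")
    case False
    with that have "length (take k r) \<noteq> length s" by simp
    then show ?thesis using False by (auto simp: path_element_def)
  qed (simp add: vr path_element_def)
  then show ?thesis
    unfolding path_algebra_mult using vr
    by (subst sum.cong[OF refl, where h = "\<lambda>k. if k = length s then
          x (qpath_end Q (v, take k r), drop k r) else 0"]) (auto simp: vr)
next
  case False
  have "path_element (u, s) (v, take k r) = (0::'a)" for k
    using False by (auto simp: path_element_def) (metis append_take_drop_id)
  then show ?thesis unfolding path_algebra_mult using False by auto
qed

lemma mult_path_element_left:
  "(path_element (u, s) \<otimes>\<^bsub>path_algebra Q\<^esub> x) (v, r) =
     (if \<exists>t. r = t @ s \<and> qpath_end Q (v, t) = u then x (v, take (length r - length s) r) else 0)"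
proof (cases "\<exists>t. r = t @ s \<and> qpath_end Q (v, t) = u")
  case True
  then obtain t where t: "r = t @ s" "qpath_end Q (v, t) = u" by auto
  have "path_element (u, s) (qpath_end Q (v, take k r), drop k r)
      = (if k = length t then 1 else (0::'a))" if "k \<le> length r" for k
  proof (cases "k = length t")
    case False
    with that t have "length (drop k r) \<noteq> length s" by simp
    then show ?thesis using False by (auto simp: path_element_def)
  qed (simp add: t path_element_def)
  then show ?thesis
    unfolding path_algebra_mult using t
    by (subst sum.cong[OF refl, where h = "\<lambda>k. if k = length t then x (v, take k r) else 0"])
       auto
next
  case False
  have "path_element (u, s) (qpath_end Q (v, take k r), drop k r) = (0::'a)" for k
    using False by (auto simp: path_element_def) (metis append_take_drop_id)
  then show ?thesis unfolding path_algebra_mult using False by auto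
qed

lemma path_element_mult:
  "path_element (v, r) \<otimes>\<^bsub>path_algebra Q\<^esub> path_element (u, s) =
     (if v = qpath_end Q (u, s) then path_element (u, s @ r) else 0)"
proof
  fix p :: "('a, 'b) qpath"
  obtain w t where p: "p = (w, t)" by (cases p)
  show "(path_element (v, r) \<otimes>\<^bsub>path_algebra Q\<^esub> path_element (u, s)) p =
     (if v = qpath_end Q (u, s) then path_element (u, s @ r) else 0) p"
    unfolding p mult_path_element_right by (auto simp: path_element_def)
qed

locale quiver_ideal =
  fixes Q :: "('v, 'e) pre_digraph"
    and I :: "(('v, 'e) qpath \<Rightarrow> 'k :: field) set"
  assumes fin_Q: "fin_digraph Q"
    and admissible: "admissible_ideal Q I"
begin

sublocale Q: fin_digraph Q by (rule fin_Q)

abbreviation KQ :: "('k, ('v, 'e) qpath \<Rightarrow> 'k) module" where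
  "KQ \<equiv> path_algebra Q"

sublocale I: ideal I KQ
  using admissible by (simp add: admissible_ideal_def)

abbreviation vx :: "'v \<Rightarrow> ('v, 'e) qpath \<Rightarrow> 'k" where
  "vx v \<equiv> path_element (v, [])"

abbreviation ar :: "'e \<Rightarrow> ('v, 'e) qpath \<Rightarrow> 'k" where
  "ar a \<equiv> path_element (tail Q a, [a])"

abbreviation pmul (infixl "\<star>" 70) where "x \<star> y \<equiv> x \<otimes>\<^bsub>KQ\<^esub> y"

lemma path_element_carrier [simp]: "p \<in> qpaths Q \<Longrightarrow> path_element p \<in> carrier KQ"
  by (auto simp: path_algebra_carrier path_element_def)

lemma vx_carrier [simp]: "v \<in> verts Q \<Longrightarrow> vx v \<in> carrier KQ"
  by simp

lemma ar_carrier [simp]: "a \<in> arcs Q \<Longrightarrow> ar a \<in> carrier KQ"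
  by simp

lemma pmul_carrier [simp]: "x \<in> carrier KQ \<Longrightarrow> y \<in> carrier KQ \<Longrightarrow> x \<star> y \<in> carrier KQ"
  by (rule I.m_closed)

lemma add_carrier [simp]: "x \<in> carrier KQ \<Longrightarrow> y \<in> carrier KQ \<Longrightarrow> x + y \<in> carrier KQ"
  using I.add.m_closed by (simp add: path_algebra_add)

lemma smult_carrier [simp]: "x \<in> carrier KQ \<Longrightarrow> (\<lambda>p. c * x p) \<in> carrier KQ"
  unfolding path_algebra_carrier by (auto elim: rev_finite_subset)

lemma zero_carrier [simp]: "0 \<in> carrier KQ"
  using I.zero_closed by (simp add: path_algebra_zero)

lemma sum_carrier [simp]: "(\<And>i. i \<in> S \<Longrightarrow> x i \<in> carrier KQ) \<Longrightarrow> sum x S \<in> carrier KQ"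
  by (induction S rule: infinite_finite_induct) auto

lemma one_carrier [simp]: "\<one>\<^bsub>KQ\<^esub> \<in> carrier KQ"
  by simp

lemma carrier_coeff: "x \<in> carrier KQ \<Longrightarrow> p \<notin> qpaths Q \<Longrightarrow> x p = 0"
  by (auto simp: path_algebra_carrier)

lemma carrier_sum_paths:
  assumes "x \<in> carrier KQ"
  shows "x = (\<Sum>p | x p \<noteq> 0. (\<lambda>q. x p * path_element p q))"
proof
  fix q
  have fin: "finite {p. x p \<noteq> 0}" using assms by (simp add: path_algebra_carrier)
  have "(\<Sum>p | x p \<noteq> 0. (\<lambda>q. x p * path_element p q)) q
     = (\<Sum>p | x p \<noteq> 0. x p * path_element p q)"
    using fin by (induction rule: finite_induct) auto
  also have "\<dots> = (\<Sum>p | x p \<noteq> 0. if p = q then x q else 0)"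
    by (intro sum.cong) (auto simp: path_element_def)
  also have "\<dots> = x q" using fin by simp
  finally show "x q = (\<Sum>p | x p \<noteq> 0. (\<lambda>q. x p * path_element p q)) q" ..
qed

lemma linear_induct [consumes 1, case_names zero add smult path]:
  assumes "x \<in> carrier KQ"
    and zero: "P 0"
    and add: "\<And>x y. x \<in> carrier KQ \<Longrightarrow> y \<in> carrier KQ \<Longrightarrow> P x \<Longrightarrow> P y \<Longrightarrow> P (x + y)"
    and smult: "\<And>c x. x \<in> carrier KQ \<Longrightarrow> P x \<Longrightarrow> P (\<lambda>p. c * x p)"
    and path: "\<And>p. p \<in> qpaths Q \<Longrightarrow> x p \<noteq> 0 \<Longrightarrow> P (path_element p)"
  shows "P x"
proof -
  have fin: "finite {p. x p \<noteq> 0}" and sub: "{p. x p \<noteq> 0} \<subseteq> qpaths Q"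
    using assms(1) by (auto simp: path_algebra_carrier)
  have *: "P (\<Sum>p\<in>S. (\<lambda>q. x p * path_element p q))
      \<and> (\<Sum>p\<in>S. (\<lambda>q. x p * path_element p q)) \<in> carrier KQ" if "S \<subseteq> {p. x p \<noteq> 0}" for S
    using finite_subset[OF that fin] that
  proof (induction S rule: finite_induct)
    case empty
    show ?case using zero by (simp only: sum.empty zero_carrier)
  next
    case (insert p S)
    then have p: "p \<in> qpaths Q" "x p \<noteq> 0" using sub by auto
    have "P (\<lambda>q. x p * path_element p q)" by (intro smult path p path_element_carrier)
    let ?z = "\<lambda>q. x p * path_element p q"
    have z: "P ?z" "?z \<in> carrier KQ" using p by (auto intro: smult path)
    have "sum (\<lambda>p q. x p * path_element p q) (insert p S)
        = ?z + sum (\<lambda>p q. x p * path_element p q) S"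
      using insert.hyps by (rule sum.insert)
    with insert z show ?case by (metis (no_types, lifting) add add_carrier insert_subset)
  qed
  define y where "y = (\<Sum>p | x p \<noteq> 0. (\<lambda>q. x p * path_element p q))"
  have "P y" unfolding y_def using * by blast
  moreover have "y = x" unfolding y_def using carrier_sum_paths[OF assms(1)] by (rule sym)
  ultimately show ?thesis by blast
qed

text \<open>
  A path is the product of its arrows, so the vertices and arrows generate.
\<close>

lemma path_algebra_induct [consumes 1, case_names zero add smult mult vertex arrow]:
  assumes "x \<in> carrier KQ"
    and zero: "P 0"
    and add: "\<And>x y. x \<in> carrier KQ \<Longrightarrow> y \<in> carrier KQ \<Longrightarrow> P x \<Longrightarrow> P y \<Longrightarrow> P (x + y)"
    and smult: "\<And>c x. x \<in> carrier KQ \<Longrightarrow> P x \<Longrightarrow> P (\<lambda>p. c * x p)"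
    and mult: "\<And>x y. x \<in> carrier KQ \<Longrightarrow> y \<in> carrier KQ \<Longrightarrow> P x \<Longrightarrow> P y \<Longrightarrow> P (x \<star> y)"
    and vertex: "\<And>v. v \<in> verts Q \<Longrightarrow> P (vx v)"
    and arrow: "\<And>a. a \<in> arcs Q \<Longrightarrow> P (ar a)"
  shows "P x"
  using assms(1)
proof (induction rule: linear_induct)
  case (path p)
  obtain u r where "p = (u, r)" by (cases p)
  moreover have "(u, r) \<in> qpaths Q \<Longrightarrow> P (path_element (u, r))" for u r
  proof (induction r arbitrary: u)
    case Nil
    then show ?case by (simp add: vertex)
  next
    case (Cons a r)
    then have a: "a \<in> arcs Q" "u = tail Q a" "(head Q a, r) \<in> qpaths Q" by auto
    have "P (path_element (head Q a, r) \<star> ar a)"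
      using Cons.IH a by (intro mult arrow path_element_carrier) auto
    then show ?case using a by (simp add: path_element_mult)
  qed
  ultimately show ?case using path by simp
qed (fact zero add smult)+

lemma vx_mult: "vx v \<star> vx w = (if v = w then vx v else 0)"
  by (simp add: path_element_mult)

lemma vx_head_ar: "vx (head Q a) \<star> ar a = ar a"
  by (simp add: path_element_mult)

lemma ar_vx_tail: "ar a \<star> vx (tail Q a) = ar a"
  by (simp add: path_element_mult)

lemma one_eq_sum_vx: "\<one>\<^bsub>KQ\<^esub> = (\<Sum>v\<in>verts Q. vx v)"
proof
  fix p :: "('v, 'e) qpath"
  obtain u r where p: "p = (u, r)" by (cases p)
  have "(\<Sum>v\<in>S. vx v) p = (\<Sum>v\<in>S. vx v p)" if "finite S" for S
    using that by (induction rule: finite_induct) auto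
  moreover have "(\<Sum>v\<in>verts Q. vx v p) = (\<Sum>v\<in>verts Q. if v = u then (if r = [] then 1 else 0) else 0)"
    by (intro sum.cong) (auto simp: path_element_def p)
  ultimately show "\<one>\<^bsub>KQ\<^esub> p = (\<Sum>v\<in>verts Q. vx v) p"
    by (simp add: path_algebra_one p)
qed

lemma smult_mult_left: "(\<lambda>p. c * x p) \<star> y = (\<lambda>p. c * (x \<star> y) p)"
  by (auto simp: fun_eq_iff path_algebra_mult sum_distrib_left mult.assoc)

lemma smult_mult_right: "x \<star> (\<lambda>p. c * y p) = (\<lambda>p. c * (x \<star> y) p)"
  by (auto simp: fun_eq_iff path_algebra_mult sum_distrib_left ac_simps)

lemma pmul_add_left: "(x + y) \<star> z = x \<star> z + y \<star> z"
  by (auto simp: fun_eq_iff path_algebra_mult sum.distrib algebra_simps)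

lemma pmul_add_right: "z \<star> (x + y) = z \<star> x + z \<star> y"
  by (auto simp: fun_eq_iff path_algebra_mult sum.distrib algebra_simps)

lemma pmul_zero_left [simp]: "0 \<star> x = 0"
  by (auto simp: fun_eq_iff path_algebra_mult)

lemma pmul_zero_right [simp]: "x \<star> 0 = 0"
  by (auto simp: fun_eq_iff path_algebra_mult)

lemma pmul_assoc:
  "x \<in> carrier KQ \<Longrightarrow> y \<in> carrier KQ \<Longrightarrow> z \<in> carrier KQ \<Longrightarrow> x \<star> y \<star> z = x \<star> (y \<star> z)"
  by (rule I.m_assoc)

lemma pmul_one [simp]: "x \<in> carrier KQ \<Longrightarrow> x \<star> \<one>\<^bsub>KQ\<^esub> = x"
  by auto

lemma ideal_carrier: "x \<in> I \<Longrightarrow> x \<in> carrier KQ"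
  by (rule I.a_Hcarr)

lemma ideal_add [simp]: "x \<in> I \<Longrightarrow> y \<in> I \<Longrightarrow> x + y \<in> I"
  using additive_subgroup.a_closed[OF I.additive_subgroup_axioms] by (simp add: path_algebra_add)

lemma ideal_zero [simp]: "0 \<in> I"
  using additive_subgroup.zero_closed[OF I.additive_subgroup_axioms]
  by (simp add: path_algebra_zero)

lemma ideal_mult_left [simp]: "x \<in> carrier KQ \<Longrightarrow> y \<in> I \<Longrightarrow> x \<star> y \<in> I"
  by (rule I.I_l_closed)

lemma ideal_mult_right [simp]: "x \<in> carrier KQ \<Longrightarrow> y \<in> I \<Longrightarrow> y \<star> x \<in> I"
  by (rule I.I_r_closed)

lemma ideal_smult [simp]: "x \<in> I \<Longrightarrow> (\<lambda>p. c * x p) \<in> I"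
  using ideal_mult_left[of "\<lambda>p. c * \<one>\<^bsub>KQ\<^esub> p" x] ideal_carrier[of x]
  by (simp add: smult_mult_left)

lemma ideal_sum: "(\<And>i. i \<in> S \<Longrightarrow> x i \<in> I) \<Longrightarrow> sum x S \<in> I"
  by (induction S rule: infinite_finite_induct) auto

text \<open>
  The elements without paths of length at most one form an ideal, which contains the relations.
\<close>

lemma ideal_coeff_short:
  assumes "x \<in> I" "length (snd p) \<le> 1"
  shows "x p = 0"
proof -
  let ?J = "{x \<in> carrier KQ. \<forall>p. length (snd p) \<le> 1 \<longrightarrow> x p = 0}"
  have 1: "x \<star> y \<in> ?J \<and> y \<star> x \<in> ?J" if "x \<in> carrier KQ" "y \<in> ?J" for x y
  proof -
    have "(x \<star> y) p = 0 \<and> (y \<star> x) p = 0" if p: "length (snd p) \<le> 1" for p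
    proof -
      obtain u r where ur: "p = (u, r)" by (cases p)
      have "r = [] \<or> (\<exists>a. r = [a])" using p ur by (cases r) auto
      then show ?thesis using \<open>y \<in> ?J\<close> ur by (auto simp: mult_at_vertex mult_at_arrow)
    qed
    then show ?thesis using that by auto
  qed
  have "ideal ?J KQ"
  proof (rule idealI)
    show "ring KQ" by (rule I.ring_axioms)
    show "subgroup ?J (add_monoid KQ)"
    proof (rule group.subgroupI)
      show "group (add_monoid KQ)" using I.add.group_axioms by simp
      show "?J \<noteq> {}" using zero_carrier by (auto intro!: exI[of _ 0])
      fix x assume x: "x \<in> ?J"
      have "(\<lambda>p. - 1 * x p) \<in> carrier KQ" using x smult_carrier by blast
      moreover have "x \<oplus>\<^bsub>KQ\<^esub> (\<lambda>p. - 1 * x p) = \<zero>\<^bsub>KQ\<^esub>"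
        by (simp add: path_algebra_add path_algebra_zero fun_eq_iff)
      ultimately have "\<ominus>\<^bsub>KQ\<^esub> x = (\<lambda>p. - 1 * x p)"
        using x I.minus_equality I.a_comm by (metis (no_types, lifting) mem_Collect_eq)
      then show "inv\<^bsub>add_monoid KQ\<^esub> x \<in> ?J"
        using x smult_carrier[of x "-1"] by (simp add: a_inv_def)
    qed (auto simp: path_algebra_add)
  qed (use 1 in auto)
  moreover obtain S where S: "\<forall>r\<in>S. quiver_relation Q r" "I = Idl\<^bsub>KQ\<^esub> S"
    using admissible by (auto simp: admissible_ideal_def)
  have "S \<subseteq> ?J"
  proof
    fix r assume "r \<in> S"
    then have "quiver_relation Q r" using S by blast
    then obtain u v where "finite {p. r p \<noteq> 0}"
      and *: "\<forall>p. r p \<noteq> 0 \<longrightarrow> p \<in> qpaths Q \<and> length (snd p) \<ge> 2 \<and> fst p = u \<and> qpath_end Q p = v"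
      unfolding quiver_relation_def by blast
    then have "r \<in> carrier KQ" by (auto simp: path_algebra_carrier)
    moreover have "r p = 0" if "length (snd p) \<le> 1" for p using *[rule_format, of p] that by force
    ultimately show "r \<in> ?J" by blast
  qed
  ultimately have "I \<subseteq> ?J" unfolding S(2) by (intro I.genideal_minimal)
  then show ?thesis using assms by blast
qed

lemma ideal_eq_zeroI:
  assumes "\<And>x u s. x \<in> I \<Longrightarrow> (u, s) \<in> qpaths Q \<Longrightarrow> x (u, s) = 0"
  shows "I = {0}"
proof -
  have "x p = 0" if "x \<in> I" for x p
    using assms[OF that] carrier_coeff[OF ideal_carrier[OF that], of p]
    by (cases p, cases "p \<in> qpaths Q") auto
  then have "x = 0" if "x \<in> I" for x using that by (simp add: fun_eq_iff)
  then show ?thesis using ideal_zero by blast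
qed

lemma long_paths_in_ideal:
  obtains m where "\<And>p. p \<in> qpaths Q \<Longrightarrow> length (snd p) \<ge> m \<Longrightarrow> path_element p \<in> I"
  using admissible by (auto simp: admissible_ideal_def)

lemma finite_paths_of_length: "finite {p \<in> qpaths Q. length (snd p) = l}"
proof -
  have "{p \<in> qpaths Q. length (snd p) = l} \<subseteq> verts Q \<times> {r. set r \<subseteq> arcs Q \<and> length r = l}"
    by (auto dest: Q.qpaths_arcs Q.qpaths_start)
  then show ?thesis
    by (rule finite_subset) (intro finite_cartesian_product Q.finite_verts finite_lists_length_eq Q.finite_arcs)
qed

end

section \<open>Representations of the quotient algebra\<close>

lemma fun_eta_zero: "(\<lambda>a. 0) = 0"
  by (simp add: fun_eq_iff)

text \<open>
  Matrix representations over a commutative ring to which the scalars are mapped by \<open>h\<close>: besides the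
  modules over \<open>K\<close> itself, families of modules and generic modules are needed.
\<close>

definition alg_rep ::
  "('k :: field, 'x) module \<Rightarrow> ('k \<Rightarrow> 't :: comm_ring_1) \<Rightarrow> nat \<Rightarrow> ('x \<Rightarrow> 't mat) \<Rightarrow> bool" where
  "alg_rep A h d \<phi> \<longleftrightarrow>
     (\<forall>x\<in>carrier A. \<phi> x \<in> carrier_mat d d) \<and>
     (\<forall>x\<in>carrier A. \<forall>y\<in>carrier A. \<phi> (x \<oplus>\<^bsub>A\<^esub> y) = \<phi> x + \<phi> y) \<and>
     (\<forall>x\<in>carrier A. \<forall>y\<in>carrier A. \<phi> (x \<otimes>\<^bsub>A\<^esub> y) = \<phi> x * \<phi> y) \<and>
     (\<forall>c. \<forall>x\<in>carrier A. \<phi> (c \<odot>\<^bsub>A\<^esub> x) = h c \<cdot>\<^sub>m \<phi> x) \<and>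
     \<phi> \<one>\<^bsub>A\<^esub> = 1\<^sub>m d"

lemma fd_module_iff_alg_rep: "fd_module A M \<longleftrightarrow> alg_rep A id (fst M) (snd M)"
  by (auto simp: fd_module_def alg_rep_def Ring.ring_hom_def ring_mat_def)

context quiver_ideal
begin

abbreviation A :: "('k, (('v, 'e) qpath \<Rightarrow> 'k) set) module" where
  "A \<equiv> quotient_algebra KQ I"

definition cl :: "(('v, 'e) qpath \<Rightarrow> 'k) \<Rightarrow> (('v, 'e) qpath \<Rightarrow> 'k) set" where
  "cl x = I +>\<^bsub>KQ\<^esub> x"

lemma cl_eq: "cl x = {i + x | i. i \<in> I}"
  by (auto simp: cl_def a_r_coset_def r_coset_def path_algebra_def plus_fun_def)

lemma cl_self: "x \<in> cl x"
  unfolding cl_eq using ideal_zero by (intro CollectI exI[of _ 0]) auto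

lemma ideal_uminus: "x \<in> I \<Longrightarrow> - x \<in> I"
  using ideal_smult[of x "-1"] by (simp add: fun_Compl_def)

lemma cl_eq_iff: "cl x = cl y \<longleftrightarrow> x - y \<in> I"
proof
  assume "cl x = cl y"
  with cl_self obtain i where "i \<in> I" "x = i + y" unfolding cl_eq by blast
  then show "x - y \<in> I" by simp
next
  assume d: "x - y \<in> I"
  show "cl x = cl y"
  proof (intro equalityI subsetI)
    fix z assume "z \<in> cl x"
    then obtain i where "i \<in> I" "z = i + x" unfolding cl_eq by blast
    then have "i + (x - y) \<in> I" "z = (i + (x - y)) + y" using d by (simp_all only: ideal_add) simp
    then show "z \<in> cl y" unfolding cl_eq by blast
  next
    fix z assume "z \<in> cl y"
    then obtain i where "i \<in> I" "z = i + y" unfolding cl_eq by blast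
    then have "i + - (x - y) \<in> I" "z = (i + - (x - y)) + x"
      using ideal_uminus[OF d] by (simp_all only: ideal_add) simp
    then show "z \<in> cl x" unfolding cl_eq by blast
  qed
qed

lemma cl_ideal: "x \<in> I \<Longrightarrow> cl x = cl 0"
  by (simp add: cl_eq_iff)

lemma quotient_carrier: "X \<in> carrier A \<longleftrightarrow> (\<exists>x\<in>carrier KQ. X = cl x)"
  by (auto simp: quotient_algebra_def ring.defs FactRing_simps cl_def)

lemma cl_carrier [simp]: "x \<in> carrier KQ \<Longrightarrow> cl x \<in> carrier A"
  unfolding quotient_carrier by blast

lemma quotient_add:
  assumes "x \<in> carrier KQ" "y \<in> carrier KQ"
  shows "cl x \<oplus>\<^bsub>A\<^esub> cl y = cl (x + y)"
  using abelian_subgroup.a_rcos_sum[OF I.abelian_subgroup_axioms assms]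
  by (simp add: quotient_algebra_def ring.defs FactRing_def cl_def path_algebra_add)

lemma quotient_mult:
  assumes "x \<in> carrier KQ" "y \<in> carrier KQ"
  shows "cl x \<otimes>\<^bsub>A\<^esub> cl y = cl (x \<star> y)"
  using I.rcoset_mult_add[OF assms]
  by (simp add: quotient_algebra_def ring.defs FactRing_def cl_def)

lemma quotient_one: "\<one>\<^bsub>A\<^esub> = cl \<one>\<^bsub>KQ\<^esub>"
  by (simp add: quotient_algebra_def ring.defs FactRing_def cl_def)

lemma quotient_smult:
  assumes "x \<in> carrier KQ"
  shows "c \<odot>\<^bsub>A\<^esub> cl x = cl (\<lambda>p. c * x p)"
proof -
  have 1: "c \<odot>\<^bsub>A\<^esub> cl x = (\<Union>z\<in>cl x. cl (\<lambda>p. c * z p))"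
    by (simp add: quotient_algebra_def ring.defs module.defs FactRing_def cl_def path_algebra_smult)
  have *: "cl (\<lambda>p. c * z p) = cl (\<lambda>p. c * x p)" if z: "z \<in> cl x" for z
  proof -
    obtain i where i: "i \<in> I" "z = i + x" using z unfolding cl_eq by blast
    have "(\<lambda>p. c * z p) - (\<lambda>p. c * x p) = (\<lambda>p. c * i p)"
      using i by (auto simp: fun_eq_iff algebra_simps)
    then show ?thesis using ideal_smult[OF i(1), of c] by (simp add: cl_eq_iff)
  qed
  have "(\<Union>z\<in>cl x. cl (\<lambda>p. c * z p)) = (\<Union>z\<in>cl x. cl (\<lambda>p. c * x p))"
    by (rule SUP_cong[OF refl *])
  also have "\<dots> = cl (\<lambda>p. c * x p)" using cl_self[of x] by blast
  finally show ?thesis using 1 by simp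
qed

text \<open>
  Representations of \<open>A\<close> as representations of the path algebra that vanish on \<open>I\<close>; their arguments are
  elements instead of cosets.
\<close>

definition qrep :: "('k \<Rightarrow> 't :: comm_ring_1) \<Rightarrow> nat \<Rightarrow> ((('v, 'e) qpath \<Rightarrow> 'k) \<Rightarrow> 't mat) \<Rightarrow> bool" where
  "qrep h d \<Phi> \<longleftrightarrow>
     (\<forall>x\<in>carrier KQ. \<Phi> x \<in> carrier_mat d d) \<and>
     (\<forall>x\<in>carrier KQ. \<forall>y\<in>carrier KQ. \<Phi> (x + y) = \<Phi> x + \<Phi> y) \<and>
     (\<forall>x\<in>carrier KQ. \<forall>y\<in>carrier KQ. \<Phi> (x \<star> y) = \<Phi> x * \<Phi> y) \<and>
     (\<forall>c. \<forall>x\<in>carrier KQ. \<Phi> (\<lambda>p. c * x p) = h c \<cdot>\<^sub>m \<Phi> x) \<and>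
     \<Phi> \<one>\<^bsub>KQ\<^esub> = 1\<^sub>m d \<and>
     (\<forall>x\<in>I. \<Phi> x = 0\<^sub>m d d)"

lemma qrepI:
  assumes "\<And>x. x \<in> carrier KQ \<Longrightarrow> \<Phi> x \<in> carrier_mat d d"
    and "\<And>x y. x \<in> carrier KQ \<Longrightarrow> y \<in> carrier KQ \<Longrightarrow> \<Phi> (x + y) = \<Phi> x + \<Phi> y"
    and "\<And>x y. x \<in> carrier KQ \<Longrightarrow> y \<in> carrier KQ \<Longrightarrow> \<Phi> (x \<star> y) = \<Phi> x * \<Phi> y"
    and "\<And>c x. x \<in> carrier KQ \<Longrightarrow> \<Phi> (\<lambda>p. c * x p) = h c \<cdot>\<^sub>m \<Phi> x"
    and "\<Phi> \<one>\<^bsub>KQ\<^esub> = 1\<^sub>m d"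
    and "\<And>x. x \<in> I \<Longrightarrow> \<Phi> x = 0\<^sub>m d d"
  shows "qrep h d \<Phi>"
  using assms by (simp add: qrep_def)

lemma qrepD:
  assumes "qrep h d \<Phi>"
  shows "x \<in> carrier KQ \<Longrightarrow> \<Phi> x \<in> carrier_mat d d"
    and "x \<in> carrier KQ \<Longrightarrow> y \<in> carrier KQ \<Longrightarrow> \<Phi> (x + y) = \<Phi> x + \<Phi> y"
    and "x \<in> carrier KQ \<Longrightarrow> y \<in> carrier KQ \<Longrightarrow> \<Phi> (x \<star> y) = \<Phi> x * \<Phi> y"
    and "x \<in> carrier KQ \<Longrightarrow> \<Phi> (\<lambda>p. c * x p) = h c \<cdot>\<^sub>m \<Phi> x"
    and "\<Phi> \<one>\<^bsub>KQ\<^esub> = 1\<^sub>m d"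
    and "x \<in> I \<Longrightarrow> \<Phi> x = 0\<^sub>m d d"
  using assms by (auto simp: qrep_def)

lemma qrep_zero: "qrep h d \<Phi> \<Longrightarrow> \<Phi> 0 = 0\<^sub>m d d"
  using qrepD(6) ideal_zero by blast

lemma qrep_sum_index:
  assumes \<Phi>: "qrep h d \<Phi>" and x: "\<And>i. i \<in> S \<Longrightarrow> x i \<in> carrier KQ" and ij: "i < d" "j < d"
  shows "\<Phi> (sum x S) $$ (i, j) = (\<Sum>s\<in>S. \<Phi> (x s) $$ (i, j))"
  using x
proof (induction S rule: infinite_finite_induct)
  case (insert s S)
  have "\<Phi> (x s) \<in> carrier_mat d d" "\<Phi> (sum x S) \<in> carrier_mat d d"
    using insert.prems by (auto intro!: qrepD(1)[OF \<Phi>] sum_carrier)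
  moreover have "\<Phi> (x s + sum x S) = \<Phi> (x s) + \<Phi> (sum x S)"
    using insert.prems by (intro qrepD(2)[OF \<Phi>] sum_carrier) auto
  moreover have "sum x (insert s S) = x s + sum x S"
    using insert.hyps by (rule sum.insert)
  ultimately have "\<Phi> (sum x (insert s S)) $$ (i, j) = \<Phi> (x s) $$ (i, j) + \<Phi> (sum x S) $$ (i, j)"
    using ij by (metis carrier_matD index_add_mat(1))
  moreover have "\<Phi> (sum x S) $$ (i, j) = (\<Sum>s\<in>S. \<Phi> (x s) $$ (i, j))"
    using insert.IH insert.prems by blast
  ultimately have "\<Phi> (sum x (insert s S)) $$ (i, j) = \<Phi> (x s) $$ (i, j) + (\<Sum>s\<in>S. \<Phi> (x s) $$ (i, j))"
    by (simp only:)
  also have "\<dots> = (\<Sum>s\<in>insert s S. \<Phi> (x s) $$ (i, j))" using insert.hyps by simp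
  finally show ?case .
qed (use ij qrep_zero[OF \<Phi>] in auto)

lemma qrep_of_alg_rep:
  assumes "alg_rep A h d \<phi>"
  shows "qrep h d (\<lambda>x. \<phi> (cl x))"
proof (rule qrepI)
  note r = assms[unfolded alg_rep_def]
  fix x y c assume x: "x \<in> carrier KQ"
  show "\<phi> (cl x) \<in> carrier_mat d d" using r x cl_carrier by blast
  show "\<phi> (cl (\<lambda>p. c * x p)) = h c \<cdot>\<^sub>m \<phi> (cl x)"
    using r x cl_carrier quotient_smult by metis
  assume y: "y \<in> carrier KQ"
  show "\<phi> (cl (x + y)) = \<phi> (cl x) + \<phi> (cl y)" "\<phi> (cl (x \<star> y)) = \<phi> (cl x) * \<phi> (cl y)"
    using r x y cl_carrier quotient_add quotient_mult by metis+
next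
  note r = assms[unfolded alg_rep_def]
  show "\<phi> (cl \<one>\<^bsub>KQ\<^esub>) = 1\<^sub>m d" using r quotient_one by simp
  fix x assume "x \<in> I"
  have c: "\<phi> (cl 0) \<in> carrier_mat d d" using r cl_carrier zero_carrier by blast
  have "\<phi> (cl 0) = \<phi> (cl 0) + \<phi> (cl 0)"
  proof -
    have "\<phi> (cl 0 \<oplus>\<^bsub>A\<^esub> cl 0) = \<phi> (cl 0) + \<phi> (cl 0)"
      using r cl_carrier[OF zero_carrier] by blast
    then show ?thesis by (simp only: quotient_add[OF zero_carrier zero_carrier] add_0_left)
  qed
  then have "\<phi> (cl 0) $$ (i, j) = \<phi> (cl 0) $$ (i, j) + \<phi> (cl 0) $$ (i, j)"
    if "i < d" "j < d" for i j
    using c that by (metis carrier_matD index_add_mat(1))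
  then have "\<phi> (cl 0) = 0\<^sub>m d d" using c by (intro eq_matI) auto
  then show "\<phi> (cl x) = 0\<^sub>m d d" using cl_ideal[OF \<open>x \<in> I\<close>] by simp
qed

text \<open>
  The value at a chosen representative of the coset; the choice does not matter if \<open>\<Phi>\<close> vanishes on \<open>I\<close>.
\<close>

definition descend :: "((('v, 'e) qpath \<Rightarrow> 'k) \<Rightarrow> 't) \<Rightarrow> (('v, 'e) qpath \<Rightarrow> 'k) set \<Rightarrow> 't" where
  "descend \<Phi> X = \<Phi> (SOME x. x \<in> carrier KQ \<and> X = cl x)"

lemma descend_cl:
  assumes "qrep h d \<Phi>" and x: "x \<in> carrier KQ"
  shows "descend \<Phi> (cl x) = \<Phi> x"
proof -
  define y where "y = (SOME y. y \<in> carrier KQ \<and> cl x = cl y)"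
  have y: "y \<in> carrier KQ \<and> cl x = cl y" unfolding y_def by (rule someI[of _ x]) (use x in auto)
  then have i: "y - x \<in> I" by (metis cl_eq_iff)
  have "\<Phi> y = \<Phi> ((y - x) + x)" by simp
  also have "\<dots> = \<Phi> (y - x) + \<Phi> x" by (intro qrepD(2)[OF assms(1)] x ideal_carrier i)
  also have "\<dots> = \<Phi> x" using qrepD(6)[OF assms(1) i] qrepD(1)[OF assms] by simp
  finally show ?thesis by (simp add: descend_def y_def)
qed

lemma alg_rep_of_qrep:
  assumes "qrep h d \<Phi>"
  shows "alg_rep A h d (descend \<Phi>)"
  unfolding alg_rep_def
proof (intro conjI ballI allI)
  note 1 = descend_cl[OF assms]
    fix X Y c assume X: "X \<in> carrier A"
    then obtain x where x: "x \<in> carrier KQ" "X = cl x" unfolding quotient_carrier by blast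
    show "descend \<Phi> X \<in> carrier_mat d d" "descend \<Phi> (c \<odot>\<^bsub>A\<^esub> X) = h c \<cdot>\<^sub>m descend \<Phi> X"
      using x qrepD(1,4)[OF assms x(1)] by (simp_all add: 1[OF x(1)] 1[OF smult_carrier[OF x(1)]] quotient_smult)
    assume "Y \<in> carrier A"
    then obtain y where y: "y \<in> carrier KQ" "Y = cl y" unfolding quotient_carrier by blast
    show "descend \<Phi> (X \<oplus>\<^bsub>A\<^esub> Y) = descend \<Phi> X + descend \<Phi> Y" "descend \<Phi> (X \<otimes>\<^bsub>A\<^esub> Y) = descend \<Phi> X * descend \<Phi> Y"
      using x y qrepD(2,3)[OF assms x(1) y(1)] by (simp_all add: 1[OF x(1)] 1[OF y(1)]
        1[OF add_carrier] 1[OF pmul_carrier] quotient_add quotient_mult)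
qed (simp add: quotient_one descend_cl[OF assms] qrepD(5)[OF assms])

definition act :: "('k, (('v, 'e) qpath \<Rightarrow> 'k) set) fd_mod \<Rightarrow> (('v, 'e) qpath \<Rightarrow> 'k) \<Rightarrow> 'k mat" where
  "act M x = snd M (cl x)"

lemma qrep_act: "fd_module A M \<Longrightarrow> qrep id (fst M) (act M)"
  using qrep_of_alg_rep[of id "fst M" "snd M"] by (simp add: fd_module_iff_alg_rep act_def[abs_def])

lemma fd_module_of_qrep:
  assumes "qrep id d \<Phi>"
  obtains M where "fd_module A M" "fst M = d" "\<And>x. x \<in> carrier KQ \<Longrightarrow> act M x = \<Phi> x"
  using that[of "(d, descend \<Phi>)"] alg_rep_of_qrep[OF assms] descend_cl[OF assms]
  by (simp add: fd_module_iff_alg_rep act_def)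

lemma mod_hom_iff:
  "f \<in> mod_hom A M N \<longleftrightarrow>
     f \<in> carrier_mat (fst N) (fst M) \<and> (\<forall>x\<in>carrier KQ. f * act M x = act N x * f)"
proof -
  have "(\<forall>X\<in>carrier A. P X) \<longleftrightarrow> (\<forall>x\<in>carrier KQ. P (cl x))" for P
    unfolding Ball_def quotient_carrier by blast
  then show ?thesis by (simp add: mod_hom_def act_def)
qed

end

section \<open>Evaluation of polynomials\<close>

definition mon_eval :: "('v \<Rightarrow> 't :: comm_ring_1) \<Rightarrow> ('v \<Rightarrow>\<^sub>0 nat) \<Rightarrow> 't" where
  "mon_eval val m = (\<Prod>v\<in>Poly_Mapping.keys m. val v ^ Poly_Mapping.lookup m v)"

text \<open>
  Polynomials in several variables are finitely supported functions on the monomials.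
\<close>

definition poly_eval ::
  "('k :: field \<Rightarrow> 't :: comm_ring_1) \<Rightarrow> ('v \<Rightarrow> 't) \<Rightarrow> (('v \<Rightarrow>\<^sub>0 nat) \<Rightarrow>\<^sub>0 'k) \<Rightarrow> 't" where
  "poly_eval h val f = (\<Sum>m\<in>Poly_Mapping.keys f. h (Poly_Mapping.lookup f m) * mon_eval val m)"

lemma mon_eval_superset:
  assumes "finite S" "Poly_Mapping.keys m \<subseteq> S"
  shows "mon_eval val m = (\<Prod>v\<in>S. val v ^ Poly_Mapping.lookup m v)"
  unfolding mon_eval_def
  by (rule prod.mono_neutral_left) (use assms in \<open>auto simp: in_keys_iff\<close>)

lemma mon_eval_add: "mon_eval val (m + m') = mon_eval val m * mon_eval val m'"
proof -
  let ?S = "Poly_Mapping.keys m \<union> Poly_Mapping.keys m'"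
  have "mon_eval val (m + m') = (\<Prod>v\<in>?S. val v ^ Poly_Mapping.lookup (m + m') v)"
    by (rule mon_eval_superset) (auto dest: set_mp[OF keys_add])
  also have "\<dots> = (\<Prod>v\<in>?S. val v ^ Poly_Mapping.lookup m v) * (\<Prod>v\<in>?S. val v ^ Poly_Mapping.lookup m' v)"
    by (simp add: lookup_add power_add prod.distrib)
  also have "\<dots> = mon_eval val m * mon_eval val m'"
    by (simp add: mon_eval_superset[of ?S])
  finally show ?thesis .
qed

lemma mon_eval_single [simp]: "mon_eval val (Poly_Mapping.single v n) = val v ^ n"
  by (simp add: mon_eval_def)

lemma mon_eval_zero [simp]: "mon_eval val 0 = 1"
  by (simp add: mon_eval_def)

lemma poly_mapping_additive_induct [case_names zero add single]:
  assumes zero: "P 0" and add: "\<And>f g. P f \<Longrightarrow> P g \<Longrightarrow> P (f + g)"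
    and single: "\<And>m c. P (Poly_Mapping.single m c)"
  shows "P f"
proof (induction f rule: update_induct)
  case (update f m c)
  have "Poly_Mapping.update m c f = f + Poly_Mapping.single m c"
    using update by (intro poly_mapping_eqI)
      (auto simp: lookup_update lookup_add lookup_single when_def in_keys_iff)
  then show ?case using update add single by simp
qed (rule zero)

context
  fixes h :: "'k :: field \<Rightarrow> 't :: comm_ring_1"
  assumes h: "comm_ring_hom h"
begin

interpretation h: comm_ring_hom h by (rule h)

lemma poly_eval_superset:
  assumes "finite S" "Poly_Mapping.keys f \<subseteq> S"
  shows "poly_eval h val f = (\<Sum>m\<in>S. h (Poly_Mapping.lookup f m) * mon_eval val m)"
  unfolding poly_eval_def
  by (rule sum.mono_neutral_left) (use assms in \<open>auto simp: in_keys_iff\<close>)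

lemma poly_eval_single: "poly_eval h val (Poly_Mapping.single m c) = h c * mon_eval val m"
  by (simp add: poly_eval_def)

lemma poly_eval_add: "poly_eval h val (f + g) = poly_eval h val f + poly_eval h val g"
proof -
  let ?S = "Poly_Mapping.keys f \<union> Poly_Mapping.keys g"
  have "poly_eval h val (f + g) = (\<Sum>m\<in>?S. h (Poly_Mapping.lookup (f + g) m) * mon_eval val m)"
    by (rule poly_eval_superset) (auto dest: set_mp[OF keys_add])
  also have "\<dots> = (\<Sum>m\<in>?S. h (Poly_Mapping.lookup f m) * mon_eval val m) + (\<Sum>m\<in>?S. h (Poly_Mapping.lookup g m) * mon_eval val m)"
    by (simp add: lookup_add h.hom_add distrib_right sum.distrib)
  also have "\<dots> = poly_eval h val f + poly_eval h val g"
    by (simp add: poly_eval_superset[of ?S])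
  finally show ?thesis .
qed

lemma poly_eval_mult: "poly_eval h val (f * g) = poly_eval h val f * poly_eval h val g"
proof (induction f rule: poly_mapping_additive_induct)
  case (single m c)
  show ?case
  proof (induction g rule: poly_mapping_additive_induct)
    case (single m' c')
    show ?case by (simp add: mult_single poly_eval_single mon_eval_add h.hom_mult ac_simps)
  qed (simp_all add: poly_eval_add distrib_left, simp add: poly_eval_def)
qed (simp_all add: poly_eval_add distrib_right, simp add: poly_eval_def)

lemma poly_eval_hom: "comm_ring_hom (poly_eval h val)"
proof
  have "poly_eval h val (Poly_Mapping.single 0 1) = 1"
    unfolding poly_eval_single by simp
  then show "poly_eval h val 1 = 1" by simp
qed (simp_all add: poly_eval_add poly_eval_mult, simp add: poly_eval_def)

lemma poly_eval_coord: "poly_eval h val (mod_coord x i j) = val (x, i, j)"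
  by (simp add: mod_coord_def poly_eval_single)

lemma poly_eval_const: "poly_eval h val (mod_const c) = h c"
  by (simp add: mod_const_def poly_eval_single)

end

lemma poly_eval_compose:
  fixes h :: "'k :: field \<Rightarrow> 't :: comm_ring_1" and g :: "'t \<Rightarrow> 's :: comm_ring_1"
  assumes "comm_ring_hom h" "comm_ring_hom g"
  shows "g (poly_eval h val f) = poly_eval (\<lambda>c. g (h c)) (\<lambda>v. g (val v)) f"
proof -
  interpret h: comm_ring_hom h by fact
  interpret g: comm_ring_hom g by fact
  show ?thesis
    by (simp add: poly_eval_def mon_eval_def g.hom_sum g.hom_mult g.hom_prod g.hom_power)
qed

lemma poly_induct [case_names const var add mult]:
  fixes f :: "('v \<Rightarrow>\<^sub>0 nat) \<Rightarrow>\<^sub>0 'k :: field"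
  assumes const: "\<And>c. P (Poly_Mapping.single 0 c)"
    and var: "\<And>v. P (Poly_Mapping.single (Poly_Mapping.single v 1) 1)"
    and add: "\<And>f g. P f \<Longrightarrow> P g \<Longrightarrow> P (f + g)"
    and mult: "\<And>f g. P f \<Longrightarrow> P g \<Longrightarrow> P (f * g)"
  shows "P f"
proof (induction f rule: poly_mapping_additive_induct)
  case zero
  then show ?case using const[of 0] by simp
next
  case (single m c)
  have pow: "P (Poly_Mapping.single (Poly_Mapping.single v n) 1)" for v n
  proof (induction n)
    case 0
    then show ?case using const[of 1] by simp
  next
    case (Suc n)
    have "Poly_Mapping.single (Poly_Mapping.single v (Suc n)) (1 :: 'k)
      = Poly_Mapping.single (Poly_Mapping.single v 1) 1 * Poly_Mapping.single (Poly_Mapping.single v n) 1"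
      by (simp add: mult_single single_add[symmetric])
    then show ?case using mult[OF var Suc] by simp
  qed
  have "P (Poly_Mapping.single m 1)"
  proof (induction m rule: poly_mapping_additive_induct)
    case zero
    then show ?case using const[of 1] by simp
  next
    case (add m m')
    then show ?case using mult[OF add] by (simp add: mult_single)
  qed (rule pow)
  then have "P (Poly_Mapping.single 0 c * Poly_Mapping.single m 1)" by (intro mult const)
  then show ?case by (simp add: mult_single)
qed (rule add)

section \<open>The scheme of modules and its points\<close>

lemma spec_pointsD:
  fixes P :: "'r :: comm_ring_1 set"
  assumes "P \<in> spec_points S"
  shows "S \<subseteq> P" "0 \<in> P" "a \<in> P \<Longrightarrow> b \<in> P \<Longrightarrow> a + b \<in> P" "a \<in> P \<Longrightarrow> r * a \<in> P"
    "a * b \<in> P \<Longrightarrow> a \<in> P \<or> b \<in> P" "1 \<notin> P"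
proof -
  interpret P: primeideal P class_ring using assms by (simp add: spec_points_def)
  show "S \<subseteq> P" using assms by (simp add: spec_points_def)
  show "0 \<in> P" using additive_subgroup.zero_closed[OF P.additive_subgroup_axioms] by simp
  show "a \<in> P \<Longrightarrow> b \<in> P \<Longrightarrow> a + b \<in> P"
    using additive_subgroup.a_closed[OF P.additive_subgroup_axioms, of a b] by simp
  show l: "a \<in> P \<Longrightarrow> r * a \<in> P" for r a using P.I_l_closed[of a r] by simp
  show "a * b \<in> P \<Longrightarrow> a \<in> P \<or> b \<in> P" using P.I_prime[of a b] by simp
  show "1 \<notin> P" using P.I_notcarr l[of 1] by auto
qed

lemma spec_pointsI:
  fixes P :: "'r :: comm_ring_1 set"
  assumes "S \<subseteq> P" "0 \<in> P" "\<And>a b. a \<in> P \<Longrightarrow> b \<in> P \<Longrightarrow> a + b \<in> P" "\<And>a r. a \<in> P \<Longrightarrow> r * a \<in> P"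
    "\<And>a b. a * b \<in> P \<Longrightarrow> a \<in> P \<or> b \<in> P" "1 \<notin> P"
  shows "P \<in> spec_points S"
proof -
  have cr: "cring (class_ring :: 'r ring)"
    by (unfold_locales, auto)
  have grp: "group (add_monoid (class_ring :: 'r ring))"
    using cr abelian_group.a_group[of "class_ring :: 'r ring"] unfolding cring_def ring_def by blast
  have "a_inv (class_ring :: 'r ring) a = - a" for a by (simp add: class_ring_simps)
  then have inv: "inv\<^bsub>add_monoid (class_ring :: 'r ring)\<^esub> a = - a" for a unfolding a_inv_def .
  have "primeideal P (class_ring :: 'r ring)"
  proof (rule primeidealI2)
    show "additive_subgroup P (class_ring :: 'r ring)"
    proof (rule additive_subgroupI, rule group.subgroupI[OF grp])
      fix a assume "a \<in> P"
      then show "inv\<^bsub>add_monoid (class_ring :: 'r ring)\<^esub> a \<in> P"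
        unfolding inv using assms(4)[of a "-1"] by simp
    qed (use assms in auto)
  qed (use assms cr in \<open>auto simp: mult.commute\<close>)
  then show ?thesis using assms(1) by (simp add: spec_points_def)
qed

text \<open>
  A homomorphism to a domain is a point with values in this domain; its kernel is the underlying prime
  ideal.
\<close>

lemma spec_points_kernel:
  fixes \<phi> :: "'r :: comm_ring_1 \<Rightarrow> 't :: idom"
  assumes "comm_ring_hom \<phi>" "\<And>s. s \<in> S \<Longrightarrow> \<phi> s = 0"
  shows "{f. \<phi> f = 0} \<in> spec_points S"
proof -
  interpret comm_ring_hom \<phi> by fact
  show ?thesis by (rule spec_pointsI) (use assms in \<open>auto simp: hom_add hom_mult\<close>)
qed

lemma closedin_spec_topology:
  "closedin (spec_topology S) F \<longleftrightarrow> (\<exists>T. F = {P \<in> spec_points S. T \<subseteq> P})"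
proof
  assume "closedin (spec_topology S) F"
  then have F: "F \<subseteq> spec_points S" "openin (spec_topology S) (spec_points S - F)"
    by (auto simp: closedin_def topspace_spec_topology)
  then obtain T where "spec_points S - F = {P \<in> spec_points S. \<not> T \<subseteq> P}"
    unfolding openin_spec_topology by blast
  then have "F = {P \<in> spec_points S. T \<subseteq> P}" using F(1) by blast
  then show "\<exists>T. F = {P \<in> spec_points S. T \<subseteq> P}" by blast
next
  assume "\<exists>T. F = {P \<in> spec_points S. T \<subseteq> P}"
  then obtain T where F: "F = {P \<in> spec_points S. T \<subseteq> P}" by blast
  have "spec_points S - F = {P \<in> spec_points S. \<not> T \<subseteq> P}" unfolding F by blast
  then show "closedin (spec_topology S) F"
    unfolding closedin_def topspace_spec_topology openin_spec_topology using F by blast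
qed

text \<open>
  The closure of \<open>P\<close> consists of the prime ideals above \<open>P\<close>, and a closed set that contains \<open>P\<close> contains
  them all.
\<close>

lemma irreducible_in_closure:
  assumes "P \<in> spec_points S"
  shows "irreducible_in (spec_topology S) {P' \<in> spec_points S. P \<subseteq> P'}"
  unfolding irreducible_in_def
proof (intro conjI allI impI)
  fix F G assume FG: "closedin (spec_topology S) F \<and> closedin (spec_topology S) G \<and>
    {P' \<in> spec_points S. P \<subseteq> P'} \<subseteq> F \<union> G"
  then obtain T T' where T: "F = {P \<in> spec_points S. T \<subseteq> P}" "G = {P \<in> spec_points S. T' \<subseteq> P}"
    unfolding closedin_spec_topology by blast
  have "P \<in> F \<union> G" using FG assms by blast
  then show "{P' \<in> spec_points S. P \<subseteq> P'} \<subseteq> F \<or> {P' \<in> spec_points S. P \<subseteq> P'} \<subseteq> G"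
    unfolding T by blast
qed (use assms in \<open>auto simp: topspace_spec_topology\<close>)

lemma irreducible_in_imp_connectedin:
  assumes "irreducible_in X C"
  shows "connectedin X C"
  unfolding connectedin_closedin
  using assms unfolding irreducible_in_def by blast

lemma specialization_same_component:
  assumes "P \<in> spec_points S" "P1 \<in> spec_points S" "P \<subseteq> P1"
  shows "connected_component_of (spec_topology S) P P1"
  unfolding connected_component_of_def
  using irreducible_in_imp_connectedin[OF irreducible_in_closure[OF assms(1)]] assms by blast

text \<open>
  Congruence modulo \<open>P\<close>, entry by entry; the carriers are included so that congruences can be composed
  without side conditions.
\<close>

definition mcong :: "'r :: comm_ring_1 set \<Rightarrow> nat \<Rightarrow> 'r mat \<Rightarrow> 'r mat \<Rightarrow> bool" where
  "mcong P d M N \<longleftrightarrow> M \<in> carrier_mat d d \<and> N \<in> carrier_mat d d \<and>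
     (\<forall>i<d. \<forall>j<d. M $$ (i, j) - N $$ (i, j) \<in> P)"

context
  fixes P :: "'r :: comm_ring_1 set" and S
  assumes P: "P \<in> spec_points S"
begin

lemma spec_point_uminus: "a \<in> P \<Longrightarrow> - a \<in> P"
  using spec_pointsD(4)[OF P, of a "-1"] by simp

lemma spec_point_sum: "(\<And>i. i \<in> X \<Longrightarrow> f i \<in> P) \<Longrightarrow> sum f X \<in> P"
  by (induction X rule: infinite_finite_induct) (auto intro: spec_pointsD[OF P])

lemma mcong_refl: "M \<in> carrier_mat d d \<Longrightarrow> mcong P d M M"
  using spec_pointsD(2)[OF P] by (simp add: mcong_def)

lemma mcong_sym: "mcong P d M N \<Longrightarrow> mcong P d N M"
  unfolding mcong_def using spec_point_uminus by (metis minus_diff_eq)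

lemma mcong_trans [trans]:
  assumes "mcong P d M N" "mcong P d N K"
  shows "mcong P d M K"
  unfolding mcong_def
proof (intro conjI allI impI)
  fix i j assume "i < d" "j < d"
  then have "(M $$ (i, j) - N $$ (i, j)) + (N $$ (i, j) - K $$ (i, j)) \<in> P"
    using assms by (intro spec_pointsD(3)[OF P]) (auto simp: mcong_def)
  then show "M $$ (i, j) - K $$ (i, j) \<in> P" by simp
qed (use assms in \<open>auto simp: mcong_def\<close>)

lemma mcong_mult:
  assumes "mcong P d M N" "mcong P d M' N'"
  shows "mcong P d (M * M') (N * N')"
  unfolding mcong_def
proof (intro conjI allI impI)
  note c = assms[unfolded mcong_def]
  fix i j assume ij: "i < d" "j < d"
  have "(\<Sum>k<d. (M $$ (i, k) - N $$ (i, k)) * M' $$ (k, j) + N $$ (i, k) * (M' $$ (k, j) - N' $$ (k, j))) \<in> P"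
  proof (intro spec_point_sum spec_pointsD(3)[OF P])
    fix k assume "k \<in> {..<d}"
    then have k: "M $$ (i, k) - N $$ (i, k) \<in> P" "M' $$ (k, j) - N' $$ (k, j) \<in> P" using c ij by auto
    show "(M $$ (i, k) - N $$ (i, k)) * M' $$ (k, j) \<in> P"
      using spec_pointsD(4)[OF P k(1), of "M' $$ (k, j)"] by (simp add: mult.commute)
    show "N $$ (i, k) * (M' $$ (k, j) - N' $$ (k, j)) \<in> P"
      using spec_pointsD(4)[OF P k(2)] .
  qed
  also have "(\<Sum>k<d. (M $$ (i, k) - N $$ (i, k)) * M' $$ (k, j) + N $$ (i, k) * (M' $$ (k, j) - N' $$ (k, j)))
     = (M * M') $$ (i, j) - (N * N') $$ (i, j)"
    using ij c by (auto simp: scalar_prod_def algebra_simps sum_subtractf sum.distrib lessThan_atLeast0)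
  finally show "(M * M') $$ (i, j) - (N * N') $$ (i, j) \<in> P" .
qed (use assms in \<open>auto simp: mcong_def\<close>)

lemma mcong_cancel:
  assumes "mcong P d (c \<cdot>\<^sub>m M) (c \<cdot>\<^sub>m N)" "c \<notin> P" "M \<in> carrier_mat d d" "N \<in> carrier_mat d d"
  shows "mcong P d M N"
  unfolding mcong_def
proof (intro conjI allI impI)
  fix i j assume ij: "i < d" "j < d"
  have "c * (M $$ (i, j) - N $$ (i, j)) \<in> P"
    using ij assms by (auto simp: mcong_def right_diff_distrib)
  then show "M $$ (i, j) - N $$ (i, j) \<in> P" using spec_pointsD(5)[OF P] assms(2) by blast
qed (use assms in auto)

end

context quiver_ideal
begin

text \<open>
  The values of the coordinate functions of the module scheme at a representation.  The coordinates with
  indices out of range are set to zero by the equations of the scheme.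
\<close>

definition coordval ::
  "nat \<Rightarrow> ((('v, 'e) qpath \<Rightarrow> 'k) \<Rightarrow> 't :: comm_ring_1 mat) \<Rightarrow>
     (('v, 'e) qpath \<Rightarrow> 'k) set \<times> nat \<times> nat \<Rightarrow> 't" where
  "coordval d \<Phi> = (\<lambda>(X, i, j). if X \<in> carrier A \<and> i < d \<and> j < d then descend \<Phi> X $$ (i, j) else 0)"

text \<open>
  The prime ideal of the functions that vanish at a representation.
\<close>

definition point ::
  "('k \<Rightarrow> 't :: comm_ring_1) \<Rightarrow> nat \<Rightarrow> ((('v, 'e) qpath \<Rightarrow> 'k) \<Rightarrow> 't mat) \<Rightarrow>
     ('k, (('v, 'e) qpath \<Rightarrow> 'k) set) mod_poly set" where
  "point h d \<Phi> = {f. poly_eval h (coordval d \<Phi>) f = 0}"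

text \<open>
  The generic matrix of an element; modulo every point of the scheme these matrices satisfy the axioms of
  a representation.
\<close>

definition gen :: "nat \<Rightarrow> (('v, 'e) qpath \<Rightarrow> 'k) \<Rightarrow> ('k, (('v, 'e) qpath \<Rightarrow> 'k) set) mod_poly mat" where
  "gen d x = generic_mat d (cl x)"

lemma gen_carrier [simp]: "gen d x \<in> carrier_mat d d"
  by (simp add: gen_def generic_mat_def)

lemma gen_index: "i < d \<Longrightarrow> j < d \<Longrightarrow> gen d x $$ (i, j) = mod_coord (cl x) i j"
  by (simp add: gen_def generic_mat_def)

lemma eval_gen:
  assumes "comm_ring_hom h" "qrep h d \<Phi>" "x \<in> carrier KQ"
  shows "map_mat (poly_eval h (coordval d \<Phi>)) (gen d x) = \<Phi> x"
  using qrepD(1)[OF assms(2,3)] descend_cl[OF assms(2,3)] assms(3)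
  by (intro eq_matI) (auto simp: gen_def generic_mat_def poly_eval_coord[OF assms(1)] coordval_def)

text \<open>
  The equations are indexed by cosets; this form has representatives instead.
\<close>

lemma mod_equations_cases:
  assumes "f \<in> mod_equations A d"
  obtains (add) x y i j where "x \<in> carrier KQ" "y \<in> carrier KQ" "i < d" "j < d"
      "f = (gen d (x + y) - (gen d x + gen d y)) $$ (i, j)"
  | (mult) x y i j where "x \<in> carrier KQ" "y \<in> carrier KQ" "i < d" "j < d"
      "f = (gen d (x \<star> y) - gen d x * gen d y) $$ (i, j)"
  | (smult) c x i j where "x \<in> carrier KQ" "i < d" "j < d"
      "f = (gen d (\<lambda>p. c * x p) - mod_const c \<cdot>\<^sub>m gen d x) $$ (i, j)"
  | (one) i j where "i < d" "j < d" "f = (gen d \<one>\<^bsub>KQ\<^esub> - 1\<^sub>m d) $$ (i, j)"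
  | (outside) X i j where "f = mod_coord X i j" "X \<notin> carrier A \<or> i \<ge> d \<or> j \<ge> d"
proof -
  let ?X = "generic_mat d"
  from assms consider
    (1) X Y i j where "X \<in> carrier A" "Y \<in> carrier A" "i < d" "j < d"
      "f = (?X (X \<oplus>\<^bsub>A\<^esub> Y) - (?X X + ?X Y)) $$ (i, j)"
  | (2) X Y i j where "X \<in> carrier A" "Y \<in> carrier A" "i < d" "j < d"
      "f = (?X (X \<otimes>\<^bsub>A\<^esub> Y) - ?X X * ?X Y) $$ (i, j)"
  | (3) c X i j where "X \<in> carrier A" "i < d" "j < d"
      "f = (?X (c \<odot>\<^bsub>A\<^esub> X) - mod_const c \<cdot>\<^sub>m ?X X) $$ (i, j)"
  | (4) i j where "i < d" "j < d" "f = (?X \<one>\<^bsub>A\<^esub> - 1\<^sub>m d) $$ (i, j)"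
  | (5) X i j where "f = mod_coord X i j" "X \<notin> carrier A \<or> i \<ge> d \<or> j \<ge> d"
    unfolding mod_equations_def Let_def
    apply (elim UnE CollectE exE conjE)
    subgoal by (rule that(1)) (assumption | hypsubst, rule refl)+
    subgoal by (rule that(2)) (assumption | hypsubst, rule refl)+
    subgoal by (rule that(3)) (assumption | hypsubst, rule refl)+
    subgoal for F i j by (rule that(4)[of i j]) simp_all
    subgoal by (rule that(5))
    done
  then show ?thesis
  proof cases
    case 1
    then obtain x y where "x \<in> carrier KQ" "X = cl x" "y \<in> carrier KQ" "Y = cl y"
      unfolding quotient_carrier by blast
    with 1 show ?thesis by (intro add[of x y i j]) (simp_all add: gen_def quotient_add)
  next
    case 2
    then obtain x y where "x \<in> carrier KQ" "X = cl x" "y \<in> carrier KQ" "Y = cl y"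
      unfolding quotient_carrier by blast
    with 2 show ?thesis by (intro mult[of x y i j]) (simp_all add: gen_def quotient_mult)
  next
    case 3
    then obtain x where "x \<in> carrier KQ" "X = cl x" unfolding quotient_carrier by blast
    with 3 show ?thesis by (intro smult[of x i j c]) (simp_all add: gen_def quotient_smult)
  next
    case 4
    then show ?thesis by (intro one[of i j]) (simp_all add: gen_def quotient_one)
  next
    case 5
    then show ?thesis by (rule outside)
  qed
qed

lemma point_in_spec:
  fixes h :: "'k \<Rightarrow> 't :: idom"
  assumes h: "comm_ring_hom h" and \<Phi>: "qrep h d \<Phi>"
  shows "point h d \<Phi> \<in> spec_points (mod_equations A d)"
  unfolding point_def
proof (rule spec_points_kernel[OF poly_eval_hom[OF h]])
  let ?e = "poly_eval h (coordval d \<Phi>)"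
  interpret e: comm_ring_hom ?e by (rule poly_eval_hom[OF h])
  note r = qrepD[OF \<Phi>]
  have ev: "?e (gen d x $$ (i, j)) = \<Phi> x $$ (i, j)" if "x \<in> carrier KQ" "i < d" "j < d" for x i j
    using eval_gen[OF h \<Phi> that(1)] that(2,3) by (metis carrier_matD gen_carrier index_map_mat(1))
  have gdim: "dim_row (gen d x) = d" "dim_col (gen d x) = d" for x by (simp_all add: gen_def generic_mat_def)
  fix f assume "f \<in> mod_equations A d"
  then show "?e f = 0"
  proof (cases rule: mod_equations_cases)
    case (add x y i j)
    then show ?thesis
      using r(1)[OF add(1)] r(1)[OF add(2)] gdim
      by (simp add: e.hom_minus e.hom_add ev r(2) del: plus_fun_apply)
  next
    case (mult x y i j)
    have "?e ((gen d x * gen d y) $$ (i, j)) = (\<Phi> x * \<Phi> y) $$ (i, j)"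
      using mult r(1)[OF mult(1)] r(1)[OF mult(2)] gdim
      by (simp add: scalar_prod_def e.hom_sum e.hom_mult ev)
    then show ?thesis
      using mult gdim ev[OF pmul_carrier[OF mult(1,2)] mult(3,4)] r(3)[OF mult(1,2)]
      by (simp add: e.hom_minus)
  next
    case (smult c x i j)
    then show ?thesis
      using r(1)[OF smult(1)] gdim ev[OF smult(1-3)] ev[OF smult_carrier[OF smult(1)] smult(2,3)]
      by (simp add: e.hom_minus e.hom_mult r(4) poly_eval_const[OF h])
  next
    case (one i j)
    then show ?thesis using gdim ev[OF one_carrier one(1,2)] r(5) by (simp add: e.hom_minus)
  next
    case (outside X i j)
    then show ?thesis by (auto simp: poly_eval_coord[OF h] coordval_def)
  qed
qed

text \<open>
  Applying \<open>g\<close> to the values of a representation leads to a point of the closure.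
\<close>

lemma point_specialize:
  fixes h :: "'k \<Rightarrow> 't :: idom" and g :: "'t \<Rightarrow> 's :: idom"
  assumes h: "comm_ring_hom h" and g: "comm_ring_hom g"
    and \<Phi>: "qrep h d \<Phi>"
    and \<Phi>': "\<And>x i j. x \<in> carrier KQ \<Longrightarrow> i < d \<Longrightarrow> j < d \<Longrightarrow> g (\<Phi> x $$ (i, j)) = \<Phi>' x $$ (i, j)"
    and h': "\<And>c. g (h c) = h' c"
  shows "point h d \<Phi> \<subseteq> point h' d \<Phi>'"
proof -
  interpret g: comm_ring_hom g by fact
  have "g (coordval d \<Phi> v) = coordval d \<Phi>' v" for v
  proof (cases v)
    case (fields X i j)
    have "(SOME x. x \<in> carrier KQ \<and> X = cl x) \<in> carrier KQ" if "X \<in> carrier A"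
      using that unfolding quotient_carrier by (metis (mono_tags, lifting) someI_ex)
    then show ?thesis by (simp add: fields coordval_def descend_def \<Phi>')
  qed
  then have "g (poly_eval h (coordval d \<Phi>) f) = poly_eval h' (coordval d \<Phi>') f" for f
    by (simp add: poly_eval_compose[OF h g] h')
  then show ?thesis unfolding point_def by (metis (mono_tags, lifting) Collect_mono g.hom_zero)
qed

context
  fixes P d
  assumes P: "P \<in> spec_points (mod_equations A d)"
begin

lemma gen_add:
  assumes "x \<in> carrier KQ" "y \<in> carrier KQ"
  shows "mcong P d (gen d (x + y)) (gen d x + gen d y)"
  unfolding mcong_def
proof (intro conjI allI impI)
  fix i j assume "i < d" "j < d"
  then have "(generic_mat d (cl x \<oplus>\<^bsub>A\<^esub> cl y) - (generic_mat d (cl x) + generic_mat d (cl y))) $$ (i, j)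
      \<in> mod_equations A d"
    unfolding mod_equations_def Let_def using assms cl_carrier by blast
  then show "gen d (x + y) $$ (i, j) - (gen d x + gen d y) $$ (i, j) \<in> P"
    using spec_pointsD(1)[OF P] \<open>i < d\<close> \<open>j < d\<close> assms
    by (auto simp: gen_def quotient_add generic_mat_def)
qed auto

lemma gen_mult:
  assumes "x \<in> carrier KQ" "y \<in> carrier KQ"
  shows "mcong P d (gen d (x \<star> y)) (gen d x * gen d y)"
  unfolding mcong_def
proof (intro conjI allI impI)
  fix i j assume "i < d" "j < d"
  then have "(generic_mat d (cl x \<otimes>\<^bsub>A\<^esub> cl y) - generic_mat d (cl x) * generic_mat d (cl y)) $$ (i, j)
      \<in> mod_equations A d"
    unfolding mod_equations_def Let_def using assms cl_carrier by blast
  then show "gen d (x \<star> y) $$ (i, j) - (gen d x * gen d y) $$ (i, j) \<in> P"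
    using spec_pointsD(1)[OF P] \<open>i < d\<close> \<open>j < d\<close> assms
    by (auto simp: gen_def quotient_mult generic_mat_def)
qed (use mult_carrier_mat[OF gen_carrier gen_carrier] in auto)

lemma gen_smult:
  assumes "x \<in> carrier KQ"
  shows "mcong P d (gen d (\<lambda>p. c * x p)) (mod_const c \<cdot>\<^sub>m gen d x)"
  unfolding mcong_def
proof (intro conjI allI impI)
  fix i j assume "i < d" "j < d"
  then have "(generic_mat d (c \<odot>\<^bsub>A\<^esub> cl x) - mod_const c \<cdot>\<^sub>m generic_mat d (cl x)) $$ (i, j)
      \<in> mod_equations A d"
    unfolding mod_equations_def Let_def using assms cl_carrier by blast
  then show "gen d (\<lambda>p. c * x p) $$ (i, j) - (mod_const c \<cdot>\<^sub>m gen d x) $$ (i, j) \<in> P"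
    using spec_pointsD(1)[OF P] \<open>i < d\<close> \<open>j < d\<close> assms
    by (auto simp: gen_def quotient_smult generic_mat_def)
qed auto

lemma gen_one: "mcong P d (gen d \<one>\<^bsub>KQ\<^esub>) (1\<^sub>m d)"
  unfolding mcong_def
proof (intro conjI allI impI)
  fix i j assume "i < d" "j < d"
  then have "(generic_mat d \<one>\<^bsub>A\<^esub> - 1\<^sub>m d) $$ (i, j) \<in> mod_equations A d"
    unfolding mod_equations_def Let_def by blast
  then show "gen d \<one>\<^bsub>KQ\<^esub> $$ (i, j) - 1\<^sub>m d $$ (i, j) \<in> P"
    using spec_pointsD(1)[OF P] \<open>i < d\<close> \<open>j < d\<close>
    by (auto simp: gen_def quotient_one generic_mat_def)
qed auto

lemma gen_ideal:
  assumes "x \<in> I"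
  shows "mcong P d (gen d x) (0\<^sub>m d d)"
proof -
  have "mcong P d (gen d (0 + 0)) (gen d 0 + gen d 0)" by (rule gen_add) auto
  then have "- gen d 0 $$ (i, j) \<in> P" if "i < d" "j < d" for i j
    using that gen_carrier[of d 0] by (auto simp: mcong_def simp del: gen_carrier)
  then have "gen d 0 $$ (i, j) \<in> P" if "i < d" "j < d" for i j
    using that spec_point_uminus[OF P] by (metis add.inverse_inverse)
  then show ?thesis using cl_ideal[OF assms] by (simp add: mcong_def gen_def generic_mat_def)
qed

lemma coord_outside: "X \<notin> carrier A \<or> i \<ge> d \<or> j \<ge> d \<Longrightarrow> mod_coord X i j \<in> P"
  using spec_pointsD(1)[OF P] unfolding mod_equations_def Let_def by blast

end

section \<open>A basis of paths for the quotient\<close>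

text \<open>
  Going down from a length where all paths lie in \<open>I\<close>, a basis of the span of the paths of length above
  \<open>j\<close> modulo \<open>I\<close> is extended by paths of length \<open>j\<close>.  A basis obtained in this way is compatible with the
  filtration by path length, which is the last property: coordinates of a combination of paths of length
  at least \<open>l\<close> are nonzero only at basis paths of length at least \<open>l\<close>.
\<close>

lemma quotient_basis:
  obtains n :: nat and q :: "nat \<Rightarrow> ('v, 'e) qpath" and coord :: "(('v, 'e) qpath \<Rightarrow> 'k) \<Rightarrow> nat \<Rightarrow> 'k"
  where "\<And>i. i < n \<Longrightarrow> q i \<in> qpaths Q"
    and "\<And>x y i. x \<in> carrier KQ \<Longrightarrow> y \<in> carrier KQ \<Longrightarrow> coord (x + y) i = coord x i + coord y i"
    and "\<And>c x i. x \<in> carrier KQ \<Longrightarrow> coord (\<lambda>p. c * x p) i = c * coord x i"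
    and "\<And>x. x \<in> carrier KQ \<Longrightarrow> (\<forall>i<n. coord x i = 0) \<longleftrightarrow> x \<in> I"
    and "\<And>i k. i < n \<Longrightarrow> k < n \<Longrightarrow> coord (path_element (q k)) i = (if i = k then 1 else 0)"
    and "\<And>x l i. x \<in> carrier KQ \<Longrightarrow> (\<And>p. x p \<noteq> 0 \<Longrightarrow> l \<le> length (snd p)) \<Longrightarrow> i < n \<Longrightarrow>
           coord x i \<noteq> 0 \<Longrightarrow> l \<le> length (snd (q i))"
proof -
  interpret V: vector_space "\<lambda>(c :: 'k) (x :: ('v, 'e) qpath \<Rightarrow> 'k) p. c * x p"
    by unfold_locales (auto simp: fun_eq_iff algebra_simps)
  let ?pe = "path_element :: ('v, 'e) qpath \<Rightarrow> ('v, 'e) qpath \<Rightarrow> 'k"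
  have I_sub: "V.subspace I"
    unfolding V.subspace_def by (auto simp del: plus_fun_apply)
  obtain BI where BI: "BI \<subseteq> I" "V.independent BI" "I \<subseteq> V.span BI"
    using V.maximal_independent_subset by metis
  obtain m where m: "\<And>p. p \<in> qpaths Q \<Longrightarrow> length (snd p) \<ge> m \<Longrightarrow> ?pe p \<in> I"
    using long_paths_in_ideal by blast
  have inj_pe: "inj ?pe" by (rule injI) (metis path_element_def zero_neq_one)
  \<comment> \<open>\<open>filt j B\<close>: the set \<open>B\<close> is such a basis for the paths of length at least \<open>j\<close>\<close>
  define filt where "filt j B \<longleftrightarrow> finite B \<and> B \<subseteq> qpaths Q \<and> V.independent (BI \<union> ?pe ` B) \<and> BI \<inter> ?pe ` B = {}
     \<and> (\<forall>l\<ge>j. \<forall>p\<in>qpaths Q. l \<le> length (snd p) \<longrightarrow>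
           ?pe p \<in> V.span (BI \<union> ?pe ` {b\<in>B. l \<le> length (snd b)}))
     \<and> (\<forall>b\<in>B. j \<le> length (snd b))" for j B
  have "\<exists>B. filt (m - k) B" if "k \<le> m" for k
    using that
  proof (induction k)
    case 0
    have "filt m {}" unfolding filt_def using BI m by auto
    then show ?case by auto
  next
    case (Suc k)
    then obtain B where B: "filt (m - k) B" by auto
    define j where "j = m - Suc k"
    have j: "m - k = Suc j" using Suc.prems by (simp add: j_def)
    note B' = B[unfolded filt_def j]
    define L where "L = {p \<in> qpaths Q. length (snd p) = j}"
    have "V.independent (BI \<union> ?pe ` B)" using B' by blast
    then obtain B1 where B1: "BI \<union> ?pe ` B \<subseteq> B1" "B1 \<subseteq> (BI \<union> ?pe ` B) \<union> ?pe ` L"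
        "V.independent B1" "(BI \<union> ?pe ` B) \<union> ?pe ` L \<subseteq> V.span B1"
      using V.maximal_independent_subset_extend[of "BI \<union> ?pe ` B" "(BI \<union> ?pe ` B) \<union> ?pe ` L"]
      by blast
    define B2 where "B2 = B \<union> {p \<in> L. ?pe p \<in> B1 \<and> ?pe p \<notin> BI}"
    have eq: "B1 = BI \<union> ?pe ` B2" unfolding B2_def using B1 by blast
    have "filt j B2"
      unfolding filt_def
    proof (intro conjI allI ballI impI)
      have "finite L" unfolding L_def by (rule finite_paths_of_length)
      then show "finite B2" unfolding B2_def using B' by auto
      show "B2 \<subseteq> qpaths Q" unfolding B2_def L_def using B' by auto
      show "V.independent (BI \<union> ?pe ` B2)" using B1 eq by simp
      show "BI \<inter> ?pe ` B2 = {}" unfolding B2_def using B' by blast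
      show "j \<le> length (snd b)" if "b \<in> B2" for b
        using that B' unfolding B2_def L_def by (auto intro: Suc_leD)
      fix l p assume l: "j \<le> l" and p: "p \<in> qpaths Q" "l \<le> length (snd p)"
      show "?pe p \<in> V.span (BI \<union> ?pe ` {b\<in>B2. l \<le> length (snd b)})"
      proof (cases "l = j \<and> length (snd p) = j")
        case True
        then have "p \<in> L" using p by (simp add: L_def)
        then have "?pe p \<in> V.span (BI \<union> ?pe ` B2)" using B1(4) eq by auto
        moreover have "{b\<in>B2. l \<le> length (snd b)} = B2"
          using \<open>\<And>b. b \<in> B2 \<Longrightarrow> j \<le> length (snd b)\<close> True by auto
        ultimately show ?thesis by simp
      next
        case False
        then have l': "Suc j \<le> max l (Suc j)" "max l (Suc j) \<le> length (snd p)" using l p by auto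
        then have "?pe p \<in> V.span (BI \<union> ?pe ` {b\<in>B. max l (Suc j) \<le> length (snd b)})"
          using B' p by blast
        then show ?thesis
          by (rule set_mp[OF V.span_mono, rotated]) (auto simp: B2_def)
      qed
    qed
    then show ?case unfolding j_def by blast
  qed
  from this[of m] obtain B where B: "filt 0 B" by auto
  note B' = B[unfolded filt_def]
  let ?S = "BI \<union> ?pe ` B"
  have ind: "V.independent ?S" using B' by blast
  have fin: "finite B" and disj: "BI \<inter> ?pe ` B = {}" and Bq: "B \<subseteq> qpaths Q"
    and filtr: "\<And>l p. p \<in> qpaths Q \<Longrightarrow> l \<le> length (snd p) \<Longrightarrow>
      ?pe p \<in> V.span (BI \<union> ?pe ` {b\<in>B. l \<le> length (snd b)})" using B' by auto
  have sp: "x \<in> V.span (BI \<union> ?pe ` {b\<in>B. l \<le> length (snd b)})"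
    if "x \<in> carrier KQ" "\<And>p. x p \<noteq> 0 \<Longrightarrow> l \<le> length (snd p)" for x l
    using that(1)
  proof (induction rule: linear_induct)
    case zero
    show ?case by (rule V.span_zero)
  next
    case (add x y)
    then show ?case by (intro V.span_add)
  next
    case (smult c x)
    then show ?case by (intro V.span_scale)
  next
    case (path p)
    then show ?case using filtr[of p l] that(2) by simp
  qed
  have sp0: "x \<in> V.span ?S" if "x \<in> carrier KQ" for x
    using sp[OF that, of 0] by simp
  obtain q where q: "bij_betw q {..<card B} B"
    using ex_bij_betw_nat_finite[OF fin] by (auto simp: atLeast0LessThan)
  have qB: "q i \<in> B" if "i < card B" for i using bij_betwE[OF q] that by auto
  define coord where "coord x i = V.representation ?S x (?pe (q i))" for x i
  show ?thesis
  proof (rule that[of "card B" q coord])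
    show "q i \<in> qpaths Q" if "i < card B" for i using qB[OF that] Bq by blast
    show "coord (x + y) i = coord x i + coord y i" if "x \<in> carrier KQ" "y \<in> carrier KQ" for x y i
      unfolding coord_def using V.representation_add[OF ind sp0[OF that(2)] sp0[OF that(1)]]
      by (simp add: add.commute)
    show "coord (\<lambda>p. c * x p) i = c * coord x i" if "x \<in> carrier KQ" for c x i
      unfolding coord_def using V.representation_scale[OF ind sp0[OF that]] by simp
    show "coord (?pe (q k)) i = (if i = k then 1 else 0)" if "i < card B" "k < card B" for i k
    proof -
      have "?pe (q k) \<in> ?S" using qB[OF that(2)] by blast
      moreover have "?pe (q i) = ?pe (q k) \<longleftrightarrow> i = k"
        using that by (simp add: inj_eq[OF inj_pe] inj_on_eq_iff[OF bij_betw_imp_inj_on[OF q]])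
      ultimately show ?thesis unfolding coord_def
        by (simp add: V.representation_basis[OF ind])
    qed
    show "l \<le> length (snd (q i))"
      if x: "x \<in> carrier KQ" "\<And>p. x p \<noteq> 0 \<Longrightarrow> l \<le> length (snd p)" and i: "i < card B" "coord x i \<noteq> 0"
      for x l i
    proof -
      let ?S' = "BI \<union> ?pe ` {b\<in>B. l \<le> length (snd b)}"
      have "V.representation ?S x = V.representation ?S' x"
        by (rule V.representation_extend[OF ind sp[OF x]]) auto
      then have "?pe (q i) \<in> ?S'"
        using i(2) V.representation_ne_zero[of ?S' x "?pe (q i)"] unfolding coord_def by simp
      moreover have "?pe (q i) \<notin> BI" using qB[OF i(1)] disj by blast
      ultimately have "?pe (q i) \<in> ?pe ` {b\<in>B. l \<le> length (snd b)}" by blast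
      then show ?thesis unfolding inj_image_mem_iff[OF inj_pe] by simp
    qed
    show "(\<forall>i<card B. coord x i = 0) \<longleftrightarrow> x \<in> I" if x: "x \<in> carrier KQ" for x
    proof
      assume "x \<in> I"
      then have "x \<in> V.span BI" using BI by blast
      then have "V.representation ?S x = V.representation BI x"
        by (intro V.representation_extend[OF ind]) auto
      moreover have "V.representation BI x (?pe (q i)) = 0" if "i < card B" for i
        using V.representation_ne_zero[of BI x "?pe (q i)"] disj qB[OF that] by blast
      ultimately show "\<forall>i<card B. coord x i = 0" unfolding coord_def by simp
    next
      assume 0: "\<forall>i<card B. coord x i = 0"
      have "(\<Sum>v | V.representation ?S x v \<noteq> 0. (\<lambda>p. V.representation ?S x v * v p)) = x"
        by (rule V.sum_nonzero_representation_eq[OF ind sp0[OF x]])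
      moreover have "(\<Sum>v | V.representation ?S x v \<noteq> 0. (\<lambda>p. V.representation ?S x v * v p)) \<in> I"
      proof (rule ideal_sum)
        fix v assume "v \<in> {v. V.representation ?S x v \<noteq> 0}"
        then have v: "V.representation ?S x v \<noteq> 0" by simp
        then have "v \<in> ?S" by (rule V.representation_ne_zero)
        moreover have "v \<notin> ?pe ` B"
        proof
          assume "v \<in> ?pe ` B"
          then have "v \<in> ?pe ` q ` {..<card B}" by (simp only: bij_betw_imp_surj_on[OF q])
          then obtain i where "i < card B" "v = ?pe (q i)" by blast
          then show False using 0 v unfolding coord_def by auto
        qed
        ultimately have "v \<in> I" using BI by blast
        then show "(\<lambda>p. V.representation ?S x v * v p) \<in> I" by (rule ideal_smult)
      qed
      ultimately show "x \<in> I" by simp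
    qed
  qed
qed

end

section \<open>Projective modules and derivations\<close>

lemma surjective_mat_right_inverse:
  assumes "surjective_mat f" "f \<in> carrier_mat m n"
  obtains s where "s \<in> carrier_mat n m" "f * s = 1\<^sub>m m"
proof -
  have "\<exists>v\<in>carrier_vec n. f *\<^sub>v v = unit_vec m j" for j
    using assms unfolding surjective_mat_def mat_image_def
    by (metis carrier_matD imageE unit_vec_carrier)
  then obtain v where v: "\<And>j. v j \<in> carrier_vec n" "\<And>j. f *\<^sub>v v j = unit_vec m j" by metis
  define s where "s = mat n m (\<lambda>(i, j). v j $ i)"
  have s: "s \<in> carrier_mat n m" by (simp add: s_def)
  have "f * s = 1\<^sub>m m"
  proof (rule eq_matI)
    fix i j assume ij: "i < dim_row (1\<^sub>m m :: 'a mat)" "j < dim_col (1\<^sub>m m :: 'a mat)"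
    have "col s j = v j" using v(1)[of j] ij by (auto simp: s_def)
    then have "(f * s) $$ (i, j) = (f *\<^sub>v v j) $ i" using ij assms(2) s by simp
    then show "(f * s) $$ (i, j) = 1\<^sub>m m $$ (i, j)" using ij by (simp add: v(2) unit_vec_def)
  qed (use assms s in auto)
  then show ?thesis using that s by blast
qed

lemma surjective_matI:
  assumes "f \<in> carrier_mat m n" "s \<in> carrier_mat n m" "f * s = 1\<^sub>m m"
  shows "surjective_mat f"
proof -
  have "f *\<^sub>v (s *\<^sub>v v) = v" if "v \<in> carrier_vec m" for v
    using assms that assoc_mult_mat_vec[OF assms(1,2) that] by simp
  then have "carrier_vec m \<subseteq> mat_image f"
    unfolding mat_image_def using assms by (metis carrier_matD(2) imageI mult_mat_vec_carrier subsetI)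
  moreover have "mat_image f \<subseteq> carrier_vec m"
    unfolding mat_image_def using assms by (auto intro: mult_mat_vec_carrier)
  ultimately show ?thesis unfolding surjective_mat_def using assms by auto
qed

lemma mat_eq_by_vec:
  assumes "X \<in> carrier_mat m n" "Y \<in> carrier_mat m n" "\<And>j. j < n \<Longrightarrow> col X j = col Y j"
  shows "X = Y"
proof (rule eq_matI)
  fix i j assume "i < dim_row Y" "j < dim_col Y"
  then have ij: "i < m" "j < n" using assms(2) by auto
  then have "X $$ (i, j) = col X j $ i" using assms(1) by simp
  also have "\<dots> = Y $$ (i, j)" using assms ij by simp
  finally show "X $$ (i, j) = Y $$ (i, j)" .
qed (use assms in auto)

lemma mult_into_image:
  fixes f :: "'a :: field mat"
  assumes f: "f \<in> carrier_mat m n" and X: "X \<in> carrier_mat m k"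
    and img: "\<And>j. j < k \<Longrightarrow> col X j \<in> mat_image f"
  obtains Y where "Y \<in> carrier_mat n k" "f * Y = X"
proof -
  have "\<forall>j. \<exists>v. j < k \<longrightarrow> v \<in> carrier_vec n \<and> f *\<^sub>v v = col X j"
    using img f unfolding mat_image_def by fastforce
  then obtain v where v: "\<And>j. j < k \<Longrightarrow> v j \<in> carrier_vec n \<and> f *\<^sub>v v j = col X j" by metis
  define Y where "Y = mat n k (\<lambda>(i, j). v j $ i)"
  have Y: "Y \<in> carrier_mat n k" by (simp add: Y_def)
  have "f * Y = X"
  proof (rule mat_eq_by_vec[OF mult_carrier_mat[OF f Y] X])
    fix j assume j: "j < k"
    have "col Y j = v j" using v[OF j] j by (auto simp: Y_def)
    then show "col (f * Y) j = col X j" unfolding col_mult2[OF f Y j] using v[OF j] by simp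
  qed
  then show ?thesis using that Y by blast
qed

lemma injective_cancel:
  fixes f :: "'a :: field mat"
  assumes f: "f \<in> carrier_mat m n" and ker: "mat_kernel f = {0\<^sub>v n}"
    and X: "X \<in> carrier_mat n k" and Y: "Y \<in> carrier_mat n k" and eq: "f * X = f * Y"
  shows "X = Y"
proof -
  have "col X j = col Y j" if j: "j < k" for j
  proof -
    have c: "col X j \<in> carrier_vec n" "col Y j \<in> carrier_vec n" using X Y by auto
    have "f *\<^sub>v col X j = f *\<^sub>v col Y j" using eq f X Y j by (metis col_mult2)
    then have "f *\<^sub>v (col X j - col Y j) = 0\<^sub>v m"
      using mult_minus_distrib_mat_vec[OF f c] f c mult_mat_vec_carrier[OF f c(2)] by simp
    then have "col X j - col Y j \<in> mat_kernel f" using f c by (auto simp: mat_kernel_def)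
    then have 0: "col X j - col Y j = 0\<^sub>v n" using ker by simp
    have "col X j $ i = col Y j $ i" if "i < n" for i
    proof -
      have "(col X j - col Y j) $ i = 0" using 0 that by simp
      moreover have "(col X j - col Y j) $ i = col X j $ i - col Y j $ i"
        using X Y j that by (intro index_minus_vec) auto
      ultimately show ?thesis by (simp only: eq_iff_diff_eq_0[of "col X j $ i"])
    qed
    then show ?thesis using X Y j by (intro eq_vecI) auto
  qed
  then show ?thesis by (rule mat_eq_by_vec[OF X Y])
qed

lemma zero_module_projective: "projective_module A (0, \<lambda>_. 0\<^sub>m 0 0)"
proof -
  have "fd_module A (0, \<lambda>_. 0\<^sub>m 0 0)"
    unfolding fd_module_iff_alg_rep alg_rep_def by (auto intro!: eq_matI)
  moreover have "\<exists>l \<in> mod_hom A (0, \<lambda>_. 0\<^sub>m 0 0) M. g * l = h"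
    if "fd_module A M" "g \<in> mod_hom A M N" "h \<in> mod_hom A (0, \<lambda>_. 0\<^sub>m 0 0) N" for M N g h
  proof (rule bexI[of _ "0\<^sub>m (fst M) 0"])
    show "g * 0\<^sub>m (fst M) 0 = h" using that by (intro eq_matI) (auto simp: mod_hom_def)
    have "snd M x \<in> carrier_mat (fst M) (fst M)" if "x \<in> carrier A" for x
      using \<open>fd_module A M\<close> that by (auto simp: fd_module_iff_alg_rep alg_rep_def)
    then show "0\<^sub>m (fst M) 0 \<in> mod_hom A (0, \<lambda>_. 0\<^sub>m 0 0) M"
      unfolding mod_hom_def using right_mult_zero_mat by fastforce
  qed
  ultimately show ?thesis unfolding projective_module_def by blast
qed

text \<open>
  A resolution of length zero is turned into one of length one by a zero module.
\<close>

lemma hereditary_resolution: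
  fixes A :: "('k :: field, 'x) module"
  assumes "hereditary A" "fd_module A M"
  obtains P0 P1 f0 f1 where "projective_module A P0" "projective_module A P1"
    "f0 \<in> mod_hom A P0 M" "surjective_mat f0" "f1 \<in> mod_hom A P1 P0"
    "mat_image f1 = mat_kernel f0" "mat_kernel f1 = {0\<^sub>v (fst P1)}"
proof -
  have "proj_dim A M \<le> gl_dim A" unfolding gl_dim_def using assms(2) by (intro Sup_upper) blast
  then have "proj_dim A M \<le> 1" using assms(1) unfolding hereditary_def by (rule order.trans)
  define X where "X = {enat n | n. \<exists>P f. projective_resolution A M n P f}"
  have "Inf X \<le> 1" using \<open>proj_dim A M \<le> 1\<close> by (simp add: proj_dim_def X_def)
  then have "X \<noteq> {}" by (auto simp: Inf_enat_def)
  then have "Inf X \<in> X" by (auto simp: Inf_enat_def intro: LeastI)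
  then obtain n P f where n: "Inf X = enat n" and res: "projective_resolution A M n P f"
    unfolding X_def by blast
  have "n \<le> 1" using \<open>Inf X \<le> 1\<close> unfolding n by (simp add: one_enat_def)
  note r = res[unfolded projective_resolution_def]
  consider "n = 0" | "n = 1" using \<open>n \<le> 1\<close> by linarith
  then show ?thesis
  proof cases
    case 2
    then show ?thesis using r by (intro that[of "P 0" "P 1" "f 0" "f 1"]) auto
  next
    case 1
    have f0: "f 0 \<in> mod_hom A (P 0) M" "mat_kernel (f 0) = {0\<^sub>v (fst (P 0))}" "projective_module A (P 0)"
      using r 1 by auto
    have P0: "snd (P 0) x \<in> carrier_mat (fst (P 0)) (fst (P 0))" if "x \<in> carrier A" for x
      using f0(3) that by (auto simp: projective_module_def fd_module_iff_alg_rep alg_rep_def)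
    show ?thesis
    proof (rule that[of "P 0" "(0, \<lambda>_. 0\<^sub>m 0 0)" "f 0" "0\<^sub>m (fst (P 0)) 0"])
      show "0\<^sub>m (fst (P 0)) 0 \<in> mod_hom A (0, \<lambda>_. 0\<^sub>m 0 0) (P 0)"
        unfolding mod_hom_def using right_mult_zero_mat[OF P0] by auto
      have "0\<^sub>m (fst (P 0)) 0 *\<^sub>v v = 0\<^sub>v (fst (P 0))" if "v \<in> carrier_vec 0" for v :: "'k vec"
        using that
        by (intro eq_vecI) (auto simp: scalar_prod_def)
      moreover have "carrier_vec 0 \<noteq> ({} :: 'k vec set)" using zero_carrier_vec by blast
      ultimately show "mat_image (0\<^sub>m (fst (P 0)) 0) = mat_kernel (f 0)"
        unfolding f0(2) mat_image_def by auto
      show "mat_kernel (0\<^sub>m (fst (P 0)) 0 :: 'k mat) = {0\<^sub>v (fst (0, \<lambda>_. 0\<^sub>m 0 0))}"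
        unfolding mat_kernel_def by (auto simp: scalar_prod_def intro!: eq_vecI)
    qed (use f0 r zero_module_projective in auto)
  qed
qed

lemma sum_split_add:
  fixes f :: "nat \<Rightarrow> 'a :: comm_monoid_add"
  shows "(\<Sum>k<p + n. f k) = (\<Sum>k<p. f k) + (\<Sum>k<n. f (p + k))"
  by (induction n) (simp_all add: add.assoc)

lemma mat_mult_index:
  assumes "M \<in> carrier_mat a b" "N \<in> carrier_mat b c" "i < a" "j < c"
  shows "(M * N) $$ (i, j) = (\<Sum>k<b. M $$ (i, k) * N $$ (k, j))"
  using assms by (auto simp: scalar_prod_def lessThan_atLeast0)

context quiver_ideal
begin

text \<open>
  The condition on \<open>\<xi>\<close> under which it can be the lower left block of a representation on the direct sum of
  \<open>M\<close> and \<open>N\<close>, that is, describe an extension of \<open>M\<close> by \<open>N\<close>.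
\<close>

definition deriv ::
  "('k, (('v, 'e) qpath \<Rightarrow> 'k) set) fd_mod \<Rightarrow> ('k, (('v, 'e) qpath \<Rightarrow> 'k) set) fd_mod \<Rightarrow>
    ((('v, 'e) qpath \<Rightarrow> 'k) \<Rightarrow> 'k mat) \<Rightarrow> bool" where
  "deriv M N \<xi> \<longleftrightarrow>
     (\<forall>x\<in>carrier KQ. \<xi> x \<in> carrier_mat (fst N) (fst M)) \<and>
     (\<forall>x\<in>carrier KQ. \<forall>y\<in>carrier KQ. \<xi> (x + y) = \<xi> x + \<xi> y) \<and>
     (\<forall>c. \<forall>x\<in>carrier KQ. \<xi> (\<lambda>p. c * x p) = c \<cdot>\<^sub>m \<xi> x) \<and>
     (\<forall>x\<in>carrier KQ. \<forall>y\<in>carrier KQ. \<xi> (x \<star> y) = \<xi> x * act M y + act N x * \<xi> y) \<and>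
     (\<forall>x\<in>I. \<xi> x = 0\<^sub>m (fst N) (fst M))"

lemma derivD:
  assumes "deriv M N \<xi>"
  shows "x \<in> carrier KQ \<Longrightarrow> \<xi> x \<in> carrier_mat (fst N) (fst M)"
    and "x \<in> carrier KQ \<Longrightarrow> y \<in> carrier KQ \<Longrightarrow> \<xi> (x + y) = \<xi> x + \<xi> y"
    and "x \<in> carrier KQ \<Longrightarrow> \<xi> (\<lambda>p. c * x p) = c \<cdot>\<^sub>m \<xi> x"
    and "x \<in> carrier KQ \<Longrightarrow> y \<in> carrier KQ \<Longrightarrow> \<xi> (x \<star> y) = \<xi> x * act M y + act N x * \<xi> y"
    and "x \<in> I \<Longrightarrow> \<xi> x = 0\<^sub>m (fst N) (fst M)"
  using assms by (auto simp: deriv_def)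

lemma act_carrier [simp]:
  "fd_module A M \<Longrightarrow> x \<in> carrier KQ \<Longrightarrow> act M x \<in> carrier_mat (fst M) (fst M)"
  using qrepD(1)[OF qrep_act] by blast

lemma act_mult:
  "fd_module A M \<Longrightarrow> x \<in> carrier KQ \<Longrightarrow> y \<in> carrier KQ \<Longrightarrow> act M (x \<star> y) = act M x * act M y"
  using qrepD(3)[OF qrep_act] by blast

lemma deriv_one:
  assumes M: "fd_module A M" and N: "fd_module A N" and \<xi>: "deriv M N \<xi>"
  shows "\<xi> \<one>\<^bsub>KQ\<^esub> = 0\<^sub>m (fst N) (fst M)"
proof -
  let ?e = "\<xi> \<one>\<^bsub>KQ\<^esub>"
  have c: "?e \<in> carrier_mat (fst N) (fst M)" by (rule derivD(1)[OF \<xi> one_carrier])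
  have "\<xi> (\<one>\<^bsub>KQ\<^esub> \<star> \<one>\<^bsub>KQ\<^esub>) = ?e * 1\<^sub>m (fst M) + 1\<^sub>m (fst N) * ?e"
    unfolding derivD(4)[OF \<xi> one_carrier one_carrier] qrepD(5)[OF qrep_act[OF M]]
      qrepD(5)[OF qrep_act[OF N]] ..
  then have "?e = ?e + ?e" using c by simp
  then have "?e $$ (i, j) = ?e $$ (i, j) + ?e $$ (i, j)" if "i < fst N" "j < fst M" for i j
    using c that by (metis carrier_matD index_add_mat(1))
  then have "?e $$ (i, j) = 0" if "i < fst N" "j < fst M" for i j
    using that by (metis add_0_right add_left_cancel)
  then show ?thesis using c by (intro eq_matI) auto
qed

lemma qrep_block:
  fixes U W L :: "(('v, 'e) qpath \<Rightarrow> 'k) \<Rightarrow> 't :: comm_ring_1 mat"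
  assumes U: "qrep h m U" and W: "qrep h n W"
    and L: "\<And>x. x \<in> carrier KQ \<Longrightarrow> L x \<in> carrier_mat n m"
      "\<And>x y. x \<in> carrier KQ \<Longrightarrow> y \<in> carrier KQ \<Longrightarrow> L (x + y) = L x + L y"
      "\<And>c x. x \<in> carrier KQ \<Longrightarrow> L (\<lambda>p. c * x p) = h c \<cdot>\<^sub>m L x"
      "\<And>x y. x \<in> carrier KQ \<Longrightarrow> y \<in> carrier KQ \<Longrightarrow> L (x \<star> y) = L x * U y + W x * L y"
      "L \<one>\<^bsub>KQ\<^esub> = 0\<^sub>m n m" "\<And>x. x \<in> I \<Longrightarrow> L x = 0\<^sub>m n m"
  shows "qrep h (m + n) (\<lambda>x. four_block_mat (U x) (0\<^sub>m m n) (L x) (W x))" (is "qrep h _ ?E")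
proof (rule qrepI)
  note M' = qrepD[OF U] and N' = qrepD[OF W]
  {
    fix x y c assume x: "x \<in> carrier KQ"
    show "?E x \<in> carrier_mat (m + n) (m + n)" using M'(1)[OF x] N'(1)[OF x] by simp
    show "?E (\<lambda>p. c * x p) = h c \<cdot>\<^sub>m ?E x"
      unfolding M'(4)[OF x] N'(4)[OF x] L(3)[OF x]
      using M'(1)[OF x] N'(1)[OF x] L(1)[OF x] by (intro eq_matI) auto
    assume y: "y \<in> carrier KQ"
    show "?E (x + y) = ?E x + ?E y"
      unfolding M'(2)[OF x y] N'(2)[OF x y] L(2)[OF x y]
      using M'(1)[OF x] N'(1)[OF x] L(1)[OF x] M'(1)[OF y] N'(1)[OF y] L(1)[OF y]
      by (intro eq_matI) auto
    show "?E (x \<star> y) = ?E x * ?E y"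
      unfolding M'(3)[OF x y] N'(3)[OF x y] L(4)[OF x y]
      using M'(1)[OF x] N'(1)[OF x] L(1)[OF x] M'(1)[OF y] N'(1)[OF y] L(1)[OF y]
      by (subst mult_four_block_mat[of _ m m _ n _ n _ _ m _ n]) auto
  }
  show "?E \<one>\<^bsub>KQ\<^esub> = 1\<^sub>m (m + n)"
    unfolding M'(5) N'(5) L(5) by (intro eq_matI) auto
  fix x assume x: "x \<in> I"
  show "?E x = 0\<^sub>m (m + n) (m + n)"
    unfolding M'(6)[OF x] N'(6)[OF x] L(6)[OF x] by (intro eq_matI) auto
qed

lemma extension_module:
  assumes M: "fd_module A M" and N: "fd_module A N" and \<xi>: "deriv M N \<xi>"
  obtains E where "fd_module A E" "fst E = fst M + fst N"
    "\<And>x. x \<in> carrier KQ \<Longrightarrow> act E x = four_block_mat (act M x) (0\<^sub>m (fst M) (fst N)) (\<xi> x) (act N x)"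
proof -
  have "qrep id (fst M + fst N) (\<lambda>x. four_block_mat (act M x) (0\<^sub>m (fst M) (fst N)) (\<xi> x) (act N x))"
    by (rule qrep_block[OF qrep_act[OF M] qrep_act[OF N]])
      (simp_all add: derivD[OF \<xi>] deriv_one[OF M N \<xi>])
  then show ?thesis using that by (rule fd_module_of_qrep)
qed

text \<open>
  The extension that a derivation on a projective module defines is split, and the splitting makes the
  derivation inner.
\<close>

lemma projective_deriv_inner:
  assumes P: "projective_module A P" and N: "fd_module A N" and \<eta>: "deriv P N \<eta>"
  obtains h where "h \<in> carrier_mat (fst N) (fst P)"
    "\<And>x. x \<in> carrier KQ \<Longrightarrow> h * act P x = act N x * h + \<eta> x"
proof -
  have Pm: "fd_module A P" using P by (simp add: projective_module_def)
  let ?p = "fst P" and ?n = "fst N"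
  obtain E where E: "fd_module A E" "fst E = ?p + ?n"
    "\<And>x. x \<in> carrier KQ \<Longrightarrow> act E x = four_block_mat (act P x) (0\<^sub>m ?p ?n) (\<eta> x) (act N x)"
    using extension_module[OF Pm N \<eta>] by blast
  define pr where "pr = mat ?p (?p + ?n) (\<lambda>(i, j). if i = j then 1 else (0 :: 'k))"
  define s where "s = mat (?p + ?n) ?p (\<lambda>(i, j). if i = j then 1 else (0 :: 'k))"
  have prs: "pr \<in> carrier_mat ?p (?p + ?n)" "s \<in> carrier_mat (?p + ?n) ?p"
    by (auto simp: pr_def s_def)
  have pr_mult: "(pr * X) $$ (i, j) = X $$ (i, j)" if "X \<in> carrier_mat (?p + ?n) k" "i < ?p" "j < k" for X i j k
  proof -
    have "(pr * X) $$ (i, j) = (\<Sum>l<?p + ?n. (if i = l then X $$ (l, j) else 0))"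
      unfolding mat_mult_index[OF prs(1) that] using that by (intro sum.cong) (auto simp: pr_def)
    then show ?thesis using that by simp
  qed
  have "pr * s = 1\<^sub>m ?p"
    using prs pr_mult[OF prs(2)] by (intro eq_matI) (auto simp: s_def)
  then have surj: "surjective_mat pr" using prs by (intro surjective_matI)
  have "pr \<in> mod_hom A E P"
    unfolding mod_hom_iff
  proof (intro conjI ballI)
    show "pr \<in> carrier_mat (fst P) (fst E)" using prs E(2) by simp
    fix x assume x: "x \<in> carrier KQ"
    have Px: "act P x \<in> carrier_mat ?p ?p" "act N x \<in> carrier_mat ?n ?n" using Pm N x by auto
    have Ex: "act E x \<in> carrier_mat (?p + ?n) (?p + ?n)" using act_carrier[OF E(1) x] E(2) by simp
    show "pr * act E x = act P x * pr"
    proof (rule eq_matI)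
      fix i j assume "i < dim_row (act P x * pr)" "j < dim_col (act P x * pr)"
      then have ij: "i < ?p" "j < ?p + ?n" using Px prs by auto
      have "(act P x * pr) $$ (i, j) = (\<Sum>l<?p. if j = l then act P x $$ (i, l) else 0)"
        unfolding mat_mult_index[OF Px(1) prs(1) ij] using ij by (intro sum.cong) (auto simp: pr_def)
      also have "\<dots> = act E x $$ (i, j)" using ij Px by (simp add: E(3)[OF x])
      finally show "(pr * act E x) $$ (i, j) = (act P x * pr) $$ (i, j)"
        using pr_mult[OF Ex ij] by simp
    qed (use Px prs Ex in auto)
  qed
  moreover have "1\<^sub>m ?p \<in> mod_hom A P P" unfolding mod_hom_iff
    by (auto simp: left_mult_one_mat[OF act_carrier[OF Pm]] right_mult_one_mat[OF act_carrier[OF Pm]])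
  ultimately obtain l where l: "l \<in> mod_hom A P E" "pr * l = 1\<^sub>m ?p"
    using P E(1) surj unfolding projective_module_def by blast
  have lc: "l \<in> carrier_mat (?p + ?n) ?p" using l(1) E(2) by (simp add: mod_hom_iff)
  define h where "h = mat ?n ?p (\<lambda>(i, j). l $$ (?p + i, j))"
  have hc: "h \<in> carrier_mat ?n ?p" by (simp add: h_def)
  have top: "l $$ (i, j) = (if i = j then 1 else 0)" if "i < ?p" "j < ?p" for i j
    using pr_mult[OF lc that] that l(2) by simp
  have "h * act P x = act N x * h + \<eta> x" if x: "x \<in> carrier KQ" for x
  proof -
    have c: "act P x \<in> carrier_mat ?p ?p" "act N x \<in> carrier_mat ?n ?n" "\<eta> x \<in> carrier_mat ?n ?p"
      using Pm N x derivD(1)[OF \<eta> x] by auto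
    have Ex: "act E x \<in> carrier_mat (?p + ?n) (?p + ?n)" using act_carrier[OF E(1) x] E(2) by simp
    show ?thesis
    proof (rule eq_matI)
      fix i j assume "i < dim_row (act N x * h + \<eta> x)" "j < dim_col (act N x * h + \<eta> x)"
      then have ij: "i < ?n" "j < ?p" "?p + i < ?p + ?n" using c by auto
      have "(h * act P x) $$ (i, j) = (\<Sum>k<?p. h $$ (i, k) * act P x $$ (k, j))"
        by (rule mat_mult_index[OF hc c(1) ij(1,2)])
      also have "\<dots> = (\<Sum>k<?p. l $$ (?p + i, k) * act P x $$ (k, j))"
        using ij by (intro sum.cong) (auto simp: h_def)
      also have "\<dots> = (l * act P x) $$ (?p + i, j)"
        by (rule mat_mult_index[OF lc c(1) ij(3,2), symmetric])
      also have "l * act P x = act E x * l" using l(1) x by (simp add: mod_hom_iff)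
      also have "(act E x * l) $$ (?p + i, j) = (\<Sum>k<?p + ?n. act E x $$ (?p + i, k) * l $$ (k, j))"
        by (rule mat_mult_index[OF Ex lc ij(3,2)])
      also have "\<dots> = (\<Sum>k<?p. \<eta> x $$ (i, k) * l $$ (k, j)) + (\<Sum>k<?n. act N x $$ (i, k) * h $$ (k, j))"
        unfolding sum_split_add using ij c by (auto simp: E(3)[OF x] h_def intro!: sum.cong arg_cong2[where f = "(+)"])
      also have "(\<Sum>k<?p. \<eta> x $$ (i, k) * l $$ (k, j)) = (\<Sum>k<?p. if k = j then \<eta> x $$ (i, k) else 0)"
        using ij by (intro sum.cong) (auto simp: top)
      also have "\<dots> = \<eta> x $$ (i, j)" using ij by simp
      also have "(\<Sum>k<?n. act N x $$ (i, k) * h $$ (k, j)) = (act N x * h) $$ (i, j)"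
        by (rule mat_mult_index[OF c(2) hc ij(1,2), symmetric])
      finally show "(h * act P x) $$ (i, j) = (act N x * h + \<eta> x) $$ (i, j)"
        using ij c hc by simp
    qed (use c hc in auto)
  qed
  then show ?thesis using that hc by blast
qed

end

section \<open>Hereditary quotients\<close>

lemma smult_minus_minus_mat:
  fixes X :: "'a :: ring mat"
  assumes "X \<in> carrier_mat m n" "Y \<in> carrier_mat m n" "Z \<in> carrier_mat m n"
  shows "c \<cdot>\<^sub>m X - (c \<cdot>\<^sub>m Y - c \<cdot>\<^sub>m Z) = c \<cdot>\<^sub>m (X - (Y - Z))"
  using assms by (intro eq_matI) (auto simp: right_diff_distrib)

lemma add_minus_minus_mat:
  fixes X :: "'a :: ab_group_add mat"
  assumes "X \<in> carrier_mat m n" "Y \<in> carrier_mat m n" "Z \<in> carrier_mat m n"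
    "X' \<in> carrier_mat m n" "Y' \<in> carrier_mat m n" "Z' \<in> carrier_mat m n"
  shows "(X + X') - ((Y + Y') - (Z + Z')) = (X - (Y - Z)) + (X' - (Y' - Z'))"
  using assms by (intro eq_matI) auto

lemma add_minus_minus_insert_mat:
  fixes X :: "'a :: ab_group_add mat"
  assumes "X \<in> carrier_mat m n" "Y \<in> carrier_mat m n" "Z \<in> carrier_mat m n"
    "V \<in> carrier_mat m n" "W \<in> carrier_mat m n"
  shows "(X + Y) - (Z - V) = (X - (W - V)) + (Y - (Z - W))"
  using assms by (intro eq_matI) auto

context quiver_ideal
begin

lemma deriv_pullback:
  assumes P0: "fd_module A P0" and M: "fd_module A M" and N2: "fd_module A N2"
    and \<xi>: "deriv M N2 \<xi>" and f: "f0 \<in> mod_hom A P0 M"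
  shows "deriv P0 N2 (\<lambda>x. \<xi> x * f0)"
proof -
  let ?m = "fst M" and ?n2 = "fst N2" and ?p = "fst P0"
  have f0: "f0 \<in> carrier_mat ?m ?p" and f0h: "\<And>x. x \<in> carrier KQ \<Longrightarrow> f0 * act P0 x = act M x * f0"
    using f by (auto simp: mod_hom_iff)
  have aM: "act M x \<in> carrier_mat ?m ?m" and aN2: "act N2 x \<in> carrier_mat ?n2 ?n2"
    and a0: "act P0 x \<in> carrier_mat ?p ?p" if "x \<in> carrier KQ" for x
    using that M N2 P0 by auto
  note \<xi>D = derivD[OF \<xi>]
  show ?thesis
    unfolding deriv_def
  proof (intro conjI ballI allI)
    fix x y c assume x: "x \<in> carrier KQ"
    show "\<xi> x * f0 \<in> carrier_mat ?n2 ?p" using \<xi>D(1)[OF x] f0 by auto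
    show "\<xi> (\<lambda>p. c * x p) * f0 = c \<cdot>\<^sub>m (\<xi> x * f0)"
      unfolding \<xi>D(3)[OF x] using \<xi>D(1)[OF x] f0 by auto
    assume y: "y \<in> carrier KQ"
    show "\<xi> (x + y) * f0 = \<xi> x * f0 + \<xi> y * f0"
      unfolding \<xi>D(2)[OF x y] by (rule add_mult_distrib_mat[OF \<xi>D(1)[OF x] \<xi>D(1)[OF y] f0])
    have "\<xi> (x \<star> y) * f0 = \<xi> x * act M y * f0 + act N2 x * \<xi> y * f0"
      unfolding \<xi>D(4)[OF x y] using \<xi>D(1)[OF x] \<xi>D(1)[OF y] aM[OF y] aN2[OF x] f0
      by (intro add_mult_distrib_mat) auto
    also have "\<xi> x * act M y * f0 = \<xi> x * (f0 * act P0 y)"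
      unfolding f0h[OF y] by (rule assoc_mult_mat[OF \<xi>D(1)[OF x] aM[OF y] f0])
    also have "\<dots> = \<xi> x * f0 * act P0 y" by (rule assoc_mult_mat[OF \<xi>D(1)[OF x] f0 a0[OF y], symmetric])
    also have "act N2 x * \<xi> y * f0 = act N2 x * (\<xi> y * f0)"
      by (rule assoc_mult_mat[OF aN2[OF x] \<xi>D(1)[OF y] f0])
    finally show "\<xi> (x \<star> y) * f0 = \<xi> x * f0 * act P0 y + act N2 x * (\<xi> y * f0)" .
  next
    fix x assume "x \<in> I"
    then show "\<xi> x * f0 = 0\<^sub>m ?n2 ?p" using \<xi>D(5) f0 by simp
  qed
qed

text \<open>
  Over an algebra of global dimension at most one, \<open>Ext\<^sup>1(M, -)\<close> is right exact: derivations, which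
  describe extensions, lift along surjections.  The pullback of \<open>\<xi>\<close> to \<open>P0\<close> is inner, given by
  \<open>h\<close>; restricted to \<open>P1\<close>, \<open>h\<close> is a homomorphism and lifts to some \<open>k\<close>; the push-forward along
  \<open>k\<close> of the class of the resolution then lifts \<open>\<xi>\<close> up to an inner derivation.
\<close>

lemma deriv_lift_of_hereditary:
  assumes her: "hereditary A" and M: "fd_module A M" and N: "fd_module A N" and N2: "fd_module A N2"
    and g: "g \<in> mod_hom A N N2" "surjective_mat g" and \<xi>: "deriv M N2 \<xi>"
  obtains \<xi>' where "deriv M N \<xi>'" "\<And>x. x \<in> carrier KQ \<Longrightarrow> g * \<xi>' x = \<xi> x"
proof -
  obtain P0 P1 f0 f1 where res: "projective_module A P0" "projective_module A P1"
    "f0 \<in> mod_hom A P0 M" "surjective_mat f0" "f1 \<in> mod_hom A P1 P0"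
    "mat_image f1 = mat_kernel f0" "mat_kernel f1 = {0\<^sub>v (fst P1)}"
    using hereditary_resolution[OF her M] by blast
  let ?m = "fst M" and ?n = "fst N" and ?n2 = "fst N2" and ?p = "fst P0" and ?q = "fst P1"
  have P0: "fd_module A P0" and P1: "fd_module A P1" using res by (auto simp: projective_module_def)
  have f0: "f0 \<in> carrier_mat ?m ?p" and f0h: "\<And>x. x \<in> carrier KQ \<Longrightarrow> f0 * act P0 x = act M x * f0"
    using res(3) by (auto simp: mod_hom_iff)
  have f1: "f1 \<in> carrier_mat ?p ?q" and f1h: "\<And>x. x \<in> carrier KQ \<Longrightarrow> f1 * act P1 x = act P0 x * f1"
    using res(5) by (auto simp: mod_hom_iff)
  have gc: "g \<in> carrier_mat ?n2 ?n" and gh: "\<And>x. x \<in> carrier KQ \<Longrightarrow> g * act N x = act N2 x * g"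
    using g(1) by (auto simp: mod_hom_iff)
  have aM: "act M x \<in> carrier_mat ?m ?m" and aN: "act N x \<in> carrier_mat ?n ?n"
    and aN2: "act N2 x \<in> carrier_mat ?n2 ?n2" and a0: "act P0 x \<in> carrier_mat ?p ?p"
    and a1: "act P1 x \<in> carrier_mat ?q ?q" if "x \<in> carrier KQ" for x
    using that M N N2 P0 P1 by auto
  note \<xi>D = derivD[OF \<xi>]
  \<comment> \<open>the pullback to \<open>P0\<close> and its trivialization\<close>
  have "deriv P0 N2 (\<lambda>x. \<xi> x * f0)" by (rule deriv_pullback[OF P0 M N2 \<xi> res(3)])
  then obtain h where h: "h \<in> carrier_mat ?n2 ?p"
    "\<And>x. x \<in> carrier KQ \<Longrightarrow> h * act P0 x = act N2 x * h + \<xi> x * f0"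
    using projective_deriv_inner[OF res(1) N2] by blast
  have f0f1: "f0 * f1 = 0\<^sub>m ?m ?q"
  proof (rule mat_eq_by_vec[of _ ?m ?q])
    fix j assume j: "j < ?q"
    have "col f1 j = f1 *\<^sub>v unit_vec ?q j" using f1 j by (intro eq_vecI) auto
    then have "col f1 j \<in> mat_image f1" unfolding mat_image_def using f1 by auto
    then have "f0 *\<^sub>v col f1 j = 0\<^sub>v ?m" unfolding res(6) using f0 by (auto simp: mat_kernel_def)
    then show "col (f0 * f1) j = col (0\<^sub>m ?m ?q) j" unfolding col_mult2[OF f0 f1 j] using j by auto
  qed (use f0 f1 in auto)
  \<comment> \<open>on \<open>P1\<close> the trivialization is a homomorphism\<close>
  have "h * f1 \<in> mod_hom A P1 N2"
    unfolding mod_hom_iff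
  proof (intro conjI ballI)
    show "h * f1 \<in> carrier_mat ?n2 ?q" using h f1 by auto
    fix x assume x: "x \<in> carrier KQ"
    have "h * f1 * act P1 x = h * (act P0 x * f1)"
      unfolding f1h[OF x, symmetric] by (rule assoc_mult_mat[OF h(1) f1 a1[OF x]])
    also have "\<dots> = (act N2 x * h + \<xi> x * f0) * f1"
      unfolding h(2)[OF x, symmetric] by (rule assoc_mult_mat[OF h(1) a0[OF x] f1, symmetric])
    also have "\<dots> = act N2 x * h * f1 + \<xi> x * f0 * f1"
      using aN2[OF x] h(1) \<xi>D(1)[OF x] f0 f1 by (intro add_mult_distrib_mat) auto
    also have "\<xi> x * f0 * f1 = \<xi> x * 0\<^sub>m ?m ?q"
      unfolding f0f1[symmetric] by (rule assoc_mult_mat[OF \<xi>D(1)[OF x] f0 f1])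
    also have "\<dots> = 0\<^sub>m ?n2 ?q" using \<xi>D(1)[OF x] by simp
    also have "act N2 x * h * f1 = act N2 x * (h * f1)" by (rule assoc_mult_mat[OF aN2[OF x] h(1) f1])
    finally show "h * f1 * act P1 x = act N2 x * (h * f1)"
      using mult_carrier_mat[OF aN2[OF x] mult_carrier_mat[OF h(1) f1]] by simp
  qed
  then obtain k where k: "k \<in> mod_hom A P1 N" "g * k = h * f1"
    using res(2) N N2 g unfolding projective_module_def by blast
  have kc: "k \<in> carrier_mat ?n ?q" and kh: "\<And>x. x \<in> carrier KQ \<Longrightarrow> k * act P1 x = act N x * k"
    using k(1) by (auto simp: mod_hom_iff)
  obtain s where s: "s \<in> carrier_mat ?p ?m" "f0 * s = 1\<^sub>m ?m"
    using surjective_mat_right_inverse[OF res(4) f0] by blast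
  \<comment> \<open>the class of the resolution, as a derivation with values in \<open>P1\<close>\<close>
  have "\<exists>D\<in>carrier_mat ?q ?m. f1 * D = act P0 x * s - s * act M x" if x: "x \<in> carrier KQ" for x
  proof -
    let ?X = "act P0 x * s - s * act M x"
    have c: "act P0 x * s \<in> carrier_mat ?p ?m" "s * act M x \<in> carrier_mat ?p ?m"
      using a0[OF x] aM[OF x] s by auto
    have X: "?X \<in> carrier_mat ?p ?m" by (rule minus_carrier_mat[OF c(2)])
    have "f0 * ?X = f0 * (act P0 x * s) - f0 * (s * act M x)"
      by (rule mult_minus_distrib_mat[OF f0 c])
    also have "f0 * (act P0 x * s) = act M x * f0 * s"
      unfolding f0h[OF x, symmetric] by (rule assoc_mult_mat[OF f0 a0[OF x] s(1), symmetric])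
    also have "\<dots> = act M x * (f0 * s)" by (rule assoc_mult_mat[OF aM[OF x] f0 s(1)])
    also have "\<dots> = act M x" using aM[OF x] by (simp add: s(2))
    also have "f0 * (s * act M x) = f0 * s * act M x" by (rule assoc_mult_mat[OF f0 s(1) aM[OF x], symmetric])
    also have "\<dots> = act M x" using aM[OF x] by (simp add: s(2))
    also have "act M x - act M x = 0\<^sub>m ?m ?m" using aM[OF x] by simp
    finally have 0: "f0 * ?X = 0\<^sub>m ?m ?m" .
    have "col ?X j \<in> mat_image f1" if "j < ?m" for j
    proof -
      have "f0 *\<^sub>v col ?X j = 0\<^sub>v ?m" using col_mult2[OF f0 X that] 0 that by auto
      then show ?thesis unfolding res(6) using f0 X that by (auto simp: mat_kernel_def)
    qed
    then show ?thesis using mult_into_image[OF f1 X] by metis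
  qed
  then obtain \<delta> where \<delta>: "\<And>x. x \<in> carrier KQ \<Longrightarrow> \<delta> x \<in> carrier_mat ?q ?m"
    "\<And>x. x \<in> carrier KQ \<Longrightarrow> f1 * \<delta> x = act P0 x * s - s * act M x"
    by metis
  note cancel = injective_cancel[OF f1 res(7), where k = ?m]
  have \<delta>_der: "deriv M P1 \<delta>"
    unfolding deriv_def
  proof (intro conjI ballI allI)
    fix x y c assume x: "x \<in> carrier KQ"
    show "\<delta> x \<in> carrier_mat ?q ?m" using \<delta> x by simp
    note cx = \<delta>(1)[OF x] a0[OF x] aM[OF x] a1[OF x] s(1) f1
    show "\<delta> (\<lambda>p. c * x p) = c \<cdot>\<^sub>m \<delta> x"
    proof (rule cancel)
      have "f1 * \<delta> (\<lambda>p. c * x p) = c \<cdot>\<^sub>m act P0 x * s - s * (c \<cdot>\<^sub>m act M x)"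
        unfolding \<delta>(2)[OF smult_carrier[OF x]] qrepD(4)[OF qrep_act[OF P0] x] qrepD(4)[OF qrep_act[OF M] x]
        by simp
      also have "\<dots> = c \<cdot>\<^sub>m (act P0 x * s) - c \<cdot>\<^sub>m (s * act M x)"
        unfolding mult_smult_assoc_mat[OF cx(2,5)] mult_smult_distrib[OF cx(5,3)] ..
      also have "\<dots> = c \<cdot>\<^sub>m (act P0 x * s - s * act M x)"
        using cx by (intro eq_matI) (auto simp: right_diff_distrib)
      also have "\<dots> = f1 * (c \<cdot>\<^sub>m \<delta> x)"
        unfolding \<delta>(2)[OF x, symmetric] by (rule mult_smult_distrib[OF f1 cx(1), symmetric])
      finally show "f1 * \<delta> (\<lambda>p. c * x p) = f1 * (c \<cdot>\<^sub>m \<delta> x)" .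
    qed (use \<delta>(1) x in auto)
    assume y: "y \<in> carrier KQ"
    note cy = \<delta>(1)[OF y] a0[OF y] aM[OF y] a1[OF y]
    show "\<delta> (x + y) = \<delta> x + \<delta> y"
    proof (rule cancel)
      have "f1 * \<delta> (x + y) = (act P0 x + act P0 y) * s - s * (act M x + act M y)"
        unfolding \<delta>(2)[OF add_carrier[OF x y]] qrepD(2)[OF qrep_act[OF P0] x y] qrepD(2)[OF qrep_act[OF M] x y] ..
      also have "\<dots> = (act P0 x * s + act P0 y * s) - (s * act M x + s * act M y)"
        unfolding add_mult_distrib_mat[OF cx(2) cy(2) s(1)] mult_add_distrib_mat[OF s(1) cx(3) cy(3)] ..
      also have "\<dots> = (act P0 x * s - s * act M x) + (act P0 y * s - s * act M y)"
        using cx cy by (intro eq_matI) auto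
      also have "\<dots> = f1 * (\<delta> x + \<delta> y)"
        unfolding \<delta>(2)[OF x, symmetric] \<delta>(2)[OF y, symmetric]
        by (rule mult_add_distrib_mat[OF f1 cx(1) cy(1), symmetric])
      finally show "f1 * \<delta> (x + y) = f1 * (\<delta> x + \<delta> y)" .
    qed (use \<delta>(1) x y add_carrier in auto)
    show "\<delta> (x \<star> y) = \<delta> x * act M y + act P1 x * \<delta> y"
    proof (rule cancel)
      have c1: "act P0 x * s \<in> carrier_mat ?p ?m" "s * act M x \<in> carrier_mat ?p ?m"
        "act P0 y * s \<in> carrier_mat ?p ?m" "s * act M y \<in> carrier_mat ?p ?m" using cx cy by auto
      have 1: "f1 * (\<delta> x * act M y) = act P0 x * s * act M y - s * (act M x * act M y)"
      proof -
        have "f1 * (\<delta> x * act M y) = (act P0 x * s - s * act M x) * act M y"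
          unfolding \<delta>(2)[OF x, symmetric] by (rule assoc_mult_mat[OF f1 cx(1) cy(3), symmetric])
        also have "\<dots> = act P0 x * s * act M y - s * act M x * act M y"
          by (rule minus_mult_distrib_mat[OF c1(1,2) cy(3)])
        finally show ?thesis unfolding assoc_mult_mat[OF s(1) cx(3) cy(3)] .
      qed
      have 2: "f1 * (act P1 x * \<delta> y) = act P0 x * act P0 y * s - act P0 x * s * act M y"
      proof -
        have "f1 * (act P1 x * \<delta> y) = act P0 x * f1 * \<delta> y"
          unfolding f1h[OF x, symmetric] by (rule assoc_mult_mat[OF f1 cx(4) cy(1), symmetric])
        also have "\<dots> = act P0 x * (act P0 y * s - s * act M y)"
          unfolding \<delta>(2)[OF y, symmetric] by (rule assoc_mult_mat[OF cx(2) f1 cy(1)])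
        also have "\<dots> = act P0 x * (act P0 y * s) - act P0 x * (s * act M y)"
          by (rule mult_minus_distrib_mat[OF cx(2) c1(3,4)])
        finally show ?thesis
          unfolding assoc_mult_mat[OF cx(2) cy(2) s(1)] assoc_mult_mat[OF cx(2) s(1) cy(3)] .
      qed
      have "f1 * \<delta> (x \<star> y) = act P0 x * act P0 y * s - s * (act M x * act M y)"
        unfolding \<delta>(2)[OF pmul_carrier[OF x y]] act_mult[OF P0 x y] act_mult[OF M x y] ..
      also have "\<dots> = (act P0 x * s * act M y - s * (act M x * act M y))
          + (act P0 x * act P0 y * s - act P0 x * s * act M y)"
        using cx cy by (intro eq_matI) auto
      also have "\<dots> = f1 * (\<delta> x * act M y + act P1 x * \<delta> y)"
        unfolding 1[symmetric] 2[symmetric]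
        using mult_carrier_mat[OF cx(1) cy(3)] mult_carrier_mat[OF cx(4) cy(1)]
        by (intro mult_add_distrib_mat[OF f1, symmetric])
      finally show "f1 * \<delta> (x \<star> y) = f1 * (\<delta> x * act M y + act P1 x * \<delta> y)" .
    qed (use cx cy \<delta>(1) pmul_carrier[OF x y] in auto)
  next
    fix x assume x: "x \<in> I"
    then have x': "x \<in> carrier KQ" by (rule ideal_carrier)
    show "\<delta> x = 0\<^sub>m ?q ?m"
    proof (rule cancel)
      show "f1 * \<delta> x = f1 * 0\<^sub>m ?q ?m"
        unfolding \<delta>(2)[OF x'] qrepD(6)[OF qrep_act[OF P0] x] qrepD(6)[OF qrep_act[OF M] x]
        using s f1 by simp
    qed (use \<delta>(1) x' in auto)
  qed
  \<comment> \<open>push it forward along \<open>k\<close> and correct by the inner derivation of a lift \<open>u\<close> of \<open>h s\<close>\<close>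
  obtain t where t: "t \<in> carrier_mat ?n ?n2" "g * t = 1\<^sub>m ?n2"
    using surjective_mat_right_inverse[OF g(2) gc] by blast
  define u where "u = t * (h * s)"
  have hs: "h * s \<in> carrier_mat ?n2 ?m" using h s by auto
  have u: "u \<in> carrier_mat ?n ?m" unfolding u_def using t hs by auto
  have gu: "g * u = h * s"
    unfolding u_def assoc_mult_mat[OF gc t(1) hs, symmetric] t(2) using hs by (rule left_mult_one_mat)
  define \<xi>' where "\<xi>' x = k * \<delta> x - (act N x * u - u * act M x)" for x
  note \<delta>D = derivD[OF \<delta>_der]
  have "deriv M N \<xi>'"
    unfolding deriv_def
  proof (intro conjI ballI allI)
    fix x y c assume x: "x \<in> carrier KQ"
    note cx = \<delta>D(1)[OF x] aN[OF x] aM[OF x]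
    have c1: "k * \<delta> x \<in> carrier_mat ?n ?m" "act N x * u \<in> carrier_mat ?n ?m" "u * act M x \<in> carrier_mat ?n ?m"
      using cx kc u by auto
    show "\<xi>' x \<in> carrier_mat ?n ?m" unfolding \<xi>'_def by (intro minus_carrier_mat c1)
    show "\<xi>' (\<lambda>p. c * x p) = c \<cdot>\<^sub>m \<xi>' x"
      unfolding \<xi>'_def \<delta>D(3)[OF x] qrepD(4)[OF qrep_act[OF N] x] qrepD(4)[OF qrep_act[OF M] x]
        mult_smult_distrib[OF kc cx(1)] mult_smult_assoc_mat[OF cx(2) u] mult_smult_distrib[OF u cx(3)] id_apply
      by (rule smult_minus_minus_mat[OF c1])
    assume y: "y \<in> carrier KQ"
    note cy = \<delta>D(1)[OF y] aN[OF y] aM[OF y]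
    have c2: "k * \<delta> y \<in> carrier_mat ?n ?m" "act N y * u \<in> carrier_mat ?n ?m" "u * act M y \<in> carrier_mat ?n ?m"
      using cy kc u by auto
    show "\<xi>' (x + y) = \<xi>' x + \<xi>' y"
      unfolding \<xi>'_def \<delta>D(2)[OF x y] qrepD(2)[OF qrep_act[OF N] x y] qrepD(2)[OF qrep_act[OF M] x y]
        mult_add_distrib_mat[OF kc cx(1) cy(1)] add_mult_distrib_mat[OF cx(2) cy(2) u]
        mult_add_distrib_mat[OF u cx(3) cy(3)]
      by (rule add_minus_minus_mat[OF c1 c2])
    have d: "\<delta> x * act M y \<in> carrier_mat ?q ?m" "act P1 x * \<delta> y \<in> carrier_mat ?q ?m"
      using cx cy a1[OF x] by auto
    have "k * (act P1 x * \<delta> y) = act N x * k * \<delta> y"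
      unfolding kh[OF x, symmetric] by (rule assoc_mult_mat[OF kc a1[OF x] cy(1), symmetric])
    also have "\<dots> = act N x * (k * \<delta> y)" by (rule assoc_mult_mat[OF cx(2) kc cy(1)])
    finally have k1: "k * (act P1 x * \<delta> y) = act N x * (k * \<delta> y)" .
    have i: "act N y * u - u * act M y \<in> carrier_mat ?n ?m" "act N x * u - u * act M x \<in> carrier_mat ?n ?m"
      using c1 c2 by (auto intro: minus_carrier_mat)
    have "\<xi>' (x \<star> y) = (k * \<delta> x * act M y + act N x * (k * \<delta> y))
        - (act N x * (act N y * u) - u * act M x * act M y)"
      unfolding \<xi>'_def \<delta>D(4)[OF x y] act_mult[OF N x y] act_mult[OF M x y]
        mult_add_distrib_mat[OF kc d] k1 assoc_mult_mat[OF kc cx(1) cy(3), symmetric]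
        assoc_mult_mat[OF cx(2) cy(2) u] assoc_mult_mat[OF u cx(3) cy(3)] ..
    also have "\<dots> = (k * \<delta> x * act M y - (act N x * u * act M y - u * act M x * act M y))
        + (act N x * (k * \<delta> y) - (act N x * (act N y * u) - act N x * u * act M y))"
      using cx cy c1 c2 by (intro add_minus_minus_insert_mat[of _ ?n ?m]) auto
    also have "k * \<delta> x * act M y - (act N x * u * act M y - u * act M x * act M y) = \<xi>' x * act M y"
      unfolding \<xi>'_def minus_mult_distrib_mat[OF c1(1) i(2) cy(3)]
        minus_mult_distrib_mat[OF c1(2,3) cy(3)] ..
    also have "act N x * (k * \<delta> y) - (act N x * (act N y * u) - act N x * u * act M y) = act N x * \<xi>' y"
      unfolding \<xi>'_def mult_minus_distrib_mat[OF cx(2) c2(1) i(1)]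
        mult_minus_distrib_mat[OF cx(2) c2(2,3)] assoc_mult_mat[OF cx(2) u cy(3)] ..
    finally show "\<xi>' (x \<star> y) = \<xi>' x * act M y + act N x * \<xi>' y" .
  next
    fix x assume x: "x \<in> I"
    show "\<xi>' x = 0\<^sub>m ?n ?m"
      unfolding \<xi>'_def \<delta>D(5)[OF x] qrepD(6)[OF qrep_act[OF N] x] qrepD(6)[OF qrep_act[OF M] x]
      using kc u by (intro eq_matI) auto
  qed
  moreover have "g * \<xi>' x = \<xi> x" if x: "x \<in> carrier KQ" for x
  proof -
    note cx = \<delta>D(1)[OF x] aN[OF x] aM[OF x] aN2[OF x] a0[OF x] \<xi>D(1)[OF x]
    have c1: "k * \<delta> x \<in> carrier_mat ?n ?m" "act N x * u \<in> carrier_mat ?n ?m" "u * act M x \<in> carrier_mat ?n ?m"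
      "act P0 x * s \<in> carrier_mat ?p ?m" "s * act M x \<in> carrier_mat ?p ?m"
      "act N2 x * h \<in> carrier_mat ?n2 ?p" "\<xi> x * f0 \<in> carrier_mat ?n2 ?p"
      using cx kc u s h f0 by auto
    have "g * (k * \<delta> x) = h * f1 * \<delta> x"
      unfolding k(2)[symmetric] by (rule assoc_mult_mat[OF gc kc cx(1), symmetric])
    also have "\<dots> = h * (act P0 x * s - s * act M x)"
      unfolding \<delta>(2)[OF x, symmetric] by (rule assoc_mult_mat[OF h(1) f1 cx(1)])
    also have "\<dots> = h * (act P0 x * s) - h * (s * act M x)"
      by (rule mult_minus_distrib_mat[OF h(1) c1(4,5)])
    also have "h * (act P0 x * s) = (act N2 x * h + \<xi> x * f0) * s"
      unfolding h(2)[OF x, symmetric] by (rule assoc_mult_mat[OF h(1) cx(5) s(1), symmetric])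
    also have "\<dots> = act N2 x * h * s + \<xi> x * f0 * s"
      by (rule add_mult_distrib_mat[OF c1(6,7) s(1)])
    also have "\<xi> x * f0 * s = \<xi> x"
      unfolding assoc_mult_mat[OF cx(6) f0 s(1)] s(2) using cx by simp
    also have "act N2 x * h * s = act N2 x * (h * s)" by (rule assoc_mult_mat[OF cx(4) h(1) s(1)])
    finally have 1: "g * (k * \<delta> x) = act N2 x * (h * s) + \<xi> x - h * (s * act M x)" .
    have "g * (act N x * u) = act N2 x * g * u"
      unfolding gh[OF x, symmetric] by (rule assoc_mult_mat[OF gc cx(2) u, symmetric])
    also have "\<dots> = act N2 x * (h * s)"
      unfolding gu[symmetric] by (rule assoc_mult_mat[OF cx(4) gc u])
    finally have 2: "g * (act N x * u) = act N2 x * (h * s)" .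
    have 3: "g * (u * act M x) = h * (s * act M x)"
      unfolding assoc_mult_mat[OF gc u cx(3), symmetric] gu by (rule assoc_mult_mat[OF h(1) s(1) cx(3)])
    have "g * \<xi>' x = g * (k * \<delta> x) - (g * (act N x * u) - g * (u * act M x))"
      unfolding \<xi>'_def mult_minus_distrib_mat[OF gc c1(1) minus_carrier_mat[OF c1(3)]]
        mult_minus_distrib_mat[OF gc c1(2,3)] ..
    also have "\<dots> = \<xi> x"
      unfolding 1 2 3 using cx hs h(1) c1(5) by (intro eq_matI) auto
    finally show ?thesis .
  qed
  ultimately show ?thesis using that by blast
qed

context
  fixes u as
  assumes path: "(u, as) \<in> qpaths Q"
begin

text \<open>
  The part between the \<open>j\<close>-th and the \<open>i\<close>-th vertex of the fixed path.
\<close>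

definition subpath :: "nat \<Rightarrow> nat \<Rightarrow> ('v, 'e) qpath" where
  "subpath j i = (qpath_end Q (u, take j as), take (i - j) (drop j as))"

lemma subpath_full: "subpath 0 (length as) = (u, as)"
  by (simp add: subpath_def)

lemma subpath_in: "subpath j i \<in> qpaths Q"
proof -
  have "as = take j as @ take (i - j) (drop j as) @ drop (i - j) (drop j as)"
    by (simp only: append_take_drop_id)
  then have "(u, take j as @ take (i - j) (drop j as) @ drop (i - j) (drop j as)) \<in> qpaths Q"
    using path by simp
  then show ?thesis unfolding Q.qpaths_append subpath_def by blast
qed

lemma subpath_length: "j \<le> i \<Longrightarrow> i \<le> length as \<Longrightarrow> length (snd (subpath j i)) = i - j"
  by (simp add: subpath_def)

text \<open>
  Cutting a subpath in two means choosing a vertex between its ends.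
\<close>

lemma subpath_mult:
  assumes "j \<le> i" "i \<le> length as"
  shows "(x \<star> y) (subpath j i) = (\<Sum>l = j..i. x (subpath l i) * y (subpath j l))"
proof -
  let ?u = "qpath_end Q (u, take j as)" and ?r = "take (i - j) (drop j as)"
  have len: "length ?r = i - j" using assms by simp
  have "(x \<star> y) (subpath j i) = (\<Sum>k\<le>i - j. x (qpath_end Q (?u, take k ?r), drop k ?r) * y (?u, take k ?r))"
    unfolding subpath_def path_algebra_mult len ..
  also have "\<dots> = (\<Sum>k\<le>i - j. x (subpath (j + k) i) * y (subpath j (j + k)))"
  proof (rule sum.cong[OF refl])
    fix k assume "k \<in> {..i - j}"
    then have k: "k \<le> i - j" by simp
    have 1: "take k ?r = take k (drop j as)" using k by (simp add: min_def)
    have 2: "drop k ?r = take (i - (j + k)) (drop (j + k) as)"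
      by (simp add: drop_take add.commute)
    have "take (j + k) as = take j as @ take k (drop j as)" by (rule take_add)
    then have 3: "qpath_end Q (?u, take k ?r) = qpath_end Q (u, take (j + k) as)"
      unfolding 1 by (simp add: qpath_end_append)
    show "x (qpath_end Q (?u, take k ?r), drop k ?r) * y (?u, take k ?r)
        = x (subpath (j + k) i) * y (subpath j (j + k))"
      unfolding 2 3 unfolding 1 subpath_def by simp
  qed
  also have "\<dots> = (\<Sum>l = j..i. x (subpath l i) * y (subpath j l))"
    using assms(1)
    by (intro sum.reindex_bij_witness[of _ "\<lambda>l. l - j" "\<lambda>k. j + k"]) auto
  finally show ?thesis .
qed

lemma subpath_one:
  assumes "j \<le> i" "i \<le> length as"
  shows "\<one>\<^bsub>KQ\<^esub> (subpath j i) = (if i = j then 1 else 0)"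
proof -
  have "fst (subpath j i) \<in> verts Q"
    using subpath_in[of j i] Q.qpaths_start by (metis prod.collapse)
  moreover have "snd (subpath j i) = [] \<longleftrightarrow> i = j"
    using subpath_length[OF assms] assms by (metis diff_is_0_eq le_antisym length_0_conv diff_self_eq_0)
  ultimately show ?thesis by (simp add: path_algebra_one case_prod_beta)
qed

text \<open>
  The uniserial module with one basis vector for each of \<open>l\<close> consecutive vertices of the path, beginning
  with vertex \<open>s\<close>: an element acts by its coefficients at the subpaths.
\<close>

definition interval_act :: "nat \<Rightarrow> nat \<Rightarrow> (('v, 'e) qpath \<Rightarrow> 'k) \<Rightarrow> 'k mat" where
  "interval_act s l x = mat l l (\<lambda>(i, j). if j \<le> i then x (subpath (s + j) (s + i)) else 0)"

lemma interval_act_qrep: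
  assumes s: "s + l \<le> Suc (length as)"
    and I0: "\<And>x i j. x \<in> I \<Longrightarrow> j \<le> i \<Longrightarrow> i < l \<Longrightarrow> x (subpath (s + j) (s + i)) = 0"
  shows "qrep id l (interval_act s l)"
proof (rule qrepI)
  fix x y
  show "interval_act s l (x \<star> y) = interval_act s l x * interval_act s l y" (is "?L = ?X * ?Y")
  proof (rule eq_matI)
    have c: "?X \<in> carrier_mat l l" "?Y \<in> carrier_mat l l" by (auto simp: interval_act_def)
    fix i j assume "i < dim_row (?X * ?Y)" "j < dim_col (?X * ?Y)"
    then have ij: "i < l" "j < l" by (auto simp: interval_act_def)
    have "(?X * ?Y) $$ (i, j) = (\<Sum>k<l. ?X $$ (i, k) * ?Y $$ (k, j))"
      by (rule mat_mult_index[OF c ij])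
    also have "\<dots> = (\<Sum>k\<in>{j..i}. x (subpath (s + k) (s + i)) * y (subpath (s + j) (s + k)))"
      by (rule sum.mono_neutral_cong_right) (use ij in \<open>auto simp: interval_act_def\<close>)
    also have "\<dots> = ?L $$ (i, j)"
    proof (cases "j \<le> i")
      case True
      have "?L $$ (i, j) = (\<Sum>k = s + j..s + i. x (subpath k (s + i)) * y (subpath (s + j) k))"
        using ij True s subpath_mult[of "s + j" "s + i" x y] by (simp add: interval_act_def)
      also have "\<dots> = (\<Sum>k\<in>{j..i}. x (subpath (s + k) (s + i)) * y (subpath (s + j) (s + k)))"
        by (intro sum.reindex_bij_witness[of _ "\<lambda>k. s + k" "\<lambda>k. k - s"]) auto
      finally show ?thesis ..
    qed (use ij in \<open>simp add: interval_act_def\<close>)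
    finally show "?L $$ (i, j) = (?X * ?Y) $$ (i, j)" ..
  qed (auto simp: interval_act_def)
next
  show "interval_act s l \<one>\<^bsub>KQ\<^esub> = 1\<^sub>m l"
    using s by (intro eq_matI) (auto simp: interval_act_def subpath_one)
next
  fix x assume "x \<in> I"
  then show "interval_act s l x = 0\<^sub>m l l"
    using I0 by (intro eq_matI) (auto simp: interval_act_def)
qed (auto simp: interval_act_def intro!: eq_matI)

text \<open>
  As proper subpaths have coefficient zero on \<open>I\<close>, the uniserial modules on the path without its last step
  (an extension of the simple module \<open>M\<close> at the start by \<open>N2\<close>) and on the path without its first step
  (the module \<open>N\<close>, which surjects onto \<open>N2\<close>) exist over \<open>A\<close>.  A lift \<open>\<xi>'\<close> of the extension to \<open>N\<close> has
  the coefficients at initial subpaths as its entries, except for the last one.  This entry is a linear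
  form that vanishes on \<open>I\<close>.  Its difference \<open>\<mu>\<close> from the coefficient at the whole path is a derivation
  with values in a one-dimensional bimodule, so it vanishes on paths of length at least two and hence on
  \<open>I\<close>.
\<close>

lemma coefficient_vanishes_step:
  assumes her: "hereditary A" and len: "length as = Suc (Suc k)"
    and short: "\<And>x i j. x \<in> I \<Longrightarrow> j \<le> i \<Longrightarrow> i \<le> length as \<Longrightarrow> i - j < length as \<Longrightarrow> x (subpath j i) = 0"
    and x: "x \<in> I"
  shows "x (u, as) = 0"
proof -
  let ?k = "Suc k"
  obtain M where M: "fd_module A M" "fst M = 1" "\<And>x. x \<in> carrier KQ \<Longrightarrow> act M x = interval_act 0 1 x"
    by (rule fd_module_of_qrep[OF interval_act_qrep[of 0 1]]) (use len short in auto)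
  obtain N where N: "fd_module A N" "fst N = Suc ?k" "\<And>x. x \<in> carrier KQ \<Longrightarrow> act N x = interval_act 1 (Suc ?k) x"
    by (rule fd_module_of_qrep[OF interval_act_qrep[of 1 "Suc ?k"]]) (use len short in auto)
  obtain N2 where N2: "fd_module A N2" "fst N2 = ?k" "\<And>x. x \<in> carrier KQ \<Longrightarrow> act N2 x = interval_act 1 ?k x"
    by (rule fd_module_of_qrep[OF interval_act_qrep[of 1 ?k]]) (use len short in auto)
  define g where "g = mat ?k (Suc ?k) (\<lambda>(i, j). if i = j then 1 else (0 :: 'k))"
  have gc: "g \<in> carrier_mat ?k (Suc ?k)" by (simp add: g_def)
  have g_mult: "(g * X) $$ (i, j) = X $$ (i, j)" if "X \<in> carrier_mat (Suc ?k) c" "i < ?k" "j < c" for X i j c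
  proof -
    have "(g * X) $$ (i, j) = (\<Sum>l<Suc ?k. (if i = l then X $$ (l, j) else 0))"
      unfolding mat_mult_index[OF gc that] using that by (intro sum.cong) (auto simp: g_def)
    then show ?thesis using that by (simp del: sum.lessThan_Suc)
  qed
  have surj: "surjective_mat g"
  proof (rule surjective_matI[OF gc])
    let ?s = "mat (Suc ?k) ?k (\<lambda>(i, j). if i = j then 1 else (0 :: 'k))"
    show s: "?s \<in> carrier_mat (Suc ?k) ?k" by simp
    show "g * ?s = 1\<^sub>m ?k"
    proof (rule eq_matI)
      fix i j assume "i < dim_row (1\<^sub>m ?k :: 'k mat)" "j < dim_col (1\<^sub>m ?k :: 'k mat)"
      then have ij: "i < ?k" "j < ?k" by auto
      show "(g * ?s) $$ (i, j) = 1\<^sub>m ?k $$ (i, j)" unfolding g_mult[OF s ij] using ij by simp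
    qed (use gc in auto)
  qed
  have gh: "g \<in> mod_hom A N N2"
    unfolding mod_hom_iff
  proof (intro conjI ballI)
    show "g \<in> carrier_mat (fst N2) (fst N)" using gc N N2 by simp
    fix x assume x: "x \<in> carrier KQ"
    have c: "act N x \<in> carrier_mat (Suc ?k) (Suc ?k)" "act N2 x \<in> carrier_mat ?k ?k"
      using N N2 x act_carrier by metis+
    show "g * act N x = act N2 x * g"
    proof (rule eq_matI)
      fix i j assume "i < dim_row (act N2 x * g)" "j < dim_col (act N2 x * g)"
      then have ij: "i < ?k" "j < Suc ?k" using c gc by auto
      have "(act N2 x * g) $$ (i, j) = (\<Sum>l<?k. if l = j then act N2 x $$ (i, l) else 0)"
        unfolding mat_mult_index[OF c(2) gc ij] using ij by (intro sum.cong) (auto simp: g_def)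
      also have "\<dots> = act N x $$ (i, j)"
        using ij by (auto simp: N(3)[OF x] N2(3)[OF x] interval_act_def simp del: sum.lessThan_Suc)
      also have "\<dots> = (g * act N x) $$ (i, j)" by (rule g_mult[OF c(1) ij, symmetric])
      finally show "(g * act N x) $$ (i, j) = (act N2 x * g) $$ (i, j)" ..
    qed (use c gc in auto)
  qed
  define \<xi> where "\<xi> x = mat ?k 1 (\<lambda>(i, j). x (subpath 0 (Suc i)))" for x :: "('v, 'e) qpath \<Rightarrow> 'k"
  have \<xi>: "deriv M N2 \<xi>"
    unfolding deriv_def
  proof (intro conjI ballI allI)
    fix x y c assume x: "x \<in> carrier KQ" and y: "y \<in> carrier KQ"
    have c: "act N2 x \<in> carrier_mat ?k ?k" "act M y \<in> carrier_mat 1 1" "\<xi> x \<in> carrier_mat ?k 1" "\<xi> y \<in> carrier_mat ?k 1"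
      using act_carrier[OF N2(1) x] act_carrier[OF M(1) y] M(2) N2(2) by (simp_all add: \<xi>_def)
    show "\<xi> (x \<star> y) = \<xi> x * act M y + act N2 x * \<xi> y"
    proof (rule eq_matI)
      fix i j assume "i < dim_row (\<xi> x * act M y + act N2 x * \<xi> y)" "j < dim_col (\<xi> x * act M y + act N2 x * \<xi> y)"
      then have ij: "i < ?k" "j < 1" using c by auto
      have "(act N2 x * \<xi> y) $$ (i, j) = (\<Sum>l<?k. act N2 x $$ (i, l) * \<xi> y $$ (l, j))"
        by (rule mat_mult_index[OF c(1,4) ij])
      also have "\<dots> = (\<Sum>l\<in>{..i}. x (subpath (Suc l) (Suc i)) * y (subpath 0 (Suc l)))"
        by (rule sum.mono_neutral_cong_right)
          (use ij in \<open>auto simp: N2(3)[OF x] interval_act_def \<xi>_def\<close>)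
      also have "\<dots> = (\<Sum>l = 1..Suc i. x (subpath l (Suc i)) * y (subpath 0 l))"
        by (intro sum.reindex_bij_witness[of _ "\<lambda>l. l - 1" Suc]) auto
      finally have 1: "(act N2 x * \<xi> y) $$ (i, j) = (\<Sum>l = 1..Suc i. x (subpath l (Suc i)) * y (subpath 0 l))" .
      have 2: "(\<xi> x * act M y) $$ (i, j) = x (subpath 0 (Suc i)) * y (subpath 0 0)"
        using ij unfolding mat_mult_index[OF c(3,2) ij] by (simp add: M(3)[OF y] interval_act_def \<xi>_def)
      have "\<xi> (x \<star> y) $$ (i, j) = (\<Sum>l = 0..Suc i. x (subpath l (Suc i)) * y (subpath 0 l))"
        using ij subpath_mult[of 0 "Suc i" x y] len by (simp add: \<xi>_def)
      also have "\<dots> = x (subpath 0 (Suc i)) * y (subpath 0 0) + (\<Sum>l = 1..Suc i. x (subpath l (Suc i)) * y (subpath 0 l))"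
        by (simp add: sum.atLeast_Suc_atMost)
      finally show "\<xi> (x \<star> y) $$ (i, j) = (\<xi> x * act M y + act N2 x * \<xi> y) $$ (i, j)"
        using 1 2 ij c by simp
    qed (use c in \<open>auto simp: \<xi>_def\<close>)
  next
    fix x assume "x \<in> I"
    then show "\<xi> x = 0\<^sub>m (fst N2) (fst M)"
      using short len M(2) N2(2) by (intro eq_matI) (auto simp: \<xi>_def)
  qed (use M(2) N2(2) in \<open>auto simp: \<xi>_def intro!: eq_matI\<close>)
  obtain \<xi>' where \<xi>': "deriv M N \<xi>'" "\<And>x. x \<in> carrier KQ \<Longrightarrow> g * \<xi>' x = \<xi> x"
    using deriv_lift_of_hereditary[OF her M(1) N(1) N2(1) gh surj \<xi>] by blast
  note \<xi>D = derivD[OF \<xi>'(1), unfolded M(2) N(2)]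
  have init: "\<xi>' x $$ (i, 0) = x (subpath 0 (Suc i))" if x: "x \<in> carrier KQ" and i: "i < ?k" for x i
    using g_mult[OF \<xi>D(1)[OF x] i, of 0] \<xi>'(2)[OF x] i by (simp add: \<xi>_def)
  define \<mu> where "\<mu> x = \<xi>' x $$ (?k, 0) - x (u, as)" for x :: "('v, 'e) qpath \<Rightarrow> 'k"
  let ?v = "qpath_end Q (u, as)"
  have \<mu>_mult: "\<mu> (x \<star> y) = \<mu> x * y (u, []) + x (?v, []) * \<mu> y" if x: "x \<in> carrier KQ" and y: "y \<in> carrier KQ" for x y
  proof -
    have c: "act N x \<in> carrier_mat (Suc ?k) (Suc ?k)" "act M y \<in> carrier_mat 1 1"
      using M N x y act_carrier by metis+
    note cx = \<xi>D(1)[OF x] \<xi>D(1)[OF y]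
    have 1: "(\<xi>' x * act M y) $$ (?k, 0) = \<xi>' x $$ (?k, 0) * y (u, [])"
      using mat_mult_index[OF cx(1) c(2), of ?k 0]
      by (simp add: M(3)[OF y] interval_act_def subpath_def)
    have "(act N x * \<xi>' y) $$ (?k, 0) = (\<Sum>l<Suc ?k. act N x $$ (?k, l) * \<xi>' y $$ (l, 0))"
      using mat_mult_index[OF c(1) cx(2), of ?k 0] by simp
    also have "\<dots> = (\<Sum>l<Suc ?k. x (subpath (Suc l) (Suc ?k)) * \<xi>' y $$ (l, 0))"
      by (intro sum.cong) (auto simp: N(3)[OF x] interval_act_def)
    also have "\<dots> = (\<Sum>l<?k. x (subpath (Suc l) (Suc ?k)) * \<xi>' y $$ (l, 0)) + x (subpath (Suc ?k) (Suc ?k)) * \<xi>' y $$ (?k, 0)"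
      by (rule sum.lessThan_Suc)
    also have "(\<Sum>l<?k. x (subpath (Suc l) (Suc ?k)) * \<xi>' y $$ (l, 0)) = (\<Sum>l<?k. x (subpath (Suc l) (Suc ?k)) * y (subpath 0 (Suc l)))"
      by (intro sum.cong) (auto simp: init[OF y])
    also have "\<dots> = (\<Sum>l = 1..?k. x (subpath l (Suc ?k)) * y (subpath 0 l))"
      by (intro sum.reindex_bij_witness[of _ "\<lambda>l. l - 1" Suc]) auto
    finally have 2: "(act N x * \<xi>' y) $$ (?k, 0) = (\<Sum>l = 1..?k. x (subpath l (Suc ?k)) * y (subpath 0 l))
      + x (?v, []) * \<xi>' y $$ (?k, 0)" by (simp add: subpath_def len)
    have "(x \<star> y) (u, as) = (\<Sum>l = 0..Suc ?k. x (subpath l (Suc ?k)) * y (subpath 0 l))"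
      using subpath_mult[of 0 "Suc ?k" x y] len subpath_full by simp
    also have "\<dots> = x (subpath 0 (Suc ?k)) * y (subpath 0 0) + (\<Sum>l = 1..Suc ?k. x (subpath l (Suc ?k)) * y (subpath 0 l))"
      by (simp add: sum.atLeast_Suc_atMost)
    also have "(\<Sum>l = 1..Suc ?k. x (subpath l (Suc ?k)) * y (subpath 0 l))
      = (\<Sum>l = 1..?k. x (subpath l (Suc ?k)) * y (subpath 0 l)) + x (subpath (Suc ?k) (Suc ?k)) * y (subpath 0 (Suc ?k))"
      by (simp add: sum.cl_ivl_Suc)
    finally have 3: "(x \<star> y) (u, as) = x (u, as) * y (u, []) +
      ((\<Sum>l = 1..?k. x (subpath l (Suc ?k)) * y (subpath 0 l)) + x (?v, []) * y (u, as))"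
      using subpath_full len by (simp add: subpath_def)
    have "\<xi>' (x \<star> y) $$ (?k, 0) = (\<xi>' x * act M y) $$ (?k, 0) + (act N x * \<xi>' y) $$ (?k, 0)"
      unfolding \<xi>D(4)[OF x y] using c cx by simp
    then show ?thesis unfolding \<mu>_def 1 2 3 by (simp add: algebra_simps)
  qed
  have xc: "x \<in> carrier KQ" by (rule ideal_carrier[OF x])
  have x2: "2 \<le> length (snd p)" if "x p \<noteq> 0" for p
    using ideal_coeff_short[OF x, of p] that by linarith
  from xc have "\<mu> x = 0"
  proof (induction rule: linear_induct)
    case zero
    have "\<xi>' 0 $$ (?k, 0) = 0" by (subst \<xi>D(5)[OF ideal_zero]) simp
    then have "\<mu> 0 = 0" by (simp add: \<mu>_def)
    then show ?case .
  next
    case (add x y)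
    have "\<mu> (x + y) = \<mu> x + \<mu> y"
      unfolding \<mu>_def \<xi>D(2)[OF add(1,2)] using \<xi>D(1)[OF add(1)] \<xi>D(1)[OF add(2)] by simp
    then show ?case using add by (simp only: add_0_left)
  next
    case (smult c x)
    have "\<mu> (\<lambda>p. c * x p) = c * \<mu> x"
      unfolding \<mu>_def \<xi>D(3)[OF smult(1)] using \<xi>D(1)[OF smult(1)] by (simp add: algebra_simps)
    then show ?case using smult by simp
  next
    case (path p)
    obtain w s where s: "p = (w, s)" by (cases p)
    then have "2 \<le> length s" using x2[OF path(2)] by simp
    then obtain a r where "s = a # r" "r \<noteq> []"
      by (metis Suc_le_length_iff list.distinct(1) numeral_2_eq_2)
    then have p: "p = (w, a # r)" "r \<noteq> []" using s by auto
    from p have a: "a \<in> arcs Q" "w = tail Q a" "(head Q a, r) \<in> qpaths Q" using path(1) by auto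
    have "path_element p = path_element (head Q a, r) \<star> ar a"
      using a p by (simp add: path_element_mult)
    then have "\<mu> (path_element p) = \<mu> (path_element (head Q a, r) \<star> ar a)" by simp
    also have "\<dots> = 0"
      unfolding \<mu>_mult[OF path_element_carrier[OF a(3)] ar_carrier[OF a(1)]]
      using p(2) by (simp add: path_element_def)
    finally show ?case .
  qed
  moreover have "\<xi>' x $$ (?k, 0) = 0" using \<xi>D(5)[OF x] by simp
  ultimately show ?thesis by (simp add: \<mu>_def)
qed

end

theorem ideal_zero_of_hereditary:
  assumes her: "hereditary A"
  shows "I = {0}"
proof -
  have "x (u, as) = 0" if "x \<in> I" "(u, as) \<in> qpaths Q" for x u as
    using that
  proof (induction "length as" arbitrary: x u as rule: less_induct)
    case less
    show ?case
    proof (cases "length as \<le> 1")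
      case True
      then show ?thesis using ideal_coeff_short[OF less.prems(1)] by simp
    next
      case False
      then obtain k where k: "length as = Suc (Suc k)"
        by (metis One_nat_def Suc_n_not_le_n le_0_eq linorder_not_le not0_implies_Suc not_less_eq_eq zero_le)
      show ?thesis
      proof (rule coefficient_vanishes_step[OF less.prems(2) her k _ less.prems(1)])
        fix y i j assume y: "y \<in> I" "j \<le> i" "i \<le> length as" "i - j < length as"
        note p = less.prems(2)
        show "y (subpath u as j i) = 0"
          using less.hyps[of "snd (subpath u as j i)" y "fst (subpath u as j i)"] y
            subpath_length[OF p y(2,3)] subpath_in[OF p] by simp
      qed
    qed
  qed
  then show ?thesis by (rule ideal_eq_zeroI)
qed

end

section \<open>The regular module and its degeneration\<close>

lemma sum_div_mod:
  fixes F :: "nat \<Rightarrow> nat \<Rightarrow> 'a :: comm_monoid_add"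
  shows "(\<Sum>s<r * D. F (s div D) (s mod D)) = (\<Sum>a<r. \<Sum>b<D. F a b)"
proof (cases "D = 0")
  case False
  show ?thesis
  proof (induction r)
    case (Suc r)
    have "(\<Sum>s<Suc r * D. F (s div D) (s mod D)) = (\<Sum>s<r * D + D. F (s div D) (s mod D))"
      by (simp add: add.commute)
    also have "\<dots> = (\<Sum>s<r * D. F (s div D) (s mod D)) + (\<Sum>k<D. F ((r * D + k) div D) ((r * D + k) mod D))"
      by (rule sum_split_add)
    also have "(\<Sum>k<D. F ((r * D + k) div D) ((r * D + k) mod D)) = (\<Sum>k<D. F r k)"
      using False by (intro sum.cong) auto
    finally show ?case by (simp add: Suc.IH)
  qed simp
qed simp

context quiver_ideal
begin

text \<open>
  The terms of \<open>x\<close> whose last arrow is \<open>a\<close>, with this arrow removed.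
\<close>

definition strip :: "'e \<Rightarrow> (('v, 'e) qpath \<Rightarrow> 'k) \<Rightarrow> ('v, 'e) qpath \<Rightarrow> 'k" where
  "strip a x = (\<lambda>(u, r). x (u, r @ [a]))"

lemma strip_carrier [simp]:
  assumes "x \<in> carrier KQ"
  shows "strip a x \<in> carrier KQ"
proof -
  have "{p. strip a x p \<noteq> 0} \<subseteq> (\<lambda>(u, r). (u, butlast r)) ` {p. x p \<noteq> 0}"
  proof
    fix p assume "p \<in> {p. strip a x p \<noteq> 0}"
    then show "p \<in> (\<lambda>(u, r). (u, butlast r)) ` {p. x p \<noteq> 0}"
      by (cases p) (auto simp: strip_def intro!: image_eqI[of _ _ "(fst p, snd p @ [a])"])
  qed
  then have "finite {p. strip a x p \<noteq> 0}"
    using assms finite_surj unfolding path_algebra_carrier by blast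
  moreover have "{p. strip a x p \<noteq> 0} \<subseteq> qpaths Q"
  proof
    fix p assume "p \<in> {p. strip a x p \<noteq> 0}"
    then have "(fst p, snd p @ [a]) \<in> qpaths Q"
      using assms by (cases p) (auto simp: strip_def path_algebra_carrier)
    then show "p \<in> qpaths Q" unfolding Q.qpaths_append by simp
  qed
  ultimately show ?thesis unfolding path_algebra_carrier by blast
qed

lemma vx_mult_apply: "(vx v \<star> x) (u, r) = (if qpath_end Q (u, r) = v then x (u, r) else 0)"
  by (simp add: mult_path_element_left)

lemma ar_mult_apply:
  "(ar a \<star> x) (u, r) = (if r \<noteq> [] \<and> last r = a \<and> qpath_end Q (u, butlast r) = tail Q a
     then x (u, butlast r) else 0)"
proof -
  have "(\<exists>t. r = t @ [a] \<and> qpath_end Q (u, t) = tail Q a) \<longleftrightarrow>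
      r \<noteq> [] \<and> last r = a \<and> qpath_end Q (u, butlast r) = tail Q a"
    by (metis append_butlast_last_id butlast_snoc last_snoc snoc_eq_iff_butlast)
  then show ?thesis by (simp add: mult_path_element_left butlast_conv_take)
qed

lemma vx_tail_strip:
  assumes "x \<in> carrier KQ" "a \<in> arcs Q"
  shows "vx (tail Q a) \<star> strip a x = strip a x"
proof
  fix p :: "('v, 'e) qpath"
  obtain u r where p: "p = (u, r)" by (cases p)
  show "(vx (tail Q a) \<star> strip a x) p = strip a x p"
  proof (cases "x (u, r @ [a]) = 0")
    case False
    then have "(u, r @ [a]) \<in> qpaths Q" using assms(1) by (auto simp: path_algebra_carrier)
    then show ?thesis unfolding p vx_mult_apply Q.qpaths_append by simp
  qed (simp add: p vx_mult_apply strip_def)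
qed

lemma sum_fun_apply: "(\<Sum>i\<in>S. f i) p = (\<Sum>i\<in>S. f i p)" for f :: "'i \<Rightarrow> 'p \<Rightarrow> 'k"
  by (induction S rule: infinite_finite_induct) auto

text \<open>
  The paths that end in \<open>v\<close> are sorted by their last arrow.
\<close>

lemma vx_mult_eq_sum_strip:
  assumes x: "x \<in> carrier KQ" and x0: "\<And>u. x (u, []) = 0"
    and b: "bij_betw b {..<r} {a \<in> arcs Q. head Q a = v}"
  shows "vx v \<star> x = (\<Sum>\<beta><r. ar (b \<beta>) \<star> strip (b \<beta>) x)"
proof
  fix p :: "('v, 'e) qpath"
  obtain u s where p: "p = (u, s)" by (cases p)
  show "(vx v \<star> x) p = (\<Sum>\<beta><r. ar (b \<beta>) \<star> strip (b \<beta>) x) p"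
  proof (cases "s = [] \<or> (u, s) \<notin> qpaths Q")
    case True
    then have "x (u, s) = 0" using x0 carrier_coeff[OF x] by auto
    moreover have "(ar a \<star> strip a x) (u, s) = 0" for a
      using \<open>x (u, s) = 0\<close> by (auto simp: ar_mult_apply strip_def)
    ultimately show ?thesis by (simp add: p sum_fun_apply vx_mult_apply)
  next
    case False
    define a t where "a = last s" and "t = butlast s"
    have s: "s = t @ [a]" using False by (simp add: a_def t_def)
    have q: "(u, t @ [a]) \<in> qpaths Q" using False s by simp
    then have ta: "a \<in> arcs Q" "qpath_end Q (u, t) = tail Q a" unfolding Q.qpaths_append by auto
    have e: "qpath_end Q (u, s) = head Q a" unfolding s qpath_end_append by simp
    have "(\<Sum>\<beta><r. ar (b \<beta>) \<star> strip (b \<beta>) x) p = (\<Sum>\<beta><r. if b \<beta> = a then x (u, s) else 0)"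
      unfolding p sum_fun_apply using ta by (intro sum.cong) (auto simp: ar_mult_apply s strip_def)
    also have "\<dots> = (\<Sum>c | c \<in> arcs Q \<and> head Q c = v. if c = a then x (u, s) else 0)"
      using sum.reindex_bij_betw[OF b, of "\<lambda>c. if c = a then x (u, s) else 0"] by simp
    also have "\<dots> = (if head Q a = v then x (u, s) else 0)"
      using ta by (simp add: sum.delta[OF finite_subset[OF _ Q.finite_arcs]] subset_iff)
    finally show ?thesis unfolding p vx_mult_apply e ..
  qed
qed

text \<open>
  The direct sum of the simple modules at the vertices \<open>f 0, \<dots>, f (n - 1)\<close>.
\<close>

definition diag_act :: "nat \<Rightarrow> ('k \<Rightarrow> 't :: comm_ring_1) \<Rightarrow> (nat \<Rightarrow> 'v) \<Rightarrow> (('v, 'e) qpath \<Rightarrow> 'k) \<Rightarrow> 't mat" where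
  "diag_act n h f x = mat n n (\<lambda>(i, k). if i = k then h (x (f k, [])) else 0)"

lemma diag_act_qrep:
  assumes h: "comm_ring_hom h" and f: "\<And>i. i < n \<Longrightarrow> f i \<in> verts Q"
  shows "qrep h n (diag_act n h f)"
proof -
  interpret h: comm_ring_hom h by (rule h)
  show ?thesis
  proof (rule qrepI)
    fix x y
    have c: "diag_act n h f x \<in> carrier_mat n n" "diag_act n h f y \<in> carrier_mat n n"
      by (auto simp: diag_act_def)
    show "diag_act n h f (x \<star> y) = diag_act n h f x * diag_act n h f y"
    proof (rule eq_matI)
      fix i k assume "i < dim_row (diag_act n h f x * diag_act n h f y)" "k < dim_col (diag_act n h f x * diag_act n h f y)"
      then have ik: "i < n" "k < n" using c by auto
      have "(diag_act n h f x * diag_act n h f y) $$ (i, k)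
          = (\<Sum>l<n. if l = i then (if i = k then h (x (f k, [])) * h (y (f k, [])) else 0) else 0)"
        unfolding mat_mult_index[OF c ik] using ik by (intro sum.cong) (auto simp: diag_act_def)
      then show "diag_act n h f (x \<star> y) $$ (i, k) = (diag_act n h f x * diag_act n h f y) $$ (i, k)"
        using ik by (simp add: diag_act_def mult_at_vertex h.hom_mult)
    qed (auto simp: diag_act_def)
  next
    fix x assume "x \<in> I"
    then show "diag_act n h f x = 0\<^sub>m n n"
      using ideal_coeff_short[of x] by (intro eq_matI) (auto simp: diag_act_def)
  next
    show "diag_act n h f \<one>\<^bsub>KQ\<^esub> = 1\<^sub>m n"
      using f by (intro eq_matI) (auto simp: diag_act_def path_algebra_one)
  qed (auto simp: diag_act_def h.hom_add h.hom_mult intro!: eq_matI)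
qed

end

text \<open>
  The paths \<open>q i\<close> represent a basis of the quotient, with coordinate functions \<open>coord\<close>, that is compatible
  with the filtration by path length.
\<close>

locale quiver_basis = quiver_ideal Q I
  for Q :: "('v, 'e) pre_digraph" and I :: "(('v, 'e) qpath \<Rightarrow> 'k :: field) set" +
  fixes n :: nat and q :: "nat \<Rightarrow> ('v, 'e) qpath" and coord :: "(('v, 'e) qpath \<Rightarrow> 'k) \<Rightarrow> nat \<Rightarrow> 'k"
  assumes q_path: "i < n \<Longrightarrow> q i \<in> qpaths Q"
    and coord_add: "x \<in> carrier KQ \<Longrightarrow> y \<in> carrier KQ \<Longrightarrow> coord (x + y) i = coord x i + coord y i"
    and coord_smult: "x \<in> carrier KQ \<Longrightarrow> coord (\<lambda>p. c * x p) i = c * coord x i"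
    and coord_zero_iff: "x \<in> carrier KQ \<Longrightarrow> (\<forall>i<n. coord x i = 0) \<longleftrightarrow> x \<in> I"
    and coord_basis: "i < n \<Longrightarrow> k < n \<Longrightarrow> coord (path_element (q k)) i = (if i = k then 1 else 0)"
    and coord_length: "x \<in> carrier KQ \<Longrightarrow> (\<And>p. x p \<noteq> 0 \<Longrightarrow> l \<le> length (snd p)) \<Longrightarrow> i < n \<Longrightarrow>
           coord x i \<noteq> 0 \<Longrightarrow> l \<le> length (snd (q i))"
begin

abbreviation basis :: "nat \<Rightarrow> ('v, 'e) qpath \<Rightarrow> 'k" where "basis k \<equiv> path_element (q k)"

abbreviation len :: "nat \<Rightarrow> nat" where "len k \<equiv> length (snd (q k))"

lemma coord_ideal: "x \<in> I \<Longrightarrow> i < n \<Longrightarrow> coord x i = 0"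
  using coord_zero_iff[OF ideal_carrier] by blast

lemma coord_sum:
  assumes "\<And>k. k \<in> S \<Longrightarrow> x k \<in> carrier KQ" "i < n"
  shows "coord (\<Sum>k\<in>S. (\<lambda>p. c k * x k p)) i = (\<Sum>k\<in>S. c k * coord (x k) i)"
  using assms(1)
proof (induction S rule: infinite_finite_induct)
  case (insert k S)
  have "(\<Sum>k\<in>insert k S. (\<lambda>p. c k * x k p)) = (\<lambda>p. c k * x k p) + (\<Sum>k\<in>S. (\<lambda>p. c k * x k p))"
    using insert.hyps by (rule sum.insert)
  moreover have "coord ((\<lambda>p. c k * x k p) + (\<Sum>k\<in>S. (\<lambda>p. c k * x k p))) i
      = coord (\<lambda>p. c k * x k p) i + coord (\<Sum>k\<in>S. (\<lambda>p. c k * x k p)) i"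
    using insert.prems by (intro coord_add smult_carrier sum_carrier) auto
  ultimately show ?case using insert coord_smult by (simp only: sum.insert insertI1 insertI2 not_False_eq_True)
qed (use coord_ideal[OF ideal_zero assms(2)] in simp_all)

text \<open>The coordinates of the difference vanish.\<close>

lemma coord_expansion:
  assumes x: "x \<in> carrier KQ"
  shows "x - (\<Sum>k<n. (\<lambda>p. coord x k * basis k p)) \<in> I"
proof -
  let ?s = "\<Sum>k<n. (\<lambda>p. coord x k * basis k p)"
  have s: "?s \<in> carrier KQ" using q_path by (intro sum_carrier smult_carrier path_element_carrier) auto
  have m: "(\<lambda>p. - 1 * ?s p) \<in> carrier KQ" by (rule smult_carrier[OF s])
  have eq: "x - ?s = x + (\<lambda>p. - 1 * ?s p)" by (simp add: fun_eq_iff)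
  have "coord (x - ?s) i = 0" if i: "i < n" for i
  proof -
    have "coord ?s i = (\<Sum>k<n. coord x k * coord (basis k) i)"
      by (rule coord_sum) (use q_path i in auto)
    also have "\<dots> = (\<Sum>k<n. if i = k then coord x i else 0)"
      by (intro sum.cong) (use i in \<open>auto simp: coord_basis\<close>)
    also have "\<dots> = coord x i" using i by simp
    finally show ?thesis unfolding eq coord_add[OF x m] coord_smult[OF s] by simp
  qed
  moreover have "x - ?s \<in> carrier KQ" unfolding eq by (rule add_carrier[OF x m])
  ultimately show ?thesis using coord_zero_iff by blast
qed

lemma coord_mult:
  assumes x: "x \<in> carrier KQ" and y: "y \<in> carrier KQ" and i: "i < n"
  shows "coord (x \<star> y) i = (\<Sum>k<n. coord y k * coord (x \<star> basis k) i)"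
proof -
  let ?s = "\<Sum>k<n. (\<lambda>p. coord y k * basis k p)"
  have b: "basis k \<in> carrier KQ" if "k < n" for k using q_path[OF that] by simp
  have d: "y - ?s \<in> I" by (rule coord_expansion[OF y])
  have "x \<star> y = x \<star> ((y - ?s) + ?s)" by simp
  also have "\<dots> = x \<star> (y - ?s) + x \<star> ?s" by (rule pmul_add_right)
  also have "x \<star> ?s = (\<Sum>k<n. (\<lambda>p. coord y k * (x \<star> basis k) p))"
  proof -
    have "x \<star> (\<Sum>k\<in>S. (\<lambda>p. coord y k * basis k p)) = (\<Sum>k\<in>S. (\<lambda>p. coord y k * (x \<star> basis k) p))"
      if "finite S" for S
      using that
    proof (induction S rule: finite_induct)
      case (insert k S)
      have "x \<star> (\<Sum>k\<in>insert k S. (\<lambda>p. coord y k * basis k p))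
          = x \<star> ((\<lambda>p. coord y k * basis k p) + (\<Sum>k\<in>S. (\<lambda>p. coord y k * basis k p)))"
        by (subst sum.insert[OF insert.hyps]) (rule refl)
      also have "\<dots> = (\<lambda>p. coord y k * (x \<star> basis k) p) + (\<Sum>k\<in>S. (\<lambda>p. coord y k * (x \<star> basis k) p))"
        unfolding pmul_add_right insert.IH smult_mult_right ..
      also have "\<dots> = (\<Sum>k\<in>insert k S. (\<lambda>p. coord y k * (x \<star> basis k) p))"
        by (rule sum.insert[OF insert.hyps, symmetric])
      finally show ?case .
    qed (simp only: sum.empty pmul_zero_right)
    then show ?thesis by blast
  qed
  finally have eq: "x \<star> y = x \<star> (y - ?s) + (\<Sum>k<n. (\<lambda>p. coord y k * (x \<star> basis k) p))" .
  have xd: "x \<star> (y - ?s) \<in> I" by (rule ideal_mult_left[OF x d])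
  have "coord (x \<star> y) i = coord (x \<star> (y - ?s)) i + coord (\<Sum>k<n. (\<lambda>p. coord y k * (x \<star> basis k) p)) i"
    unfolding eq
  proof (rule coord_add[OF ideal_carrier[OF xd]])
    show "(\<Sum>k<n. (\<lambda>p. coord y k * (x \<star> basis k) p)) \<in> carrier KQ"
      using x b by (intro sum_carrier smult_carrier pmul_carrier) auto
  qed
  then show ?thesis
    using coord_ideal[OF xd i] coord_sum[of "{..<n}" "\<lambda>k. x \<star> basis k" i "coord y"] x b i by simp
qed

lemma coord_mult_basis_length:
  assumes x: "x \<in> carrier KQ" and ik: "i < n" "k < n" and nz: "coord (x \<star> basis k) i \<noteq> 0"
    and l: "\<And>p. x p \<noteq> 0 \<Longrightarrow> l \<le> length (snd p)"
  shows "l + len k \<le> len i"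
proof (rule coord_length[OF _ _ ik(1) nz])
  show "x \<star> basis k \<in> carrier KQ" using x q_path[OF ik(2)] by simp
  fix p assume nz': "(x \<star> basis k) p \<noteq> 0"
  then obtain t where "snd p = snd (q k) @ t" "x (qpath_end Q (q k), drop (length (snd (q k))) (snd p)) \<noteq> 0"
    using nz' mult_path_element_right[where x = x and Q = Q and u = "fst (q k)" and s = "snd (q k)" and v = "fst p" and r = "snd p"]
    by (auto split: if_splits)
  then show "l + len k \<le> length (snd p)" using l by fastforce
qed

text \<open>
  The regular representation in the basis, conjugated by the powers of \<open>t\<close> given by the path
  lengths.  The exponents are never negative where it matters, so \<open>t\<close> need not be invertible; at
  \<open>t = 0\<close> only the diagonal part survives.
\<close>

definition regular_act :: "('k \<Rightarrow> 't :: comm_ring_1) \<Rightarrow> 't \<Rightarrow> (('v, 'e) qpath \<Rightarrow> 'k) \<Rightarrow> 't mat" where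
  "regular_act h t x = mat n n (\<lambda>(i, k). h (coord (x \<star> basis k) i) * t ^ (len i - len k))"

lemma regular_act_qrep:
  assumes h: "comm_ring_hom h"
  shows "qrep h n (regular_act h t)"
proof -
  interpret h: comm_ring_hom h by (rule h)
  have b: "basis k \<in> carrier KQ" if "k < n" for k using q_path[OF that] by simp
  show ?thesis
  proof (rule qrepI)
    fix x y assume x: "x \<in> carrier KQ" and y: "y \<in> carrier KQ"
    have c: "regular_act h t x \<in> carrier_mat n n" "regular_act h t y \<in> carrier_mat n n"
      by (auto simp: regular_act_def)
    show "regular_act h t (x + y) = regular_act h t x + regular_act h t y"
      using x y b by (intro eq_matI)
        (auto simp: regular_act_def pmul_add_left coord_add h.hom_add distrib_right simp del: plus_fun_apply)
    show "regular_act h t (x \<star> y) = regular_act h t x * regular_act h t y"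
    proof (rule eq_matI)
      fix i k assume "i < dim_row (regular_act h t x * regular_act h t y)"
        "k < dim_col (regular_act h t x * regular_act h t y)"
      then have ik: "i < n" "k < n" using c by auto
      have *: "h (coord (x \<star> basis l) i) * t ^ (len i - len l) * (h (coord (y \<star> basis k) l) * t ^ (len l - len k))
          = h (coord (y \<star> basis k) l * coord (x \<star> basis l) i) * t ^ (len i - len k)" if l: "l < n" for l
      proof (cases "coord (x \<star> basis l) i = 0 \<or> coord (y \<star> basis k) l = 0")
        case False
        then have "len l \<le> len i" "len k \<le> len l"
          using coord_mult_basis_length[OF x ik(1) l, of 0] coord_mult_basis_length[OF y l ik(2), of 0] by auto
        then have "t ^ (len i - len k) = t ^ (len i - len l) * t ^ (len l - len k)"
          by (simp add: power_add[symmetric])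
        then show ?thesis by (simp add: h.hom_mult ac_simps)
      qed (auto simp: h.hom_mult)
      have "(regular_act h t x * regular_act h t y) $$ (i, k)
          = (\<Sum>l<n. h (coord (y \<star> basis k) l * coord (x \<star> basis l) i) * t ^ (len i - len k))"
        unfolding mat_mult_index[OF c ik] using ik * by (intro sum.cong) (auto simp: regular_act_def)
      also have "\<dots> = h (coord (x \<star> (y \<star> basis k)) i) * t ^ (len i - len k)"
        unfolding coord_mult[OF x pmul_carrier[OF y b[OF ik(2)]] ik(1)] h.hom_sum
        by (simp add: sum_distrib_right)
      also have "x \<star> (y \<star> basis k) = x \<star> y \<star> basis k"
        by (rule pmul_assoc[OF x y b[OF ik(2)], symmetric])
      finally show "regular_act h t (x \<star> y) $$ (i, k) = (regular_act h t x * regular_act h t y) $$ (i, k)"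
        using ik by (simp add: regular_act_def)
    qed (auto simp: regular_act_def)
  next
    fix c x assume x: "x \<in> carrier KQ"
    show "regular_act h t (\<lambda>p. c * x p) = h c \<cdot>\<^sub>m regular_act h t x"
      using x b by (intro eq_matI)
        (auto simp: regular_act_def smult_mult_left coord_smult h.hom_mult mult.assoc)
  next
    show "regular_act h t \<one>\<^bsub>KQ\<^esub> = 1\<^sub>m n"
      using b by (intro eq_matI) (auto simp: regular_act_def coord_basis)
  next
    fix x assume "x \<in> I"
    then show "regular_act h t x = 0\<^sub>m n n"
      using b by (intro eq_matI) (auto simp: regular_act_def coord_ideal)
  qed (auto simp: regular_act_def)
qed

abbreviation label :: "nat \<Rightarrow> 'v" where "label k \<equiv> qpath_end Q (q k)"

lemma label_verts: "k < n \<Longrightarrow> label k \<in> verts Q"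
  using q_path Q.qpath_end_in_verts by (metis prod.collapse)

text \<open>
  Arrows raise the length, so only the vertices contribute between basis paths whose length does not
  increase.
\<close>

lemma coord_mult_basis_short:
  assumes x: "x \<in> carrier KQ" and ik: "i < n" "k < n" and le: "len i \<le> len k"
  shows "coord (x \<star> basis k) i = (if i = k then x (label k, []) else 0)"
  using x
proof (induction rule: linear_induct)
  case zero
  have "coord (0 \<star> basis k) i = 0" using coord_ideal[OF ideal_zero ik(1)] by simp
  then show ?case by (simp add: fun_eta_zero)
next
  case (add x y)
  have b: "basis k \<in> carrier KQ" using q_path[OF ik(2)] by simp
  have "coord ((x + y) \<star> basis k) i = coord (x \<star> basis k) i + coord (y \<star> basis k) i"
    unfolding pmul_add_left using add b by (intro coord_add pmul_carrier)
  then have "coord ((x + y) \<star> basis k) i = (if i = k then (x + y) (label k, []) else 0)"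
    unfolding add(3,4) by simp
  then show ?case .
next
  case (smult c x)
  have b: "basis k \<in> carrier KQ" using q_path[OF ik(2)] by simp
  show ?case
    unfolding smult_mult_left coord_smult[OF pmul_carrier[OF smult(1) b]] smult(2) by simp
next
  case (path p)
  obtain w r where p: "p = (w, r)" by (cases p)
  show ?case
  proof (cases r)
    case Nil
    have "path_element p \<star> basis k = (if w = label k then basis k else 0)"
      by (cases "q k") (simp add: p Nil path_element_mult)
    moreover have "path_element p (label k, []) = (if w = label k then 1 else (0 :: 'k))"
      by (simp add: p Nil path_element_def)
    ultimately show ?thesis
      using coord_basis[OF ik] coord_ideal[OF ideal_zero ik(1)] by (cases "w = label k") (simp_all add: fun_eta_zero)
  next
    case (Cons a r')
    have "coord (path_element p \<star> basis k) i = 0"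
    proof (rule ccontr)
      assume "coord (path_element p \<star> basis k) i \<noteq> 0"
      then have "1 + len k \<le> len i"
        by (rule coord_mult_basis_length[OF path_element_carrier[OF path(1)] ik])
          (auto simp: path_element_def p Cons split: if_splits)
      then show False using le by simp
    qed
    then show ?thesis by (simp add: p Cons path_element_def)
  qed
qed

lemma regular_act_zero:
  assumes x: "x \<in> carrier KQ" and h: "comm_ring_hom h"
  shows "regular_act h 0 x = diag_act n h label x"
proof -
  interpret h: comm_ring_hom h by (rule h)
  have "h (coord (x \<star> basis k) i) * 0 ^ (len i - len k) = (if i = k then h (x (label k, [])) else 0)"
    if "i < n" "k < n" for i k
    using coord_mult_basis_short[OF x that] by (cases "len i \<le> len k") (auto simp: power_0_left)
  then show ?thesis by (intro eq_matI) (auto simp: regular_act_def diag_act_def)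
qed

text \<open>
  The image of \<open>1\<close> under \<open>x\<close> is \<open>x\<close>.
\<close>

lemma regular_act_faithful:
  assumes x: "x \<in> carrier KQ" and "\<And>i k. i < n \<Longrightarrow> k < n \<Longrightarrow> coord (x \<star> basis k) i = 0"
  shows "x \<in> I"
proof -
  have "coord (x \<star> \<one>\<^bsub>KQ\<^esub>) i = 0" if "i < n" for i
    unfolding coord_mult[OF x one_carrier that] using assms(2) that by simp
  then show ?thesis using coord_zero_iff[OF x] x by simp
qed

end

section \<open>Geometrically irreducible quotients\<close>

lemma connected_component_ofI_irreducible:
  assumes "\<forall>C \<in> connected_components_of X. irreducible_in X C" "p \<in> topspace X"
  shows "irreducible_in X (connected_component_of_set X p)"
  using assms by (simp add: connected_component_in_connected_components_of)

lemma comm_ring_hom_poly: "comm_ring_hom (\<lambda>p :: 'a :: comm_ring_1 poly. poly p t)"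
  by unfold_locales auto

lemma comm_ring_hom_const: "comm_ring_hom (\<lambda>c :: 'a :: comm_ring_1. [:c:])"
  by unfold_locales auto

lemma block_index:
  fixes i d \<beta> :: nat
  assumes "i < d"
  shows "(\<beta> * d + i) div d = \<beta>" "(\<beta> * d + i) mod d = i"
  using assms by auto

lemma comm_ring_hom_id: "comm_ring_hom (id :: 'a :: comm_ring_1 \<Rightarrow> 'a)"
  by unfold_locales auto

context quiver_ideal
begin

lemma quiver_basis_exists:
  obtains n q coord where "quiver_basis Q I n q coord"
proof (rule quotient_basis, goal_cases)
  case (1 n q coord)
  show ?case by (rule that, unfold_locales) (rule 1; assumption)+
qed

lemma spec_gen_sum:
  assumes P: "P \<in> spec_points (mod_equations A d)" and x: "\<And>\<beta>. \<beta> \<in> T \<Longrightarrow> x \<beta> \<in> carrier KQ"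
    and ij: "i < d" "j < d"
  shows "gen d (\<Sum>\<beta>\<in>T. x \<beta>) $$ (i, j) - (\<Sum>\<beta>\<in>T. gen d (x \<beta>) $$ (i, j)) \<in> P"
  using x
proof (induction T rule: infinite_finite_induct)
  case (insert \<beta> T)
  let ?s = "\<Sum>\<beta>\<in>T. x \<beta>"
  have s: "?s \<in> carrier KQ" using insert.prems by (intro sum_carrier) auto
  have x\<beta>: "x \<beta> \<in> carrier KQ" using insert.prems by auto
  have "gen d (x \<beta> + ?s) $$ (i, j) - (gen d (x \<beta>) + gen d ?s) $$ (i, j) \<in> P"
    using gen_add[OF P x\<beta> s] ij by (auto simp: mcong_def)
  moreover have "(gen d (x \<beta>) + gen d ?s) $$ (i, j) = gen d (x \<beta>) $$ (i, j) + gen d ?s $$ (i, j)"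
    using ij by (intro index_add_mat) (auto simp: gen_def generic_mat_def)
  moreover have "gen d ?s $$ (i, j) - (\<Sum>\<beta>\<in>T. gen d (x \<beta>) $$ (i, j)) \<in> P"
    using insert by simp
  ultimately have "(gen d (x \<beta> + ?s) $$ (i, j) - (gen d (x \<beta>) $$ (i, j) + gen d ?s $$ (i, j)))
      + (gen d ?s $$ (i, j) - (\<Sum>\<beta>\<in>T. gen d (x \<beta>) $$ (i, j))) \<in> P"
    using spec_pointsD(3)[OF P] by metis
  moreover have "(\<Sum>\<beta>\<in>insert \<beta> T. x \<beta>) = x \<beta> + ?s" by (rule sum.insert[OF insert.hyps])
  moreover have "(p - (q + r)) + (r - s) = p - (q + s)" for p q r s :: "('k, (('v, 'e) qpath \<Rightarrow> 'k) set) mod_poly"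
    by simp
  ultimately have "gen d (\<Sum>\<beta>\<in>insert \<beta> T. x \<beta>) $$ (i, j)
      - (gen d (x \<beta>) $$ (i, j) + (\<Sum>\<beta>\<in>T. gen d (x \<beta>) $$ (i, j))) \<in> P"
    by (simp only:)
  then show ?case unfolding sum.insert[OF insert.hyps, of "\<lambda>\<beta>. gen d (x \<beta>) $$ (i, j)"] .
qed (use gen_ideal[OF P ideal_zero] ij in \<open>simp_all add: mcong_def\<close>)

end

context quiver_basis
begin

text \<open>
  All arrows into one vertex are treated at once, since a relation may involve paths with different last
  arrows.
\<close>

context
  fixes v :: 'v and r :: nat and b :: "nat \<Rightarrow> 'e"
  assumes no_loops: "\<forall>a\<in>arcs Q. tail Q a \<noteq> head Q a"
    and b: "bij_betw b {..<r} {a \<in> arcs Q. head Q a = v}"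
    and v: "v \<in> verts Q"
begin

lemma b_arc:
  assumes "\<beta> < r"
  shows "b \<beta> \<in> arcs Q" "head Q (b \<beta>) = v" "tail Q (b \<beta>) \<noteq> v"
proof -
  have "b \<beta> \<in> {a \<in> arcs Q. head Q a = v}" using bij_betwE[OF b] assms by blast
  then show 1: "b \<beta> \<in> arcs Q" "head Q (b \<beta>) = v" by auto
  then show "tail Q (b \<beta>) \<noteq> v" using no_loops by metis
qed

definition top_block :: "('k \<Rightarrow> 't :: comm_ring_1) \<Rightarrow> (('v, 'e) qpath \<Rightarrow> 'k) \<Rightarrow> 't mat" where
  "top_block h x = diag_act (r * n) h (\<lambda>_. v) x"

text \<open>
  The arrow \<open>b \<beta>\<close> maps the basis vectors at its start to the \<open>\<beta>\<close>-th block of \<open>n\<close> copies of the simple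
  module at \<open>v\<close>, multiplied by \<open>t\<close>.
\<close>

definition arrow_block :: "('k \<Rightarrow> 't :: comm_ring_1) \<Rightarrow> 't \<Rightarrow> (('v, 'e) qpath \<Rightarrow> 'k) \<Rightarrow> 't mat" where
  "arrow_block h t x = mat (r * n) n (\<lambda>(i, k). if i mod n = k \<and> tail Q (b (i div n)) = label k
     then t * h (x (tail Q (b (i div n)), [b (i div n)])) else 0)"

text \<open>
  At \<open>t = 1\<close> these are the regular module plus copies of the simple module at \<open>v\<close>, and an extension of
  semisimple modules on which all arrows into \<open>v\<close> are jointly injective.  At \<open>t = 0\<close> they agree.
\<close>

definition regular_family :: "('k \<Rightarrow> 't :: comm_ring_1) \<Rightarrow> 't \<Rightarrow> (('v, 'e) qpath \<Rightarrow> 'k) \<Rightarrow> 't mat" where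
  "regular_family h t x = four_block_mat (regular_act h t x) (0\<^sub>m n (r * n)) (0\<^sub>m (r * n) n) (top_block h x)"

definition arrow_family :: "('k \<Rightarrow> 't :: comm_ring_1) \<Rightarrow> 't \<Rightarrow> (('v, 'e) qpath \<Rightarrow> 'k) \<Rightarrow> 't mat" where
  "arrow_family h t x = four_block_mat (diag_act n h label x) (0\<^sub>m n (r * n)) (arrow_block h t x) (top_block h x)"

lemma div_less_r: "i < r * n \<Longrightarrow> i div n < r"
  by (simp add: less_mult_imp_div_less)

lemma regular_family_qrep:
  assumes h: "comm_ring_hom h"
  shows "qrep h (n + r * n) (regular_family h t)"
  unfolding regular_family_def[abs_def]
proof (rule qrep_block[OF regular_act_qrep[OF h]])
  show W: "qrep h (r * n) (top_block h)"
    unfolding top_block_def[abs_def] by (rule diag_act_qrep[OF h v])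
  fix x y assume x: "x \<in> carrier KQ" and y: "y \<in> carrier KQ"
  show "0\<^sub>m (r * n) n = 0\<^sub>m (r * n) n * regular_act h t y + top_block h x * 0\<^sub>m (r * n) n"
    using qrepD(1)[OF regular_act_qrep[OF h] y, of t] qrepD(1)[OF W x] by simp
qed auto

lemma arrow_family_qrep:
  assumes h: "comm_ring_hom h"
  shows "qrep h (n + r * n) (arrow_family h t)"
  unfolding arrow_family_def[abs_def]
proof (rule qrep_block)
  interpret h: comm_ring_hom h by (rule h)
  show U: "qrep h n (diag_act n h label)" by (rule diag_act_qrep[OF h label_verts])
  show W: "qrep h (r * n) (top_block h)"
    unfolding top_block_def[abs_def] by (rule diag_act_qrep[OF h v])
  fix x y assume x: "x \<in> carrier KQ" and y: "y \<in> carrier KQ"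
  have c: "arrow_block h t x \<in> carrier_mat (r * n) n" "arrow_block h t y \<in> carrier_mat (r * n) n"
    by (auto simp: arrow_block_def)
  note cU = qrepD(1)[OF U y] and cW = qrepD(1)[OF W x]
  show "arrow_block h t (x \<star> y) = arrow_block h t x * diag_act n h label y + top_block h x * arrow_block h t y"
  proof (rule eq_matI)
    fix i k assume "i < dim_row (arrow_block h t x * diag_act n h label y + top_block h x * arrow_block h t y)"
      "k < dim_col (arrow_block h t x * diag_act n h label y + top_block h x * arrow_block h t y)"
    then have ik: "i < r * n" "k < n" using c cU cW by auto
    have 1: "(arrow_block h t x * diag_act n h label y) $$ (i, k)
        = (\<Sum>l<n. if l = k then arrow_block h t x $$ (i, k) * h (y (label k, [])) else 0)"
      unfolding mat_mult_index[OF c(1) cU ik] using ik by (intro sum.cong) (auto simp: diag_act_def)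
    have 2: "(top_block h x * arrow_block h t y) $$ (i, k)
        = (\<Sum>l<r * n. if l = i then h (x (v, [])) * arrow_block h t y $$ (i, k) else 0)"
      unfolding mat_mult_index[OF cW c(2) ik] using ik by (intro sum.cong) (auto simp: top_block_def diag_act_def)
    have e: "arrow_block h t (x \<star> y) $$ (i, k)
        = arrow_block h t x $$ (i, k) * h (y (label k, [])) + h (x (v, [])) * arrow_block h t y $$ (i, k)"
      using ik b_arc(2)[OF div_less_r[OF ik(1)]]
      by (auto simp: arrow_block_def mult_at_arrow h.hom_add h.hom_mult algebra_simps)
    show "arrow_block h t (x \<star> y) $$ (i, k)
        = (arrow_block h t x * diag_act n h label y + top_block h x * arrow_block h t y) $$ (i, k)"
      using ik c cU cW unfolding e by (simp add: 1 2 del: index_mult_mat(1))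
  qed (use c cU cW in \<open>auto simp: arrow_block_def\<close>)
next
  fix x assume "x \<in> I"
  then show "arrow_block h t x = 0\<^sub>m (r * n) n"
    using ideal_coeff_short[of x] comm_ring_hom.axioms[OF h]
    by (intro eq_matI) (auto simp: arrow_block_def ring_hom_def semiring_hom_def comm_monoid_add_hom_def
        monoid_add_hom_def zero_hom_def)
next
  interpret h: comm_ring_hom h by (rule h)
  fix c x y
  show "arrow_block h t (x + y) = arrow_block h t x + arrow_block h t y"
    by (intro eq_matI) (auto simp: arrow_block_def h.hom_add distrib_left)
  show "arrow_block h t (\<lambda>p. c * x p) = h c \<cdot>\<^sub>m arrow_block h t x"
    by (intro eq_matI) (auto simp: arrow_block_def h.hom_mult)
  show "arrow_block h t \<one>\<^bsub>KQ\<^esub> = 0\<^sub>m (r * n) n"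
    by (intro eq_matI) (auto simp: arrow_block_def path_algebra_one)
qed (auto simp: arrow_block_def)

abbreviation D :: nat where "D \<equiv> n + r * n"

lemma families_meet:
  assumes x: "x \<in> carrier KQ" and h: "comm_ring_hom h"
  shows "arrow_family h 0 x = regular_family h 0 x"
proof -
  have "arrow_block h 0 x = 0\<^sub>m (r * n) n" by (intro eq_matI) (auto simp: arrow_block_def)
  then show ?thesis unfolding arrow_family_def regular_family_def regular_act_zero[OF x h] by simp
qed

lemma regular_family_specialize:
  assumes x: "x \<in> carrier KQ" and ij: "i < D" "j < D"
  shows "poly (regular_family (\<lambda>c. [:c:]) [:0, 1:] x $$ (i, j)) t = regular_family id t x $$ (i, j)"
  using ij by (auto simp: regular_family_def regular_act_def top_block_def diag_act_def)

lemma arrow_family_specialize: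
  assumes x: "x \<in> carrier KQ" and ij: "i < D" "j < D"
  shows "poly (arrow_family (\<lambda>c. [:c:]) [:0, 1:] x $$ (i, j)) t = arrow_family id t x $$ (i, j)"
  using ij by (auto simp: arrow_family_def arrow_block_def top_block_def diag_act_def)

abbreviation S where "S \<equiv> mod_equations A D"

text \<open>
  The families over the polynomial ring in \<open>t\<close> define points whose closures contain all members of the
  families.
\<close>

lemma families_connected:
  "connected_component_of (mod_scheme A D) (point id D (regular_family id 0)) (point id D (regular_family id 1))"
  "connected_component_of (mod_scheme A D) (point id D (regular_family id 0)) (point id D (arrow_family id 1))"
proof -
  let ?h = "\<lambda>c :: 'k. [:c:]"
  let ?X = "point ?h D (regular_family ?h [:0, 1:])" and ?Y = "point ?h D (arrow_family ?h [:0, 1:])"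
  have id: "comm_ring_hom (id :: 'k \<Rightarrow> 'k)" by (rule comm_ring_hom_id)
  have h: "comm_ring_hom ?h" by (rule comm_ring_hom_const)
  have X: "?X \<in> spec_points S" and Y: "?Y \<in> spec_points S"
    and X': "\<And>t. point id D (regular_family id t) \<in> spec_points S"
    and Y': "\<And>t. point id D (arrow_family id t) \<in> spec_points S"
    by (intro point_in_spec h id regular_family_qrep arrow_family_qrep)+
  have XX: "?X \<subseteq> point id D (regular_family id t)" for t
    by (rule point_specialize[OF h comm_ring_hom_poly regular_family_qrep[OF h] regular_family_specialize]) auto
  have YY: "?Y \<subseteq> point id D (arrow_family id t)" for t
    by (rule point_specialize[OF h comm_ring_hom_poly arrow_family_qrep[OF h] arrow_family_specialize]) auto
  have YX: "?Y \<subseteq> point id D (regular_family id 0)"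
  proof (rule point_specialize[OF h comm_ring_hom_poly arrow_family_qrep[OF h]])
    fix x i j assume x: "x \<in> carrier KQ" and ij: "i < D" "j < D"
    show "poly (arrow_family ?h [:0, 1:] x $$ (i, j)) 0 = regular_family id 0 x $$ (i, j)"
      unfolding arrow_family_specialize[OF x ij] families_meet[OF x id] ..
  qed simp
  note c = specialization_same_component[where S = S, folded mod_scheme_def]
  show "connected_component_of (mod_scheme A D) (point id D (regular_family id 0)) (point id D (regular_family id 1))"
    by (rule connected_component_of_trans[OF connected_component_of_sym[THEN iffD1, OF c[OF X X' XX]] c[OF X X' XX]])
  show "connected_component_of (mod_scheme A D) (point id D (regular_family id 0)) (point id D (arrow_family id 1))"
    by (rule connected_component_of_trans[OF connected_component_of_sym[THEN iffD1, OF c[OF Y X' YX]] c[OF Y Y' YY]])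
qed

text \<open>
  Written in blocks, the matrix maps \<open>(y\<^sub>\<beta>)\<^sub>\<beta>\<close> to the vector with \<open>\<gamma>\<close>-th block
  \<open>p\<^sub>\<gamma> (\<Sum>\<^sub>\<beta> b\<^sub>\<beta> y\<^sub>\<beta>) + (1 - e\<^sub>\<gamma>) y\<^sub>\<gamma>\<close>, where \<open>e\<^sub>\<gamma>\<close> is the vertex at the start of \<open>b\<^sub>\<gamma>\<close> and \<open>p\<^sub>\<gamma>\<close> picks the
  coordinates of the \<open>\<gamma>\<close>-th block of copies of the simple module at \<open>v\<close>.  If it is invertible, the arrows
  into \<open>v\<close> are jointly injective.
\<close>

definition splitting :: "('k, (('v, 'e) qpath \<Rightarrow> 'k) set) mod_poly mat" where
  "splitting = mat (r * D) (r * D) (\<lambda>(s, s').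
     (if s mod D < n then gen D (ar (b (s' div D))) $$ (n + (s div D) * n + s mod D, s' mod D) else 0) +
     (if s div D = s' div D then (if s mod D = s' mod D then 1 else 0)
        - gen D (vx (tail Q (b (s div D)))) $$ (s mod D, s' mod D) else 0))"

lemma row_less: "\<beta> < r \<Longrightarrow> i < n \<Longrightarrow> n + \<beta> * n + i < D"
  using mult_le_mono1[of "Suc \<beta>" r n] by simp

text \<open>
  There the matrix is the identity.  As no \<open>b \<beta>\<close> is a loop, the space at its start lies in the span of the
  first \<open>n\<close> basis vectors, which \<open>b \<beta>\<close> maps to the \<open>\<beta>\<close>-th block.
\<close>

lemma splitting_at_arrow_module:
  "poly_eval id (coordval D (arrow_family id 1)) (det splitting) = 1"
proof -
  let ?e = "poly_eval (id :: 'k \<Rightarrow> 'k) (coordval D (arrow_family id 1))"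
  have id: "comm_ring_hom (id :: 'k \<Rightarrow> 'k)" by (rule comm_ring_hom_id)
  interpret e: comm_ring_hom ?e by (rule poly_eval_hom[OF id])
  have ev: "?e (gen D x $$ (i, j)) = arrow_family id 1 x $$ (i, j)" if "x \<in> carrier KQ" "i < D" "j < D" for x i j
    using eval_gen[OF id arrow_family_qrep[OF id] that(1), of 1] that(2,3)
    by (metis carrier_matD gen_carrier index_map_mat(1))
  have "map_mat ?e splitting = 1\<^sub>m (r * D)"
  proof (rule eq_matI)
    fix s s' assume "s < dim_row (1\<^sub>m (r * D) :: 'k mat)" "s' < dim_col (1\<^sub>m (r * D) :: 'k mat)"
    then have s: "s < r * D" "s' < r * D" by auto
    define \<beta> i \<beta>' i' where "\<beta> = s div D" and "i = s mod D" and "\<beta>' = s' div D" and "i' = s' mod D"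
    have D0: "0 < D" using s(1) by (cases "D = 0") auto
    have \<beta>: "\<beta> < r" "\<beta>' < r" using s by (auto simp: \<beta>_def \<beta>'_def less_mult_imp_div_less)
    have i: "i < D" "i' < D" using D0 by (auto simp: i_def i'_def)
    have eq: "s = s' \<longleftrightarrow> \<beta> = \<beta>' \<and> i = i'"
      unfolding \<beta>_def i_def \<beta>'_def i'_def by (metis div_mult_mod_eq)
    have vt: "tail Q (b \<beta>) \<in> verts Q" using b_arc(1)[OF \<beta>(1)] by simp
    have vxe: "?e (gen D (vx (tail Q (b \<beta>))) $$ (i, i'))
        = (if i = i' \<and> i < n \<and> label i = tail Q (b \<beta>) then 1 else 0)"
      unfolding ev[OF vx_carrier[OF vt] i]
      using i b_arc(3)[OF \<beta>(1)]
      by (auto simp: arrow_family_def diag_act_def arrow_block_def top_block_def path_element_def)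
    have are: "?e (gen D (ar (b \<beta>')) $$ (n + \<beta> * n + i, i'))
        = (if \<beta> = \<beta>' \<and> i = i' \<and> label i = tail Q (b \<beta>) then 1 else 0)" if "i < n"
    proof -
      have d: "(\<beta> * n + i) div n = \<beta>" "(\<beta> * n + i) mod n = i" "\<beta> * n + i < r * n"
        using that row_less[OF \<beta>(1) that] by auto
      have inj: "b \<beta> = b \<beta>' \<longleftrightarrow> \<beta> = \<beta>'"
        using inj_on_eq_iff[OF bij_betw_imp_inj_on[OF b]] \<beta> by simp
      have arc: "b \<beta>' \<in> arcs Q" by (rule b_arc(1)[OF \<beta>(2)])
      show ?thesis
        unfolding ev[OF ar_carrier[OF arc] row_less[OF \<beta>(1) that] i(2)]
        using i that d inj row_less[OF \<beta>(1) that]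
        by (auto simp: arrow_family_def diag_act_def arrow_block_def top_block_def path_element_def
            add.assoc)
    qed
    have "map_mat ?e splitting $$ (s, s') = ?e (splitting $$ (s, s'))"
      using s by (simp add: splitting_def)
    also have "\<dots> = (if i < n then ?e (gen D (ar (b \<beta>')) $$ (n + \<beta> * n + i, i')) else 0) +
        (if \<beta> = \<beta>' then (if i = i' then 1 else 0) - ?e (gen D (vx (tail Q (b \<beta>))) $$ (i, i')) else 0)"
      using s by (simp add: splitting_def \<beta>_def i_def \<beta>'_def i'_def e.hom_add e.hom_minus)
    also have "\<dots> = (if s = s' then 1 else 0)"
      unfolding vxe eq using are by auto
    finally show "map_mat ?e splitting $$ (s, s') = 1\<^sub>m (r * D) $$ (s, s')" using s by simp
  qed (auto simp: splitting_def)
  then have "det (map_mat ?e splitting) = 1" by simp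
  then show ?thesis by simp
qed

text \<open>
  For \<open>x\<close> in \<open>I\<close>, the matrix annihilates the vector of the stripped elements, since
  \<open>v x = \<Sum>\<^sub>\<beta> b\<^sub>\<beta> x\<^sub>\<beta>\<close>; multiplication by the adjugate leaves the determinant as a factor.
\<close>

lemma entry_times_splitting:
  assumes P: "P \<in> spec_points S" and x: "x \<in> I" and \<beta>: "\<beta> < r" and ij: "i < D" "j < D"
  shows "det splitting * gen D (strip (b \<beta>) x) $$ (i, j) \<in> P"
proof -
  have xc: "x \<in> carrier KQ" by (rule ideal_carrier[OF x])
  let ?N = "r * D"
  have sc: "splitting \<in> carrier_mat ?N ?N" by (simp add: splitting_def)
  define w where "w s = gen D (strip (b (s div D)) x) $$ (s mod D, j)" for s
  have D0: "0 < D" using ij(1) by (rule le_less_trans[OF le0])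
  have ann: "(\<Sum>s'<?N. splitting $$ (s, s') * w s') \<in> P" if s: "s < ?N" for s
  proof -
    define \<gamma> k where "\<gamma> = s div D" and "k = s mod D"
    have \<gamma>: "\<gamma> < r" and k: "k < D" using s D0 by (auto simp: \<gamma>_def k_def less_mult_imp_div_less)
    let ?a = "\<lambda>\<beta>' i'. if k < n then gen D (ar (b \<beta>')) $$ (n + \<gamma> * n + k, i') else 0"
    let ?c = "\<lambda>\<beta>' i'. if \<gamma> = \<beta>' then (if k = i' then 1 else 0) - gen D (vx (tail Q (b \<gamma>))) $$ (k, i') else 0"
    let ?w = "\<lambda>\<beta>' i'. gen D (strip (b \<beta>') x) $$ (i', j)"
    have "(\<Sum>s'<?N. splitting $$ (s, s') * w s')
        = (\<Sum>s'<?N. (?a (s' div D) (s' mod D) + ?c (s' div D) (s' mod D)) * ?w (s' div D) (s' mod D))"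
      using s by (intro sum.cong) (auto simp: splitting_def w_def \<gamma>_def k_def)
    also have "\<dots> = (\<Sum>\<beta>'<r. \<Sum>i'<D. (?a \<beta>' i' + ?c \<beta>' i') * ?w \<beta>' i')"
      by (rule sum_div_mod[where F = "\<lambda>\<beta>' i'. (?a \<beta>' i' + ?c \<beta>' i') * ?w \<beta>' i'"])
    also have "\<dots> = (\<Sum>\<beta>'<r. \<Sum>i'<D. ?a \<beta>' i' * ?w \<beta>' i') + (\<Sum>\<beta>'<r. \<Sum>i'<D. ?c \<beta>' i' * ?w \<beta>' i')"
      by (simp add: distrib_right sum.distrib)
    finally have split: "(\<Sum>s'<?N. splitting $$ (s, s') * w s')
      = (\<Sum>\<beta>'<r. \<Sum>i'<D. ?a \<beta>' i' * ?w \<beta>' i') + (\<Sum>\<beta>'<r. \<Sum>i'<D. ?c \<beta>' i' * ?w \<beta>' i')" .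
    have "(\<Sum>\<beta>'<r. \<Sum>i'<D. ?a \<beta>' i' * ?w \<beta>' i') \<in> P"
    proof (cases "k < n")
      case False
      then show ?thesis using spec_pointsD(2)[OF P] by simp
    next
      case True
      let ?row = "n + \<gamma> * n + k"
      have row: "?row < D" by (rule row_less[OF \<gamma> True])
      have prod: "(\<Sum>i'<D. ?a \<beta>' i' * ?w \<beta>' i') = (gen D (ar (b \<beta>')) * gen D (strip (b \<beta>') x)) $$ (?row, j)" for \<beta>'
        unfolding mat_mult_index[OF gen_carrier gen_carrier row ij(2)] using True by simp
      let ?y = "\<lambda>\<beta>'. ar (b \<beta>') \<star> strip (b \<beta>') x"
      have y: "?y \<beta>' \<in> carrier KQ" if "\<beta>' < r" for \<beta>' using b_arc(1)[OF that] xc by simp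
      have 1: "gen D (?y \<beta>') $$ (?row, j) - (\<Sum>i'<D. ?a \<beta>' i' * ?w \<beta>' i') \<in> P" if "\<beta>' < r" for \<beta>'
        unfolding prod using gen_mult[OF P ar_carrier[OF b_arc(1)[OF that]] strip_carrier[OF xc]] row ij
        by (auto simp: mcong_def)
      have 2: "gen D (\<Sum>\<beta>'<r. ?y \<beta>') $$ (?row, j) - (\<Sum>\<beta>'<r. gen D (?y \<beta>') $$ (?row, j)) \<in> P"
        by (rule spec_gen_sum[OF P _ row ij(2)]) (use y in auto)
      have "(\<Sum>\<beta>'<r. ?y \<beta>') = vx v \<star> x"
        using vx_mult_eq_sum_strip[OF xc _ b] ideal_coeff_short[OF x] by simp
      then have 3: "gen D (\<Sum>\<beta>'<r. ?y \<beta>') $$ (?row, j) \<in> P"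
        using gen_ideal[OF P ideal_mult_left[OF vx_carrier[OF v] x]] row ij by (auto simp: mcong_def)
      have "(\<Sum>\<beta>'<r. gen D (?y \<beta>') $$ (?row, j) - (\<Sum>i'<D. ?a \<beta>' i' * ?w \<beta>' i')) \<in> P"
        by (rule spec_point_sum[OF P]) (use 1 in auto)
      then have 4: "- (\<Sum>\<beta>'<r. gen D (?y \<beta>') $$ (?row, j) - (\<Sum>i'<D. ?a \<beta>' i' * ?w \<beta>' i')) \<in> P"
        by (rule spec_point_uminus[OF P])
      have 5: "- (gen D (\<Sum>\<beta>'<r. ?y \<beta>') $$ (?row, j) - (\<Sum>\<beta>'<r. gen D (?y \<beta>') $$ (?row, j))) \<in> P"
        by (rule spec_point_uminus[OF P 2])
      have "(\<Sum>\<beta>'<r. \<Sum>i'<D. ?a \<beta>' i' * ?w \<beta>' i')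
          = - (\<Sum>\<beta>'<r. gen D (?y \<beta>') $$ (?row, j) - (\<Sum>i'<D. ?a \<beta>' i' * ?w \<beta>' i'))
            + (- (gen D (\<Sum>\<beta>'<r. ?y \<beta>') $$ (?row, j) - (\<Sum>\<beta>'<r. gen D (?y \<beta>') $$ (?row, j)))
            + gen D (\<Sum>\<beta>'<r. ?y \<beta>') $$ (?row, j))"
        unfolding sum_subtractf by simp
      then show ?thesis using spec_pointsD(3)[OF P 4 spec_pointsD(3)[OF P 5 3]] by metis
    qed
    moreover have "(\<Sum>\<beta>'<r. \<Sum>i'<D. ?c \<beta>' i' * ?w \<beta>' i') \<in> P"
    proof -
      let ?g = "gen D (vx (tail Q (b \<gamma>)))"
      have arc: "b \<gamma> \<in> arcs Q" by (rule b_arc(1)[OF \<gamma>])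
      have "(\<Sum>\<beta>'<r. \<Sum>i'<D. ?c \<beta>' i' * ?w \<beta>' i')
          = (\<Sum>\<beta>'<r. if \<beta>' = \<gamma> then (\<Sum>i'<D. ((if k = i' then 1 else 0) - ?g $$ (k, i')) * ?w \<gamma> i') else 0)"
        by (intro sum.cong) auto
      also have "\<dots> = (\<Sum>i'<D. ((if k = i' then 1 else 0) - ?g $$ (k, i')) * ?w \<gamma> i')" using \<gamma> by simp
      also have "\<dots> = (\<Sum>i'<D. (if k = i' then ?w \<gamma> k else 0)) - (\<Sum>i'<D. ?g $$ (k, i') * ?w \<gamma> i')"
        unfolding sum_subtractf[symmetric] by (intro sum.cong) (auto simp: left_diff_distrib)
      also have "\<dots> = ?w \<gamma> k - (?g * gen D (strip (b \<gamma>) x)) $$ (k, j)"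
        unfolding mat_mult_index[OF gen_carrier gen_carrier k ij(2)] using k by simp
      also have "?w \<gamma> k = gen D (vx (tail Q (b \<gamma>)) \<star> strip (b \<gamma>) x) $$ (k, j)"
        by (simp add: vx_tail_strip[OF xc arc])
      finally show ?thesis
        using gen_mult[OF P vx_carrier strip_carrier[OF xc], of "tail Q (b \<gamma>)"] arc k ij
        by (auto simp: mcong_def)
    qed
    ultimately show ?thesis unfolding split by (rule spec_pointsD(3)[OF P])
  qed
  let ?adj = "adj_mat splitting" and ?s = "\<beta> * D + i"
  have adj: "?adj \<in> carrier_mat ?N ?N" "?adj * splitting = det splitting \<cdot>\<^sub>m 1\<^sub>m ?N"
    using adj_mat[OF sc] by auto
  have s: "?s < ?N" "?s div D = \<beta>" "?s mod D = i"
    using \<beta> mult_le_mono1[of "Suc \<beta>" r D] ij(1) block_index[OF ij(1), of \<beta>] by simp_all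
  have "(\<Sum>s'<?N. ?adj $$ (?s, s') * (\<Sum>s''<?N. splitting $$ (s', s'') * w s'')) \<in> P"
    by (intro spec_point_sum[OF P] spec_pointsD(4)[OF P] ann) auto
  also have "(\<Sum>s'<?N. ?adj $$ (?s, s') * (\<Sum>s''<?N. splitting $$ (s', s'') * w s''))
      = (\<Sum>s''<?N. (\<Sum>s'<?N. ?adj $$ (?s, s') * splitting $$ (s', s'')) * w s'')"
    unfolding sum_distrib_left sum_distrib_right by (subst sum.swap) (simp add: mult.assoc)
  also have "\<dots> = (\<Sum>s''<?N. (?adj * splitting) $$ (?s, s'') * w s'')"
    by (intro sum.cong) (use mat_mult_index[OF adj(1) sc s(1)] in auto)
  also have "\<dots> = (\<Sum>s''<?N. if s'' = ?s then det splitting * w ?s else 0)"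
    unfolding adj(2) by (intro sum.cong) (use s in auto)
  also have "\<dots> = det splitting * w ?s" using s by simp
  finally show ?thesis unfolding w_def s .
qed

text \<open>
  The component of the two families is covered by the closed sets where an entry of the stripped element,
  or the determinant, vanishes.  The second one misses the module with injective arrows, so the first one
  contains the component and the regular module.
\<close>

lemma strip_in_ideal_of_irreducible:
  assumes irr: "geometrically_irreducible A" and x: "x \<in> I" and \<beta>: "\<beta> < r"
  shows "strip (b \<beta>) x \<in> I"
proof (rule regular_act_faithful)
  let ?y = "strip (b \<beta>) x"
  show y: "?y \<in> carrier KQ" using ideal_carrier[OF x] by simp
  fix i j assume ij: "i < n" "j < n"
  have id: "comm_ring_hom (id :: 'k \<Rightarrow> 'k)" by (rule comm_ring_hom_id)
  let ?X0 = "point id D (regular_family id (0 :: 'k))"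
  let ?X1 = "point id D (regular_family id (1 :: 'k))" and ?Y1 = "point id D (arrow_family id (1 :: 'k))"
  let ?C = "connected_component_of_set (mod_scheme A D) ?X0"
  have X0: "?X0 \<in> spec_points S" by (intro point_in_spec id regular_family_qrep)
  then have "irreducible_in (mod_scheme A D) ?C"
    using irr unfolding geometrically_irreducible_def
    by (intro connected_component_ofI_irreducible) (auto simp: mod_scheme_def topspace_spec_topology)
  moreover define f where "f = gen D ?y $$ (i, j)"
  have ij': "i < D" "j < D" using ij by auto
  let ?F = "{P \<in> spec_points S. {f} \<subseteq> P}" and ?G = "{P \<in> spec_points S. {det splitting} \<subseteq> P}"
  have "closedin (mod_scheme A D) ?F" "closedin (mod_scheme A D) ?G"
    unfolding mod_scheme_def closedin_spec_topology by blast+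
  moreover have Cs: "?C \<subseteq> spec_points S"
    using connected_component_of_subset_topspace[of "mod_scheme A D" ?X0]
    by (simp add: mod_scheme_def topspace_spec_topology)
  have "?C \<subseteq> ?F \<union> ?G"
  proof
    fix P assume "P \<in> ?C"
    then have P: "P \<in> spec_points S" using Cs by blast
    have "det splitting * f \<in> P" unfolding f_def by (rule entry_times_splitting[OF P x \<beta> ij'])
    then show "P \<in> ?F \<union> ?G" using P spec_pointsD(5)[OF P] by blast
  qed
  ultimately have "?C \<subseteq> ?F \<or> ?C \<subseteq> ?G" unfolding irreducible_in_def by blast
  moreover have "?X1 \<in> ?C" "?Y1 \<in> ?C" using families_connected by auto
  ultimately have "f \<in> ?X1 \<or> det splitting \<in> ?Y1" by blast
  moreover have "det splitting \<notin> ?Y1" using splitting_at_arrow_module by (simp add: point_def)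
  ultimately have "poly_eval id (coordval D (regular_family id 1)) f = 0" by (simp add: point_def)
  moreover have "poly_eval id (coordval D (regular_family id 1)) f = regular_family id 1 ?y $$ (i, j)"
    unfolding f_def using eval_gen[OF id regular_family_qrep[OF id] y, of 1] ij'
    by (metis carrier_matD gen_carrier index_map_mat(1))
  ultimately show "coord (?y \<star> basis j) i = 0"
    using ij by (simp add: regular_family_def regular_act_def top_block_def diag_act_def)
qed

end

end

context quiver_ideal
begin

text \<open>
  The coefficient of \<open>x\<close> at a path is the coefficient at a trivial path of the element of \<open>I\<close> that is left
  after all arrows of the path have been stripped.
\<close>

theorem ideal_zero_of_geometrically_irreducible:
  assumes irr: "geometrically_irreducible A"
    and no_loops: "\<forall>a\<in>arcs Q. tail Q a \<noteq> head Q a"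
  shows "I = {0}"
proof -
  obtain n q coord where B: "quiver_basis Q I n q coord" by (rule quiver_basis_exists)
  interpret quiver_basis Q I n q coord by (rule B)
  have strip: "strip a x \<in> I" if x: "x \<in> I" and a: "a \<in> arcs Q" for x a
  proof -
    let ?A = "{c \<in> arcs Q. head Q c = head Q a}"
    obtain b where b: "bij_betw b {..<card ?A} ?A"
      using ex_bij_betw_nat_finite[of ?A] by (auto simp: atLeast0LessThan)
    obtain \<beta> where "\<beta> < card ?A" "b \<beta> = a"
      using a bij_betw_imp_surj_on[OF b] by (metis (mono_tags, lifting) imageE lessThan_iff mem_Collect_eq)
    then show ?thesis
      using strip_in_ideal_of_irreducible[OF no_loops b _ irr x, of \<beta>] a by simp
  qed
  have "x (u, s) = 0" if "x \<in> I" "(u, s) \<in> qpaths Q" for x u s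
    using that
  proof (induction s arbitrary: x rule: rev_induct)
    case Nil
    then show ?case using ideal_coeff_short[of x "(u, [])"] by simp
  next
    case (snoc a s)
    then have a: "a \<in> arcs Q" "(u, s) \<in> qpaths Q" unfolding Q.qpaths_append by auto
    have "strip a x (u, s) = 0" using snoc.IH[OF strip[OF snoc.prems(1) a(1)] a(2)] .
    then show ?case by (simp add: strip_def)
  qed
  then show ?thesis by (rule ideal_eq_zeroI)
qed

end

section \<open>Representations without relations\<close>

text \<open>
  The determinant is additive in each column.
\<close>

lemma det_sum_columns:
  fixes X :: "'v \<Rightarrow> 'r :: comm_ring_1 mat"
  assumes V: "finite V"
  shows "det (mat d d (\<lambda>(i, j). \<Sum>v\<in>V. X v $$ (i, j)))
    = (\<Sum>\<sigma>\<in>{..<d} \<rightarrow>\<^sub>E V. det (mat d d (\<lambda>(i, j). X (\<sigma> j) $$ (i, j))))"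
proof -
  let ?P = "{p. p permutes {0..<d}}"
  have perm: "p i < d" if "p permutes {0..<d}" "i < d" for p i
    using permutes_in_image[OF that(1), of i] that(2) by simp
  have "det (mat d d (\<lambda>(i, j). \<Sum>v\<in>V. X v $$ (i, j)))
      = (\<Sum>p\<in>?P. signof p * (\<Prod>j<d. \<Sum>v\<in>V. X v $$ (p j, j)))"
    by (subst det_col[of _ d])
      (auto intro!: sum.cong prod.cong simp: perm)
  also have "\<dots> = (\<Sum>p\<in>?P. \<Sum>\<sigma>\<in>{..<d} \<rightarrow>\<^sub>E V. signof p * (\<Prod>j<d. X (\<sigma> j) $$ (p j, j)))"
    by (subst prod_sum_PiE) (use V in \<open>auto simp: sum_distrib_left\<close>)
  also have "\<dots> = (\<Sum>\<sigma>\<in>{..<d} \<rightarrow>\<^sub>E V. \<Sum>p\<in>?P. signof p * (\<Prod>j<d. X (\<sigma> j) $$ (p j, j)))"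
    by (rule sum.swap)
  also have "\<dots> = (\<Sum>\<sigma>\<in>{..<d} \<rightarrow>\<^sub>E V. det (mat d d (\<lambda>(i, j). X (\<sigma> j) $$ (i, j))))"
    by (rule sum.cong[OF refl], subst det_col[of _ d])
      (auto intro!: sum.cong prod.cong simp: perm)
  finally show ?thesis .
qed

text \<open>
  By expansion of \<open>det 1\<close>, where \<open>1 = e + (1 - e)\<close>, some basis consists of columns of \<open>e\<close> and of \<open>1 - e\<close>;
  those of \<open>e\<close> span its image.
\<close>

lemma split_idempotent:
  fixes e :: "'a :: field mat"
  assumes e: "e \<in> carrier_mat n n" "e * e = e"
  obtains k \<iota> \<rho> where "\<iota> \<in> carrier_mat n k" "\<rho> \<in> carrier_mat k n" "\<rho> * \<iota> = 1\<^sub>m k" "\<iota> * \<rho> = e"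
proof -
  define X where "X c = (if c then e else 1\<^sub>m n - e)" for c
  have Xc: "X c \<in> carrier_mat n n" for c using e minus_carrier_mat[OF e(1)] by (simp add: X_def)
  have "mat n n (\<lambda>(i, j). \<Sum>c\<in>UNIV. X c $$ (i, j)) = 1\<^sub>m n"
    using e by (intro eq_matI) (auto simp: X_def UNIV_bool)
  then have "(\<Sum>\<sigma>\<in>{..<n} \<rightarrow>\<^sub>E UNIV. det (mat n n (\<lambda>(i, j). X (\<sigma> j) $$ (i, j)))) = 1"
    using det_sum_columns[of UNIV n X] by simp
  then obtain \<sigma> where \<sigma>: "det (mat n n (\<lambda>(i, j). X (\<sigma> j) $$ (i, j))) \<noteq> 0"
    by (metis (no_types, lifting) sum.neutral zero_neq_one)
  define g where "g = mat n n (\<lambda>(i, j). X (\<sigma> j) $$ (i, j))"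
  have g: "g \<in> carrier_mat n n" by (simp add: g_def)
  obtain g' where g': "g' \<in> carrier_mat n n" "g * g' = 1\<^sub>m n" "g' * g = 1\<^sub>m n"
    using det_non_zero_imp_unit[OF g, of "()"] \<sigma> unfolding g_def[symmetric]
    by (auto simp: Units_def ring_mat_def)
  have eX: "e * X c = (if c then e else 0\<^sub>m n n)" for c
    using e mult_minus_distrib_mat[OF e(1) one_carrier_mat e(1)] by (auto simp: X_def)
  have eg: "(e * g) $$ (i, j) = (if \<sigma> j then g $$ (i, j) else 0)" if ij: "i < n" "j < n" for i j
  proof -
    have "(e * g) $$ (i, j) = (\<Sum>l<n. e $$ (i, l) * X (\<sigma> j) $$ (l, j))"
      unfolding mat_mult_index[OF e(1) g ij] using ij by (intro sum.cong) (auto simp: g_def)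
    also have "\<dots> = (e * X (\<sigma> j)) $$ (i, j)" by (rule mat_mult_index[OF e(1) Xc ij, symmetric])
    finally show ?thesis unfolding eX using ij by (auto simp: g_def X_def)
  qed
  define J where "J = {j. j < n \<and> \<sigma> j}"
  obtain b where b: "bij_betw b {..<card J} J"
    using ex_bij_betw_nat_finite[of J] by (auto simp: J_def atLeast0LessThan)
  have bJ: "b l < n" "\<sigma> (b l)" if "l < card J" for l
    using bij_betwE[OF b] that by (auto simp: J_def)
  define \<iota> where "\<iota> = mat n (card J) (\<lambda>(i, l). g $$ (i, b l))"
  define \<rho> where "\<rho> = mat (card J) n (\<lambda>(l, j). g' $$ (b l, j))"
  have c: "\<iota> \<in> carrier_mat n (card J)" "\<rho> \<in> carrier_mat (card J) n" by (auto simp: \<iota>_def \<rho>_def)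
  have "\<rho> * \<iota> = 1\<^sub>m (card J)"
  proof (rule eq_matI)
    fix l m assume "l < dim_row (1\<^sub>m (card J) :: 'a mat)" "m < dim_col (1\<^sub>m (card J) :: 'a mat)"
    then have lm: "l < card J" "m < card J" by auto
    have "(\<rho> * \<iota>) $$ (l, m) = (\<Sum>i<n. g' $$ (b l, i) * g $$ (i, b m))"
      unfolding mat_mult_index[OF c(2,1) lm] using lm by (intro sum.cong) (auto simp: \<iota>_def \<rho>_def)
    also have "\<dots> = (g' * g) $$ (b l, b m)"
      by (rule mat_mult_index[OF g'(1) g bJ(1)[OF lm(1)] bJ(1)[OF lm(2)], symmetric])
    also have "\<dots> = (if l = m then 1 else 0)"
      unfolding g'(3) using bJ lm inj_on_eq_iff[OF bij_betw_imp_inj_on[OF b]] by simp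
    finally show "(\<rho> * \<iota>) $$ (l, m) = 1\<^sub>m (card J) $$ (l, m)" using lm by simp
  qed (use c in auto)
  moreover have "\<iota> * \<rho> = e"
  proof (rule eq_matI)
    fix i j assume "i < dim_row e" "j < dim_col e"
    then have ij: "i < n" "j < n" using e by auto
    have "(\<iota> * \<rho>) $$ (i, j) = (\<Sum>l<card J. g $$ (i, b l) * g' $$ (b l, j))"
      unfolding mat_mult_index[OF c ij] using ij by (intro sum.cong) (auto simp: \<iota>_def \<rho>_def)
    also have "\<dots> = (\<Sum>l\<in>J. g $$ (i, l) * g' $$ (l, j))"
      by (rule sum.reindex_bij_betw[OF b])
    also have "\<dots> = (\<Sum>l<n. (e * g) $$ (i, l) * g' $$ (l, j))"
      by (rule sum.mono_neutral_cong_left) (use ij in \<open>auto simp: J_def eg simp del: index_mult_mat\<close>)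
    also have "\<dots> = (e * g * g') $$ (i, j)"
      by (rule mat_mult_index[OF mult_carrier_mat[OF e(1) g] g'(1) ij, symmetric])
    also have "e * g * g' = e" using assoc_mult_mat[OF e(1) g g'(1)] g'(2) e(1) by simp
    finally show "(\<iota> * \<rho>) $$ (i, j) = e $$ (i, j)" .
  qed (use c e in auto)
  ultimately show ?thesis using that c by blast
qed

text \<open>
  The type of matrices has no zero that fits every size, so the size of a sum is an argument.
\<close>

definition msum :: "nat \<Rightarrow> nat \<Rightarrow> 'v set \<Rightarrow> ('v \<Rightarrow> 'a :: comm_ring_1 mat) \<Rightarrow> 'a mat" where
  "msum m n S F = mat m n (\<lambda>(i, j). \<Sum>v\<in>S. F v $$ (i, j))"

lemma msum_carrier [simp]: "msum m n S F \<in> carrier_mat m n"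
  by (simp add: msum_def)

lemma msum_mult_left:
  assumes B: "B \<in> carrier_mat l m" and F: "\<And>v. v \<in> S \<Longrightarrow> F v \<in> carrier_mat m n"
  shows "B * msum m n S F = msum l n S (\<lambda>v. B * F v)"
proof (rule eq_matI)
  fix i j assume "i < dim_row (msum l n S (\<lambda>v. B * F v))" "j < dim_col (msum l n S (\<lambda>v. B * F v))"
  then have ij: "i < l" "j < n" by (auto simp: msum_def)
  have "(B * msum m n S F) $$ (i, j) = (\<Sum>k<m. \<Sum>v\<in>S. B $$ (i, k) * F v $$ (k, j))"
    unfolding mat_mult_index[OF B msum_carrier ij] using ij
    by (intro sum.cong) (auto simp: msum_def sum_distrib_left)
  also have "\<dots> = (\<Sum>v\<in>S. \<Sum>k<m. B $$ (i, k) * F v $$ (k, j))" by (rule sum.swap)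
  also have "\<dots> = (\<Sum>v\<in>S. (B * F v) $$ (i, j))"
    by (rule sum.cong[OF refl]) (rule mat_mult_index[OF B F ij, symmetric])
  finally show "(B * msum m n S F) $$ (i, j) = msum l n S (\<lambda>v. B * F v) $$ (i, j)"
    using ij by (simp add: msum_def)
qed (use B in \<open>auto simp: msum_def\<close>)

lemma msum_mult_right:
  assumes B: "B \<in> carrier_mat n l" and F: "\<And>v. v \<in> S \<Longrightarrow> F v \<in> carrier_mat m n"
  shows "msum m n S F * B = msum m l S (\<lambda>v. F v * B)"
proof (rule eq_matI)
  fix i j assume "i < dim_row (msum m l S (\<lambda>v. F v * B))" "j < dim_col (msum m l S (\<lambda>v. F v * B))"
  then have ij: "i < m" "j < l" by (auto simp: msum_def)
  have "(msum m n S F * B) $$ (i, j) = (\<Sum>k<n. \<Sum>v\<in>S. F v $$ (i, k) * B $$ (k, j))"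
    unfolding mat_mult_index[OF msum_carrier B ij] using ij
    by (intro sum.cong) (auto simp: msum_def sum_distrib_right)
  also have "\<dots> = (\<Sum>v\<in>S. \<Sum>k<n. F v $$ (i, k) * B $$ (k, j))" by (rule sum.swap)
  also have "\<dots> = (\<Sum>v\<in>S. (F v * B) $$ (i, j))"
    by (rule sum.cong[OF refl]) (rule mat_mult_index[OF F B ij, symmetric])
  finally show "(msum m n S F * B) $$ (i, j) = msum m l S (\<lambda>v. F v * B) $$ (i, j)"
    using ij by (simp add: msum_def)
qed (use B in \<open>auto simp: msum_def\<close>)

lemma msum_cong: "(\<And>v. v \<in> S \<Longrightarrow> F v = G v) \<Longrightarrow> msum m n S F = msum m n S G"
  by (auto simp: msum_def intro!: eq_matI sum.cong)

context quiver_ideal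
begin

lemma qrep_sum_vertices:
  assumes "qrep h d \<Phi>"
  shows "msum d d (verts Q) (\<lambda>v. \<Phi> (vx v)) = 1\<^sub>m d"
proof -
  have "\<Phi> \<one>\<^bsub>KQ\<^esub> $$ (i, j) = (\<Sum>v\<in>verts Q. \<Phi> (vx v) $$ (i, j))" if "i < d" "j < d" for i j
    unfolding one_eq_sum_vx by (rule qrep_sum_index[OF assms _ that]) auto
  then show ?thesis unfolding qrepD(5)[OF assms] by (intro eq_matI) (auto simp: msum_def)
qed

primrec path_mat :: "('v \<Rightarrow> 't :: comm_ring_1 mat) \<Rightarrow> ('e \<Rightarrow> 't mat) \<Rightarrow> 'e list \<Rightarrow> 'v \<Rightarrow> 't mat" where
  "path_mat e m [] u = e u"
| "path_mat e m (a # r) u = path_mat e m r (head Q a) * m a"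

text \<open>
  Without relations, arbitrary matrices for the arrows, placed between orthogonal idempotents for
  the vertices, define a representation.
\<close>

lemma qrep_of_arrows:
  fixes h :: "'k \<Rightarrow> 't :: comm_ring_1" and e :: "'v \<Rightarrow> 't mat" and m :: "'e \<Rightarrow> 't mat"
  assumes I0: "I = {0}" and h: "comm_ring_hom h"
    and e: "\<And>v. v \<in> verts Q \<Longrightarrow> e v \<in> carrier_mat d d"
    and m: "\<And>a. a \<in> arcs Q \<Longrightarrow> m a \<in> carrier_mat d d"
    and ee: "\<And>v w. v \<in> verts Q \<Longrightarrow> w \<in> verts Q \<Longrightarrow> e v * e w = (if v = w then e v else 0\<^sub>m d d)"
    and e1: "msum d d (verts Q) e = 1\<^sub>m d"
    and em: "\<And>a. a \<in> arcs Q \<Longrightarrow> e (head Q a) * m a = m a"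
    and me: "\<And>a. a \<in> arcs Q \<Longrightarrow> m a * e (tail Q a) = m a"
  obtains \<Phi> where "qrep h d \<Phi>" "\<And>v. v \<in> verts Q \<Longrightarrow> \<Phi> (vx v) = e v" "\<And>a. a \<in> arcs Q \<Longrightarrow> \<Phi> (ar a) = m a"
proof -
  interpret h: comm_ring_hom h by (rule h)
  let ?F = "path_mat e m"
  have F: "?F r u \<in> carrier_mat d d" if "(u, r) \<in> qpaths Q" for r u
    using that by (induction r arbitrary: u) (auto simp: e intro!: mult_carrier_mat m)
  have hv: "head Q a \<in> verts Q" "tail Q a \<in> verts Q" if "a \<in> arcs Q" for a using that by auto
  have em': "e w * m a = (if w = head Q a then m a else 0\<^sub>m d d)" if "a \<in> arcs Q" "w \<in> verts Q" for a w
  proof -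
    have "e w * m a = e w * e (head Q a) * m a"
      using em[OF that(1)] assoc_mult_mat[OF e[OF that(2)] e[OF hv(1)[OF that(1)]] m[OF that(1)]] by simp
    then show ?thesis using ee[OF that(2) hv(1)[OF that(1)]] em[OF that(1)] m[OF that(1)] by simp
  qed
  have me': "m a * e w = (if w = tail Q a then m a else 0\<^sub>m d d)" if "a \<in> arcs Q" "w \<in> verts Q" for a w
  proof -
    have "m a * e w = m a * (e (tail Q a) * e w)"
      using me[OF that(1)] assoc_mult_mat[OF m[OF that(1)] e[OF hv(2)[OF that(1)]] e[OF that(2)]] by simp
    then show ?thesis using ee[OF hv(2)[OF that(1)] that(2)] me[OF that(1)] m[OF that(1)] by auto
  qed
  have eF: "e w * ?F r u = (if w = qpath_end Q (u, r) then ?F r u else 0\<^sub>m d d)"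
    if "(u, r) \<in> qpaths Q" "w \<in> verts Q" for w r u
    using that(1)
  proof (induction r arbitrary: u)
    case Nil
    then show ?case using ee[OF that(2), of u] by auto
  next
    case (Cons a r)
    then have a: "a \<in> arcs Q" "(head Q a, r) \<in> qpaths Q" by auto
    have "e w * ?F (a # r) u = e w * ?F r (head Q a) * m a"
      using assoc_mult_mat[OF e[OF that(2)] F[OF a(2)] m[OF a(1)]] by simp
    then show ?case using Cons.IH[OF a(2)] m[OF a(1)] by simp
  qed
  have Fe: "?F r u * e w = (if w = u then ?F r u else 0\<^sub>m d d)"
    if "(u, r) \<in> qpaths Q" "w \<in> verts Q" for w r u
  proof (cases r)
    case Nil
    then show ?thesis using ee[of u w] that by auto
  next
    case (Cons a r')
    then have a: "a \<in> arcs Q" "u = tail Q a" "(head Q a, r') \<in> qpaths Q" using that by auto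
    have "?F r u * e w = ?F r' (head Q a) * (m a * e w)"
      using assoc_mult_mat[OF F[OF a(3)] m[OF a(1)] e[OF that(2)]] by (simp add: Cons)
    then show ?thesis using me'[OF a(1) that(2)] a F[OF a(3)] by (simp add: Cons)
  qed
  have FF: "?F (s @ r) u = ?F r (qpath_end Q (u, s)) * ?F s u" if "(u, s @ r) \<in> qpaths Q" for s r u
    using that
  proof (induction s arbitrary: u)
    case Nil
    then show ?case using Fe[of u r u] by (auto dest: Q.qpaths_start)
  next
    case (Cons a s)
    then have a: "a \<in> arcs Q" "(head Q a, s @ r) \<in> qpaths Q" by auto
    then have p: "(head Q a, s) \<in> qpaths Q" "(qpath_end Q (head Q a, s), r) \<in> qpaths Q"
      unfolding Q.qpaths_append by auto
    show ?case
      using Cons.IH[OF a(2)] assoc_mult_mat[OF F[OF p(2)] F[OF p(1)] m[OF a(1)]] by simp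
  qed
  define \<Phi> where "\<Phi> x = mat d d (\<lambda>(i, j). \<Sum>p | x p \<noteq> 0. h (x p) * ?F (snd p) (fst p) $$ (i, j))"
    for x :: "('v, 'e) qpath \<Rightarrow> 'k"
  have \<Phi>c: "\<Phi> x \<in> carrier_mat d d" for x by (simp add: \<Phi>_def)
  have \<Phi>_index: "\<Phi> x $$ (i, j) = (\<Sum>p\<in>T. h (x p) * ?F (snd p) (fst p) $$ (i, j))"
    if "finite T" "{p. x p \<noteq> 0} \<subseteq> T" "i < d" "j < d" for x T i j
    unfolding \<Phi>_def using that by (simp, intro sum.mono_neutral_left) auto
  have \<Phi>_add: "\<Phi> (x + y) = \<Phi> x + \<Phi> y" if "x \<in> carrier KQ" "y \<in> carrier KQ" for x y
  proof (rule eq_matI)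
    fix i j assume "i < dim_row (\<Phi> x + \<Phi> y)" "j < dim_col (\<Phi> x + \<Phi> y)"
    then have ij: "i < d" "j < d" by (auto simp: \<Phi>_def)
    let ?T = "{p. x p \<noteq> 0} \<union> {p. y p \<noteq> 0}"
    have T: "finite ?T" "{p. x p \<noteq> 0} \<subseteq> ?T" "{p. y p \<noteq> 0} \<subseteq> ?T" "{p. (x + y) p \<noteq> 0} \<subseteq> ?T"
      using that by (auto simp: path_algebra_carrier)
    have "(\<Phi> x + \<Phi> y) $$ (i, j) = \<Phi> x $$ (i, j) + \<Phi> y $$ (i, j)"
      using ij \<Phi>c[of y] by auto
    then show "\<Phi> (x + y) $$ (i, j) = (\<Phi> x + \<Phi> y) $$ (i, j)"
      by (simp add: \<Phi>_index[OF T(1,2) ij] \<Phi>_index[OF T(1,3) ij] \<Phi>_index[OF T(1,4) ij]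
          h.hom_add distrib_right sum.distrib del: plus_fun_def)
  qed (auto simp: \<Phi>_def)
  have \<Phi>_smult: "\<Phi> (\<lambda>p. c * x p) = h c \<cdot>\<^sub>m \<Phi> x" if "x \<in> carrier KQ" for c x
  proof (rule eq_matI)
    fix i j assume "i < dim_row (h c \<cdot>\<^sub>m \<Phi> x)" "j < dim_col (h c \<cdot>\<^sub>m \<Phi> x)"
    then have ij: "i < d" "j < d" by (auto simp: \<Phi>_def)
    let ?T = "{p. x p \<noteq> 0}"
    have T: "finite ?T" "{p. x p \<noteq> 0} \<subseteq> ?T" "{p. c * x p \<noteq> 0} \<subseteq> ?T"
      using that by (auto simp: path_algebra_carrier)
    have "(h c \<cdot>\<^sub>m \<Phi> x) $$ (i, j) = h c * \<Phi> x $$ (i, j)"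
      using ij \<Phi>c[of x] by auto
    then show "\<Phi> (\<lambda>p. c * x p) $$ (i, j) = (h c \<cdot>\<^sub>m \<Phi> x) $$ (i, j)"
      by (simp add: \<Phi>_index[OF T(1,2) ij] \<Phi>_index[OF T(1,3) ij]
          h.hom_mult sum_distrib_left mult.assoc)
  qed (auto simp: \<Phi>_def)
  have \<Phi>_zero: "\<Phi> 0 = 0\<^sub>m d d" by (intro eq_matI) (auto simp: \<Phi>_def)
  have \<Phi>_path: "\<Phi> (path_element (u, r)) = ?F r u" if "(u, r) \<in> qpaths Q" for u r
  proof (rule eq_matI)
    fix i j assume "i < dim_row (?F r u)" "j < dim_col (?F r u)"
    then have ij: "i < d" "j < d" using F[OF that] by auto
    have "\<Phi> (path_element (u, r)) $$ (i, j) = (\<Sum>p\<in>{(u, r)}. h (path_element (u, r) p) * ?F (snd p) (fst p) $$ (i, j))"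
      by (rule \<Phi>_index) (use ij in \<open>auto simp: path_element_def split: if_splits\<close>)
    then show "\<Phi> (path_element (u, r)) $$ (i, j) = ?F r u $$ (i, j)" by simp
  qed (use F[OF that] in \<open>auto simp: \<Phi>_def\<close>)
  have mult_paths: "\<Phi> (path_element p \<star> path_element q) = \<Phi> (path_element p) * \<Phi> (path_element q)"
    if "p \<in> qpaths Q" "q \<in> qpaths Q" for p q
  proof -
    obtain v r u s where pq: "p = (v, r)" "q = (u, s)" by (cases p, cases q)
    note P = that[unfolded pq]
    have vv: "v \<in> verts Q" by (rule Q.qpaths_start[OF P(1)])
    show ?thesis
    proof (cases "v = qpath_end Q (u, s)")
      case True
      then have "(u, s @ r) \<in> qpaths Q" unfolding Q.qpaths_append using P by simp
      then show ?thesis using True P FF[of u s r] by (simp add: pq path_element_mult \<Phi>_path)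
    next
      case False
      have "?F r v * ?F s u = ?F r v * (e v * ?F s u)"
        using Fe[OF P(1) vv] assoc_mult_mat[OF F[OF P(1)] e[OF vv] F[OF P(2)]] by simp
      also have "\<dots> = 0\<^sub>m d d" using eF[OF P(2) vv] False F[OF P(1)] by simp
      finally show ?thesis using False P by (simp add: pq path_element_mult \<Phi>_path \<Phi>_zero)
    qed
  qed
  have mult_path: "\<Phi> (x \<star> path_element q) = \<Phi> x * \<Phi> (path_element q)"
    if x: "x \<in> carrier KQ" and q: "q \<in> qpaths Q" for x q
    using x
  proof (induction rule: linear_induct)
    case zero
    have "\<Phi> (0 \<star> path_element q) = \<Phi> 0 * \<Phi> (path_element q)"
      unfolding pmul_zero_left \<Phi>_zero using left_mult_zero_mat[OF \<Phi>c] by simp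
    then show ?case .
  next
    case (add x y)
    have "\<Phi> ((x + y) \<star> path_element q) = \<Phi> (x + y) * \<Phi> (path_element q)"
      unfolding pmul_add_left \<Phi>_add[OF add(1,2)] add_mult_distrib_mat[OF \<Phi>c \<Phi>c \<Phi>c] add(3,4)[symmetric]
      using add(1,2) q by (intro \<Phi>_add pmul_carrier path_element_carrier)
    then show ?case .
  next
    case (smult c x)
    show ?case
      unfolding smult_mult_left \<Phi>_smult[OF smult(1)]
        \<Phi>_smult[OF pmul_carrier[OF smult(1) path_element_carrier[OF q]]] smult(2)
      by (rule mult_smult_assoc_mat[OF \<Phi>c \<Phi>c, symmetric])
  next
    case (path p)
    show ?case by (rule mult_paths[OF path(1) q])
  qed
  have mult: "\<Phi> (x \<star> y) = \<Phi> x * \<Phi> y" if x: "x \<in> carrier KQ" and y: "y \<in> carrier KQ" for x y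
    using y
  proof (induction rule: linear_induct)
    case zero
    have "\<Phi> (x \<star> 0) = \<Phi> x * \<Phi> 0"
      unfolding pmul_zero_right \<Phi>_zero using right_mult_zero_mat[OF \<Phi>c] by simp
    then show ?case .
  next
    case (add y z)
    have "\<Phi> (x \<star> (y + z)) = \<Phi> x * \<Phi> (y + z)"
      unfolding pmul_add_right \<Phi>_add[OF add(1,2)] mult_add_distrib_mat[OF \<Phi>c \<Phi>c \<Phi>c] add(3,4)[symmetric]
      using add(1,2) x by (intro \<Phi>_add pmul_carrier)
    then show ?case .
  next
    case (smult c y)
    show ?case
      unfolding smult_mult_right \<Phi>_smult[OF smult(1)] \<Phi>_smult[OF pmul_carrier[OF x smult(1)]] smult(2)
      by (rule mult_smult_distrib[OF \<Phi>c \<Phi>c, symmetric])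
  next
    case (path q)
    show ?case by (rule mult_path[OF x path(1)])
  qed
  have one: "\<Phi> \<one>\<^bsub>KQ\<^esub> = 1\<^sub>m d"
  proof (rule eq_matI)
    fix i j assume "i < dim_row (1\<^sub>m d :: 't mat)" "j < dim_col (1\<^sub>m d :: 't mat)"
    then have ij: "i < d" "j < d" by auto
    have "\<Phi> \<one>\<^bsub>KQ\<^esub> $$ (i, j) = (\<Sum>p\<in>(\<lambda>v. (v, [])) ` verts Q. h (\<one>\<^bsub>KQ\<^esub> p) * ?F (snd p) (fst p) $$ (i, j))"
      by (rule \<Phi>_index) (use ij in \<open>auto simp: path_algebra_one split: if_splits\<close>)
    also have "\<dots> = (\<Sum>v\<in>verts Q. e v $$ (i, j))"
      by (subst sum.reindex) (auto simp: inj_on_def path_algebra_one)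
    also have "\<dots> = msum d d (verts Q) e $$ (i, j)" using ij by (simp add: msum_def)
    finally show "\<Phi> \<one>\<^bsub>KQ\<^esub> $$ (i, j) = 1\<^sub>m d $$ (i, j)" unfolding e1 .
  qed (auto simp: \<Phi>_def)
  have "qrep h d \<Phi>"
    by (rule qrepI) (use \<Phi>c \<Phi>_add mult \<Phi>_smult one \<Phi>_zero I0 in auto)
  moreover have "\<Phi> (vx v) = e v" if "v \<in> verts Q" for v using \<Phi>_path[of v "[]"] that by simp
  moreover have "\<Phi> (ar a) = m a" if "a \<in> arcs Q" for a
    using \<Phi>_path[of "tail Q a" "[a]"] that em[OF that] by simp
  ultimately show ?thesis using that by blast
qed

end

section \<open>Free modules\<close>

context quiver_basis
begin

text \<open>
  The direct sum of \<open>d\<close> copies of the regular module.  The index \<open>s\<close> stands for the basis path \<open>s mod n\<close> in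
  the copy \<open>s div n\<close>.
\<close>

definition free_act :: "nat \<Rightarrow> (('v, 'e) qpath \<Rightarrow> 'k) \<Rightarrow> 'k mat" where
  "free_act d x = mat (d * n) (d * n) (\<lambda>(s, s').
     if s div n = s' div n then coord (x \<star> basis (s' mod n)) (s mod n) else 0)"

lemma basis_carrier [simp]: "k < n \<Longrightarrow> basis k \<in> carrier KQ"
  using q_path by simp

lemma index_bounds:
  assumes "s < d * n"
  shows "0 < n" "s mod n < n" "s div n < d"
proof -
  show "0 < n" using assms by (cases n) auto
  then show "s mod n < n" by simp
  show "s div n < d" using assms by (simp add: less_mult_imp_div_less)
qed

lemma index_eq_iff: "s div n = s' div n \<and> s mod n = s' mod n \<longleftrightarrow> s = s'"
  by (metis div_mult_mod_eq)

lemma free_act_qrep: "qrep id (d * n) (free_act d)"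
proof (rule qrepI)
  fix x y assume x: "x \<in> carrier KQ" and y: "y \<in> carrier KQ"
  have c: "free_act d x \<in> carrier_mat (d * n) (d * n)" "free_act d y \<in> carrier_mat (d * n) (d * n)"
    by (auto simp: free_act_def)
  show "free_act d (x + y) = free_act d x + free_act d y"
  proof (rule eq_matI)
    fix s s' assume "s < dim_row (free_act d x + free_act d y)" "s' < dim_col (free_act d x + free_act d y)"
    then have s: "s < d * n" "s' < d * n" using c by auto
    have "coord ((x + y) \<star> basis (s' mod n)) (s mod n)
      = coord (x \<star> basis (s' mod n)) (s mod n) + coord (y \<star> basis (s' mod n)) (s mod n)"
      unfolding pmul_add_left using x y index_bounds[OF s(2)] by (intro coord_add) auto
    then show "free_act d (x + y) $$ (s, s') = (free_act d x + free_act d y) $$ (s, s')"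
      using s by (simp add: free_act_def)
  qed (use c in \<open>auto simp: free_act_def\<close>)
  show "free_act d (x \<star> y) = free_act d x * free_act d y"
  proof (rule eq_matI)
    fix s s' assume "s < dim_row (free_act d x * free_act d y)" "s' < dim_col (free_act d x * free_act d y)"
    then have s: "s < d * n" "s' < d * n" using c by auto
    note b = index_bounds[OF s(1)] index_bounds[OF s(2)]
    let ?F = "\<lambda>a l. (if s div n = a then coord (x \<star> basis l) (s mod n) else 0) *
      (if a = s' div n then coord (y \<star> basis (s' mod n)) l else 0)"
    have "(free_act d x * free_act d y) $$ (s, s') = (\<Sum>u<d * n. ?F (u div n) (u mod n))"
      unfolding mat_mult_index[OF c s] using s by (intro sum.cong) (auto simp: free_act_def)
    also have "\<dots> = (\<Sum>a<d. \<Sum>l<n. ?F a l)" by (rule sum_div_mod[where F = ?F])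
    also have "\<dots> = (\<Sum>a<d. if a = s div n then (if s div n = s' div n then
        (\<Sum>l<n. coord (y \<star> basis (s' mod n)) l * coord (x \<star> basis l) (s mod n)) else 0) else 0)"
      by (intro sum.cong) (auto simp: mult.commute)
    also have "\<dots> = (if s div n = s' div n then
        (\<Sum>l<n. coord (y \<star> basis (s' mod n)) l * coord (x \<star> basis l) (s mod n)) else 0)"
      using b(3) by simp
    also have "(\<Sum>l<n. coord (y \<star> basis (s' mod n)) l * coord (x \<star> basis l) (s mod n))
        = coord (x \<star> (y \<star> basis (s' mod n))) (s mod n)"
      using b y by (intro coord_mult[OF x, symmetric]) auto
    also have "x \<star> (y \<star> basis (s' mod n)) = x \<star> y \<star> basis (s' mod n)"
      using x y b by (intro pmul_assoc[symmetric]) auto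
    finally show "free_act d (x \<star> y) $$ (s, s') = (free_act d x * free_act d y) $$ (s, s')"
      using s by (simp add: free_act_def)
  qed (use c in \<open>auto simp: free_act_def\<close>)
next
  fix c x assume x: "x \<in> carrier KQ"
  show "free_act d (\<lambda>p. c * x p) = id c \<cdot>\<^sub>m free_act d x"
    using x by (intro eq_matI) (auto simp: free_act_def smult_mult_left coord_smult index_bounds)
next
  show "free_act d \<one>\<^bsub>KQ\<^esub> = 1\<^sub>m (d * n)"
  proof (rule eq_matI)
    fix s s' assume "s < dim_row (1\<^sub>m (d * n) :: 'k mat)" "s' < dim_col (1\<^sub>m (d * n) :: 'k mat)"
    then have s: "s < d * n" "s' < d * n" by auto
    note b = index_bounds[OF s(1)] index_bounds[OF s(2)]
    show "free_act d \<one>\<^bsub>KQ\<^esub> $$ (s, s') = 1\<^sub>m (d * n) $$ (s, s')"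
      using s b index_eq_iff[of s s'] by (auto simp: free_act_def coord_basis)
  qed (auto simp: free_act_def)
next
  fix x assume "x \<in> I"
  then show "free_act d x = 0\<^sub>m (d * n) (d * n)"
    by (intro eq_matI) (auto simp: free_act_def coord_ideal index_bounds)
qed (auto simp: free_act_def)

lemma act_coord:
  assumes M: "fd_module A M" and y: "y \<in> carrier KQ" and ab: "a < fst M" "b < fst M"
  shows "act M y $$ (a, b) = (\<Sum>l<n. coord y l * act M (basis l) $$ (a, b))"
proof -
  let ?s = "\<Sum>k<n. (\<lambda>p. coord y k * basis k p)"
  note M' = qrepD[OF qrep_act[OF M]]
  have s: "?s \<in> carrier KQ" by (intro sum_carrier smult_carrier) auto
  have d: "y - ?s \<in> I" by (rule coord_expansion[OF y])
  have "act M ((y - ?s) + ?s) = act M (y - ?s) + act M ?s" by (rule M'(2)[OF ideal_carrier[OF d] s])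
  also have "\<dots> = act M ?s" unfolding M'(6)[OF d] using M'(1)[OF s] by simp
  finally have "act M y = act M ?s" by simp
  then have "act M y $$ (a, b) = (\<Sum>l<n. act M (\<lambda>p. coord y l * basis l p) $$ (a, b))"
    using qrep_sum_index[OF qrep_act[OF M] _ ab, of "{..<n}" "\<lambda>k p. coord y k * basis k p"] by simp
  also have "\<dots> = (\<Sum>l<n. coord y l * act M (basis l) $$ (a, b))"
  proof (rule sum.cong[OF refl])
    fix l assume "l \<in> {..<n}"
    then have l: "basis l \<in> carrier KQ" by simp
    show "act M (\<lambda>p. coord y l * basis l p) $$ (a, b) = coord y l * act M (basis l) $$ (a, b)"
      unfolding M'(4)[OF l] using M'(1)[OF l] ab by simp
  qed
  finally show ?thesis .
qed

text \<open>
  The columns are the units of the copies.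
\<close>

definition free_gens :: "nat \<Rightarrow> 'k mat" where
  "free_gens d = mat (d * n) d (\<lambda>(s, j). if s div n = j then coord \<one>\<^bsub>KQ\<^esub> (s mod n) else 0)"

text \<open>
  The homomorphism to \<open>M\<close> that sends the units to the columns of \<open>V\<close>.
\<close>

definition free_map ::
  "('k, (('v, 'e) qpath \<Rightarrow> 'k) set) fd_mod \<Rightarrow> nat \<Rightarrow> 'k mat \<Rightarrow> 'k mat" where
  "free_map M d V = mat (fst M) (d * n) (\<lambda>(a, s). (act M (basis (s mod n)) * V) $$ (a, s div n))"

lemma free_map_index:
  "a < fst M \<Longrightarrow> s < d * n \<Longrightarrow> free_map M d V $$ (a, s) = (act M (basis (s mod n)) * V) $$ (a, s div n)"
  by (simp add: free_map_def)

lemma free_map_carrier [simp]: "free_map M d V \<in> carrier_mat (fst M) (d * n)"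
  by (simp add: free_map_def)

lemma free_map_coord:
  assumes M: "fd_module A M" and V: "V \<in> carrier_mat (fst M) d" and y: "y \<in> carrier KQ"
    and a: "a < fst M" "j < d"
  shows "(act M y * V) $$ (a, j) = (\<Sum>l<n. (act M (basis l) * V) $$ (a, j) * coord y l)"
proof -
  have "(act M y * V) $$ (a, j) = (\<Sum>b<fst M. \<Sum>l<n. coord y l * act M (basis l) $$ (a, b) * V $$ (b, j))"
    unfolding mat_mult_index[OF act_carrier[OF M y] V a]
    by (intro sum.cong) (auto simp: act_coord[OF M y a(1)] sum_distrib_right)
  also have "\<dots> = (\<Sum>l<n. \<Sum>b<fst M. coord y l * act M (basis l) $$ (a, b) * V $$ (b, j))"
    by (rule sum.swap)
  also have "\<dots> = (\<Sum>l<n. (act M (basis l) * V) $$ (a, j) * coord y l)"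
    by (intro sum.cong)
      (auto simp: mat_mult_index[OF act_carrier[OF M] V a] sum_distrib_left sum_distrib_right ac_simps simp del: index_mult_mat)
  finally show ?thesis .
qed

lemma free_map_hom:
  assumes M: "fd_module A M" and V: "V \<in> carrier_mat (fst M) d" and x: "x \<in> carrier KQ"
  shows "free_map M d V * free_act d x = act M x * free_map M d V"
proof (rule eq_matI)
  have c: "free_act d x \<in> carrier_mat (d * n) (d * n)" "act M x \<in> carrier_mat (fst M) (fst M)"
    using M x by (auto simp: free_act_def)
  fix a s assume "a < dim_row (act M x * free_map M d V)" "s < dim_col (act M x * free_map M d V)"
  then have as: "a < fst M" "s < d * n" using c by (auto simp: free_map_def)
  note b = index_bounds[OF as(2)]
  let ?q = "basis (s mod n)"
  have q: "?q \<in> carrier KQ" using b by simp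
  have "(act M x * free_map M d V) $$ (a, s) = (\<Sum>e<fst M. act M x $$ (a, e) * (act M ?q * V) $$ (e, s div n))"
    unfolding mat_mult_index[OF c(2) free_map_carrier as]
    by (intro sum.cong) (auto simp: free_map_index as simp del: index_mult_mat)
  also have "\<dots> = (act M x * (act M ?q * V)) $$ (a, s div n)"
    by (rule mat_mult_index[OF c(2) mult_carrier_mat[OF act_carrier[OF M q] V] as(1) b(3), symmetric])
  also have "act M x * (act M ?q * V) = act M (x \<star> ?q) * V"
    unfolding act_mult[OF M x q] by (rule assoc_mult_mat[OF c(2) act_carrier[OF M q] V, symmetric])
  also have "\<dots> $$ (a, s div n) = (\<Sum>l<n. (act M (basis l) * V) $$ (a, s div n) * coord (x \<star> ?q) l)"
    using x q as b by (intro free_map_coord[OF M V]) auto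
  also have "\<dots> = (\<Sum>e<d. if e = s div n then (\<Sum>l<n. (act M (basis l) * V) $$ (a, s div n) * coord (x \<star> ?q) l) else 0)"
    using b by simp
  also have "\<dots> = (\<Sum>e<d. \<Sum>l<n. (act M (basis l) * V) $$ (a, e) * (if e = s div n then coord (x \<star> ?q) l else 0))"
    by (intro sum.cong) auto
  also have "\<dots> = (\<Sum>u<d * n. (act M (basis (u mod n)) * V) $$ (a, u div n) *
      (if u div n = s div n then coord (x \<star> ?q) (u mod n) else 0))"
    by (rule sum_div_mod[where F = "\<lambda>e l. (act M (basis l) * V) $$ (a, e) *
      (if e = s div n then coord (x \<star> ?q) l else 0)", symmetric])
  also have "\<dots> = (\<Sum>u<d * n. free_map M d V $$ (a, u) * free_act d x $$ (u, s))"
    by (intro sum.cong) (use as in \<open>auto simp: free_map_index free_act_def simp del: index_mult_mat\<close>)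
  also have "\<dots> = (free_map M d V * free_act d x) $$ (a, s)"
    by (rule mat_mult_index[OF free_map_carrier c(1) as, symmetric])
  finally show "(free_map M d V * free_act d x) $$ (a, s) = (act M x * free_map M d V) $$ (a, s)" ..
qed (use M x in \<open>auto simp: free_map_def free_act_def carrier_matD[OF act_carrier[OF M x]]\<close>)

lemma free_gens_carrier [simp]: "free_gens d \<in> carrier_mat (d * n) d"
  by (simp add: free_gens_def)

lemma free_act_gens:
  assumes k: "k < n" and s: "s < d * n" and j: "j < d"
  shows "(free_act d (basis k) * free_gens d) $$ (s, j) = (if s div n = j \<and> s mod n = k then 1 else 0)"
proof -
  have c: "free_act d (basis k) \<in> carrier_mat (d * n) (d * n)" by (simp add: free_act_def)
  note b = index_bounds[OF s]
  let ?F = "\<lambda>e l. (if s div n = e then coord (basis k \<star> basis l) (s mod n) else 0) *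
    (if e = j then coord \<one>\<^bsub>KQ\<^esub> l else 0)"
  have "(free_act d (basis k) * free_gens d) $$ (s, j) = (\<Sum>u<d * n. ?F (u div n) (u mod n))"
    unfolding mat_mult_index[OF c free_gens_carrier s j] using s j
    by (intro sum.cong) (auto simp: free_act_def free_gens_def)
  also have "\<dots> = (\<Sum>e<d. \<Sum>l<n. ?F e l)" by (rule sum_div_mod[where F = ?F])
  also have "\<dots> = (\<Sum>e<d. if e = j then (if s div n = j then
      (\<Sum>l<n. coord \<one>\<^bsub>KQ\<^esub> l * coord (basis k \<star> basis l) (s mod n)) else 0) else 0)"
    by (intro sum.cong) (auto simp: mult.commute)
  also have "\<dots> = (if s div n = j then (\<Sum>l<n. coord \<one>\<^bsub>KQ\<^esub> l * coord (basis k \<star> basis l) (s mod n)) else 0)"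
    using j by simp
  also have "(\<Sum>l<n. coord \<one>\<^bsub>KQ\<^esub> l * coord (basis k \<star> basis l) (s mod n)) = coord (basis k \<star> \<one>\<^bsub>KQ\<^esub>) (s mod n)"
    using k b by (intro coord_mult[symmetric]) auto
  also have "\<dots> = (if s mod n = k then 1 else 0)" using k b by (simp add: coord_basis)
  finally show ?thesis by simp
qed

lemma free_hom_eq_free_map:
  assumes P: "fd_module A P" "fst P = d * n" "\<And>x. x \<in> carrier KQ \<Longrightarrow> act P x = free_act d x"
    and f: "f \<in> mod_hom A P N" and N: "fd_module A N"
  shows "f = free_map N d (f * free_gens d)"
proof (rule eq_matI)
  have fc: "f \<in> carrier_mat (fst N) (d * n)" using f P(2) by (simp add: mod_hom_iff)
  fix a s assume "a < dim_row (free_map N d (f * free_gens d))" "s < dim_col (free_map N d (f * free_gens d))"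
  then have as: "a < fst N" "s < d * n" by (auto simp: free_map_def)
  note b = index_bounds[OF as(2)]
  let ?q = "basis (s mod n)"
  have q: "?q \<in> carrier KQ" using b by simp
  have c: "free_act d ?q \<in> carrier_mat (d * n) (d * n)" by (simp add: free_act_def)
  have "act N ?q * (f * free_gens d) = act N ?q * f * free_gens d"
    by (rule assoc_mult_mat[OF act_carrier[OF N q] fc free_gens_carrier, symmetric])
  also have "act N ?q * f = f * free_act d ?q" using f q P(3) by (simp add: mod_hom_iff)
  also have "\<dots> * free_gens d = f * (free_act d ?q * free_gens d)"
    by (rule assoc_mult_mat[OF fc c free_gens_carrier])
  finally have "free_map N d (f * free_gens d) $$ (a, s) = (f * (free_act d ?q * free_gens d)) $$ (a, s div n)"
    using as by (simp add: free_map_index del: index_mult_mat)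
  also have "\<dots> = (\<Sum>u<d * n. f $$ (a, u) * (free_act d ?q * free_gens d) $$ (u, s div n))"
    by (rule mat_mult_index[OF fc mult_carrier_mat[OF c free_gens_carrier] as(1) b(3)])
  also have "\<dots> = (\<Sum>u<d * n. if u = s then f $$ (a, s) else 0)"
    by (intro sum.cong) (use b index_eq_iff[of _ s] in \<open>auto simp: free_act_gens simp del: index_mult_mat\<close>)
  also have "\<dots> = f $$ (a, s)" using as by simp
  finally show "f $$ (a, s) = free_map N d (f * free_gens d) $$ (a, s)" ..
qed (use f P(2) in \<open>auto simp: mod_hom_iff free_map_def\<close>)

lemma free_map_comp:
  assumes M: "fd_module A M" and N: "fd_module A N" and g: "g \<in> mod_hom A M N"
    and V: "V \<in> carrier_mat (fst M) d"
  shows "g * free_map M d V = free_map N d (g * V)"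
proof (rule eq_matI)
  have gc: "g \<in> carrier_mat (fst N) (fst M)" using g by (simp add: mod_hom_iff)
  fix a s assume "a < dim_row (free_map N d (g * V))" "s < dim_col (free_map N d (g * V))"
  then have as: "a < fst N" "s < d * n" by (auto simp: free_map_def)
  note b = index_bounds[OF as(2)]
  let ?q = "basis (s mod n)"
  have q: "?q \<in> carrier KQ" using b by simp
  have "(g * free_map M d V) $$ (a, s) = (\<Sum>e<fst M. g $$ (a, e) * (act M ?q * V) $$ (e, s div n))"
    unfolding mat_mult_index[OF gc free_map_carrier as]
    by (intro sum.cong) (auto simp: free_map_index as simp del: index_mult_mat)
  also have "\<dots> = (g * (act M ?q * V)) $$ (a, s div n)"
    by (rule mat_mult_index[OF gc mult_carrier_mat[OF act_carrier[OF M q] V] as(1) b(3), symmetric])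
  also have "g * (act M ?q * V) = g * act M ?q * V"
    by (rule assoc_mult_mat[OF gc act_carrier[OF M q] V, symmetric])
  also have "g * act M ?q = act N ?q * g" using g q by (simp add: mod_hom_iff)
  also have "\<dots> * V = act N ?q * (g * V)" by (rule assoc_mult_mat[OF act_carrier[OF N q] gc V])
  also have "\<dots> $$ (a, s div n) = free_map N d (g * V) $$ (a, s)"
    using as by (simp add: free_map_index del: index_mult_mat)
  finally show "(g * free_map M d V) $$ (a, s) = free_map N d (g * V) $$ (a, s)" .
qed (use g in \<open>auto simp: mod_hom_iff free_map_def\<close>)

text \<open>
  A free module whose generators are sent to the basis vectors of \<open>M\<close>; a free module is projective since
  the images of its generators can be lifted arbitrarily.
\<close>

lemma enough_projectives:
  assumes M: "fd_module A M"
  obtains P f where "projective_module A P" "f \<in> mod_hom A P M" "surjective_mat f"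
proof -
  let ?d = "fst M"
  obtain P where P: "fd_module A P" "fst P = ?d * n" "\<And>x. x \<in> carrier KQ \<Longrightarrow> act P x = free_act ?d x"
    using fd_module_of_qrep[OF free_act_qrep[of ?d]] by blast
  have "projective_module A P"
    unfolding projective_module_def
  proof (intro conjI P(1) allI ballI impI)
    fix M' N g h
    assume g: "g \<in> mod_hom A M' N" and h: "h \<in> mod_hom A P N"
      and mods: "fd_module A M' \<and> fd_module A N \<and> surjective_mat g"
    have gc: "g \<in> carrier_mat (fst N) (fst M')" using g by (simp add: mod_hom_iff)
    have hc: "h \<in> carrier_mat (fst N) (?d * n)" using h P(2) by (simp add: mod_hom_iff)
    obtain t where t: "t \<in> carrier_mat (fst M') (fst N)" "g * t = 1\<^sub>m (fst N)"
      using surjective_mat_right_inverse[OF _ gc] mods by blast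
    let ?V = "t * (h * free_gens ?d)"
    have hg: "h * free_gens ?d \<in> carrier_mat (fst N) ?d" by (rule mult_carrier_mat[OF hc free_gens_carrier])
    have V: "?V \<in> carrier_mat (fst M') ?d" by (rule mult_carrier_mat[OF t(1) hg])
    show "\<exists>l \<in> mod_hom A P M'. g * l = h"
    proof (rule bexI[of _ "free_map M' ?d ?V"])
      show "free_map M' ?d ?V \<in> mod_hom A P M'"
        unfolding mod_hom_iff using free_map_hom[OF _ V] mods by (auto simp: P)
      have "g * ?V = h * free_gens ?d"
        using assoc_mult_mat[OF gc t(1) hg] t(2) left_mult_one_mat[OF hg] by simp
      then show "g * free_map M' ?d ?V = h"
        using free_map_comp[OF _ _ g V] mods free_hom_eq_free_map[OF P h] by simp
    qed
  qed
  moreover have f: "free_map M ?d (1\<^sub>m ?d) \<in> mod_hom A P M"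
    unfolding mod_hom_iff using free_map_hom[OF M one_carrier_mat] by (auto simp: P)
  moreover have "surjective_mat (free_map M ?d (1\<^sub>m ?d))"
  proof (rule surjective_matI[OF free_map_carrier free_gens_carrier], rule eq_matI)
    fix a j assume "a < dim_row (1\<^sub>m ?d :: 'k mat)" "j < dim_col (1\<^sub>m ?d :: 'k mat)"
    then have aj: "a < ?d" "j < ?d" by auto
    let ?F = "\<lambda>e l. (act M (basis l) * 1\<^sub>m ?d) $$ (a, e) * (if e = j then coord \<one>\<^bsub>KQ\<^esub> l else 0)"
    have "(free_map M ?d (1\<^sub>m ?d) * free_gens ?d) $$ (a, j) = (\<Sum>u<?d * n. ?F (u div n) (u mod n))"
      unfolding mat_mult_index[OF free_map_carrier free_gens_carrier aj] using aj
      by (intro sum.cong) (auto simp: free_map_index free_gens_def simp del: index_mult_mat)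
    also have "\<dots> = (\<Sum>e<?d. \<Sum>l<n. ?F e l)" by (rule sum_div_mod[where F = ?F])
    also have "\<dots> = (\<Sum>e<?d. if e = j then (\<Sum>l<n. (act M (basis l) * 1\<^sub>m ?d) $$ (a, j) * coord \<one>\<^bsub>KQ\<^esub> l) else 0)"
      by (intro sum.cong) auto
    also have "\<dots> = (\<Sum>l<n. (act M (basis l) * 1\<^sub>m ?d) $$ (a, j) * coord \<one>\<^bsub>KQ\<^esub> l)" using aj by simp
    also have "\<dots> = (act M \<one>\<^bsub>KQ\<^esub> * 1\<^sub>m ?d) $$ (a, j)"
      by (rule free_map_coord[OF M one_carrier_mat one_carrier aj, symmetric])
    finally show "(free_map M ?d (1\<^sub>m ?d) * free_gens ?d) $$ (a, j) = 1\<^sub>m ?d $$ (a, j)"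
      unfolding qrepD(5)[OF qrep_act[OF M]] using aj by simp
  qed (auto simp: free_map_def free_gens_def)
  ultimately show ?thesis using that by blast
qed

end

section \<open>Global dimension of path algebras\<close>

lemma four_block_mat_lower_cong:
  assumes "four_block_mat A B C D = four_block_mat A B C' D"
    and "A \<in> carrier_mat m m" "B \<in> carrier_mat m n" "C \<in> carrier_mat n m" "C' \<in> carrier_mat n m"
      "D \<in> carrier_mat n n"
  shows "C = C'"
proof (rule eq_matI)
  fix i j assume "i < dim_row C'" "j < dim_col C'"
  then have ij: "i < n" "j < m" using assms by auto
  have "four_block_mat A B C D $$ (m + i, j) = four_block_mat A B C' D $$ (m + i, j)" using assms(1) by simp
  then show "C $$ (i, j) = C' $$ (i, j)" using ij assms(2-) by auto
qed (use assms in auto)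

lemma
  fixes X Y Z :: "'a :: ab_group_add mat"
  assumes "X \<in> carrier_mat m n" "Y \<in> carrier_mat m n"
  shows diff_diff_mat: "X - (X - Y) = Y"
    and add_diff_cancel_mat: "Z \<in> carrier_mat m n \<Longrightarrow> (X + Z) - (Y + Z) = X - Y"
    and add_diff_commute_mat: "Z \<in> carrier_mat m n \<Longrightarrow> (X + Z) - Y = (X - Y) + Z"
  using assms by (auto intro!: eq_matI)

context quiver_ideal
begin

text \<open>
  A lift of the values at the arrows is obtained from a right inverse \<open>t\<close> of \<open>g\<close> and trimmed to the vertices
  at the ends of the arrows.  Without relations it extends to a representation on the direct sum of \<open>M\<close>
  and \<open>N\<close>, whose lower left block is the derivation.
\<close>

lemma deriv_lift_of_ideal_zero:
  assumes I0: "I = {0}" and M: "fd_module A M" and N: "fd_module A N" and N2: "fd_module A N2"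
    and g: "g \<in> mod_hom A N N2" "surjective_mat g" and \<xi>: "deriv M N2 \<xi>"
    and \<xi>v: "\<And>v. v \<in> verts Q \<Longrightarrow> \<xi> (vx v) = 0\<^sub>m (fst N2) (fst M)"
  obtains \<xi>' where "deriv M N \<xi>'" "\<And>x. x \<in> carrier KQ \<Longrightarrow> g * \<xi>' x = \<xi> x"
proof -
  let ?m = "fst M" and ?n = "fst N" and ?n2 = "fst N2"
  note M' = qrepD[OF qrep_act[OF M], simplified] and N' = qrepD[OF qrep_act[OF N], simplified]
  note \<xi>D = derivD[OF \<xi>]
  have gc: "g \<in> carrier_mat ?n2 ?n" and gh: "\<And>x. x \<in> carrier KQ \<Longrightarrow> g * act N x = act N2 x * g"
    using g(1) by (auto simp: mod_hom_iff)
  obtain t where t: "t \<in> carrier_mat ?n ?n2" "g * t = 1\<^sub>m ?n2"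
    using surjective_mat_right_inverse[OF g(2) gc] by blast
  let ?B = "\<lambda>x L. four_block_mat (act M x) (0\<^sub>m ?m ?n) L (act N x)"
  define \<zeta> where "\<zeta> a = act N (vx (head Q a)) * (t * \<xi> (ar a)) * act M (vx (tail Q a))" for a
  have aM: "act M x \<in> carrier_mat ?m ?m" and aN: "act N x \<in> carrier_mat ?n ?n"
    and aN2: "act N2 x \<in> carrier_mat ?n2 ?n2" if "x \<in> carrier KQ" for x using that M N N2 by auto
  have B_mult: "?B x L * ?B y L' = ?B (x \<star> y) (L * act M y + act N x * L')"
    if "x \<in> carrier KQ" "y \<in> carrier KQ" "L \<in> carrier_mat ?n ?m" "L' \<in> carrier_mat ?n ?m" for x y L L'
    using aM[OF that(1)] aM[OF that(2)] aN[OF that(1)] aN[OF that(2)] that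
      right_mult_zero_mat[OF aM[OF that(1)], of ?n] left_mult_zero_mat[OF aN[OF that(2)], of ?m]
      right_add_zero_mat[OF mult_carrier_mat[OF aM[OF that(1)] aM[OF that(2)]]]
      left_add_zero_mat[OF mult_carrier_mat[OF aN[OF that(1)] aN[OF that(2)]]]
    by (subst mult_four_block_mat[of _ ?m ?m _ ?n _ ?n _ _ ?m _ ?n]) (auto simp: act_mult M N)
  have \<zeta>: "\<zeta> a \<in> carrier_mat ?n ?m" "act N (vx (head Q a)) * \<zeta> a = \<zeta> a"
    "\<zeta> a * act M (vx (tail Q a)) = \<zeta> a" "g * \<zeta> a = \<xi> (ar a)" if a: "a \<in> arcs Q" for a
  proof -
    let ?h = "vx (head Q a)" and ?t = "vx (tail Q a)" and ?X = "t * \<xi> (ar a)"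
    have h: "?h \<in> carrier KQ" and tl: "?t \<in> carrier KQ" and ac: "ar a \<in> carrier KQ" using a by auto
    have X: "?X \<in> carrier_mat ?n ?m" by (rule mult_carrier_mat[OF t(1) \<xi>D(1)[OF ac]])
    have NX: "act N ?h * ?X \<in> carrier_mat ?n ?m" by (rule mult_carrier_mat[OF aN[OF h] X])
    show c: "\<zeta> a \<in> carrier_mat ?n ?m" unfolding \<zeta>_def by (rule mult_carrier_mat[OF NX aM[OF tl]])
    have hh: "act N ?h * act N ?h = act N ?h" unfolding act_mult[OF N h h, symmetric] by (simp add: vx_mult)
    have tt: "act M ?t * act M ?t = act M ?t" unfolding act_mult[OF M tl tl, symmetric] by (simp add: vx_mult)
    show "act N ?h * \<zeta> a = \<zeta> a"
      unfolding \<zeta>_def assoc_mult_mat[OF aN[OF h] NX aM[OF tl], symmetric]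
        assoc_mult_mat[OF aN[OF h] aN[OF h] X, symmetric] hh ..
    show "\<zeta> a * act M ?t = \<zeta> a"
      unfolding \<zeta>_def assoc_mult_mat[OF NX aM[OF tl] aM[OF tl]] tt ..
    have \<xi>c: "\<xi> (ar a) \<in> carrier_mat ?n2 ?m" by (rule \<xi>D(1)[OF ac])
    have "\<xi> (?h \<star> ar a) = \<xi> ?h * act M (ar a) + act N2 ?h * \<xi> (ar a)" by (rule \<xi>D(4)[OF h ac])
    then have 1: "act N2 ?h * \<xi> (ar a) = \<xi> (ar a)"
      using a aM[OF ac] mult_carrier_mat[OF aN2[OF h] \<xi>c] by (simp add: vx_head_ar \<xi>v)
    have "\<xi> (ar a \<star> ?t) = \<xi> (ar a) * act M ?t + act N2 (ar a) * \<xi> ?t" by (rule \<xi>D(4)[OF ac tl])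
    then have 2: "\<xi> (ar a) * act M ?t = \<xi> (ar a)"
      using a aN2[OF ac] mult_carrier_mat[OF \<xi>c aM[OF tl]] by (simp add: ar_vx_tail \<xi>v)
    have "g * \<zeta> a = g * (act N ?h * ?X) * act M ?t"
      unfolding \<zeta>_def by (rule assoc_mult_mat[OF gc NX aM[OF tl], symmetric])
    also have "g * (act N ?h * ?X) = act N2 ?h * g * ?X"
      unfolding gh[OF h, symmetric] by (rule assoc_mult_mat[OF gc aN[OF h] X, symmetric])
    also have "\<dots> = act N2 ?h * (g * ?X)" by (rule assoc_mult_mat[OF aN2[OF h] gc X])
    also have "g * ?X = \<xi> (ar a)"
      unfolding assoc_mult_mat[OF gc t(1) \<xi>c, symmetric] t(2) by (rule left_mult_one_mat[OF \<xi>c])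
    finally show "g * \<zeta> a = \<xi> (ar a)" unfolding 1 2 .
  qed
  have z: "0\<^sub>m ?n ?m \<in> carrier_mat ?n ?m" by simp
  obtain \<Phi> where \<Phi>: "qrep id (?m + ?n) \<Phi>"
    "\<And>v. v \<in> verts Q \<Longrightarrow> \<Phi> (vx v) = ?B (vx v) (0\<^sub>m ?n ?m)"
    "\<And>a. a \<in> arcs Q \<Longrightarrow> \<Phi> (ar a) = ?B (ar a) (\<zeta> a)"
  proof (rule qrep_of_arrows[OF I0 comm_ring_hom_id,
        where e = "\<lambda>v. ?B (vx v) (0\<^sub>m ?n ?m)" and m = "\<lambda>a. ?B (ar a) (\<zeta> a)" and d = "?m + ?n"])
    fix v assume v: "v \<in> verts Q"
    then have vc: "vx v \<in> carrier KQ" by simp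
    show "?B (vx v) (0\<^sub>m ?n ?m) \<in> carrier_mat (?m + ?n) (?m + ?n)" using aM[OF vc] aN[OF vc] by simp
    fix w assume w: "w \<in> verts Q"
    then have wc: "vx w \<in> carrier KQ" by simp
    have "?B (vx v) (0\<^sub>m ?n ?m) * ?B (vx w) (0\<^sub>m ?n ?m) = ?B (vx v \<star> vx w) (0\<^sub>m ?n ?m)"
      unfolding B_mult[OF vc wc z z] using aM[OF wc] aN[OF vc] by simp
    moreover have "?B 0 (0\<^sub>m ?n ?m) = 0\<^sub>m (?m + ?n) (?m + ?n)"
      unfolding qrep_zero[OF qrep_act[OF M]] qrep_zero[OF qrep_act[OF N]] by (intro eq_matI) auto
    ultimately show "?B (vx v) (0\<^sub>m ?n ?m) * ?B (vx w) (0\<^sub>m ?n ?m)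
        = (if v = w then ?B (vx v) (0\<^sub>m ?n ?m) else 0\<^sub>m (?m + ?n) (?m + ?n))"
      by (simp add: vx_mult)
  next
    fix a assume a: "a \<in> arcs Q"
    then have ac: "ar a \<in> carrier KQ" and h: "vx (head Q a) \<in> carrier KQ" and tl: "vx (tail Q a) \<in> carrier KQ"
      by auto
    show "?B (ar a) (\<zeta> a) \<in> carrier_mat (?m + ?n) (?m + ?n)" using aM[OF ac] aN[OF ac] by simp
    show "?B (vx (head Q a)) (0\<^sub>m ?n ?m) * ?B (ar a) (\<zeta> a) = ?B (ar a) (\<zeta> a)"
      unfolding B_mult[OF h ac z \<zeta>(1)[OF a]] using aM[OF ac] \<zeta>(1,2)[OF a] by (simp add: vx_head_ar)
    show "?B (ar a) (\<zeta> a) * ?B (vx (tail Q a)) (0\<^sub>m ?n ?m) = ?B (ar a) (\<zeta> a)"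
      unfolding B_mult[OF ac tl \<zeta>(1)[OF a] z] using aN[OF ac] \<zeta>(1,3)[OF a] by (simp add: ar_vx_tail)
  next
    have sM: "(\<Sum>v\<in>verts Q. act M (vx v) $$ (i, j)) = 1\<^sub>m ?m $$ (i, j)" if "i < ?m" "j < ?m" for i j
      using that by (simp add: qrep_sum_vertices[OF qrep_act[OF M], symmetric] msum_def)
    have sN: "(\<Sum>v\<in>verts Q. act N (vx v) $$ (i, j)) = 1\<^sub>m ?n $$ (i, j)" if "i < ?n" "j < ?n" for i j
      using that by (simp add: qrep_sum_vertices[OF qrep_act[OF N], symmetric] msum_def)
    show "msum (?m + ?n) (?m + ?n) (verts Q) (\<lambda>v. ?B (vx v) (0\<^sub>m ?n ?m)) = 1\<^sub>m (?m + ?n)"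
    proof (rule eq_matI)
      fix i j assume "i < dim_row (1\<^sub>m (?m + ?n) :: 'k mat)" "j < dim_col (1\<^sub>m (?m + ?n) :: 'k mat)"
      then have ij: "i < ?m + ?n" "j < ?m + ?n" by auto
      have "msum (?m + ?n) (?m + ?n) (verts Q) (\<lambda>v. ?B (vx v) (0\<^sub>m ?n ?m)) $$ (i, j)
          = (\<Sum>v\<in>verts Q. if i < ?m then if j < ?m then act M (vx v) $$ (i, j) else 0
             else if j < ?m then 0 else act N (vx v) $$ (i - ?m, j - ?m))"
        using ij carrier_matD[OF aM[OF vx_carrier]] carrier_matD[OF aN[OF vx_carrier]]
        by (auto simp: msum_def intro!: sum.cong)
      also have "\<dots> = 1\<^sub>m (?m + ?n) $$ (i, j)"
        using ij sM[of i j] sN[of "i - ?m" "j - ?m"]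
        by (cases "i < ?m"; cases "j < ?m"; cases "i = j") auto
      finally show "msum (?m + ?n) (?m + ?n) (verts Q) (\<lambda>v. ?B (vx v) (0\<^sub>m ?n ?m)) $$ (i, j)
          = 1\<^sub>m (?m + ?n) $$ (i, j)" .
    qed (auto simp: msum_def)
  qed blast
  note \<Phi>' = qrepD[OF \<Phi>(1), simplified]
  have "\<exists>L\<in>carrier_mat ?n ?m. \<Phi> x = ?B x L \<and> g * L = \<xi> x" if "x \<in> carrier KQ" for x
    using that
  proof (induction rule: path_algebra_induct)
    case zero
    have "\<Phi> 0 = ?B 0 (0\<^sub>m ?n ?m)"
      unfolding qrep_zero[OF qrep_act[OF M]] qrep_zero[OF qrep_act[OF N]] qrep_zero[OF \<Phi>(1)]
      by (intro eq_matI) auto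
    moreover have "g * 0\<^sub>m ?n ?m = \<xi> 0" using gc \<xi>D(5)[OF ideal_zero] by simp
    ultimately have "\<exists>L\<in>carrier_mat ?n ?m. \<Phi> 0 = ?B 0 L \<and> g * L = \<xi> 0" using z by blast
    then show ?case .
  next
    case (add x y)
    then obtain L L' where L: "L \<in> carrier_mat ?n ?m" "\<Phi> x = ?B x L" "g * L = \<xi> x"
      "L' \<in> carrier_mat ?n ?m" "\<Phi> y = ?B y L'" "g * L' = \<xi> y" by blast
    have "?B (x + y) (L + L') = \<Phi> x + \<Phi> y"
      unfolding L(2,5) M'(2)[OF add(1,2)] N'(2)[OF add(1,2)]
      using aM[OF add(1)] aM[OF add(2)] aN[OF add(1)] aN[OF add(2)] L by (intro eq_matI) auto
    moreover have "g * (L + L') = \<xi> (x + y)"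
      unfolding \<xi>D(2)[OF add(1,2)] L(3,6)[symmetric] by (rule mult_add_distrib_mat[OF gc L(1,4)])
    ultimately have "\<Phi> (x + y) = ?B (x + y) (L + L') \<and> g * (L + L') = \<xi> (x + y)"
      unfolding \<Phi>'(2)[OF add(1,2)] by simp
    moreover have "L + L' \<in> carrier_mat ?n ?m" using L by simp
    ultimately show ?case by blast
  next
    case (smult c x)
    then obtain L where L: "L \<in> carrier_mat ?n ?m" "\<Phi> x = ?B x L" "g * L = \<xi> x" by blast
    have "?B (\<lambda>p. c * x p) (c \<cdot>\<^sub>m L) = c \<cdot>\<^sub>m \<Phi> x"
      unfolding L(2) M'(4)[OF smult(1)] N'(4)[OF smult(1)]
      using aM[OF smult(1)] aN[OF smult(1)] L by (intro eq_matI) auto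
    moreover have "g * (c \<cdot>\<^sub>m L) = \<xi> (\<lambda>p. c * x p)"
      unfolding \<xi>D(3)[OF smult(1)] L(3)[symmetric] by (rule mult_smult_distrib[OF gc L(1)])
    ultimately have "\<Phi> (\<lambda>p. c * x p) = ?B (\<lambda>p. c * x p) (c \<cdot>\<^sub>m L) \<and> g * (c \<cdot>\<^sub>m L) = \<xi> (\<lambda>p. c * x p)"
      unfolding \<Phi>'(4)[OF smult(1)] by simp
    moreover have "c \<cdot>\<^sub>m L \<in> carrier_mat ?n ?m" using L by simp
    ultimately show ?case by blast
  next
    case (mult x y)
    then obtain L L' where L: "L \<in> carrier_mat ?n ?m" "\<Phi> x = ?B x L" "g * L = \<xi> x"
      "L' \<in> carrier_mat ?n ?m" "\<Phi> y = ?B y L'" "g * L' = \<xi> y" by blast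
    let ?L = "L * act M y + act N x * L'"
    have c: "L * act M y \<in> carrier_mat ?n ?m" "act N x * L' \<in> carrier_mat ?n ?m"
      using L aM[OF mult(2)] aN[OF mult(1)] by auto
    have "g * ?L = g * (L * act M y) + g * (act N x * L')" by (rule mult_add_distrib_mat[OF gc c])
    also have "g * (L * act M y) = \<xi> x * act M y"
      unfolding L(3)[symmetric] by (rule assoc_mult_mat[OF gc L(1) aM[OF mult(2)], symmetric])
    also have "g * (act N x * L') = act N2 x * g * L'"
      unfolding gh[OF mult(1), symmetric] by (rule assoc_mult_mat[OF gc aN[OF mult(1)] L(4), symmetric])
    also have "\<dots> = act N2 x * \<xi> y" unfolding L(6)[symmetric] by (rule assoc_mult_mat[OF aN2[OF mult(1)] gc L(4)])
    finally have "g * ?L = \<xi> (x \<star> y)" unfolding \<xi>D(4)[OF mult(1,2)] .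
    moreover have "\<Phi> (x \<star> y) = ?B (x \<star> y) ?L"
      unfolding \<Phi>'(3)[OF mult(1,2)] L(2,5) by (rule B_mult[OF mult(1,2) L(1,4)])
    moreover have "?L \<in> carrier_mat ?n ?m" using c by simp
    ultimately show ?case by blast
  next
    case (vertex v)
    show ?case using \<Phi>(2)[OF vertex] \<xi>v[OF vertex] gc z by (intro bexI[of _ "0\<^sub>m ?n ?m"]) auto
  next
    case (arrow a)
    show ?case using \<Phi>(3)[OF arrow] \<zeta>[OF arrow] by (intro bexI[of _ "\<zeta> a"]) auto
  qed
  then obtain \<xi>' where \<xi>': "\<And>x. x \<in> carrier KQ \<Longrightarrow> \<xi>' x \<in> carrier_mat ?n ?m"
    "\<And>x. x \<in> carrier KQ \<Longrightarrow> \<Phi> x = ?B x (\<xi>' x)" "\<And>x. x \<in> carrier KQ \<Longrightarrow> g * \<xi>' x = \<xi> x"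
    by metis
  have uniq: "\<xi>' x = L" if x: "x \<in> carrier KQ" and L: "L \<in> carrier_mat ?n ?m" "\<Phi> x = ?B x L" for x L
    by (rule four_block_mat_lower_cong[OF _ aM[OF x] zero_carrier_mat \<xi>'(1)[OF x] L(1) aN[OF x]])
      (use \<xi>'(2)[OF x] L(2) in simp)
  have "deriv M N \<xi>'"
    unfolding deriv_def
  proof (intro conjI ballI allI)
    fix x y c assume x: "x \<in> carrier KQ"
    show "\<xi>' x \<in> carrier_mat ?n ?m" by (rule \<xi>'(1)[OF x])
    show "\<xi>' (\<lambda>p. c * x p) = c \<cdot>\<^sub>m \<xi>' x"
    proof (rule uniq[OF smult_carrier[OF x]])
      show "\<Phi> (\<lambda>p. c * x p) = ?B (\<lambda>p. c * x p) (c \<cdot>\<^sub>m \<xi>' x)"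
        unfolding \<Phi>'(4)[OF x] \<xi>'(2)[OF x] M'(4)[OF x] N'(4)[OF x]
        using aM[OF x] aN[OF x] \<xi>'(1)[OF x] by (intro eq_matI) auto
    qed (use \<xi>'(1)[OF x] in simp)
    assume y: "y \<in> carrier KQ"
    show "\<xi>' (x + y) = \<xi>' x + \<xi>' y"
    proof (rule uniq[OF add_carrier[OF x y]])
      show "\<Phi> (x + y) = ?B (x + y) (\<xi>' x + \<xi>' y)"
        unfolding \<Phi>'(2)[OF x y] \<xi>'(2)[OF x] \<xi>'(2)[OF y] M'(2)[OF x y] N'(2)[OF x y]
        using aM[OF x] aN[OF x] \<xi>'(1)[OF x] aM[OF y] aN[OF y] \<xi>'(1)[OF y] by (intro eq_matI) auto
    qed (use \<xi>'(1)[OF x] \<xi>'(1)[OF y] in simp)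
    show "\<xi>' (x \<star> y) = \<xi>' x * act M y + act N x * \<xi>' y"
    proof (rule uniq[OF pmul_carrier[OF x y]])
      show "\<Phi> (x \<star> y) = ?B (x \<star> y) (\<xi>' x * act M y + act N x * \<xi>' y)"
        unfolding \<Phi>'(3)[OF x y] \<xi>'(2)[OF x] \<xi>'(2)[OF y]
        by (rule B_mult[OF x y \<xi>'(1)[OF x] \<xi>'(1)[OF y]])
    qed (use \<xi>'(1)[OF x] \<xi>'(1)[OF y] aM[OF y] aN[OF x] in auto)
  next
    fix x assume x: "x \<in> I"
    then have xc: "x \<in> carrier KQ" by (rule ideal_carrier)
    show "\<xi>' x = 0\<^sub>m ?n ?m"
    proof (rule uniq[OF xc z])
      show "\<Phi> x = ?B x (0\<^sub>m ?n ?m)"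
        unfolding \<Phi>'(6)[OF x] M'(6)[OF x] N'(6)[OF x] by (intro eq_matI) auto
    qed
  qed
  then show ?thesis using that \<xi>'(3) by blast
qed

text \<open>
  The average of a linear section over the vertices, \<open>\<Sum>\<^sub>v v s v\<close>, is still a section and commutes with
  the vertices.
\<close>

lemma vertex_section:
  assumes P: "fd_module A P" and M: "fd_module A M" and f: "f \<in> mod_hom A P M" "surjective_mat f"
  obtains s where "s \<in> carrier_mat (fst P) (fst M)" "f * s = 1\<^sub>m (fst M)"
    "\<And>v. v \<in> verts Q \<Longrightarrow> act P (vx v) * s = s * act M (vx v)"
proof -
  let ?p = "fst P" and ?m = "fst M" and ?V = "verts Q"
  have fc: "f \<in> carrier_mat ?m ?p" and fh: "\<And>x. x \<in> carrier KQ \<Longrightarrow> f * act P x = act M x * f"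
    using f(1) by (auto simp: mod_hom_iff)
  obtain s0 where s0: "s0 \<in> carrier_mat ?p ?m" "f * s0 = 1\<^sub>m ?m"
    using surjective_mat_right_inverse[OF f(2) fc] by blast
  let ?F = "\<lambda>v. act P (vx v) * s0 * act M (vx v)"
  define s where "s = msum ?p ?m ?V ?F"
  have aP: "act P (vx v) \<in> carrier_mat ?p ?p" and aM: "act M (vx v) \<in> carrier_mat ?m ?m"
    if "v \<in> ?V" for v using that P M by auto
  have Ps: "act P (vx v) * s0 \<in> carrier_mat ?p ?m" if "v \<in> ?V" for v
    by (rule mult_carrier_mat[OF aP[OF that] s0(1)])
  have F: "?F v \<in> carrier_mat ?p ?m" if "v \<in> ?V" for v using Ps[OF that] aM[OF that] by auto
  have PP: "act P (vx w) * act P (vx v) = (if w = v then act P (vx v) else 0\<^sub>m ?p ?p)"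
    if "v \<in> ?V" "w \<in> ?V" for v w
    using act_mult[OF P vx_carrier[OF that(2)] vx_carrier[OF that(1)]] qrep_zero[OF qrep_act[OF P]]
    by (auto simp: vx_mult)
  have MM: "act M (vx v) * act M (vx w) = (if v = w then act M (vx v) else 0\<^sub>m ?m ?m)"
    if "v \<in> ?V" "w \<in> ?V" for v w
    using act_mult[OF M vx_carrier[OF that(1)] vx_carrier[OF that(2)]] qrep_zero[OF qrep_act[OF M]]
    by (auto simp: vx_mult)
  have "f * s = msum ?m ?m ?V (\<lambda>v. f * ?F v)"
    unfolding s_def by (rule msum_mult_left[OF fc F])
  also have "\<dots> = msum ?m ?m ?V (\<lambda>v. act M (vx v))"
  proof (rule msum_cong)
    fix v assume v: "v \<in> ?V"
    have "f * ?F v = f * (act P (vx v) * s0) * act M (vx v)"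
      by (rule assoc_mult_mat[OF fc Ps[OF v] aM[OF v], symmetric])
    also have "f * (act P (vx v) * s0) = act M (vx v) * f * s0"
      unfolding fh[OF vx_carrier[OF v], symmetric] by (rule assoc_mult_mat[OF fc aP[OF v] s0(1), symmetric])
    also have "\<dots> = act M (vx v) * 1\<^sub>m ?m"
      unfolding s0(2)[symmetric] by (rule assoc_mult_mat[OF aM[OF v] fc s0(1)])
    also have "\<dots> * act M (vx v) = act M (vx v)" using aM[OF v] MM[OF v v] by simp
    finally show "f * ?F v = act M (vx v)" .
  qed
  also have "\<dots> = 1\<^sub>m ?m" by (rule qrep_sum_vertices[OF qrep_act[OF M]])
  finally have 1: "f * s = 1\<^sub>m ?m" .
  have 2: "act P (vx w) * s = s * act M (vx w)" if w: "w \<in> ?V" for w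
  proof -
    have PF: "act P (vx w) * ?F v = (if v = w then ?F w else 0\<^sub>m ?p ?m)" if v: "v \<in> ?V" for v
    proof -
      have "act P (vx w) * ?F v = act P (vx w) * (act P (vx v) * s0) * act M (vx v)"
        by (rule assoc_mult_mat[OF aP[OF w] Ps[OF v] aM[OF v], symmetric])
      also have "act P (vx w) * (act P (vx v) * s0) = act P (vx w) * act P (vx v) * s0"
        by (rule assoc_mult_mat[OF aP[OF w] aP[OF v] s0(1), symmetric])
      finally show ?thesis using PP[OF v w] s0(1) aM[OF v] by auto
    qed
    have FM: "?F v * act M (vx w) = (if v = w then ?F w else 0\<^sub>m ?p ?m)" if v: "v \<in> ?V" for v
      using assoc_mult_mat[OF Ps[OF v] aM[OF v] aM[OF w]] MM[OF v w] right_mult_zero_mat[OF Ps[OF v], of ?m]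
      by auto
    have "act P (vx w) * s = msum ?p ?m ?V (\<lambda>v. act P (vx w) * ?F v)"
      unfolding s_def by (rule msum_mult_left[OF aP[OF w] F])
    also have "\<dots> = msum ?p ?m ?V (\<lambda>v. ?F v * act M (vx w))"
      by (rule msum_cong) (simp add: PF FM)
    also have "\<dots> = s * act M (vx w)"
      unfolding s_def by (rule msum_mult_right[OF aM[OF w] F, symmetric])
    finally show ?thesis .
  qed
  show ?thesis by (rule that[OF _ 1 2]) (auto simp: s_def)
qed

text \<open>
  A homomorphism \<open>h\<close> from the kernel to \<open>N2\<close> gives an extension of \<open>M\<close> by \<open>N2\<close>, which lifts to an extension by \<open>N\<close>; the pullback
  of the latter to \<open>P\<close> splits, and the splitting, corrected by a homomorphism defined on \<open>P\<close>, restricts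
  to a lift of \<open>h\<close>.
\<close>

lemma projective_kernel_of_ideal_zero:
  assumes I0: "I = {0}" and P: "projective_module A P" and M: "fd_module A M"
    and f: "f \<in> mod_hom A P M" "surjective_mat f"
  obtains K \<iota> where "projective_module A K" "\<iota> \<in> mod_hom A K P" "mat_image \<iota> = mat_kernel f"
    "mat_kernel \<iota> = {0\<^sub>v (fst K)}"
proof -
  have Pm: "fd_module A P" using P by (simp add: projective_module_def)
  let ?p = "fst P" and ?m = "fst M"
  have fc: "f \<in> carrier_mat ?m ?p" and fh: "\<And>x. x \<in> carrier KQ \<Longrightarrow> f * act P x = act M x * f"
    using f(1) by (auto simp: mod_hom_iff)
  have aP: "act P x \<in> carrier_mat ?p ?p" and aM: "act M x \<in> carrier_mat ?m ?m" if "x \<in> carrier KQ" for x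
    using that Pm M by auto
  obtain s where s: "s \<in> carrier_mat ?p ?m" "f * s = 1\<^sub>m ?m"
    "\<And>v. v \<in> verts Q \<Longrightarrow> act P (vx v) * s = s * act M (vx v)"
    using vertex_section[OF Pm M f] by blast
  have sf: "s * f \<in> carrier_mat ?p ?p" by (rule mult_carrier_mat[OF s(1) fc])
  define e where "e = 1\<^sub>m ?p - s * f"
  have ec: "e \<in> carrier_mat ?p ?p" unfolding e_def by (rule minus_carrier_mat[OF sf])
  have fe: "f * e = 0\<^sub>m ?m ?p"
  proof -
    have "f * e = f * 1\<^sub>m ?p - f * (s * f)"
      unfolding e_def by (rule mult_minus_distrib_mat[OF fc one_carrier_mat sf])
    also have "f * (s * f) = f * s * f" by (rule assoc_mult_mat[OF fc s(1) fc, symmetric])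
    finally show ?thesis using fc s(2) by simp
  qed
  have ee: "e * e = e"
  proof -
    have "e * e = 1\<^sub>m ?p * e - s * f * e"
      unfolding e_def by (rule minus_mult_distrib_mat[OF one_carrier_mat sf ec[unfolded e_def]])
    also have "s * f * e = s * (f * e)" by (rule assoc_mult_mat[OF s(1) fc ec])
    also have "\<dots> = 0\<^sub>m ?p ?p" unfolding fe using s(1) by simp
    finally have "e * e = 1\<^sub>m ?p * e - 0\<^sub>m ?p ?p" .
    also have "\<dots> = e" using ec by (intro eq_matI) auto
    finally show ?thesis .
  qed
  obtain k \<iota> \<rho> where split: "\<iota> \<in> carrier_mat ?p k" "\<rho> \<in> carrier_mat k ?p" "\<rho> * \<iota> = 1\<^sub>m k" "\<iota> * \<rho> = e"
    using split_idempotent[OF ec ee] by blast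
  have decomp: "\<iota> * \<rho> + s * f = 1\<^sub>m ?p"
    unfolding split(4) e_def using carrier_matD[OF s(1)] carrier_matD[OF fc]
    by (intro eq_matI) auto
  have e\<iota>: "e * \<iota> = \<iota>"
    unfolding split(4)[symmetric] assoc_mult_mat[OF split(1,2,1)] split(3) by (rule right_mult_one_mat[OF split(1)])
  have f\<iota>: "f * \<iota> = 0\<^sub>m ?m k"
  proof -
    have "f * \<iota> = f * e * \<iota>" unfolding assoc_mult_mat[OF fc ec split(1)] e\<iota> ..
    then show ?thesis unfolding fe using split(1) by simp
  qed
  have \<rho>s: "\<rho> * s = 0\<^sub>m k ?m"
  proof -
    have es: "e * s = 0\<^sub>m ?p ?m"
    proof -
      have "e * s = 1\<^sub>m ?p * s - s * f * s"
        unfolding e_def by (rule minus_mult_distrib_mat[OF one_carrier_mat sf s(1)])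
      also have "s * f * s = s * (f * s)" by (rule assoc_mult_mat[OF s(1) fc s(1)])
      finally show ?thesis using s by simp
    qed
    have "\<rho> * s = \<rho> * \<iota> * \<rho> * s" using split by simp
    also have "\<rho> * \<iota> * \<rho> = \<rho> * e" unfolding split(4)[symmetric] by (rule assoc_mult_mat[OF split(2,1,2)])
    also have "\<dots> * s = \<rho> * (e * s)" by (rule assoc_mult_mat[OF split(2) ec s(1)])
    finally show ?thesis unfolding es using split(2) by simp
  qed
  \<comment> \<open>a map on \<open>P\<close> is determined by its parts on the kernel of \<open>f\<close> and on the image of \<open>s\<close>\<close>
  have insert: "X = X * \<iota> * \<rho> + X * s * f" if X: "X \<in> carrier_mat l ?p" for X l
  proof -
    have "X = X * (\<iota> * \<rho> + s * f)" unfolding decomp using X by simp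
    also have "\<dots> = X * (\<iota> * \<rho>) + X * (s * f)"
      by (rule mult_add_distrib_mat[OF X mult_carrier_mat[OF split(1,2)] sf])
    finally show ?thesis
      unfolding assoc_mult_mat[OF X split(1,2), symmetric] assoc_mult_mat[OF X s(1) fc, symmetric] .
  qed
  define \<Omega> where "\<Omega> x = \<rho> * act P x * \<iota>" for x
  have \<rho>P: "\<rho> * act P x \<in> carrier_mat k ?p" if "x \<in> carrier KQ" for x
    by (rule mult_carrier_mat[OF split(2) aP[OF that]])
  have \<Omega>c: "\<Omega> x \<in> carrier_mat k k" if "x \<in> carrier KQ" for x
    unfolding \<Omega>_def by (rule mult_carrier_mat[OF \<rho>P[OF that] split(1)])
  have \<iota>\<Omega>: "\<iota> * \<Omega> x = act P x * \<iota>" if x: "x \<in> carrier KQ" for x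
  proof -
    have Pi: "act P x * \<iota> \<in> carrier_mat ?p k" by (rule mult_carrier_mat[OF aP[OF x] split(1)])
    have "f * (act P x * \<iota>) = act M x * f * \<iota>"
      unfolding fh[OF x, symmetric] by (rule assoc_mult_mat[OF fc aP[OF x] split(1), symmetric])
    also have "\<dots> = act M x * (f * \<iota>)" by (rule assoc_mult_mat[OF aM[OF x] fc split(1)])
    also have "\<dots> = 0\<^sub>m ?m k" unfolding f\<iota> using aM[OF x] by simp
    finally have fPi: "f * (act P x * \<iota>) = 0\<^sub>m ?m k" .
    have "\<iota> * \<Omega> x = \<iota> * (\<rho> * (act P x * \<iota>))"
      unfolding \<Omega>_def assoc_mult_mat[OF split(2) aP[OF x] split(1)] ..
    also have "\<dots> = e * (act P x * \<iota>)"
      unfolding split(4)[symmetric] by (rule assoc_mult_mat[OF split(1,2) Pi, symmetric])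
    also have "\<dots> = 1\<^sub>m ?p * (act P x * \<iota>) - s * f * (act P x * \<iota>)"
      unfolding e_def by (rule minus_mult_distrib_mat[OF one_carrier_mat sf Pi])
    also have "s * f * (act P x * \<iota>) = s * (f * (act P x * \<iota>))" by (rule assoc_mult_mat[OF s(1) fc Pi])
    also have "\<dots> = 0\<^sub>m ?p k" unfolding fPi using s(1) by simp
    finally show ?thesis
      unfolding left_mult_one_mat[OF Pi] using carrier_matD[OF aP[OF x]] carrier_matD[OF split(1)]
      by (auto intro!: eq_matI)
  qed
  note P' = qrepD[OF qrep_act[OF Pm], simplified]
  have "qrep id k \<Omega>"
  proof (rule qrepI)
    fix x y c assume x: "x \<in> carrier KQ"
    show "\<Omega> x \<in> carrier_mat k k" by (rule \<Omega>c[OF x])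
    show "\<Omega> (\<lambda>p. c * x p) = id c \<cdot>\<^sub>m \<Omega> x"
      unfolding \<Omega>_def P'(4)[OF x] mult_smult_distrib[OF split(2) aP[OF x]]
        mult_smult_assoc_mat[OF \<rho>P[OF x] split(1)] by simp
    assume y: "y \<in> carrier KQ"
    show "\<Omega> (x + y) = \<Omega> x + \<Omega> y"
      unfolding \<Omega>_def P'(2)[OF x y] mult_add_distrib_mat[OF split(2) aP[OF x] aP[OF y]]
      by (rule add_mult_distrib_mat[OF \<rho>P[OF x] \<rho>P[OF y] split(1)])
    have "\<Omega> (x \<star> y) = \<rho> * (act P x * (act P y * \<iota>))"
      unfolding \<Omega>_def P'(3)[OF x y] assoc_mult_mat[OF split(2) mult_carrier_mat[OF aP[OF x] aP[OF y]] split(1)]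
        assoc_mult_mat[OF aP[OF x] aP[OF y] split(1)] ..
    also have "\<dots> = \<rho> * (act P x * (\<iota> * \<Omega> y))" unfolding \<iota>\<Omega>[OF y] ..
    also have "\<dots> = \<rho> * (act P x * \<iota> * \<Omega> y)"
      unfolding assoc_mult_mat[OF aP[OF x] split(1) \<Omega>c[OF y]] ..
    also have "\<dots> = \<rho> * (act P x * \<iota>) * \<Omega> y"
      by (rule assoc_mult_mat[OF split(2) mult_carrier_mat[OF aP[OF x] split(1)] \<Omega>c[OF y], symmetric])
    finally show "\<Omega> (x \<star> y) = \<Omega> x * \<Omega> y"
      unfolding \<Omega>_def assoc_mult_mat[OF split(2) aP[OF x] split(1)] .
  next
    show "\<Omega> \<one>\<^bsub>KQ\<^esub> = 1\<^sub>m k" unfolding \<Omega>_def P'(5) using split by simp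
    fix x assume x: "x \<in> I"
    show "\<Omega> x = 0\<^sub>m k k" unfolding \<Omega>_def P'(6)[OF x] using split by simp
  qed
  then obtain K where K: "fd_module A K" "fst K = k" "\<And>x. x \<in> carrier KQ \<Longrightarrow> act K x = \<Omega> x"
    using fd_module_of_qrep by blast
  have "projective_module A K"
    unfolding projective_module_def
  proof (intro conjI K(1) allI ballI impI)
    fix N N2 g h
    assume g: "g \<in> mod_hom A N N2" and h: "h \<in> mod_hom A K N2"
      and mods: "fd_module A N \<and> fd_module A N2 \<and> surjective_mat g"
    then have N: "fd_module A N" and N2: "fd_module A N2" and gs: "surjective_mat g" by auto
    let ?n = "fst N" and ?n2 = "fst N2"
    have gc: "g \<in> carrier_mat ?n2 ?n" and gh: "\<And>x. x \<in> carrier KQ \<Longrightarrow> g * act N x = act N2 x * g"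
      using g by (auto simp: mod_hom_iff)
    have hc: "h \<in> carrier_mat ?n2 k" and hh: "\<And>x. x \<in> carrier KQ \<Longrightarrow> h * \<Omega> x = act N2 x * h"
      using h K by (auto simp: mod_hom_iff)
    have aN: "act N x \<in> carrier_mat ?n ?n" and aN2: "act N2 x \<in> carrier_mat ?n2 ?n2" if "x \<in> carrier KQ" for x
      using that N N2 by auto
    let ?r = "h * \<rho>"
    have rc: "?r \<in> carrier_mat ?n2 ?p" by (rule mult_carrier_mat[OF hc split(2)])
    have r\<iota>: "?r * act P x * \<iota> = act N2 x * h" if x: "x \<in> carrier KQ" for x
    proof -
      have "?r * act P x * \<iota> = h * (\<rho> * act P x) * \<iota>"
        unfolding assoc_mult_mat[OF hc split(2) aP[OF x]] ..
      also have "\<dots> = h * \<Omega> x" unfolding \<Omega>_def by (rule assoc_mult_mat[OF hc \<rho>P[OF x] split(1)])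
      finally show ?thesis unfolding hh[OF x] .
    qed
    define \<xi> where "\<xi> x = ?r * act P x * s" for x
    have rP: "?r * act P x \<in> carrier_mat ?n2 ?p" if "x \<in> carrier KQ" for x
      by (rule mult_carrier_mat[OF rc aP[OF that]])
    have \<xi>c: "\<xi> x \<in> carrier_mat ?n2 ?m" if "x \<in> carrier KQ" for x
      unfolding \<xi>_def by (rule mult_carrier_mat[OF rP[OF that] s(1)])
    have rP_split: "?r * act P x = act N2 x * ?r + \<xi> x * f" if x: "x \<in> carrier KQ" for x
    proof -
      have "?r * act P x = ?r * act P x * \<iota> * \<rho> + ?r * act P x * s * f" by (rule insert[OF rP[OF x]])
      then show ?thesis
        unfolding r\<iota>[OF x] \<xi>_def[symmetric] assoc_mult_mat[OF aN2[OF x] hc split(2)] .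
    qed
    have \<xi>: "deriv M N2 \<xi>"
      unfolding deriv_def
    proof (intro conjI ballI allI)
      fix x y c assume x: "x \<in> carrier KQ"
      show "\<xi> x \<in> carrier_mat ?n2 ?m" by (rule \<xi>c[OF x])
      show "\<xi> (\<lambda>p. c * x p) = c \<cdot>\<^sub>m \<xi> x"
        unfolding \<xi>_def P'(4)[OF x] mult_smult_distrib[OF rc aP[OF x]] mult_smult_assoc_mat[OF rP[OF x] s(1)] ..
      assume y: "y \<in> carrier KQ"
      show "\<xi> (x + y) = \<xi> x + \<xi> y"
        unfolding \<xi>_def P'(2)[OF x y] mult_add_distrib_mat[OF rc aP[OF x] aP[OF y]]
        by (rule add_mult_distrib_mat[OF rP[OF x] rP[OF y] s(1)])
      have Ps: "act P y * s \<in> carrier_mat ?p ?m" by (rule mult_carrier_mat[OF aP[OF y] s(1)])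
      have "\<xi> (x \<star> y) = ?r * act P x * (act P y * s)"
        unfolding \<xi>_def P'(3)[OF x y] assoc_mult_mat[OF rc aP[OF x] aP[OF y], symmetric]
        by (rule assoc_mult_mat[OF rP[OF x] aP[OF y] s(1)])
      also have "\<dots> = act N2 x * ?r * (act P y * s) + \<xi> x * f * (act P y * s)"
        unfolding rP_split[OF x]
        by (rule add_mult_distrib_mat[OF mult_carrier_mat[OF aN2[OF x] rc] mult_carrier_mat[OF \<xi>c[OF x] fc] Ps])
      also have "act N2 x * ?r * (act P y * s) = act N2 x * (?r * (act P y * s))"
        by (rule assoc_mult_mat[OF aN2[OF x] rc Ps])
      also have "?r * (act P y * s) = \<xi> y"
        unfolding \<xi>_def by (rule assoc_mult_mat[OF rc aP[OF y] s(1), symmetric])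
      also have "\<xi> x * f * (act P y * s) = \<xi> x * (f * (act P y * s))"
        by (rule assoc_mult_mat[OF \<xi>c[OF x] fc Ps])
      also have "f * (act P y * s) = act M y * f * s"
        unfolding fh[OF y, symmetric] by (rule assoc_mult_mat[OF fc aP[OF y] s(1), symmetric])
      also have "\<dots> = act M y" unfolding assoc_mult_mat[OF aM[OF y] fc s(1)] s(2) using aM[OF y] by simp
      finally show "\<xi> (x \<star> y) = \<xi> x * act M y + act N2 x * \<xi> y"
        using comm_add_mat[OF mult_carrier_mat[OF aN2[OF x] \<xi>c[OF y]] mult_carrier_mat[OF \<xi>c[OF x] aM[OF y]]]
        by simp
    next
      fix x assume x: "x \<in> I"
      show "\<xi> x = 0\<^sub>m ?n2 ?m" unfolding \<xi>_def P'(6)[OF x]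
        using right_mult_zero_mat[OF rc, of ?p] left_mult_zero_mat[OF s(1), of ?n2] by simp
    qed
    have \<xi>v: "\<xi> (vx v) = 0\<^sub>m ?n2 ?m" if v: "v \<in> verts Q" for v
    proof -
      have vc: "vx v \<in> carrier KQ" using v by simp
      have "\<xi> (vx v) = ?r * (s * act M (vx v))"
        unfolding \<xi>_def s(3)[OF v, symmetric] by (rule assoc_mult_mat[OF rc aP[OF vc] s(1)])
      also have "\<dots> = ?r * s * act M (vx v)" by (rule assoc_mult_mat[OF rc s(1) aM[OF vc], symmetric])
      also have "?r * s = h * (\<rho> * s)" by (rule assoc_mult_mat[OF hc split(2) s(1)])
      also have "\<dots> = 0\<^sub>m ?n2 ?m" unfolding \<rho>s using hc by simp
      finally show ?thesis using aM[OF vc] by simp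
    qed
    obtain \<xi>' where \<xi>': "deriv M N \<xi>'" "\<And>x. x \<in> carrier KQ \<Longrightarrow> g * \<xi>' x = \<xi> x"
      using deriv_lift_of_ideal_zero[OF I0 M N N2 g gs \<xi> \<xi>v] by blast
    note \<xi>'c = derivD(1)[OF \<xi>'(1)]
    obtain k0 where k0: "k0 \<in> carrier_mat ?n ?p"
      "\<And>x. x \<in> carrier KQ \<Longrightarrow> k0 * act P x = act N x * k0 + \<xi>' x * f"
      using projective_deriv_inner[OF P N deriv_pullback[OF Pm M N \<xi>'(1) f(1)]] by blast
    define w where "w = g * k0 - ?r"
    have gk: "g * k0 \<in> carrier_mat ?n2 ?p" by (rule mult_carrier_mat[OF gc k0(1)])
    have wc: "w \<in> carrier_mat ?n2 ?p" unfolding w_def by (rule minus_carrier_mat[OF rc])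
    have "w \<in> mod_hom A P N2"
      unfolding mod_hom_iff
    proof (intro conjI ballI wc)
      fix x assume x: "x \<in> carrier KQ"
      have \<xi>f: "\<xi> x * f \<in> carrier_mat ?n2 ?p" by (rule mult_carrier_mat[OF \<xi>c[OF x] fc])
      have Ngk: "act N2 x * (g * k0) \<in> carrier_mat ?n2 ?p" by (rule mult_carrier_mat[OF aN2[OF x] gk])
      have Nr: "act N2 x * ?r \<in> carrier_mat ?n2 ?p" by (rule mult_carrier_mat[OF aN2[OF x] rc])
      have "g * k0 * act P x = g * (act N x * k0 + \<xi>' x * f)"
        unfolding k0(2)[OF x, symmetric] by (rule assoc_mult_mat[OF gc k0(1) aP[OF x]])
      also have "\<dots> = g * (act N x * k0) + g * (\<xi>' x * f)"
        by (rule mult_add_distrib_mat[OF gc mult_carrier_mat[OF aN[OF x] k0(1)] mult_carrier_mat[OF \<xi>'c[OF x] fc]])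
      also have "g * (act N x * k0) = act N2 x * g * k0"
        unfolding gh[OF x, symmetric] by (rule assoc_mult_mat[OF gc aN[OF x] k0(1), symmetric])
      also have "\<dots> = act N2 x * (g * k0)" by (rule assoc_mult_mat[OF aN2[OF x] gc k0(1)])
      also have "g * (\<xi>' x * f) = \<xi> x * f"
        unfolding \<xi>'(2)[OF x, symmetric] by (rule assoc_mult_mat[OF gc \<xi>'c[OF x] fc, symmetric])
      finally have 1: "g * k0 * act P x = act N2 x * (g * k0) + \<xi> x * f" .
      have "w * act P x = (act N2 x * (g * k0) + \<xi> x * f) - (act N2 x * ?r + \<xi> x * f)"
        unfolding w_def minus_mult_distrib_mat[OF gk rc aP[OF x]] 1 rP_split[OF x] ..
      also have "\<dots> = act N2 x * (g * k0) - act N2 x * ?r"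
        by (rule add_diff_cancel_mat[OF Ngk Nr \<xi>f])
      also have "\<dots> = act N2 x * w" unfolding w_def by (rule mult_minus_distrib_mat[OF aN2[OF x] gk rc, symmetric])
      finally show "w * act P x = act N2 x * w" .
    qed
    then obtain w' where w': "w' \<in> mod_hom A P N" "g * w' = w"
      using P N N2 gs g unfolding projective_module_def by blast
    have w'c: "w' \<in> carrier_mat ?n ?p" and w'h: "\<And>x. x \<in> carrier KQ \<Longrightarrow> w' * act P x = act N x * w'"
      using w'(1) by (auto simp: mod_hom_iff)
    let ?l = "k0 - w'"
    have lc: "?l \<in> carrier_mat ?n ?p" by (rule minus_carrier_mat[OF w'c])
    have l\<iota>: "?l * \<iota> \<in> carrier_mat ?n k" by (rule mult_carrier_mat[OF lc split(1)])
    have lP: "?l * act P x = act N x * ?l + \<xi>' x * f" if x: "x \<in> carrier KQ" for x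
    proof -
      have c: "act N x * k0 \<in> carrier_mat ?n ?p" "act N x * w' \<in> carrier_mat ?n ?p" "\<xi>' x * f \<in> carrier_mat ?n ?p"
        using aN[OF x] k0(1) w'c \<xi>'c[OF x] fc by auto
      have "?l * act P x = (act N x * k0 + \<xi>' x * f) - act N x * w'"
        unfolding minus_mult_distrib_mat[OF k0(1) w'c aP[OF x]] k0(2)[OF x] w'h[OF x] ..
      also have "\<dots> = (act N x * k0 - act N x * w') + \<xi>' x * f"
        by (rule add_diff_commute_mat[OF c(1,2,3)])
      finally show ?thesis unfolding mult_minus_distrib_mat[OF aN[OF x] k0(1) w'c] .
    qed
    show "\<exists>l \<in> mod_hom A K N. g * l = h"
    proof (rule bexI[of _ "?l * \<iota>"])
      have "g * (?l * \<iota>) = (g * k0 - w) * \<iota>"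
        unfolding assoc_mult_mat[OF gc lc split(1), symmetric] mult_minus_distrib_mat[OF gc k0(1) w'c] w'(2) ..
      also have "g * k0 - w = ?r" unfolding w_def by (rule diff_diff_mat[OF gk rc])
      also have "?r * \<iota> = h" unfolding assoc_mult_mat[OF hc split(2,1)] split(3) by (rule right_mult_one_mat[OF hc])
      finally show "g * (?l * \<iota>) = h" .
      show "?l * \<iota> \<in> mod_hom A K N"
        unfolding mod_hom_iff
      proof (intro conjI ballI)
        show "?l * \<iota> \<in> carrier_mat ?n (fst K)" using l\<iota> K(2) by simp
        fix x assume x: "x \<in> carrier KQ"
        have "?l * \<iota> * \<Omega> x = ?l * (act P x * \<iota>)"
          unfolding \<iota>\<Omega>[OF x, symmetric] by (rule assoc_mult_mat[OF lc split(1) \<Omega>c[OF x]])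
        also have "\<dots> = (act N x * ?l + \<xi>' x * f) * \<iota>"
          unfolding lP[OF x, symmetric] by (rule assoc_mult_mat[OF lc aP[OF x] split(1), symmetric])
        also have "\<dots> = act N x * ?l * \<iota> + \<xi>' x * f * \<iota>"
          by (rule add_mult_distrib_mat[OF mult_carrier_mat[OF aN[OF x] lc] mult_carrier_mat[OF \<xi>'c[OF x] fc] split(1)])
        also have "\<xi>' x * f * \<iota> = 0\<^sub>m ?n k"
          unfolding assoc_mult_mat[OF \<xi>'c[OF x] fc split(1)] f\<iota> using \<xi>'c[OF x] by simp
        also have "act N x * ?l * \<iota> = act N x * (?l * \<iota>)" by (rule assoc_mult_mat[OF aN[OF x] lc split(1)])
        finally show "?l * \<iota> * act K x = act N x * (?l * \<iota>)"
          unfolding K(3)[OF x] using mult_carrier_mat[OF aN[OF x] l\<iota>] by simp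
      qed
    qed
  qed
  moreover have "\<iota> \<in> mod_hom A K P"
    unfolding mod_hom_iff using split(1) K \<iota>\<Omega> by auto
  moreover have "mat_image \<iota> = mat_kernel f"
  proof (intro equalityI subsetI)
    fix v assume "v \<in> mat_image \<iota>"
    then obtain u where u: "u \<in> carrier_vec k" "v = \<iota> *\<^sub>v u" using split(1) by (auto simp: mat_image_def)
    have "f *\<^sub>v v = 0\<^sub>m ?m k *\<^sub>v u"
      unfolding u(2) f\<iota>[symmetric] by (rule assoc_mult_mat_vec[OF fc split(1) u(1), symmetric])
    also have "\<dots> = 0\<^sub>v ?m" using u(1) by (intro eq_vecI) auto
    finally show "v \<in> mat_kernel f" using fc u split(1) by (auto simp: mat_kernel_def)
  next
    fix v assume "v \<in> mat_kernel f"
    then have v: "v \<in> carrier_vec ?p" "f *\<^sub>v v = 0\<^sub>v ?m" using fc by (auto simp: mat_kernel_def)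
    have \<rho>v: "\<rho> *\<^sub>v v \<in> carrier_vec k" using split(2) v(1) by simp
    have "v = (\<iota> * \<rho> + s * f) *\<^sub>v v" unfolding decomp using v by simp
    also have "\<dots> = \<iota> * \<rho> *\<^sub>v v + s * f *\<^sub>v v"
      by (rule add_mult_distrib_mat_vec[OF mult_carrier_mat[OF split(1,2)] sf v(1)])
    also have "s * f *\<^sub>v v = s *\<^sub>v 0\<^sub>v ?m" unfolding v(2)[symmetric] by (rule assoc_mult_mat_vec[OF s(1) fc v(1)])
    also have "\<dots> = 0\<^sub>v ?p" using s(1) by (intro eq_vecI) auto
    also have "\<iota> * \<rho> *\<^sub>v v = \<iota> *\<^sub>v (\<rho> *\<^sub>v v)" by (rule assoc_mult_mat_vec[OF split(1,2) v(1)])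
    finally have "v = \<iota> *\<^sub>v (\<rho> *\<^sub>v v)" using split(1) \<rho>v by simp
    then show "v \<in> mat_image \<iota>" unfolding mat_image_def using \<rho>v split(1) by auto
  qed
  moreover have "mat_kernel \<iota> = {0\<^sub>v (fst K)}"
  proof (intro equalityI subsetI)
    fix v assume "v \<in> mat_kernel \<iota>"
    then have v: "v \<in> carrier_vec k" "\<iota> *\<^sub>v v = 0\<^sub>v ?p" using split(1) by (auto simp: mat_kernel_def)
    have "v = \<rho> * \<iota> *\<^sub>v v" unfolding split(3) using v by simp
    also have "\<dots> = \<rho> *\<^sub>v 0\<^sub>v ?p" unfolding v(2)[symmetric] by (rule assoc_mult_mat_vec[OF split(2,1) v(1)])
    also have "\<dots> = 0\<^sub>v k" using split(2) by (intro eq_vecI) auto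
    finally show "v \<in> {0\<^sub>v (fst K)}" using K(2) by simp
  next
    fix v :: "'k vec" assume "v \<in> {0\<^sub>v (fst K)}"
    then show "v \<in> mat_kernel \<iota>" using split(1) K(2) by (auto simp: mat_kernel_def intro!: eq_vecI)
  qed
  ultimately show ?thesis using that by blast
qed

theorem hereditary_of_ideal_zero:
  assumes I0: "I = {0}"
  shows "hereditary A"
  unfolding hereditary_def gl_dim_def
proof (rule Sup_least)
  fix z assume "z \<in> {proj_dim A M |M. fd_module A M}"
  then obtain M where M: "fd_module A M" and z: "z = proj_dim A M" by blast
  obtain n q coord where "quiver_basis Q I n q coord" by (rule quiver_basis_exists)
  then interpret quiver_basis Q I n q coord .
  obtain P f where P: "projective_module A P" "f \<in> mod_hom A P M" "surjective_mat f"
    using enough_projectives[OF M] by blast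
  obtain K \<iota> where K: "projective_module A K" "\<iota> \<in> mod_hom A K P" "mat_image \<iota> = mat_kernel f"
    "mat_kernel \<iota> = {0\<^sub>v (fst K)}"
    using projective_kernel_of_ideal_zero[OF I0 P(1) M P(2,3)] by blast
  have "projective_resolution A M 1 (\<lambda>i. if i = 0 then P else K) (\<lambda>i. if i = 0 then f else \<iota>)"
    unfolding projective_resolution_def using P K by auto
  then have "enat 1 \<in> {enat n | n. \<exists>P f. projective_resolution A M n P f}" by blast
  then have "proj_dim A M \<le> enat 1" unfolding proj_dim_def by (rule Inf_lower)
  then show "z \<le> 1" unfolding z one_enat_def by simp
qed

end

section \<open>Specialization of fractions\<close>

lemma comm_ring_hom_adj_mat:
  assumes h: "comm_ring_hom h" and A: "A \<in> carrier_mat n n"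
  shows "map_mat h (adj_mat A) = adj_mat (map_mat h A)"
proof -
  interpret h: comm_ring_hom h by (rule h)
  have "map_mat h (mat_delete A i j) = mat_delete (map_mat h A) i j" if "i < n" "j < n" for i j
    using that A by (intro eq_matI) (auto simp: mat_delete_def)
  then show ?thesis
    using A by (intro eq_matI) (auto simp: adj_mat_def cofactor_def h.hom_mult h.hom_power h.hom_uminus
      h.hom_det[symmetric])
qed

lemma comm_ring_hom_map_mat_mult:
  assumes h: "comm_ring_hom h" and "A \<in> carrier_mat m n" "B \<in> carrier_mat n k"
  shows "map_mat h (A * B) = map_mat h A * map_mat h B"
proof -
  interpret h: comm_ring_hom h by (rule h)
  show ?thesis using assms(2,3) by (rule h.mat_hom_mult)
qed

lemma spec_prod_cong:
  assumes P: "P \<in> spec_points S" and f: "\<And>i. i \<in> X \<Longrightarrow> f i - g i \<in> P"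
  shows "prod f X - prod g X \<in> P"
  using f
proof (induction X rule: infinite_finite_induct)
  case (insert x X)
  then have "f x - g x \<in> P" "prod f X - prod g X \<in> P" by auto
  then have "prod f X * (f x - g x) + g x * (prod f X - prod g X) \<in> P"
    by (intro spec_pointsD(3)[OF P] spec_pointsD(4)[OF P])
  moreover have "prod f X * (f x - g x) + g x * (prod f X - prod g X) = f x * prod f X - g x * prod g X"
    by (simp add: algebra_simps)
  ultimately show ?case using insert.hyps by simp
qed (use spec_pointsD(2)[OF P] in auto)

text \<open>
  By the Leibniz formula.
\<close>

lemma mcong_det:
  assumes P: "P \<in> spec_points S" and MN: "mcong P d M N"
  shows "det M - det N \<in> P"
proof -
  have c: "M \<in> carrier_mat d d" "N \<in> carrier_mat d d" using MN by (auto simp: mcong_def)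
  have "det M - det N = (\<Sum>p | p permutes {0..<d}.
      signof p * ((\<Prod>i = 0..<d. M $$ (i, p i)) - (\<Prod>i = 0..<d. N $$ (i, p i))))"
    unfolding det_def'[OF c(1)] det_def'[OF c(2)] by (simp add: sum_subtractf right_diff_distrib)
  also have "\<dots> \<in> P"
  proof (rule spec_point_sum[OF P])
    fix p assume "p \<in> {p. p permutes {0..<d}}"
    then have p: "p permutes {0..<d}" by simp
    have "p i < d" if "i < d" for i using permutes_in_image[OF p, of i] that by simp
    then show "signof p * ((\<Prod>i = 0..<d. M $$ (i, p i)) - (\<Prod>i = 0..<d. N $$ (i, p i))) \<in> P"
      using MN by (intro spec_pointsD(4)[OF P] spec_prod_cong[OF P]) (auto simp: mcong_def)
  qed
  finally show ?thesis .
qed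

text \<open>
  A partial specialization of a fraction field: \<open>y\<close> is a value modulo \<open>P\<close> of the fraction \<open>x\<close> if
  some representation of \<open>x\<close> has a denominator whose value is invertible at \<open>P\<close>.
\<close>

definition specializes ::
  "('b :: idom \<Rightarrow> 'r :: comm_ring_1) \<Rightarrow> 'r set \<Rightarrow> 'b fract \<Rightarrow> 'r \<Rightarrow> bool" where
  "specializes \<psi> P x y \<longleftrightarrow> (\<exists>a b. x = Fract a b \<and> b \<noteq> 0 \<and> \<psi> b \<notin> P \<and> \<psi> b * y - \<psi> a \<in> P)"

context
  fixes \<psi> :: "'b :: idom \<Rightarrow> 'r :: comm_ring_1" and P S :: "'r set"
  assumes \<psi>: "comm_ring_hom \<psi>" and P: "P \<in> spec_points S"
begin

interpretation \<psi>: comm_ring_hom \<psi> by (rule \<psi>)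

lemma specializes_add:
  assumes "specializes \<psi> P x y" "specializes \<psi> P x' y'"
  shows "specializes \<psi> P (x + x') (y + y')"
proof -
  obtain a b where 1: "x = Fract a b" "b \<noteq> 0" "\<psi> b \<notin> P" "\<psi> b * y - \<psi> a \<in> P"
    using assms(1) by (auto simp: specializes_def)
  obtain a' b' where 2: "x' = Fract a' b'" "b' \<noteq> 0" "\<psi> b' \<notin> P" "\<psi> b' * y' - \<psi> a' \<in> P"
    using assms(2) by (auto simp: specializes_def)
  have "\<psi> b' * (\<psi> b * y - \<psi> a) + \<psi> b * (\<psi> b' * y' - \<psi> a') \<in> P"
    using 1 2 by (intro spec_pointsD(3)[OF P] spec_pointsD(4)[OF P])
  moreover have "\<psi> b' * (\<psi> b * y - \<psi> a) + \<psi> b * (\<psi> b' * y' - \<psi> a')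
      = \<psi> (b * b') * (y + y') - \<psi> (a * b' + a' * b)"
    by (simp add: \<psi>.hom_mult \<psi>.hom_add algebra_simps)
  moreover have "\<psi> (b * b') \<notin> P" using 1(3) 2(3) spec_pointsD(5)[OF P] by (auto simp: \<psi>.hom_mult)
  ultimately show ?thesis
    unfolding specializes_def using 1(1,2) 2(1,2)
    by (intro exI[of _ "a * b' + a' * b"] exI[of _ "b * b'"]) simp
qed

lemma specializes_mult:
  assumes "specializes \<psi> P x y" "specializes \<psi> P x' y'"
  shows "specializes \<psi> P (x * x') (y * y')"
proof -
  obtain a b where 1: "x = Fract a b" "b \<noteq> 0" "\<psi> b \<notin> P" "\<psi> b * y - \<psi> a \<in> P"
    using assms(1) by (auto simp: specializes_def)
  obtain a' b' where 2: "x' = Fract a' b'" "b' \<noteq> 0" "\<psi> b' \<notin> P" "\<psi> b' * y' - \<psi> a' \<in> P"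
    using assms(2) by (auto simp: specializes_def)
  have "\<psi> b' * y' * (\<psi> b * y - \<psi> a) + \<psi> a * (\<psi> b' * y' - \<psi> a') \<in> P"
    using 1 2 by (intro spec_pointsD(3)[OF P] spec_pointsD(4)[OF P])
  moreover have "\<psi> b' * y' * (\<psi> b * y - \<psi> a) + \<psi> a * (\<psi> b' * y' - \<psi> a')
      = \<psi> (b * b') * (y * y') - \<psi> (a * a')"
    by (simp add: \<psi>.hom_mult algebra_simps)
  moreover have "\<psi> (b * b') \<notin> P" using 1(3) 2(3) spec_pointsD(5)[OF P] by (auto simp: \<psi>.hom_mult)
  ultimately show ?thesis
    unfolding specializes_def using 1(1,2) 2(1,2)
    by (intro exI[of _ "a * a'"] exI[of _ "b * b'"]) simp
qed

lemma specializes_const: "specializes \<psi> P (Fract a 1) (\<psi> a)"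
  unfolding specializes_def using spec_pointsD(2,6)[OF P] by (intro exI[of _ a] exI[of _ 1]) simp

lemma specializes_cong:
  assumes "specializes \<psi> P x y" "y' - y \<in> P"
  shows "specializes \<psi> P x y'"
proof -
  obtain a b where 1: "x = Fract a b" "b \<noteq> 0" "\<psi> b \<notin> P" "\<psi> b * y - \<psi> a \<in> P"
    using assms(1) by (auto simp: specializes_def)
  have "\<psi> b * (y' - y) + (\<psi> b * y - \<psi> a) \<in> P"
    using 1 assms(2) by (intro spec_pointsD(3)[OF P] spec_pointsD(4)[OF P])
  then have "\<psi> b * y' - \<psi> a \<in> P" by (simp add: algebra_simps)
  then show ?thesis unfolding specializes_def using 1 by blast
qed

lemma specializes_zero_in:
  assumes "specializes \<psi> P 0 y"
  shows "y \<in> P"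
proof -
  obtain a b where 1: "0 = Fract a b" "b \<noteq> 0" "\<psi> b \<notin> P" "\<psi> b * y - \<psi> a \<in> P"
    using assms by (auto simp: specializes_def)
  have "a = 0" using 1(1,2) by (simp add: Zero_fract_def eq_fract)
  then have "\<psi> b * y \<in> P" using 1(4) by simp
  from spec_pointsD(5)[OF P this] 1(3) show ?thesis by simp
qed

lemma specializes_zero: "y \<in> P \<Longrightarrow> specializes \<psi> P 0 y"
  using specializes_cong[OF specializes_const[of 0], of y] by (simp add: Zero_fract_def[symmetric])

lemma specializes_sum:
  "(\<And>i. i \<in> X \<Longrightarrow> specializes \<psi> P (f i) (g i)) \<Longrightarrow> specializes \<psi> P (sum f X) (sum g X)"
  by (induction X rule: infinite_finite_induct)
    (auto intro: specializes_add specializes_zero spec_pointsD(2)[OF P])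

definition mspecializes :: "nat \<Rightarrow> 'b fract mat \<Rightarrow> 'r mat \<Rightarrow> bool" where
  "mspecializes d X Y \<longleftrightarrow> X \<in> carrier_mat d d \<and> Y \<in> carrier_mat d d \<and>
     (\<forall>i<d. \<forall>j<d. specializes \<psi> P (X $$ (i, j)) (Y $$ (i, j)))"

lemma mspecializes_cong:
  assumes "mspecializes d X Y" "mcong P d Y' Y"
  shows "mspecializes d X Y'"
  unfolding mspecializes_def
proof (intro conjI allI impI)
  fix i j assume "i < d" "j < d"
  with assms have "specializes \<psi> P (X $$ (i, j)) (Y $$ (i, j))" "Y' $$ (i, j) - Y $$ (i, j) \<in> P"
    by (auto simp: mspecializes_def mcong_def)
  then show "specializes \<psi> P (X $$ (i, j)) (Y' $$ (i, j))" by (rule specializes_cong)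
qed (use assms in \<open>auto simp: mspecializes_def mcong_def\<close>)

lemma mspecializes_add:
  "mspecializes d X Y \<Longrightarrow> mspecializes d X' Y' \<Longrightarrow> mspecializes d (X + X') (Y + Y')"
  by (auto simp: mspecializes_def intro!: specializes_add)

lemma mspecializes_mult:
  assumes "mspecializes d X Y" "mspecializes d X' Y'"
  shows "mspecializes d (X * X') (Y * Y')"
proof -
  have c: "X \<in> carrier_mat d d" "X' \<in> carrier_mat d d" "Y \<in> carrier_mat d d" "Y' \<in> carrier_mat d d"
    using assms by (auto simp: mspecializes_def)
  have "specializes \<psi> P ((X * X') $$ (i, j)) ((Y * Y') $$ (i, j))" if ij: "i < d" "j < d" for i j
    unfolding mat_mult_index[OF c(1,2) ij] mat_mult_index[OF c(3,4) ij]
    using assms ij by (intro specializes_sum specializes_mult) (auto simp: mspecializes_def)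
  then show ?thesis unfolding mspecializes_def using c by auto
qed

lemma mspecializes_smult:
  assumes "specializes \<psi> P c c'" "mspecializes d X Y"
  shows "mspecializes d (c \<cdot>\<^sub>m X) (c' \<cdot>\<^sub>m Y)"
  using assms by (auto simp: mspecializes_def intro!: specializes_mult)

end

lemma comm_ring_hom_Fract: "comm_ring_hom (\<lambda>a :: 'b :: idom. Fract a 1)"
  by unfold_locales (simp_all add: Zero_fract_def One_fract_def)

lemma comm_ring_hom_single:
  "comm_ring_hom (\<lambda>c :: 'k :: field. Poly_Mapping.single (0 :: 'v \<Rightarrow>\<^sub>0 nat) c)"
  by unfold_locales (simp_all add: single_add mult_single)

lemma specializes_divide:
  assumes \<psi>: "comm_ring_hom \<psi>" and P: "P \<in> spec_points S"
    and xy: "specializes \<psi> P x y" and \<delta>: "\<delta> \<noteq> 0" "\<psi> \<delta> \<notin> P" and z: "\<psi> \<delta> * z - y \<in> P"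
  shows "specializes \<psi> P (Fract 1 \<delta> * x) z"
proof -
  interpret \<psi>: comm_ring_hom \<psi> by (rule \<psi>)
  obtain a b where 1: "x = Fract a b" "b \<noteq> 0" "\<psi> b \<notin> P" "\<psi> b * y - \<psi> a \<in> P"
    using xy by (auto simp: specializes_def)
  have "\<psi> b * (\<psi> \<delta> * z - y) + (\<psi> b * y - \<psi> a) \<in> P"
    using 1 z by (intro spec_pointsD(3)[OF P] spec_pointsD(4)[OF P])
  moreover have "\<psi> b * (\<psi> \<delta> * z - y) + (\<psi> b * y - \<psi> a) = \<psi> (\<delta> * b) * z - \<psi> a"
    by (simp add: \<psi>.hom_mult algebra_simps)
  moreover have "\<psi> (\<delta> * b) \<notin> P" using 1(3) \<delta>(2) spec_pointsD(5)[OF P] by (auto simp: \<psi>.hom_mult)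
  ultimately show ?thesis
    unfolding specializes_def using 1(1,2) \<delta>(1) by (intro exI[of _ a] exI[of _ "\<delta> * b"]) simp
qed

lemma mspecializes_divide:
  assumes \<psi>: "comm_ring_hom \<psi>" and P: "P \<in> spec_points S"
    and XY: "mspecializes \<psi> P d X Y" and \<delta>: "\<delta> \<noteq> 0" "\<psi> \<delta> \<notin> P"
    and Z: "Z \<in> carrier_mat d d" "mcong P d (\<psi> \<delta> \<cdot>\<^sub>m Z) Y"
  shows "mspecializes \<psi> P d (Fract 1 \<delta> \<cdot>\<^sub>m X) Z"
  unfolding mspecializes_def[OF \<psi> P]
proof (intro conjI allI impI)
  show "Fract 1 \<delta> \<cdot>\<^sub>m X \<in> carrier_mat d d" using XY by (auto simp: mspecializes_def[OF \<psi> P])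
  fix i j assume ij: "i < d" "j < d"
  have X: "X \<in> carrier_mat d d" "specializes \<psi> P (X $$ (i, j)) (Y $$ (i, j))"
    using XY ij by (auto simp: mspecializes_def[OF \<psi> P])
  have "\<psi> \<delta> * Z $$ (i, j) - Y $$ (i, j) \<in> P" using Z ij by (auto simp: mcong_def)
  then have "specializes \<psi> P (Fract 1 \<delta> * X $$ (i, j)) (Z $$ (i, j))"
    by (rule specializes_divide[OF \<psi> P X(2) \<delta>])
  then show "specializes \<psi> P ((Fract 1 \<delta> \<cdot>\<^sub>m X) $$ (i, j)) (Z $$ (i, j))" using X(1) ij by simp
qed (rule Z)

lemma mspecializes_map:
  assumes \<psi>: "comm_ring_hom \<psi>" and P: "P \<in> spec_points S" and X: "X \<in> carrier_mat d d"
  shows "mspecializes \<psi> P d (map_mat (\<lambda>a. Fract a 1) X) (map_mat \<psi> X)"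
  unfolding mspecializes_def[OF \<psi> P] using X by (auto intro: specializes_const[OF \<psi> P])

section \<open>Dimension vectors and the module scheme of a path algebra\<close>

context quiver_ideal
begin

text \<open>
  A dimension vector is encoded by a map \<open>\<sigma>\<close> that assigns a vertex to each of the \<open>d\<close> standard basis
  vectors.
\<close>

definition vertex_proj :: "nat \<Rightarrow> (nat \<Rightarrow> 'v) \<Rightarrow> 'v \<Rightarrow> 't :: comm_ring_1 mat" where
  "vertex_proj d \<sigma> v = mat d d (\<lambda>(i, j). if i = j \<and> \<sigma> i = v then 1 else 0)"

lemma vertex_proj_carrier [simp]: "vertex_proj d \<sigma> v \<in> carrier_mat d d"
  by (simp add: vertex_proj_def)

lemma vertex_proj_mult_left:
  assumes "X \<in> carrier_mat d d" "i < d" "j < d"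
  shows "(vertex_proj d \<sigma> v * X) $$ (i, j) = (if \<sigma> i = v then X $$ (i, j) else 0)"
proof -
  have "(vertex_proj d \<sigma> v * X) $$ (i, j) = (\<Sum>k<d. if k = i then (if \<sigma> i = v then X $$ (i, j) else 0) else 0)"
    unfolding mat_mult_index[OF vertex_proj_carrier assms] using assms
    by (intro sum.cong) (auto simp: vertex_proj_def)
  then show ?thesis using assms by simp
qed

lemma vertex_proj_mult_right:
  assumes "X \<in> carrier_mat d d" "i < d" "j < d"
  shows "(X * vertex_proj d \<sigma> v) $$ (i, j) = (if \<sigma> j = v then X $$ (i, j) else 0)"
proof -
  have "(X * vertex_proj d \<sigma> v) $$ (i, j) = (\<Sum>k<d. if k = j then (if \<sigma> j = v then X $$ (i, j) else 0) else 0)"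
    unfolding mat_mult_index[OF assms(1) vertex_proj_carrier assms(2,3)] using assms
    by (intro sum.cong) (auto simp: vertex_proj_def)
  then show ?thesis using assms by simp
qed

lemma qrep_conjugate:
  fixes G H :: "'t :: comm_ring_1 mat"
  assumes I0: "I = {0}" and h: "comm_ring_hom h"
    and G: "G \<in> carrier_mat d d" and H: "H \<in> carrier_mat d d" "G * H = 1\<^sub>m d" "H * G = 1\<^sub>m d"
    and \<sigma>: "\<And>i. i < d \<Longrightarrow> \<sigma> i \<in> verts Q"
    and m: "\<And>a. a \<in> arcs Q \<Longrightarrow> m a \<in> carrier_mat d d"
    and supp: "\<And>a i j. a \<in> arcs Q \<Longrightarrow> i < d \<Longrightarrow> j < d \<Longrightarrow> m a $$ (i, j) \<noteq> 0 \<Longrightarrow> \<sigma> i = head Q a \<and> \<sigma> j = tail Q a"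
  obtains \<Phi> where "qrep h d \<Phi>" "\<And>v. v \<in> verts Q \<Longrightarrow> \<Phi> (vx v) = G * vertex_proj d \<sigma> v * H"
    "\<And>a. a \<in> arcs Q \<Longrightarrow> \<Phi> (ar a) = G * m a * H"
proof -
  have conj: "(G * X * H) * (G * Y * H) = G * (X * Y) * H"
    if X: "X \<in> carrier_mat d d" and Y: "Y \<in> carrier_mat d d" for X Y
  proof -
    have GX: "G * X \<in> carrier_mat d d" and GY: "G * Y \<in> carrier_mat d d" and YH: "Y * H \<in> carrier_mat d d"
      using G X Y H by auto
    have "(G * X * H) * (G * Y * H) = G * X * (H * (G * Y * H))"
      using assoc_mult_mat[OF GX H(1), of "G * Y * H" d] GY H(1) by simp
    also have "H * (G * Y * H) = H * G * (Y * H)"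
      using assoc_mult_mat[OF G Y H(1)] assoc_mult_mat[OF H(1) G YH] by simp
    also have "\<dots> = Y * H" unfolding H(3) by (rule left_mult_one_mat[OF YH])
    also have "G * X * (Y * H) = G * X * Y * H" using assoc_mult_mat[OF GX Y H(1)] by simp
    also have "G * X * Y = G * (X * Y)" by (rule assoc_mult_mat[OF G X Y])
    finally show ?thesis .
  qed
  have conjc: "G * X * H \<in> carrier_mat d d" if "X \<in> carrier_mat d d" for X using G H that by auto
  have zero: "G * 0\<^sub>m d d * H = 0\<^sub>m d d" using G H by simp
  show ?thesis
  proof (rule qrep_of_arrows[OF I0 h, where e = "\<lambda>v. G * vertex_proj d \<sigma> v * H" and m = "\<lambda>a. G * m a * H" and d = d])
    fix v w assume "v \<in> verts Q" "w \<in> verts Q"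
    have "vertex_proj d \<sigma> v * vertex_proj d \<sigma> w = (if v = w then vertex_proj d \<sigma> v else (0\<^sub>m d d :: 't mat))"
    proof (rule eq_matI)
      fix i j assume "i < dim_row (if v = w then vertex_proj d \<sigma> v else (0\<^sub>m d d :: 't mat))"
        "j < dim_col (if v = w then vertex_proj d \<sigma> v else (0\<^sub>m d d :: 't mat))"
      then have "i < d" "j < d" by (auto simp: vertex_proj_def split: if_splits)
      then show "(vertex_proj d \<sigma> v * vertex_proj d \<sigma> w) $$ (i, j)
          = (if v = w then vertex_proj d \<sigma> v else (0\<^sub>m d d :: 't mat)) $$ (i, j)"
        by (simp add: vertex_proj_mult_left[OF vertex_proj_carrier] del: index_mult_mat) (auto simp: vertex_proj_def)
    qed (auto simp: vertex_proj_def)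
    then show "G * vertex_proj d \<sigma> v * H * (G * vertex_proj d \<sigma> w * H)
        = (if v = w then G * vertex_proj d \<sigma> v * H else 0\<^sub>m d d)"
      unfolding conj[OF vertex_proj_carrier vertex_proj_carrier] using zero by simp
  next
    have "msum d d (verts Q) (\<lambda>v. G * vertex_proj d \<sigma> v * H) = msum d d (verts Q) (\<lambda>v. G * vertex_proj d \<sigma> v) * H"
      by (rule msum_mult_right[OF H(1), symmetric]) (use G in auto)
    also have "msum d d (verts Q) (\<lambda>v. G * vertex_proj d \<sigma> v) = G * msum d d (verts Q) (vertex_proj d \<sigma>)"
      by (rule msum_mult_left[OF G, symmetric]) auto
    also have "msum d d (verts Q) (vertex_proj d \<sigma>) = (1\<^sub>m d :: 't mat)"
    proof (rule eq_matI)
      fix i j assume "i < dim_row (1\<^sub>m d :: 't mat)" "j < dim_col (1\<^sub>m d :: 't mat)"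
      then have ij: "i < d" "j < d" by auto
      have "(\<Sum>v\<in>verts Q. vertex_proj d \<sigma> v $$ (i, j)) = (\<Sum>v\<in>verts Q. if v = \<sigma> i then (if i = j then 1 else (0 :: 't)) else 0)"
        by (intro sum.cong) (use ij in \<open>auto simp: vertex_proj_def\<close>)
      then show "msum d d (verts Q) (vertex_proj d \<sigma>) $$ (i, j) = (1\<^sub>m d :: 't mat) $$ (i, j)"
        using ij \<sigma>[OF ij(1)] by (simp add: msum_def)
    qed (auto simp: msum_def)
    finally show "msum d d (verts Q) (\<lambda>v. G * vertex_proj d \<sigma> v * H) = 1\<^sub>m d" using G H by simp
  next
    fix a assume a: "a \<in> arcs Q"
    have "vertex_proj d \<sigma> (head Q a) * m a = m a"
      using m[OF a] by (intro eq_matI)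
        (auto simp: vertex_proj_mult_left[OF m[OF a]] carrier_matD[OF vertex_proj_carrier] simp del: index_mult_mat(1)
          dest: supp[OF a])
    then show "G * vertex_proj d \<sigma> (head Q a) * H * (G * m a * H) = G * m a * H"
      unfolding conj[OF vertex_proj_carrier m[OF a]] by simp
    have "m a * vertex_proj d \<sigma> (tail Q a) = m a"
      using m[OF a] by (intro eq_matI)
        (auto simp: vertex_proj_mult_right[OF m[OF a]] carrier_matD[OF vertex_proj_carrier] simp del: index_mult_mat(1)
          dest: supp[OF a])
    then show "G * m a * H * (G * vertex_proj d \<sigma> (tail Q a) * H) = G * m a * H"
      unfolding conj[OF m[OF a] vertex_proj_carrier] by simp
  qed (use conjc m that in auto)
qed

text \<open>
  A matrix \<open>g\<close> over the coordinate ring is adapted to \<open>\<sigma>\<close> if its columns lie in the images of the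
  generic idempotents prescribed by \<open>\<sigma>\<close>.  Where \<open>det g\<close> is invertible, \<open>g\<close> is a change of basis to a
  representation of the quiver in standard form.
\<close>

definition adapted ::
  "nat \<Rightarrow> (nat \<Rightarrow> 'v) \<Rightarrow> ('k, (('v, 'e) qpath \<Rightarrow> 'k) set) mod_poly mat \<Rightarrow> bool" where
  "adapted d \<sigma> g \<longleftrightarrow> g \<in> carrier_mat d d \<and>
     (\<forall>P\<in>spec_points (mod_equations A d). \<forall>v\<in>verts Q. mcong P d (gen d (vx v) * g) (g * vertex_proj d \<sigma> v))"

definition stratum ::
  "nat \<Rightarrow> (nat \<Rightarrow> 'v) \<Rightarrow> ('k, (('v, 'e) qpath \<Rightarrow> 'k) set) mod_poly set set" where
  "stratum d \<sigma> = {P \<in> spec_points (mod_equations A d). \<exists>g. adapted d \<sigma> g \<and> det g \<notin> P}"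

lemma openin_stratum: "openin (mod_scheme A d) (stratum d \<sigma>)"
proof -
  have "stratum d \<sigma> = {P \<in> spec_points (mod_equations A d). \<not> {det g | g. adapted d \<sigma> g} \<subseteq> P}"
    unfolding stratum_def by blast
  then show ?thesis unfolding mod_scheme_def openin_spec_topology by blast
qed

text \<open>
  The sum of the generic idempotents is congruent to \<open>1\<close>.  Hence some term in the expansion of its
  determinant by columns is not in \<open>P\<close>; the columns of this term form an adapted matrix.
\<close>

lemma strata_cover:
  assumes P: "P \<in> spec_points (mod_equations A d)"
  obtains \<sigma> where "\<sigma> \<in> {..<d} \<rightarrow>\<^sub>E verts Q" "P \<in> stratum d \<sigma>"
proof -
  define g where "g \<sigma> = mat d d (\<lambda>(i, j). gen d (vx (\<sigma> j)) $$ (i, j))" for \<sigma> :: "nat \<Rightarrow> 'v"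
  have gc: "g \<sigma> \<in> carrier_mat d d" for \<sigma> by (simp add: g_def)
  have ad: "adapted d \<sigma> (g \<sigma>)" if \<sigma>: "\<sigma> \<in> {..<d} \<rightarrow>\<^sub>E verts Q" for \<sigma>
    unfolding adapted_def
  proof (intro conjI ballI gc)
    fix P' v assume P': "P' \<in> spec_points (mod_equations A d)" and v: "v \<in> verts Q"
    show "mcong P' d (gen d (vx v) * g \<sigma>) (g \<sigma> * vertex_proj d \<sigma> v)"
      unfolding mcong_def
    proof (intro conjI allI impI)
      fix i j assume ij: "i < d" "j < d"
      have \<sigma>j: "\<sigma> j \<in> verts Q" using \<sigma> ij by auto
      have "(gen d (vx v) * g \<sigma>) $$ (i, j) = (\<Sum>k<d. gen d (vx v) $$ (i, k) * gen d (vx (\<sigma> j)) $$ (k, j))"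
        unfolding mat_mult_index[OF gen_carrier gc ij] using ij by (intro sum.cong) (auto simp: g_def)
      also have "\<dots> = (gen d (vx v) * gen d (vx (\<sigma> j))) $$ (i, j)"
        by (rule mat_mult_index[OF gen_carrier gen_carrier ij, symmetric])
      finally have 1: "(gen d (vx v) * g \<sigma>) $$ (i, j) = (gen d (vx v) * gen d (vx (\<sigma> j))) $$ (i, j)" .
      have 2: "(g \<sigma> * vertex_proj d \<sigma> v) $$ (i, j) = (if \<sigma> j = v then gen d (vx (\<sigma> j)) $$ (i, j) else 0)"
        unfolding vertex_proj_mult_right[OF gc ij] using ij by (simp add: g_def)
      have 3: "(gen d (vx v) * gen d (vx (\<sigma> j))) $$ (i, j) - gen d (vx v \<star> vx (\<sigma> j)) $$ (i, j) \<in> P'"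
        using mcong_sym[OF P' gen_mult[OF P' vx_carrier[OF v] vx_carrier[OF \<sigma>j]]] ij by (auto simp: mcong_def)
      show "(gen d (vx v) * g \<sigma>) $$ (i, j) - (g \<sigma> * vertex_proj d \<sigma> v) $$ (i, j) \<in> P'"
      proof (cases "\<sigma> j = v")
        case True
        then show ?thesis unfolding 1 2 using 3 by (simp add: vx_mult)
      next
        case False
        have "gen d (vx v \<star> vx (\<sigma> j)) $$ (i, j) \<in> P'"
          using gen_ideal[OF P' ideal_zero] False ij by (auto simp: vx_mult mcong_def)
        from spec_pointsD(3)[OF P' 3 this] show ?thesis unfolding 1 2 using False by simp
      qed
    qed (rule mult_carrier_mat[OF gen_carrier gc] mult_carrier_mat[OF gc vertex_proj_carrier])+
  qed
  define s where "s = mat d d (\<lambda>(i, j). \<Sum>v\<in>verts Q. gen d (vx v) $$ (i, j))"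
  have sc: "s \<in> carrier_mat d d" by (simp add: s_def)
  have "mcong P d s (1\<^sub>m d)"
  proof -
    have "mcong P d (gen d \<one>\<^bsub>KQ\<^esub>) s"
      unfolding mcong_def
    proof (intro conjI allI impI gen_carrier sc)
      fix i j assume ij: "i < d" "j < d"
      show "gen d \<one>\<^bsub>KQ\<^esub> $$ (i, j) - s $$ (i, j) \<in> P"
        unfolding one_eq_sum_vx using spec_gen_sum[OF P _ ij, of "verts Q" vx] ij by (simp add: s_def)
    qed
    from mcong_trans[OF P mcong_sym[OF P this] gen_one[OF P]] show ?thesis .
  qed
  then have "det s - 1 \<in> P" using mcong_det[OF P, of d s "1\<^sub>m d"] by simp
  have "det s \<notin> P"
  proof
    assume "det s \<in> P"
    then have "det s + - (det s - 1) \<in> P"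
      by (intro spec_pointsD(3)[OF P] spec_point_uminus[OF P] \<open>det s - 1 \<in> P\<close>)
    then show False using spec_pointsD(6)[OF P] by simp
  qed
  moreover have "det s = (\<Sum>\<sigma>\<in>{..<d} \<rightarrow>\<^sub>E verts Q. det (g \<sigma>))"
    unfolding s_def g_def by (rule det_sum_columns) simp
  ultimately obtain \<sigma> where "\<sigma> \<in> {..<d} \<rightarrow>\<^sub>E verts Q" "det (g \<sigma>) \<notin> P"
    using spec_point_sum[OF P] by metis
  then show ?thesis using that ad P unfolding stratum_def by blast
qed

text \<open>
  The congruence \<open>v g \<equiv> g v\<^sub>\<sigma>\<close>, where \<open>v\<^sub>\<sigma>\<close> is the projection for \<open>v\<close>, is multiplied by the adjugate of \<open>g\<close> on
  one side and on both sides; in the latter case a factor \<open>det g\<close> cancels.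
\<close>

lemma adapted_conjugate:
  assumes P: "P \<in> spec_points (mod_equations A d)" and g: "adapted d \<sigma> g" and v: "v \<in> verts Q"
  shows "mcong P d (det g \<cdot>\<^sub>m gen d (vx v)) (g * vertex_proj d \<sigma> v * adj_mat g)"
    and "det g \<notin> P \<Longrightarrow> mcong P d (adj_mat g * gen d (vx v)) (vertex_proj d \<sigma> v * adj_mat g)"
proof -
  let ?X = "gen d (vx v)" and ?E = "vertex_proj d \<sigma> v" and ?a = "adj_mat g"
  have gc: "g \<in> carrier_mat d d" and c1: "mcong P d (?X * g) (g * ?E)"
    using g P v by (auto simp: adapted_def)
  note a = adj_mat[OF gc]
  have ga: "?X * g * ?a = det g \<cdot>\<^sub>m ?X"
    unfolding assoc_mult_mat[OF gen_carrier gc a(1)] a(2) by (simp add: mult_smult_distrib[OF gen_carrier one_carrier_mat] right_mult_one_mat[OF gen_carrier])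
  show A: "mcong P d (det g \<cdot>\<^sub>m ?X) (g * ?E * ?a)"
    using mcong_mult[OF P c1 mcong_refl[OF P a(1)]] unfolding ga .
  assume nP: "det g \<notin> P"
  have Ea: "?E * ?a \<in> carrier_mat d d" by (rule mult_carrier_mat[OF vertex_proj_carrier a(1)])
  have "?a * (det g \<cdot>\<^sub>m ?X) = det g \<cdot>\<^sub>m (?a * ?X)" by (rule mult_smult_distrib[OF a(1) gen_carrier])
  moreover have "?a * (g * ?E * ?a) = det g \<cdot>\<^sub>m (?E * ?a)"
  proof -
    have "?a * (g * ?E * ?a) = ?a * (g * (?E * ?a))"
      unfolding assoc_mult_mat[OF gc vertex_proj_carrier a(1)] ..
    also have "\<dots> = ?a * g * (?E * ?a)" by (rule assoc_mult_mat[OF a(1) gc Ea, symmetric])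
    also have "\<dots> = det g \<cdot>\<^sub>m (?E * ?a)"
      unfolding a(3) mult_smult_assoc_mat[OF one_carrier_mat Ea] left_mult_one_mat[OF Ea] ..
    finally show ?thesis .
  qed
  ultimately have "mcong P d (det g \<cdot>\<^sub>m (?a * ?X)) (det g \<cdot>\<^sub>m (?E * ?a))"
    using mcong_mult[OF P mcong_refl[OF P a(1)] A] by simp
  then show "mcong P d (?a * ?X) (?E * ?a)"
    by (rule mcong_cancel[OF P _ nP mult_carrier_mat[OF a(1) gen_carrier] Ea])
qed

text \<open>
  An arrow is unchanged by multiplication with the vertices at its ends, and in the basis given by an
  adapted matrix these act by the projections.
\<close>

lemma adapted_arrow_entry:
  assumes P: "P \<in> spec_points (mod_equations A d)" and g: "adapted d \<sigma> g" "det g \<notin> P"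
    and a: "a \<in> arcs Q" and ij: "i < d" "j < d" "\<not> (\<sigma> i = head Q a \<and> \<sigma> j = tail Q a)"
  shows "(adj_mat g * gen d (ar a) * g) $$ (i, j) \<in> P"
proof -
  let ?X = "gen d (ar a)" and ?h = "vx (head Q a)" and ?t = "vx (tail Q a)" and ?a = "adj_mat g"
  let ?N = "?a * ?X * g"
  have gc: "g \<in> carrier_mat d d" using g by (auto simp: adapted_def)
  note adj = adj_mat[OF gc]
  have h: "?h \<in> carrier KQ" "head Q a \<in> verts Q" and t: "?t \<in> carrier KQ" "tail Q a \<in> verts Q"
    and ac: "ar a \<in> carrier KQ" using a by auto
  have aX: "?a * ?X \<in> carrier_mat d d" by (rule mult_carrier_mat[OF adj(1) gen_carrier])
  have Nc: "?N \<in> carrier_mat d d" by (rule mult_carrier_mat[OF aX gc])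
  have 1: "mcong P d ?N (vertex_proj d \<sigma> (head Q a) * ?N)"
  proof -
    have "mcong P d ?X (gen d ?h * ?X)" using gen_mult[OF P h(1) ac] a by (simp add: vx_head_ar)
    then have "mcong P d (?a * ?X) (?a * (gen d ?h * ?X))" by (rule mcong_mult[OF P mcong_refl[OF P adj(1)]])
    also have "?a * (gen d ?h * ?X) = ?a * gen d ?h * ?X"
      by (rule assoc_mult_mat[OF adj(1) gen_carrier gen_carrier, symmetric])
    also have "mcong P d (?a * gen d ?h * ?X) (vertex_proj d \<sigma> (head Q a) * ?a * ?X)"
      by (rule mcong_mult[OF P adapted_conjugate(2)[OF P g(1) h(2) g(2)] mcong_refl[OF P gen_carrier]])
    finally (mcong_trans[OF P]) have "mcong P d (?a * ?X) (vertex_proj d \<sigma> (head Q a) * ?a * ?X)" .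
    from mcong_mult[OF P this mcong_refl[OF P gc]]
    show ?thesis
      unfolding assoc_mult_mat[OF vertex_proj_carrier adj(1) gen_carrier]
        assoc_mult_mat[OF vertex_proj_carrier aX gc] .
  qed
  have 2: "mcong P d ?N (?N * vertex_proj d \<sigma> (tail Q a))"
  proof -
    have "mcong P d ?X (?X * gen d ?t)" using gen_mult[OF P ac t(1)] a by (simp add: ar_vx_tail)
    then have "mcong P d (?X * g) (?X * gen d ?t * g)" by (rule mcong_mult[OF P _ mcong_refl[OF P gc]])
    also have "?X * gen d ?t * g = ?X * (gen d ?t * g)" by (rule assoc_mult_mat[OF gen_carrier gen_carrier gc])
    also have "mcong P d (?X * (gen d ?t * g)) (?X * (g * vertex_proj d \<sigma> (tail Q a)))"
      using g(1) P t by (intro mcong_mult[OF P mcong_refl[OF P gen_carrier]]) (auto simp: adapted_def)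
    finally (mcong_trans[OF P]) have "mcong P d (?X * g) (?X * (g * vertex_proj d \<sigma> (tail Q a)))" .
    from mcong_mult[OF P mcong_refl[OF P adj(1)] this]
    show ?thesis
      unfolding assoc_mult_mat[OF adj(1) gen_carrier gc]
        assoc_mult_mat[OF adj(1) mult_carrier_mat[OF gen_carrier gc] vertex_proj_carrier]
        assoc_mult_mat[OF gen_carrier gc vertex_proj_carrier, symmetric]
      by (simp add: assoc_mult_mat[OF gen_carrier gc vertex_proj_carrier])
  qed
  show ?thesis
  proof (cases "\<sigma> i = head Q a")
    case False
    have "?N $$ (i, j) - (vertex_proj d \<sigma> (head Q a) * ?N) $$ (i, j) \<in> P"
      using 1 ij by (simp add: mcong_def del: index_mult_mat)
    then show ?thesis unfolding vertex_proj_mult_left[OF Nc ij(1,2)] using False by (simp del: index_mult_mat)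
  next
    case True
    then have "\<sigma> j \<noteq> tail Q a" using ij by simp
    have "?N $$ (i, j) - (?N * vertex_proj d \<sigma> (tail Q a)) $$ (i, j) \<in> P"
      using 2 ij by (simp add: mcong_def del: index_mult_mat)
    then show ?thesis
      unfolding vertex_proj_mult_right[OF Nc ij(1,2)] using \<open>\<sigma> j \<noteq> tail Q a\<close> by (simp del: index_mult_mat)
  qed
qed

text \<open>
  The generic point is the representation over the field of rational functions whose arrows have
  indeterminate entries, conjugated by a matrix of indeterminates.  A point \<open>P\<close> of the stratum with
  adapted matrix \<open>g\<close> is recovered by the values \<open>\<psi> g\<close>: the conjugating matrix becomes \<open>g\<close> and the matrix of
  an arrow becomes \<open>adj g X g\<close>, where \<open>X\<close> is its generic matrix.  Fractions are needed for the inverse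
  of the conjugating matrix only, whose determinant has the value \<open>det g\<close>, which is not in \<open>P\<close>.
\<close>

lemma stratum_generic_point:
  assumes I0: "I = {0}" and \<sigma>: "\<sigma> \<in> {..<d} \<rightarrow>\<^sub>E verts Q" and ne: "stratum d \<sigma> \<noteq> {}"
  obtains P0 where "P0 \<in> spec_points (mod_equations A d)" "\<And>P. P \<in> stratum d \<sigma> \<Longrightarrow> P0 \<subseteq> P"
proof -
  obtain ix :: "'e \<Rightarrow> nat" where ix: "inj_on ix (arcs Q)"
    using finite_imp_inj_to_nat_seg[OF Q.finite_arcs] by blast
  let ?enc = "\<lambda>l i j. prod_encode (l, prod_encode (i, j))"
  \<comment> \<open>index \<open>0\<close> belongs to the conjugating matrix and \<open>Suc (ix a)\<close> to the arrow \<open>a\<close>\<close>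
  define var where "var l i j = (Poly_Mapping.single (Poly_Mapping.single (?enc l i j) 1) 1 :: (nat \<Rightarrow>\<^sub>0 nat) \<Rightarrow>\<^sub>0 'k)" for l i j :: nat
  define gB where "gB = mat d d (\<lambda>(i, j). var 0 i j)"
  define mB where "mB a = mat d d (\<lambda>(i, j). if \<sigma> i = head Q a \<and> \<sigma> j = tail Q a then var (Suc (ix a)) i j else 0)" for a
  define \<delta> where "\<delta> = det gB"
  let ?emb = "\<lambda>a :: (nat \<Rightarrow>\<^sub>0 nat) \<Rightarrow>\<^sub>0 'k. Fract a 1"
  let ?h = "\<lambda>c :: 'k. Fract (Poly_Mapping.single (0 :: nat \<Rightarrow>\<^sub>0 nat) c) 1"
  have emb: "comm_ring_hom ?emb" by (rule comm_ring_hom_Fract)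
  interpret emb: comm_ring_hom ?emb by (rule emb)
  interpret sing: comm_ring_hom "\<lambda>c :: 'k. Poly_Mapping.single (0 :: nat \<Rightarrow>\<^sub>0 nat) c"
    by (rule comm_ring_hom_single)
  have h: "comm_ring_hom ?h"
    by unfold_locales (simp_all only: sing.hom_add sing.hom_mult emb.hom_add emb.hom_mult
      sing.hom_zero sing.hom_one emb.hom_zero emb.hom_one)
  have gB: "gB \<in> carrier_mat d d" and mB: "mB a \<in> carrier_mat d d" for a by (auto simp: gB_def mB_def)
  note adjB = adj_mat[OF gB]
  define val where "val g k = (case prod_decode k of (l, c) \<Rightarrow> case prod_decode c of (i, j) \<Rightarrow>
      if l = 0 then g $$ (i, j)
      else (adj_mat g * gen d (ar (inv_into (arcs Q) ix (l - 1))) * g) $$ (i, j))"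
    for g :: "('k, (('v, 'e) qpath \<Rightarrow> 'k) set) mod_poly mat" and k
  define \<psi> where "\<psi> g = poly_eval mod_const (val g)" for g
  have mc: "comm_ring_hom (mod_const :: 'k \<Rightarrow> ('k, (('v, 'e) qpath \<Rightarrow> 'k) set) mod_poly)"
    unfolding mod_const_def[abs_def] by (rule comm_ring_hom_single)
  have \<psi>: "comm_ring_hom (\<psi> g)" for g unfolding \<psi>_def by (rule poly_eval_hom[OF mc])
  have \<psi>_var: "\<psi> g (var l i j) = val g (?enc l i j)" for g l i j
    unfolding \<psi>_def var_def poly_eval_single[OF mc] by (simp add: mod_const_def)
  have \<psi>_const: "\<psi> g (Poly_Mapping.single 0 c) = mod_const c" for g c
    unfolding \<psi>_def poly_eval_single[OF mc] by simp
  have \<psi>_g: "map_mat (\<psi> g) gB = g" if "g \<in> carrier_mat d d" for g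
    using that by (intro eq_matI) (auto simp: gB_def \<psi>_var val_def)
  have \<psi>_det: "\<psi> g \<delta> = det g" if "g \<in> carrier_mat d d" for g
  proof -
    interpret \<psi>: comm_ring_hom "\<psi> g" by (rule \<psi>)
    show ?thesis unfolding \<delta>_def \<psi>.hom_det[symmetric] \<psi>_g[OF that] ..
  qed
  have \<psi>_adj: "map_mat (\<psi> g) (adj_mat gB) = adj_mat g" if "g \<in> carrier_mat d d" for g
    unfolding comm_ring_hom_adj_mat[OF \<psi> gB] \<psi>_g[OF that] ..
  have \<psi>_m: "map_mat (\<psi> g) (mB a) $$ (i, j) = (if \<sigma> i = head Q a \<and> \<sigma> j = tail Q a
      then (adj_mat g * gen d (ar a) * g) $$ (i, j) else 0)" if "a \<in> arcs Q" "i < d" "j < d" for g a i j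
  proof -
    interpret \<psi>: comm_ring_hom "\<psi> g" by (rule \<psi>)
    show ?thesis using that ix by (simp add: mB_def \<psi>_var val_def del: index_mult_mat)
  qed
  have \<delta>0: "\<delta> \<noteq> 0"
  proof -
    obtain P g where P: "P \<in> spec_points (mod_equations A d)" and g: "adapted d \<sigma> g" "det g \<notin> P"
      using ne by (auto simp: stratum_def)
    interpret \<psi>: comm_ring_hom "\<psi> g" by (rule \<psi>)
    have "\<psi> g \<delta> \<notin> P" using g \<psi>_det by (simp add: adapted_def)
    then show ?thesis using spec_pointsD(2)[OF P] by auto
  qed
  let ?G = "map_mat ?emb gB" and ?Ad = "map_mat ?emb (adj_mat gB)" and ?u = "Fract 1 \<delta>"
  define H where "H = ?u \<cdot>\<^sub>m ?Ad"
  have Gc: "?G \<in> carrier_mat d d" and Adc: "?Ad \<in> carrier_mat d d" and Hc: "H \<in> carrier_mat d d"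
    using gB adjB by (auto simp: H_def)
  have u1: "Fract \<delta> \<delta> = 1" and u0: "Fract 0 \<delta> = 0"
    unfolding One_fract_def Zero_fract_def by (subst eq_fract; use \<delta>0 in simp)+
  have unit: "?u \<cdot>\<^sub>m map_mat ?emb (\<delta> \<cdot>\<^sub>m 1\<^sub>m d) = 1\<^sub>m d"
    by (intro eq_matI) (auto simp: u1 u0)
  have GH: "?G * H = 1\<^sub>m d"
  proof -
    have "?G * H = ?u \<cdot>\<^sub>m (?G * ?Ad)" unfolding H_def by (rule mult_smult_distrib[OF Gc Adc])
    also have "?G * ?Ad = map_mat ?emb (\<delta> \<cdot>\<^sub>m 1\<^sub>m d)"
      unfolding comm_ring_hom_map_mat_mult[OF emb gB adjB(1), symmetric] adjB(2) \<delta>_def ..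
    finally show ?thesis unfolding unit .
  qed
  have HG: "H * ?G = 1\<^sub>m d"
  proof -
    have "H * ?G = ?u \<cdot>\<^sub>m (?Ad * ?G)" unfolding H_def by (rule mult_smult_assoc_mat[OF Adc Gc])
    also have "?Ad * ?G = map_mat ?emb (\<delta> \<cdot>\<^sub>m 1\<^sub>m d)"
      unfolding comm_ring_hom_map_mat_mult[OF emb adjB(1) gB, symmetric] adjB(3) \<delta>_def ..
    finally show ?thesis unfolding unit .
  qed
  have \<sigma>v: "\<sigma> i \<in> verts Q" if "i < d" for i using \<sigma> that by auto
  \<comment> \<open>the factor \<open>?u\<close> makes up for the use of \<open>adj g\<close> instead of the inverse of \<open>g\<close> in the values of the arrows\<close>
  obtain \<Phi> where \<Phi>: "qrep ?h d \<Phi>"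
    "\<And>v. v \<in> verts Q \<Longrightarrow> \<Phi> (vx v) = ?G * vertex_proj d \<sigma> v * H"
    "\<And>a. a \<in> arcs Q \<Longrightarrow> \<Phi> (ar a) = ?G * (?u \<cdot>\<^sub>m map_mat ?emb (mB a)) * H"
  proof (rule qrep_conjugate[OF I0 h Gc Hc GH HG \<sigma>v, where m = "\<lambda>a. ?u \<cdot>\<^sub>m map_mat ?emb (mB a)"])
    fix a i j assume "a \<in> arcs Q" "i < d" "j < d" "(?u \<cdot>\<^sub>m map_mat ?emb (mB a)) $$ (i, j) \<noteq> 0"
    then show "\<sigma> i = head Q a \<and> \<sigma> j = tail Q a"
      by (auto simp: mB_def u0 split: if_splits)
  qed (use mB in auto)
  show ?thesis
  proof (rule that[of "point ?h d \<Phi>"])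
    show "point ?h d \<Phi> \<in> spec_points (mod_equations A d)" by (rule point_in_spec[OF h \<Phi>(1)])
    fix P assume "P \<in> stratum d \<sigma>"
    then obtain g where P: "P \<in> spec_points (mod_equations A d)" and g: "adapted d \<sigma> g" "det g \<notin> P"
      by (auto simp: stratum_def)
    have gc: "g \<in> carrier_mat d d" using g by (simp add: adapted_def)
    note adj = adj_mat[OF gc]
    have nP: "\<psi> g \<delta> \<notin> P" using g \<psi>_det[OF gc] by simp
    interpret \<psi>: comm_ring_hom "\<psi> g" by (rule \<psi>)
    note ms = mspecializes_def[OF \<psi>[of g] P] and ms_mult = mspecializes_mult[OF \<psi>[of g] P]
      and ms_cong = mspecializes_cong[OF \<psi>[of g] P] and ms_div = mspecializes_divide[OF \<psi>[of g] P _ \<delta>0 nP]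
    have sG: "mspecializes (\<psi> g) P d ?G g" using mspecializes_map[OF \<psi>[of g] P gB] by (simp add: \<psi>_g[OF gc])
    have sAd: "mspecializes (\<psi> g) P d ?Ad (adj_mat g)"
      using mspecializes_map[OF \<psi>[of g] P adjB(1)] by (simp add: \<psi>_adj[OF gc])
    have sE: "mspecializes (\<psi> g) P d (vertex_proj d \<sigma> v) (vertex_proj d \<sigma> v)" for v
      unfolding ms using specializes_const[OF \<psi>[of g] P, of 0] specializes_const[OF \<psi>[of g] P, of 1]
      by (auto simp: vertex_proj_def Zero_fract_def[symmetric] One_fract_def[symmetric])
    have main: "mspecializes (\<psi> g) P d (\<Phi> x) (gen d x)" if "x \<in> carrier KQ" for x
      using that
    proof (induction rule: path_algebra_induct)
      case zero
      have "mspecializes (\<psi> g) P d (0\<^sub>m d d) (0\<^sub>m d d)"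
        unfolding ms using specializes_zero[OF \<psi>[of g] P] spec_pointsD(2)[OF P] by auto
      from ms_cong[OF this gen_ideal[OF P ideal_zero]] have "mspecializes (\<psi> g) P d (\<Phi> 0) (gen d 0)"
        unfolding qrep_zero[OF \<Phi>(1)] .
      then show ?case .
    next
      case (add x y)
      have "mspecializes (\<psi> g) P d (\<Phi> (x + y)) (gen d (x + y))"
        unfolding qrepD(2)[OF \<Phi>(1) add(1,2)]
        by (rule ms_cong[OF mspecializes_add[OF \<psi>[of g] P add(3,4)] gen_add[OF P add(1,2)]])
      then show ?case .
    next
      case (smult c x)
      have "specializes (\<psi> g) P (?h c) (mod_const c)"
        using specializes_const[OF \<psi>[of g] P, of "Poly_Mapping.single 0 c"] by (simp add: \<psi>_const)
      then show ?case
        unfolding qrepD(4)[OF \<Phi>(1) smult(1)]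
        by (intro ms_cong[OF mspecializes_smult[OF \<psi>[of g] P _ smult(2)] gen_smult[OF P smult(1)]])
    next
      case (mult x y)
      show ?case
        unfolding qrepD(3)[OF \<Phi>(1) mult(1,2)] by (rule ms_cong[OF ms_mult[OF mult(3,4)] gen_mult[OF P mult(1,2)]])
    next
      case (vertex v)
      have "\<Phi> (vx v) = ?u \<cdot>\<^sub>m (?G * vertex_proj d \<sigma> v * ?Ad)"
        unfolding \<Phi>(2)[OF vertex] H_def
        by (rule mult_smult_distrib[OF mult_carrier_mat[OF Gc vertex_proj_carrier] Adc])
      moreover have "mcong P d (\<psi> g \<delta> \<cdot>\<^sub>m gen d (vx v)) (g * vertex_proj d \<sigma> v * adj_mat g)"
        unfolding \<psi>_det[OF gc] by (rule adapted_conjugate(1)[OF P g(1) vertex])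
      ultimately show ?case
        using ms_div[OF ms_mult[OF ms_mult[OF sG sE] sAd] gen_carrier] by simp
    next
      case (arrow a)
      let ?X = "gen d (ar a)" and ?mF = "map_mat ?emb (mB a)" and ?m = "map_mat (\<psi> g) (mB a)"
      let ?N = "adj_mat g * ?X * g"
      have mF: "?mF \<in> carrier_mat d d" and mc: "?m \<in> carrier_mat d d" using mB by auto
      have aX: "adj_mat g * ?X \<in> carrier_mat d d" by (rule mult_carrier_mat[OF adj(1) gen_carrier])
      have Nc: "?N \<in> carrier_mat d d" by (rule mult_carrier_mat[OF aX gc])
      have GmF: "?G * ?mF \<in> carrier_mat d d" by (rule mult_carrier_mat[OF Gc mF])
      have "\<Phi> (ar a) = ?u \<cdot>\<^sub>m (?u \<cdot>\<^sub>m (?G * ?mF * ?Ad))"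
        unfolding \<Phi>(3)[OF arrow] H_def mult_smult_distrib[OF Gc mF]
          mult_smult_assoc_mat[OF GmF smult_carrier_mat[OF Adc]] mult_smult_distrib[OF GmF Adc] ..
      moreover have "mcong P d ?m ?N"
        unfolding mcong_def
      proof (intro conjI allI impI mc Nc)
        fix i j assume ij: "i < d" "j < d"
        show "?m $$ (i, j) - ?N $$ (i, j) \<in> P"
        proof (cases "\<sigma> i = head Q a \<and> \<sigma> j = tail Q a")
          case True
          then show ?thesis unfolding \<psi>_m[OF arrow ij] using spec_pointsD(2)[OF P] by simp
        next
          case False
          then show ?thesis
            unfolding \<psi>_m[OF arrow ij] if_not_P[OF False]
            using spec_point_uminus[OF P adapted_arrow_entry[OF P g arrow ij False]] by simp
        qed
      qed
      then have "mcong P d (g * ?m * adj_mat g) (g * ?N * adj_mat g)"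
        by (intro mcong_mult[OF P] mcong_refl[OF P] gc adj)
      moreover have "g * ?N * adj_mat g = det g \<cdot>\<^sub>m (det g \<cdot>\<^sub>m ?X)"
      proof -
        have Xg: "?X * g \<in> carrier_mat d d" by (rule mult_carrier_mat[OF gen_carrier gc])
        have "g * ?N = g * (adj_mat g * (?X * g))" unfolding assoc_mult_mat[OF adj(1) gen_carrier gc] ..
        also have "\<dots> = g * adj_mat g * (?X * g)" by (rule assoc_mult_mat[OF gc adj(1) Xg, symmetric])
        also have "\<dots> = det g \<cdot>\<^sub>m (?X * g)"
          unfolding adj(2) mult_smult_assoc_mat[OF one_carrier_mat Xg] left_mult_one_mat[OF Xg] ..
        finally have "g * ?N * adj_mat g = det g \<cdot>\<^sub>m (?X * g) * adj_mat g" by simp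
        also have "\<dots> = det g \<cdot>\<^sub>m (?X * g * adj_mat g)" by (rule mult_smult_assoc_mat[OF Xg adj(1)])
        also have "?X * g * adj_mat g = det g \<cdot>\<^sub>m ?X"
          unfolding assoc_mult_mat[OF gen_carrier gc adj(1)] adj(2)
          by (simp add: mult_smult_distrib[OF gen_carrier one_carrier_mat] right_mult_one_mat[OF gen_carrier])
        finally show ?thesis .
      qed
      ultimately have e: "\<Phi> (ar a) = ?u \<cdot>\<^sub>m (?u \<cdot>\<^sub>m (?G * ?mF * ?Ad))"
        "mcong P d (\<psi> g \<delta> \<cdot>\<^sub>m (det g \<cdot>\<^sub>m ?X)) (g * ?m * adj_mat g)"
        using mcong_sym[OF P] \<psi>_det[OF gc] by simp_all
      have "mspecializes (\<psi> g) P d (?G * ?mF * ?Ad) (g * ?m * adj_mat g)"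
        by (rule ms_mult[OF ms_mult[OF sG mspecializes_map[OF \<psi>[of g] P mB]] sAd])
      then have "mspecializes (\<psi> g) P d (?u \<cdot>\<^sub>m (?G * ?mF * ?Ad)) (det g \<cdot>\<^sub>m ?X)"
        by (rule ms_div[OF _ _ e(2)]) simp
      then have "mspecializes (\<psi> g) P d (?u \<cdot>\<^sub>m (?u \<cdot>\<^sub>m (?G * ?mF * ?Ad))) ?X"
        by (rule ms_div[OF _ gen_carrier]) (simp add: \<psi>_det[OF gc] mcong_refl[OF P])
      then show ?case unfolding e(1) .
    qed
    show "point ?h d \<Phi> \<subseteq> P"
    proof
      fix f assume "f \<in> point ?h d \<Phi>"
      then have 0: "poly_eval ?h (coordval d \<Phi>) f = 0" by (simp add: point_def)
      interpret ev: comm_ring_hom "poly_eval ?h (coordval d \<Phi>)" by (rule poly_eval_hom[OF h])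
      have "specializes (\<psi> g) P (poly_eval ?h (coordval d \<Phi>) f) f"
      proof (induction f rule: poly_induct)
        case (const c)
        show ?case
          using specializes_const[OF \<psi>[of g] P, of "Poly_Mapping.single 0 c"]
          by (simp add: \<psi>_const poly_eval_single[OF h] mod_const_def)
      next
        case (var x)
        obtain X i j where x: "x = (X, i, j)" by (cases x)
        have e: "poly_eval ?h (coordval d \<Phi>) (mod_coord X i j) = coordval d \<Phi> (X, i, j)"
          by (rule poly_eval_coord[OF h])
        have "specializes (\<psi> g) P (coordval d \<Phi> (X, i, j)) (mod_coord X i j)"
        proof (cases "X \<in> carrier A \<and> i < d \<and> j < d")
          case True
          then obtain y where y: "y \<in> carrier KQ" "X = cl y" unfolding quotient_carrier by blast
          have "coordval d \<Phi> (X, i, j) = \<Phi> y $$ (i, j)"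
            using True y descend_cl[OF \<Phi>(1) y(1)] by (simp add: coordval_def)
          then show ?thesis using main[OF y(1)] True y by (simp add: ms gen_index)
        next
          case False
          then have "mod_coord X i j \<in> P" by (intro coord_outside[OF P]) auto
          then show ?thesis using specializes_zero[OF \<psi>[of g] P] False by (auto simp: coordval_def)
        qed
        then show ?case unfolding x using e by (simp add: mod_coord_def)
      next
        case (add f f')
        then show ?case unfolding ev.hom_add by (rule specializes_add[OF \<psi>[of g] P])
      next
        case (mult f f')
        then show ?case unfolding ev.hom_mult by (rule specializes_mult[OF \<psi>[of g] P])
      qed
      then show "f \<in> P" unfolding 0 by (rule specializes_zero_in[OF \<psi>[of g] P])
    qed
  qed
qed

lemma det_permute_columns_notin:
  assumes P: "P \<in> spec_points S" and g: "g \<in> carrier_mat d d" and p: "p permutes {0..<d}" and nP: "det g \<notin> P"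
  shows "det (mat d d (\<lambda>(i, j). g $$ (i, p j))) \<notin> P"
proof
  let ?g = "mat d d (\<lambda>(i, j). g $$ (i, p j))"
  assume "det ?g \<in> P"
  have pd: "p j < d" if "j < d" for j using permutes_in_image[OF p, of j] that by simp
  have "det ?g = det (transpose_mat ?g)" by (rule det_transpose[symmetric]) auto
  also have "transpose_mat ?g = mat d d (\<lambda>(i, j). transpose_mat g $$ (p i, j))"
    using g pd by (intro eq_matI) auto
  also have "det \<dots> = signof p * det (transpose_mat g)"
    by (rule det_permute_rows[OF _ p]) (use g in auto)
  also have "det (transpose_mat g) = det g" by (rule det_transpose[OF g])
  finally have "signof p * (signof p * det g) \<in> P"
    using \<open>det ?g \<in> P\<close> spec_pointsD(4)[OF P] by metis
  moreover have "signof p * signof p = (1 :: 'a)" by (simp add: sign_def)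
  ultimately show False using nP by (simp add: mult.assoc[symmetric])
qed

lemma stratum_permute:
  assumes p: "p permutes {0..<d}" and \<sigma>: "\<And>j. j < d \<Longrightarrow> \<sigma> j = \<tau> (p j)"
  shows "stratum d \<tau> \<subseteq> stratum d \<sigma>"
proof
  fix P assume "P \<in> stratum d \<tau>"
  then obtain g where P: "P \<in> spec_points (mod_equations A d)" and g: "adapted d \<tau> g" "det g \<notin> P"
    by (auto simp: stratum_def)
  have gc: "g \<in> carrier_mat d d" using g by (simp add: adapted_def)
  have pd: "p j < d" if "j < d" for j using permutes_in_image[OF p, of j] that by simp
  let ?g = "mat d d (\<lambda>(i, j). g $$ (i, p j))"
  have gc': "?g \<in> carrier_mat d d" by simp
  have "adapted d \<sigma> ?g"
    unfolding adapted_def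
  proof (intro conjI ballI gc')
    fix P' v assume P': "P' \<in> spec_points (mod_equations A d)" and v: "v \<in> verts Q"
    show "mcong P' d (gen d (vx v) * ?g) (?g * vertex_proj d \<sigma> v)"
      unfolding mcong_def
    proof (intro conjI allI impI)
      fix i j assume ij: "i < d" "j < d"
      have "(gen d (vx v) * ?g) $$ (i, j) = (\<Sum>k<d. gen d (vx v) $$ (i, k) * g $$ (k, p j))"
        unfolding mat_mult_index[OF gen_carrier gc' ij] using ij by (intro sum.cong) auto
      also have "\<dots> = (gen d (vx v) * g) $$ (i, p j)"
        by (rule mat_mult_index[OF gen_carrier gc ij(1) pd[OF ij(2)], symmetric])
      finally have 1: "(gen d (vx v) * ?g) $$ (i, j) = (gen d (vx v) * g) $$ (i, p j)" .
      have 2: "(?g * vertex_proj d \<sigma> v) $$ (i, j) = (g * vertex_proj d \<tau> v) $$ (i, p j)"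
        unfolding vertex_proj_mult_right[OF gc' ij] vertex_proj_mult_right[OF gc ij(1) pd[OF ij(2)]]
        using ij \<sigma> by simp
      have "mcong P' d (gen d (vx v) * g) (g * vertex_proj d \<tau> v)" using g P' v by (simp add: adapted_def)
      then show "(gen d (vx v) * ?g) $$ (i, j) - (?g * vertex_proj d \<sigma> v) $$ (i, j) \<in> P'"
        unfolding 1 2 using ij pd by (simp add: mcong_def del: index_mult_mat)
    qed (use mult_carrier_mat[OF gen_carrier gc'] mult_carrier_mat[OF gc' vertex_proj_carrier] in auto)
  qed
  then show "P \<in> stratum d \<sigma>"
    unfolding stratum_def using P det_permute_columns_notin[OF P gc p g(2)] by blast
qed

text \<open>
  If \<open>g\<close> and \<open>k\<close> are adapted to \<open>\<sigma>\<close> and \<open>\<tau>\<close> at \<open>P\<close>, then \<open>adj g k\<close> is invertible at \<open>P\<close> and commutes with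
  the projections, so its entries \<open>(i, j)\<close> with \<open>\<sigma> i \<noteq> \<tau> j\<close> are in \<open>P\<close>.  A term of the Leibniz formula that
  is not in \<open>P\<close> gives a permutation that turns \<open>\<tau>\<close> into \<open>\<sigma>\<close>.
\<close>

lemma stratum_overlap:
  assumes \<sigma>: "\<sigma> \<in> {..<d} \<rightarrow>\<^sub>E verts Q" and \<tau>: "\<tau> \<in> {..<d} \<rightarrow>\<^sub>E verts Q"
    and P: "P \<in> stratum d \<sigma>" "P \<in> stratum d \<tau>"
  shows "stratum d \<sigma> = stratum d \<tau>"
proof -
  obtain g where Ps: "P \<in> spec_points (mod_equations A d)" and g: "adapted d \<sigma> g" "det g \<notin> P"
    using P by (auto simp: stratum_def)
  obtain k where k: "adapted d \<tau> k" "det k \<notin> P" using P by (auto simp: stratum_def)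
  have gc: "g \<in> carrier_mat d d" and kc: "k \<in> carrier_mat d d" using g k by (auto simp: adapted_def)
  note adj = adj_mat[OF gc]
  let ?M = "adj_mat g * k"
  have Mc: "?M \<in> carrier_mat d d" by (rule mult_carrier_mat[OF adj(1) kc])
  have pow: "x ^ n \<notin> P" if "x \<notin> P" for x n
    using that spec_pointsD(5,6)[OF Ps] by (induction n) auto
  have "det (adj_mat g) \<notin> P"
  proof
    assume "det (adj_mat g) \<in> P"
    then have "det g * det (adj_mat g) \<in> P" by (rule spec_pointsD(4)[OF Ps])
    also have "det g * det (adj_mat g) = det (det g \<cdot>\<^sub>m 1\<^sub>m d)"
      unfolding adj(2)[symmetric] by (rule det_mult[OF gc adj(1), symmetric])
    also have "\<dots> = det g ^ d" by simp
    finally show False using pow[OF g(2)] by blast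
  qed
  then have "det ?M \<notin> P"
    unfolding det_mult[OF adj(1) kc] using k(2) spec_pointsD(5)[OF Ps] by blast
  moreover have "det ?M = (\<Sum>p | p permutes {0..<d}. signof p * (\<Prod>i = 0..<d. ?M $$ (i, p i)))"
    by (rule det_def'[OF Mc])
  ultimately obtain p where p: "p permutes {0..<d}" "signof p * (\<Prod>i = 0..<d. ?M $$ (i, p i)) \<notin> P"
    using spec_point_sum[OF Ps] by (metis (no_types, lifting) mem_Collect_eq)
  then have prod: "(\<Prod>i = 0..<d. ?M $$ (i, p i)) \<notin> P" using spec_pointsD(4)[OF Ps] by blast
  have pd: "p j < d" if "j < d" for j using permutes_in_image[OF p(1), of j] that by simp
  have entry: "\<sigma> i = \<tau> j" if ij: "i < d" "j < d" and nz: "?M $$ (i, j) \<notin> P" for i j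
  proof (rule ccontr)
    assume ne: "\<sigma> i \<noteq> \<tau> j"
    let ?v = "\<sigma> i"
    have v: "?v \<in> verts Q" using \<sigma> ij by auto
    have "mcong P d (adj_mat g * gen d (vx ?v) * k) (vertex_proj d \<sigma> ?v * adj_mat g * k)"
      by (rule mcong_mult[OF Ps adapted_conjugate(2)[OF Ps g(1) v g(2)] mcong_refl[OF Ps kc]])
    then have 1: "mcong P d (adj_mat g * gen d (vx ?v) * k) (vertex_proj d \<sigma> ?v * ?M)"
      unfolding assoc_mult_mat[OF vertex_proj_carrier adj(1) kc] .
    have "mcong P d (adj_mat g * (gen d (vx ?v) * k)) (adj_mat g * (k * vertex_proj d \<tau> ?v))"
      using k(1) Ps v by (intro mcong_mult[OF Ps mcong_refl[OF Ps adj(1)]]) (auto simp: adapted_def)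
    then have 2: "mcong P d (adj_mat g * gen d (vx ?v) * k) (?M * vertex_proj d \<tau> ?v)"
      unfolding assoc_mult_mat[OF adj(1) gen_carrier kc] assoc_mult_mat[OF adj(1) kc vertex_proj_carrier] .
    have "mcong P d (vertex_proj d \<sigma> ?v * ?M) (?M * vertex_proj d \<tau> ?v)"
      by (rule mcong_trans[OF Ps mcong_sym[OF Ps 1] 2])
    then have "(vertex_proj d \<sigma> ?v * ?M) $$ (i, j) - (?M * vertex_proj d \<tau> ?v) $$ (i, j) \<in> P"
      using ij by (simp add: mcong_def del: index_mult_mat)
    then show False
      unfolding vertex_proj_mult_left[OF Mc ij] vertex_proj_mult_right[OF Mc ij] using ne nz by simp
  qed
  have "?M $$ (i, p i) \<notin> P" if "i < d" for i
  proof
    assume m: "?M $$ (i, p i) \<in> P"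
    have "(\<Prod>i = 0..<d. ?M $$ (i, p i)) = (\<Prod>i\<in>{0..<d} - {i}. ?M $$ (i, p i)) * ?M $$ (i, p i)"
      by (subst mult.commute, rule prod.remove) (use that in auto)
    also have "\<dots> \<in> P" by (rule spec_pointsD(4)[OF Ps m])
    finally show False using prod by simp
  qed
  then have eq: "\<sigma> i = \<tau> (p i)" if "i < d" for i using entry pd that by blast
  have "stratum d \<tau> \<subseteq> stratum d \<sigma>" by (rule stratum_permute[OF p(1)]) (rule eq)
  moreover have "stratum d \<sigma> \<subseteq> stratum d \<tau>"
  proof (rule stratum_permute[OF permutes_inv[OF p(1)]])
    fix j assume j: "j < d"
    have "Hilbert_Choice.inv p j < d" using permutes_in_image[OF permutes_inv[OF p(1)], of j] j by simp
    then show "\<tau> j = \<sigma> (Hilbert_Choice.inv p j)" using eq permutes_inverses(1)[OF p(1)] by simp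
  qed
  ultimately show ?thesis by blast
qed

text \<open>
  The complement of a stratum is the union of the other strata, so a connected set that meets a stratum is
  contained in it.
\<close>

theorem geometrically_irreducible_of_ideal_zero:
  assumes I0: "I = {0}"
  shows "geometrically_irreducible A"
  unfolding geometrically_irreducible_def
proof (intro allI ballI)
  fix d C assume C: "C \<in> connected_components_of (mod_scheme A d)"
  let ?S = "mod_equations A d"
  have Cs: "C \<subseteq> spec_points ?S"
    using connected_components_of_subset[OF C] by (simp add: mod_scheme_def topspace_spec_topology)
  obtain P where P: "P \<in> C" using nonempty_connected_components_of[OF C] by blast
  then obtain \<sigma> where \<sigma>: "\<sigma> \<in> {..<d} \<rightarrow>\<^sub>E verts Q" "P \<in> stratum d \<sigma>" using strata_cover Cs by blast
  have sub: "stratum d \<tau> \<subseteq> spec_points ?S" for \<tau> by (auto simp: stratum_def)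
  have "openin (mod_scheme A d) (spec_points ?S - stratum d \<sigma>)"
  proof -
    have "spec_points ?S - stratum d \<sigma>
        = \<Union>{stratum d \<tau> | \<tau>. \<tau> \<in> {..<d} \<rightarrow>\<^sub>E verts Q \<and> stratum d \<tau> \<noteq> stratum d \<sigma>}" (is "_ = \<Union>?U")
    proof (intro equalityI subsetI)
      fix P' assume P': "P' \<in> spec_points ?S - stratum d \<sigma>"
      then obtain \<tau> where "\<tau> \<in> {..<d} \<rightarrow>\<^sub>E verts Q" "P' \<in> stratum d \<tau>" using strata_cover by blast
      then show "P' \<in> \<Union>?U" using P' by blast
    next
      fix P' assume "P' \<in> \<Union>?U"
      then obtain \<tau> where \<tau>: "\<tau> \<in> {..<d} \<rightarrow>\<^sub>E verts Q" "stratum d \<tau> \<noteq> stratum d \<sigma>" "P' \<in> stratum d \<tau>"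
        by blast
      then show "P' \<in> spec_points ?S - stratum d \<sigma>" using stratum_overlap[OF \<tau>(1) \<sigma>(1)] sub by blast
    qed
    moreover have "openin (mod_scheme A d) (\<Union>?U)" by (rule openin_Union) (use openin_stratum in blast)
    ultimately show ?thesis by simp
  qed
  then have CW: "C \<subseteq> stratum d \<sigma>"
    using connectedin_connected_components_of[OF C] openin_stratum[of d \<sigma>] P \<sigma>(2) Cs
    unfolding connectedin by blast
  obtain P0 where P0: "P0 \<in> spec_points ?S" "\<And>P'. P' \<in> stratum d \<sigma> \<Longrightarrow> P0 \<subseteq> P'"
    using stratum_generic_point[OF I0 \<sigma>(1)] \<sigma>(2) by blast
  let ?V = "{P' \<in> spec_points ?S. P0 \<subseteq> P'}"
  have irr: "irreducible_in (mod_scheme A d) ?V"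
    unfolding mod_scheme_def by (rule irreducible_in_closure[OF P0(1)])
  have "C \<subseteq> ?V" using CW P0(2) Cs by blast
  moreover have "?V \<subseteq> C"
    by (rule connected_components_of_maximal[OF C irreducible_in_imp_connectedin[OF irr]])
      (use P \<open>C \<subseteq> ?V\<close> in \<open>auto simp: disjnt_iff\<close>)
  ultimately show "irreducible_in (mod_scheme A d) C" using irr by simp
qed

end

section \<open>The equivalence\<close>

theorem theorem1p3:
  fixes Q :: "('v, 'e) pre_digraph"
    and I :: "(('v, 'e) qpath \<Rightarrow> 'k :: alg_closed_field) set"
  assumes "fin_digraph Q"
    and "admissible_ideal Q I"
    and no_loops: "\<forall>a\<in>arcs Q. tail Q a \<noteq> head Q a"
  shows "geometrically_irreducible (quotient_algebra (path_algebra Q) I) \<longleftrightarrow>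
         hereditary (quotient_algebra (path_algebra Q) I)"
proof -
  interpret quiver_ideal Q I by (rule quiver_ideal.intro[OF assms(1,2)])
  show ?thesis
    using ideal_zero_of_geometrically_irreducible[OF _ no_loops] ideal_zero_of_hereditary
      geometrically_irreducible_of_ideal_zero hereditary_of_ideal_zero by blast
qed

end
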